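(* Let $F$ be a number field. Suppose $f:G\to G'$ is a morphism in $\mathsf{LCA}_F$ with $G\in\mathsf{LCA}_{F,qab+fd}$ and $G'\in\mathsf{LCA}_{F}$ arbitrary. Then the kernel of $f$ in $\mathsf{LCA}_{F}$ lies in $\mathsf{LCA}_{F,qab+fd}$.
   Context: Let $\mathcal{O}$ be the ring of integers of $F$. $\mathsf{LCA}_{F}$ is the category of $F$-vector spaces (with $F$ discrete) equipped with a locally compact Hausdorff group topology such that multiplication by each element of $F$ is continuous, morphisms continuous $F$-linear maps; it is quasi-abelian, the kernel of $f$ being $f^{-1}(0)$ with the subspace topology. For a real or complex embedding $\nu$, $\mathbb{R}_\nu$ is $\mathbb{R}$ (resp. $\mathbb{C}$) with $\alpha\cdot x=\nu(\alpha)x$. A quasi-adelic block is an object $Q\in\mathsf{LCA}_F$ possessing a compact open $\mathcal{O}$-submodule $C$ such that $Q=\bigoplus_{\sigma\in I}\mathbb{R}_{\sigma}\oplus\bigcup_{n\ge1}\frac1nC$ for a finite list $I$ of real and complex places. $\mathsf{LCA}_{F,qab+fd}$ is the full subcategory of objects isomorphic to $Q\oplus D$ with $Q$ a quasi-adelic block and $D$ a finite-dimensional $F$-vector space with the discrete topology. *)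

theory Defs
  imports "HOL-Analysis.Analysis" "HOL-Algebra.Module" "HOL-Algebra.Algebraic_Closure_Type"
begin

definition number_field :: "'f::field_char_0 itself \<Rightarrow> bool" where
  "number_field _ \<longleftrightarrow>
    (\<exists>B :: 'f set. finite B \<and> Modules.module.span (\<lambda>(q::rat) x. of_rat q * x) B = UNIV)"

abbreviation field_rec :: "'f::field ring" where
  "field_rec \<equiv> ring_of_type_algebra"

definition integers_rec :: "'f::field ring" where
  "integers_rec = field_rec\<lparr>carrier := {x. algebraic_int x}\<rparr>"

(* The record module of HOL-Algebra extends ring, so that every object below also has fields
   mult and one; the locale Module.module ignores them, and they are left undefined. *)
record ('f, 'a) topmod = "('f, 'a) module" +
  topo :: "'a topology"

definition lca_object :: "('f::field_char_0, 'a) topmod \<Rightarrow> bool" where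
  "lca_object G \<longleftrightarrow>
    Module.module (field_rec :: 'f ring) G \<and>
    topspace (topo G) = carrier G \<and>
    continuous_map (prod_topology (topo G) (topo G)) (topo G) (\<lambda>(x, y). x \<oplus>\<^bsub>G\<^esub> y) \<and>
    continuous_map (topo G) (topo G) (\<lambda>x. \<ominus>\<^bsub>G\<^esub> x) \<and>
    (\<forall>\<alpha>. continuous_map (topo G) (topo G) (\<lambda>x. \<alpha> \<odot>\<^bsub>G\<^esub> x)) \<and>
    Hausdorff_space (topo G) \<and> locally_compact_space (topo G)"

definition lca_morphism ::
  "('f::field_char_0, 'a) topmod \<Rightarrow> ('f, 'b) topmod \<Rightarrow> ('a \<Rightarrow> 'b) \<Rightarrow> bool" where
  "lca_morphism G G' f \<longleftrightarrow>
    f \<in> hom (add_monoid G) (add_monoid G') \<and>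
    (\<forall>\<alpha>. \<forall>x\<in>carrier G. f (\<alpha> \<odot>\<^bsub>G\<^esub> x) = \<alpha> \<odot>\<^bsub>G'\<^esub> f x) \<and>
    continuous_map (topo G) (topo G') f"

definition lca_isomorphic ::
  "('f::field_char_0, 'a) topmod \<Rightarrow> ('f, 'b) topmod \<Rightarrow> bool" where
  "lca_isomorphic G G' \<longleftrightarrow>
    (\<exists>f g. lca_morphism G G' f \<and> lca_morphism G' G g \<and>
      (\<forall>x\<in>carrier G. g (f x) = x) \<and> (\<forall>y\<in>carrier G'. f (g y) = y))"

definition lca_kernel ::
  "('f::field_char_0, 'a) topmod \<Rightarrow> ('f, 'b) topmod \<Rightarrow> ('a \<Rightarrow> 'b) \<Rightarrow> ('f, 'a) topmod" where
  "lca_kernel G G' f = (let K = {x \<in> carrier G. f x = \<zero>\<^bsub>G'\<^esub>} in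
    G\<lparr>carrier := K, topo := subtopology (topo G) K\<rparr>)"

definition direct_sum ::
  "('f::field_char_0, 'a) topmod \<Rightarrow> ('f, 'b) topmod \<Rightarrow> ('f, 'a \<times> 'b) topmod" where
  "direct_sum G H = \<lparr>
     carrier = carrier G \<times> carrier H,
     monoid.mult = undefined,
     one = undefined,
     ring.zero = (\<zero>\<^bsub>G\<^esub>, \<zero>\<^bsub>H\<^esub>),
     add = (\<lambda>(x, y) (x', y'). (x \<oplus>\<^bsub>G\<^esub> x', y \<oplus>\<^bsub>H\<^esub> y')),
     module.smult = (\<lambda>\<alpha> (x, y). (\<alpha> \<odot>\<^bsub>G\<^esub> x, \<alpha> \<odot>\<^bsub>H\<^esub> y)),
     topo = prod_topology (topo G) (topo H)\<rparr>"

definition list_direct_sum ::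
  "('f::field_char_0, 'a) topmod list \<Rightarrow> ('f, nat \<Rightarrow> 'a) topmod" where
  "list_direct_sum Gs = (let J = {..<length Gs} in \<lparr>
     carrier = (\<Pi>\<^sub>E i\<in>J. carrier (Gs ! i)),
     monoid.mult = undefined,
     one = undefined,
     ring.zero = (\<lambda>i\<in>J. \<zero>\<^bsub>Gs ! i\<^esub>),
     add = (\<lambda>x y. \<lambda>i\<in>J. x i \<oplus>\<^bsub>Gs ! i\<^esub> y i),
     module.smult = (\<lambda>\<alpha> x. \<lambda>i\<in>J. \<alpha> \<odot>\<^bsub>Gs ! i\<^esub> x i),
     topo = product_topology (\<lambda>i. topo (Gs ! i)) J\<rparr>)"

(* Archimedean places are represented by embeddings into complex: a real embedding is one with
   values in the reals. Conjugate complex embeddings represent the same place and give isomorphic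
   objects arch_module, so lists of embeddings cover exactly the lists of places. *)
definition arch_embeddings :: "('f::field_char_0 \<Rightarrow> complex) set" where
  "arch_embeddings = ring_hom field_rec field_rec"

definition arch_module :: "('f::field_char_0 \<Rightarrow> complex) \<Rightarrow> ('f, complex) topmod" where
  "arch_module \<nu> = (let S = (if range \<nu> \<subseteq> \<real> then \<real> else UNIV) in \<lparr>
     carrier = S,
     monoid.mult = undefined,
     one = undefined,
     ring.zero = 0,
     add = (+),
     module.smult = (\<lambda>\<alpha> x. \<nu> \<alpha> * x),
     topo = top_of_set S\<rparr>)"

(* The union of the (1/n)C is the summand H; C is compact open in H (openness in all of Q would
   force the archimedean part to vanish). Taking H on the element type of Q loses nothing, since
   H can be replaced by its image in Q; similarly for Q and D in lca_qab_fd. *)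
definition quasi_adelic_block :: "('f::field_char_0, 'a) topmod \<Rightarrow> bool" where
  "quasi_adelic_block Q \<longleftrightarrow> lca_object Q \<and>
    (\<exists>\<nu>s (H :: ('f, 'a) topmod) C.
      set \<nu>s \<subseteq> arch_embeddings \<and>
      lca_object H \<and>
      submodule C integers_rec H \<and>
      compactin (topo H) C \<and> openin (topo H) C \<and>
      carrier H = (\<Union>n\<in>{1::nat..}. (\<lambda>x. (1 / of_nat n) \<odot>\<^bsub>H\<^esub> x) ` C) \<and>
      lca_isomorphic Q (direct_sum (list_direct_sum (map arch_module \<nu>s)) H))"

definition finite_dim_discrete :: "('f::field_char_0, 'a) topmod \<Rightarrow> bool" where
  "finite_dim_discrete D \<longleftrightarrow>
    Module.module (field_rec :: 'f ring) D \<and>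
    (\<exists>B. finite B \<and> B \<subseteq> carrier D \<and>
      (\<forall>x\<in>carrier D. \<exists>c :: 'a \<Rightarrow> 'f. x = (\<Oplus>\<^bsub>D\<^esub>b\<in>B. c b \<odot>\<^bsub>D\<^esub> b))) \<and>
    topo D = discrete_topology (carrier D)"

definition lca_qab_fd :: "('f::field_char_0, 'a) topmod \<Rightarrow> bool" where
  "lca_qab_fd G \<longleftrightarrow> lca_object G \<and>
    (\<exists>(Q :: ('f, 'a) topmod) (D :: ('f, 'a) topmod). quasi_adelic_block Q \<and> finite_dim_discrete D \<and>
      lca_isomorphic G (direct_sum Q D))"

end

theory Submission
  imports Defs
begin

text \<open>Let \<open>K\<close> be the kernel, a closed subspace of \<open>V \<oplus> H \<oplus> D\<close> with \<open>V\<close> archimedean, \<open>H\<close> the union of the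
  \<open>(1/n)C\<close> and \<open>D\<close> discrete. Take a maximal set of coordinates of \<open>V\<close> over which the projection of \<open>K\<close>
  has a continuous \<open>F\<close>-linear section and split this part off. On the rest, the elements lying over
  \<open>C\<close> and \<open>0 \<in> D\<close> have discrete image in \<open>V\<close>: otherwise the image, being a closed subgroup, contains a
  line; this line lifts to a one-parameter subgroup of \<open>K\<close> because the kernel of the projection is
  compact, and averaging the lift over the separability idempotent of \<open>F\<close> over the rationals yields an
  \<open>F\<close>-linear section over one more coordinate. Hence \<open>K \<inter> H\<close> is open in the rest with
  finite-dimensional quotient, so it has a discrete complement there.

  Lifting lines only needs that the characters of a compact abelian group separate points, which
  follows from power iteration of convolution operators for the invariant mean.\<close>

section \<open>The invariant mean on a compact abelian group\<close>

text \<open>The compact group \<open>C\<close> may be connected, a solenoid for instance, so a line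
  in the archimedean image of \<open>K\<close> can be coupled with a dense winding inside
  \<open>C\<close>. The line must therefore be lifted through an extension by an arbitrary compact
  group. That such an extension of the reals splits is a form of Pontryagin duality; separation of
  points by characters is the part of it that suffices. It in turn rests on an invariant integral:
  the mean is von Neumann's limit of averages over finitely many translates. Compactness of
  convolution operators is replaced by a pointwise Cauchy-Schwarz bound: it makes powers that are
  Cauchy in the L2 norm uniformly Cauchy, so that only continuous functions ever occur. The lifted
  line is additive, while a splitting must commute with \<open>F\<close>, and at a complex place one
  line covers only half of the completion. A scalar with nonreal image supplies the missing
  direction, and the trace form supplies an averaging that restores linearity without disturbing the
  section property.\<close>

lemma continuous_map_lift2:
  fixes h :: "'b::topological_space \<Rightarrow> 'c::topological_space \<Rightarrow> 'd::topological_space"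
  assumes "continuous_map Y euclidean f" "continuous_map Y euclidean g"
    and "continuous_on UNIV (\<lambda>p. h (fst p) (snd p))"
  shows "continuous_map Y euclidean (\<lambda>x. h (f x) (g x))"
proof -
  have a: "continuous_map Y (prod_topology euclidean euclidean) (\<lambda>x. (f x, g x))"
    using assms(1,2) by (rule continuous_map_pairedI)
  have b: "continuous_map (prod_topology euclidean euclidean) euclidean (\<lambda>p. h (fst p) (snd p))"
    using assms(3) by (simp only: prod_topology_euclidean continuous_map_iff_continuous2)
  show ?thesis using continuous_map_compose[OF a b] by (simp add: o_def)
qed

lemma continuous_map_lift1:
  fixes h :: "'b::topological_space \<Rightarrow> 'd::topological_space"
  assumes "continuous_map Y euclidean f" and "continuous_on UNIV h"
  shows "continuous_map Y euclidean (\<lambda>x. h (f x))"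
  using continuous_map_compose[OF assms(1), of euclidean h] assms(2)
  by (simp only: o_def continuous_map_iff_continuous2)

locale compact_ab_group = abelian_group G for G :: "('a, 'm) ring_scheme" (structure) +
  fixes T :: "'a topology"
  assumes topspace_T: "topspace T = carrier G"
    and compact_T: "compact_space T"
    and add_cont: "continuous_map (prod_topology T T) T (\<lambda>(x, y). x \<oplus> y)"
    and neg_cont: "continuous_map T T (\<lambda>x. \<ominus> x)"
begin

abbreviation cont :: "('a \<Rightarrow> complex) \<Rightarrow> bool" where
  "cont f \<equiv> continuous_map T euclidean f"

abbreviation cont2 :: "('a \<Rightarrow> 'a \<Rightarrow> complex) \<Rightarrow> bool" where
  "cont2 F \<equiv> continuous_map (prod_topology T T) euclidean (\<lambda>p. F (fst p) (snd p))"

lemma cont_add: "cont f \<Longrightarrow> cont g \<Longrightarrow> cont (\<lambda>x. f x + g x)"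
  by (erule (1) continuous_map_lift2) (intro continuous_intros)

lemma cont_diff: "cont f \<Longrightarrow> cont g \<Longrightarrow> cont (\<lambda>x. f x - g x)"
  by (erule (1) continuous_map_lift2) (intro continuous_intros)

lemma cont_mult: "cont f \<Longrightarrow> cont g \<Longrightarrow> cont (\<lambda>x. f x * g x)"
  by (erule (1) continuous_map_lift2) (intro continuous_intros)

lemma cont_const: "cont (\<lambda>x. c)"
  by simp

lemma cont_cmult: "cont f \<Longrightarrow> cont (\<lambda>x. c * f x)"
  by (rule cont_mult) auto

lemma cont_cnj: "cont f \<Longrightarrow> cont (\<lambda>x. cnj (f x))"
  by (erule continuous_map_lift1) (intro continuous_intros)

lemma cont_Re: "cont f \<Longrightarrow> continuous_map T euclidean (\<lambda>x. Re (f x))"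
  by (erule continuous_map_lift1) (intro continuous_intros)

lemma cont_norm2: "cont f \<Longrightarrow> cont (\<lambda>x. of_real ((cmod (f x))\<^sup>2))"
  by (erule continuous_map_lift1) (intro continuous_intros)

lemma cont_sum: "finite I \<Longrightarrow> (\<And>i. i \<in> I \<Longrightarrow> cont (f i)) \<Longrightarrow> cont (\<lambda>x. \<Sum>i\<in>I. f i x)"
  by (induction I rule: finite_induct) (auto intro!: cont_add)

lemma add_cont': 
  assumes "continuous_map Y T f" "continuous_map Y T g"
  shows "continuous_map Y T (\<lambda>x. f x \<oplus> g x)"
proof -
  have "continuous_map Y (prod_topology T T) (\<lambda>x. (f x, g x))"
    using assms by (simp add: continuous_map_paired)
  from continuous_map_compose[OF this add_cont] show ?thesis by (simp add: o_def)
qed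

lemma neg_cont': "continuous_map Y T f \<Longrightarrow> continuous_map Y T (\<lambda>x. \<ominus> f x)"
  using continuous_map_compose[OF _ neg_cont] by (auto simp: o_def)

lemma minus_cont': "continuous_map Y T f \<Longrightarrow> continuous_map Y T g \<Longrightarrow> continuous_map Y T (\<lambda>x. f x \<ominus> g x)"
  unfolding a_minus_def by (intro add_cont' neg_cont')

lemma id_cont: "continuous_map T T (\<lambda>x. x)"
  by (simp add: continuous_map_id[unfolded id_def])

lemma const_cont: "a \<in> carrier G \<Longrightarrow> continuous_map Y T (\<lambda>x. a)"
  by (simp add: topspace_T)

lemmas grp_cont = add_cont' neg_cont' minus_cont' id_cont const_cont continuous_map_fst[unfolded o_def]
  continuous_map_snd

lemma cont_comp: "cont f \<Longrightarrow> continuous_map T T g \<Longrightarrow> cont (\<lambda>x. f (g x))"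
  using continuous_map_compose by (force simp: o_def)

lemma cont2_comp: "cont f \<Longrightarrow> continuous_map (prod_topology T T) T (\<lambda>p. g (fst p) (snd p)) \<Longrightarrow> cont2 (\<lambda>x y. f (g x y))"
  using continuous_map_compose by (force simp: o_def)

lemma cont2_mult: "cont2 F \<Longrightarrow> cont2 H \<Longrightarrow> cont2 (\<lambda>x y. F x y * H x y)"
  by (erule (1) continuous_map_lift2) (intro continuous_intros)

lemma cont2_slice: assumes "cont2 F" "x \<in> carrier G" shows "cont (F x)"
proof -
  have "continuous_map T (prod_topology T T) (\<lambda>y. (x, y))"
    using assms by (simp add: continuous_map_paired topspace_T id_cont)
  from continuous_map_compose[OF this assms(1)] show ?thesis by (simp add: o_def)
qed

lemma cont2_swap: assumes "cont2 F" shows "cont2 (\<lambda>x y. F y x)"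
proof -
  have "continuous_map (prod_topology T T) (prod_topology T T) (\<lambda>p. (snd p, fst p))"
    by (simp add: continuous_map_paired continuous_map_fst continuous_map_snd)
  from continuous_map_compose[OF this assms] show ?thesis by (simp add: o_def)
qed

section \<open>Uniform continuity and finite covers by translates\<close>

lemma tube:
  assumes F: "cont2 F" and x0: "x0 \<in> carrier G" and e: "e > 0"
  obtains U where "openin T U" "x0 \<in> U" "\<And>x y. x \<in> U \<Longrightarrow> y \<in> carrier G \<Longrightarrow> cmod (F x y - F x0 y) < e"
proof -
  have "cont2 (\<lambda>x y. F x0 y)"
    using continuous_map_compose[OF continuous_map_snd cont2_slice[OF F x0]] by (simp add: o_def)
  then have c: "cont2 (\<lambda>x y. F x y - F x0 y)"
    using F by (intro continuous_map_lift2[where h = "(-)"] continuous_intros)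
  define D where "D = {p \<in> topspace (prod_topology T T). F (fst p) (snd p) - F x0 (snd p) \<in> {z. cmod z \<ge> e}}"
  have "closed {z. cmod z \<ge> e}"
    by (intro closed_Collect_le continuous_intros)
  then have "closedin (prod_topology T T) D"
    unfolding D_def by (intro closedin_continuous_map_preimage[OF c]) simp
  \<comment> \<open>Projection along the compact second factor is a closed map, so the first
    coordinates that admit some bad \<open>y\<close> form a closed set.\<close>
  then have cl: "closedin T (fst ` D)"
    using closed_map_fst[OF compact_T, of T] unfolding closed_map_def by auto
  show ?thesis
  proof
    show "openin T (topspace T - fst ` D)" using cl by auto
    show "x0 \<in> topspace T - fst ` D" using x0 e by (auto simp: D_def topspace_T)
    show "cmod (F x y - F x0 y) < e" if "x \<in> topspace T - fst ` D" "y \<in> carrier G" for x y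
    proof (rule ccontr)
      assume "\<not> cmod (F x y - F x0 y) < e"
      then have "(x, y) \<in> D" using that by (auto simp: D_def topspace_T)
      then show False using that(1) by force
    qed
  qed
qed

lemma add_diff_cancel: "a \<in> carrier G \<Longrightarrow> y \<in> carrier G \<Longrightarrow> a \<oplus> (y \<ominus> a) = y"
  by (simp add: a_minus_def a_lcomm[of a y] r_neg)

lemma add_swap: "x \<in> carrier G \<Longrightarrow> a \<in> carrier G \<Longrightarrow> b \<in> carrier G \<Longrightarrow> x \<oplus> a \<oplus> b = x \<oplus> b \<oplus> a"
  by (simp add: a_ac)

text \<open>This is \<open>tube\<close> at \<open>\<zero>\<close> for the function
  \<open>f (y \<oplus> u)\<close> of \<open>u\<close> and \<open>y\<close>: one neighbourhood
  \<open>U\<close> of \<open>\<zero>\<close> serves all \<open>y\<close>.\<close>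

lemma unif_cont:
  assumes f: "cont f" and e: "e > 0"
  obtains U where "openin T U" "\<zero> \<in> U" "\<And>u y. u \<in> U \<Longrightarrow> y \<in> carrier G \<Longrightarrow> cmod (f (y \<oplus> u) - f y) < e"
proof -
  have "cont2 (\<lambda>u y. f (y \<oplus> u))"
    by (intro cont2_comp[OF f] grp_cont)
  from tube[OF this _ e, of \<zero>] obtain U where U: "openin T U" "\<zero> \<in> U"
     "\<And>x y. x \<in> U \<Longrightarrow> y \<in> carrier G \<Longrightarrow> cmod (f (y \<oplus> x) - f (y \<oplus> \<zero>)) < e" by auto
  show ?thesis by (rule that[OF U(1,2)]) (use U(3) in force)
qed

text \<open>Compactness in the form needed for averaging: from any starting point, some shift in the
  finite set \<open>S\<close> comes within \<open>U\<close> of any prescribed target.\<close>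

lemma translate_cover:
  assumes U: "openin T U" "\<zero> \<in> U"
  obtains S where "finite S" "S \<noteq> {}" "S \<subseteq> carrier G" "\<And>y. y \<in> carrier G \<Longrightarrow> \<exists>a\<in>S. \<exists>u\<in>U. y = a \<oplus> u"
proof -
  define V where "V a = {y \<in> topspace T. y \<ominus> a \<in> U}" for a
  have V: "openin T (V a)" if "a \<in> carrier G" for a
    unfolding V_def by (rule openin_continuous_map_preimage[OF _ U(1)]) (intro grp_cont that)
  have aV: "a \<in> V a" if "a \<in> carrier G" for a
    using that U(2) by (simp add: V_def topspace_T r_neg a_minus_def)
  have "topspace T \<subseteq> \<Union>(V ` carrier G)" using aV by (auto simp: topspace_T)
  with compact_T V obtain \<F> where F: "finite \<F>" "\<F> \<subseteq> V ` carrier G" "topspace T \<subseteq> \<Union>\<F>"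
    unfolding compact_space_def compactin_def by (metis (no_types, lifting) image_iff)
  then obtain S where S: "finite S" "S \<subseteq> carrier G" "\<F> = V ` S"
    by (meson finite_subset_image)
  show ?thesis
  proof (rule that[OF S(1) _ S(2)])
    have "\<zero> \<in> topspace T" by (simp add: topspace_T)
    then show "S \<noteq> {}" using F(3) S(3) by auto
    fix y assume y: "y \<in> carrier G"
    then obtain a where a: "a \<in> S" "y \<ominus> a \<in> U" using F(3) S(3) by (auto simp: topspace_T V_def)
    have "y = a \<oplus> (y \<ominus> a)" using a(1) S(2) y by (auto simp: add_diff_cancel)
    with a show "\<exists>a\<in>S. \<exists>u\<in>U. y = a \<oplus> u" by blast
  qed
qed

section \<open>Averages over finitely many translates\<close>

definition avg :: "'a set \<Rightarrow> ('a \<Rightarrow> complex) \<Rightarrow> 'a \<Rightarrow> complex" where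
  "avg S f x = (\<Sum>a\<in>S. f (x \<oplus> a)) / of_nat (card S)"

text \<open>Composing two averages gives an average over a sum of sets with multiplicities; keeping
  a list of sets avoids the multiplicities. The head of the list is applied last.\<close>

fun avgs :: "'a set list \<Rightarrow> ('a \<Rightarrow> complex) \<Rightarrow> 'a \<Rightarrow> complex" where
  "avgs [] f = f"
| "avgs (S # Ss) f = avg S (avgs Ss f)"

definition avg_sets :: "'a set list \<Rightarrow> bool" where
  "avg_sets Ss \<longleftrightarrow> (\<forall>S\<in>set Ss. finite S \<and> S \<noteq> {} \<and> S \<subseteq> carrier G)"

lemma avg_sets_Nil [simp]: "avg_sets []" and avg_sets_Cons: "avg_sets (S # Ss) \<longleftrightarrow> (finite S \<and> S \<noteq> {} \<and> S \<subseteq> carrier G) \<and> avg_sets Ss"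
  and avg_sets_append [simp]: "avg_sets (Ss @ Rs) \<longleftrightarrow> avg_sets Ss \<and> avg_sets Rs"
  by (auto simp: avg_sets_def)

lemma avgs_append: "avgs (Ss @ Rs) f = avgs Ss (avgs Rs f)"
  by (induction Ss) auto

lemma avg_cong:
  assumes "S \<subseteq> carrier G" "x \<in> carrier G" "\<And>y. y \<in> carrier G \<Longrightarrow> f y = g y"
  shows "avg S f x = avg S g x"
  unfolding avg_def using assms by (auto intro!: sum.cong arg_cong2[where f = "(/)"])

lemma avgs_cong:
  assumes "avg_sets Ss" "x \<in> carrier G" "\<And>y. y \<in> carrier G \<Longrightarrow> f y = g y"
  shows "avgs Ss f x = avgs Ss g x"
  using assms(1,2) by (induction Ss arbitrary: x) (auto simp: avg_sets_Cons assms(3) intro!: avg_cong)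

text \<open>Commutativity of the group enters here. It is what makes the limiting value independent
  of the chosen averages, see \<open>good_dist\<close>.\<close>

lemma avg_commute:
  assumes "S \<subseteq> carrier G" "R \<subseteq> carrier G" "x \<in> carrier G"
  shows "avg S (avg R f) x = avg R (avg S f) x"
proof -
  have "f (x \<oplus> a \<oplus> b) = f (x \<oplus> b \<oplus> a)" if "a \<in> S" "b \<in> R" for a b
    using assms that by (intro arg_cong[of _ _ f] add_swap) auto
  then have "(\<Sum>a\<in>S. \<Sum>b\<in>R. f (x \<oplus> a \<oplus> b)) = (\<Sum>a\<in>S. \<Sum>b\<in>R. f (x \<oplus> b \<oplus> a))"
    by (intro sum.cong refl) auto
  also have "\<dots> = (\<Sum>b\<in>R. \<Sum>a\<in>S. f (x \<oplus> b \<oplus> a))" by (rule sum.swap)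
  finally show ?thesis unfolding avg_def
    by (simp add: sum_divide_distrib[symmetric] mult.commute)
qed

lemma avgs_commute1:
  assumes "S \<subseteq> carrier G" "avg_sets Rs" "x \<in> carrier G"
  shows "avg S (avgs Rs f) x = avgs Rs (avg S f) x"
  using assms
proof (induction Rs arbitrary: x)
  case (Cons R Rs)
  then have "avg R (avg S (avgs Rs f)) x = avg R (avgs Rs (avg S f)) x"
    by (intro avg_cong) (auto simp: avg_sets_Cons)
  then show ?case using avg_commute[of S R x "avgs Rs f"] Cons by (simp add: avg_sets_Cons)
qed simp

lemma avgs_commute:
  assumes "avg_sets Ss" "avg_sets Rs" "x \<in> carrier G"
  shows "avgs Ss (avgs Rs f) x = avgs Rs (avgs Ss f) x"
  using assms
proof (induction Ss arbitrary: x)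
  case (Cons S Ss)
  then have "avg S (avgs Ss (avgs Rs f)) x = avg S (avgs Rs (avgs Ss f)) x"
    by (intro avg_cong) (auto simp: avg_sets_Cons)
  then show ?case using avgs_commute1[of S Rs x "avgs Ss f"] Cons by (simp add: avg_sets_Cons)
qed simp

lemma avg_closed_ball:
  assumes S: "finite S" "S \<noteq> {}" "S \<subseteq> carrier G" and x: "x \<in> carrier G"
    and b: "\<And>y. y \<in> carrier G \<Longrightarrow> cmod (f y - m) \<le> e"
  shows "cmod (avg S f x - m) \<le> e"
proof -
  have c: "card S > 0" using S by (simp add: card_gt_0_iff)
  have "avg S f x - m = (\<Sum>a\<in>S. f (x \<oplus> a) - m) / of_nat (card S)"
    using c by (simp add: avg_def sum_subtractf diff_divide_distrib)
  also have "cmod \<dots> \<le> (\<Sum>a\<in>S. e) / card S"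
  proof -
    have "cmod (\<Sum>a\<in>S. f (x \<oplus> a) - m) \<le> (\<Sum>a\<in>S. e)"
      by (intro sum_norm_le b) (use S x in auto)
    then show ?thesis unfolding norm_divide norm_of_nat by (intro divide_right_mono) auto
  qed
  also have "\<dots> = e" using c by simp
  finally show ?thesis .
qed

lemma avgs_closed_ball:
  assumes "avg_sets Ss" "x \<in> carrier G"
    and b: "\<And>y. y \<in> carrier G \<Longrightarrow> cmod (f y - m) \<le> e"
  shows "cmod (avgs Ss f x - m) \<le> e"
  using assms(1,2) by (induction Ss arbitrary: x) (auto simp: avg_sets_Cons b intro!: avg_closed_ball)

lemma avgs_add: "avgs Ss (\<lambda>x. f x + g x) = (\<lambda>x. avgs Ss f x + avgs Ss g x)"
  by (induction Ss) (auto simp: avg_def fun_eq_iff sum.distrib add_divide_distrib)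

lemma avgs_cmult: "avgs Ss (\<lambda>x. c * f x) = (\<lambda>x. c * avgs Ss f x)"
  by (induction Ss) (auto simp: avg_def fun_eq_iff sum_distrib_left)

lemma avgs_cnj: "avgs Ss (\<lambda>x. cnj (f x)) = (\<lambda>x. cnj (avgs Ss f x))"
  by (induction Ss) (auto simp: avg_def fun_eq_iff)

lemma cont_avg: "finite S \<Longrightarrow> S \<subseteq> carrier G \<Longrightarrow> cont f \<Longrightarrow> cont (avg S f)"
proof -
  assume a: "finite S" "S \<subseteq> carrier G" "cont f"
  have "cont (\<lambda>x. \<Sum>a\<in>S. f (x \<oplus> a))"
    by (rule cont_sum[OF a(1)], rule cont_comp[OF a(3)], intro add_cont' id_cont const_cont) (use a in auto)
  from cont_mult[OF this cont_const] show ?thesis unfolding avg_def divide_inverse .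
qed

text \<open>An average of translates inherits the modulus of continuity of \<open>f\<close>, so one
  neighbourhood and one finite cover serve through the whole iteration in
  \<open>avgs_osc_Re\<close>.\<close>

lemma Re_avg_modulus:
  assumes S: "finite S" "S \<noteq> {}" "S \<subseteq> carrier G" and "U \<subseteq> carrier G"
    and m: "\<And>u y. u \<in> U \<Longrightarrow> y \<in> carrier G \<Longrightarrow> cmod (f (y \<oplus> u) - f y) \<le> e"
    and uy: "u \<in> U" "y \<in> carrier G"
  shows "cmod (avg S f (y \<oplus> u) - avg S f y) \<le> e"
proof -
  have u: "u \<in> carrier G" using assms by auto
  have "cmod (avg S (\<lambda>y. f (y \<oplus> u) - f y) y - 0) \<le> e"
    by (rule avg_closed_ball) (use S uy m in auto)
  moreover have "avg S (\<lambda>y. f (y \<oplus> u) - f y) y = avg S f (y \<oplus> u) - avg S f y"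
  proof -
    have "f (y \<oplus> a \<oplus> u) = f (y \<oplus> u \<oplus> a)" if "a \<in> S" for a
      using that S u uy by (intro arg_cong[of _ _ f] add_swap) auto
    then show ?thesis by (simp add: avg_def sum_subtractf diff_divide_distrib)
  qed
  ultimately show ?thesis by simp
qed

text \<open>Von Neumann's contraction. From every \<open>x\<close>, one of the \<open>k\<close>
  shifts in \<open>S\<close> lands within \<open>U\<close> of a point \<open>z\<close> where the
  real part is minimal. Averaging over \<open>S\<close> therefore lowers the maximum by a definite
  amount, while the minimum cannot drop.\<close>

lemma avgs_osc_Re:
  assumes f: "cont f" and e: "e > 0"
  obtains Ss where "avg_sets Ss" "\<And>x y. x \<in> carrier G \<Longrightarrow> y \<in> carrier G \<Longrightarrow> Re (avgs Ss f x) - Re (avgs Ss f y) \<le> e"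
proof -
  obtain U where U: "openin T U" "\<zero> \<in> U" "\<And>u y. u \<in> U \<Longrightarrow> y \<in> carrier G \<Longrightarrow> cmod (f (y \<oplus> u) - f y) < e/3"
    using unif_cont[OF f, of "e/3"] e by auto
  have Uc: "U \<subseteq> carrier G" using openin_subset[OF U(1)] by (simp add: topspace_T)
  obtain S where S: "finite S" "S \<noteq> {}" "S \<subseteq> carrier G"
    "\<And>y. y \<in> carrier G \<Longrightarrow> \<exists>a\<in>S. \<exists>u\<in>U. y = a \<oplus> u"
    using translate_cover[OF U(1,2)] by blast
  define k where "k = card S"
  have k: "k > 0" unfolding k_def using S by (simp add: card_gt_0_iff)
  \<comment> \<open>Induction on the number \<open>n\<close> of decrements
    \<open>e / (3 * k)\<close> by which the oscillation may exceed \<open>e\<close>. The modulus of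
    continuity on \<open>U\<close> belongs to the invariant, so \<open>S\<close> never has to
    change.\<close>
  have main: "\<exists>Ss. avg_sets Ss \<and> (\<forall>x\<in>carrier G. \<forall>y\<in>carrier G. Re (avgs Ss g x) - Re (avgs Ss g y) \<le> e)"
    if "cont g" "\<And>u y. u \<in> U \<Longrightarrow> y \<in> carrier G \<Longrightarrow> cmod (g (y \<oplus> u) - g y) \<le> e/3"
      "\<And>x y. x \<in> carrier G \<Longrightarrow> y \<in> carrier G \<Longrightarrow> Re (g x) - Re (g y) \<le> e + of_nat n * (e / (3 * k))" for g n
    using that
  proof (induction n arbitrary: g)
    case 0
    then show ?case by (intro exI[of _ "[]"]) auto
  next
    case (Suc n)
    define D where "D = e + of_nat (Suc n) * (e / (3 * k))"
    have "compact ((\<lambda>x. Re (g x)) ` topspace T)"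
      using image_compactin[OF _ cont_Re[OF Suc.prems(1)]] compact_T
      by (simp add: compact_space_def compactin_euclidean_iff)
    moreover have "(\<lambda>x. Re (g x)) ` topspace T \<noteq> {}" using topspace_T by auto
    ultimately obtain z where z: "z \<in> carrier G" "\<And>y. y \<in> carrier G \<Longrightarrow> Re (g z) \<le> Re (g y)"
      using compact_attains_inf[of "(\<lambda>x. Re (g x)) ` topspace T"] by (auto simp: topspace_T)
    \<comment> \<open>One of the \<open>k\<close> summands is at most \<open>Re (g z) + e/3\<close>,
      the others are at most \<open>Re (g z) + D\<close>.\<close>
    have up: "Re (avg S g x) \<le> Re (g z) + D - (D - e/3) / k" if x: "x \<in> carrier G" for x
    proof -
      obtain a u where au: "a \<in> S" "u \<in> U" "z \<ominus> x = a \<oplus> u" using S(4) x z by (meson minus_closed)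
      have cc: "a \<in> carrier G" "u \<in> carrier G" using au S Uc by auto
      have "z = x \<oplus> a \<oplus> u"
        using au(3) x z cc add_diff_cancel[of x z] by (simp add: a_assoc)
      then have "cmod (g z - g (x \<oplus> a)) \<le> e/3"
        using Suc.prems(2)[OF au(2), of "x \<oplus> a"] x cc by auto
      then have small: "Re (g (x \<oplus> a)) \<le> Re (g z) + e/3"
        using abs_Re_le_cmod[of "g z - g (x \<oplus> a)"] by auto
      have "(\<Sum>b\<in>S. Re (g (x \<oplus> b))) = Re (g (x \<oplus> a)) + (\<Sum>b\<in>S-{a}. Re (g (x \<oplus> b)))"
        using S au(1) by (meson sum.remove)
      also have "\<dots> \<le> Re (g z) + e/3 + (\<Sum>b\<in>S-{a}. (Re (g z) + D))"
      proof (intro add_mono small sum_mono)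
        fix b assume "b \<in> S - {a}"
        then have "x \<oplus> b \<in> carrier G" using S x by auto
        from Suc.prems(3)[OF this z(1)] show "Re (g (x \<oplus> b)) \<le> Re (g z) + D" by (simp add: D_def)
      qed
      also have "\<dots> = k * (Re (g z) + D) - (D - e/3)"
        using S au(1) k by (simp add: k_def of_nat_diff algebra_simps)
      finally have "(\<Sum>b\<in>S. Re (g (x \<oplus> b))) \<le> k * (Re (g z) + D) - (D - e/3)" .
      then have "(\<Sum>b\<in>S. Re (g (x \<oplus> b))) / k \<le> (k * (Re (g z) + D) - (D - e/3)) / k"
        using k by (intro divide_right_mono) auto
      also have "\<dots> = Re (g z) + D - (D - e/3) / k" using k by (simp add: diff_divide_distrib)
      finally show ?thesis by (simp add: avg_def k_def)
    qed
    have lo: "Re (avg S g y) \<ge> Re (g z)" if y: "y \<in> carrier G" for y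
    proof -
      have "(\<Sum>b\<in>S. Re (g (y \<oplus> b))) \<ge> (\<Sum>b\<in>S. Re (g z))"
        by (intro sum_mono z) (use S y in auto)
      then have "(\<Sum>b\<in>S. Re (g (y \<oplus> b))) / k \<ge> (k * Re (g z)) / k"
        by (intro divide_right_mono) (auto simp: k_def)
      then show ?thesis using k by (simp add: avg_def k_def)
    qed
    have De: "(D - e/3) / k \<ge> e / (3*k)"
    proof -
      have "D \<ge> e" using e k by (simp add: D_def)
      then have "D - e/3 \<ge> e/3" using e by simp
      then have "(D - e/3) / k \<ge> (e/3) / k" by (intro divide_right_mono) auto
      then show ?thesis by simp
    qed
    have "\<exists>Ss. avg_sets Ss \<and> (\<forall>x\<in>carrier G. \<forall>y\<in>carrier G. Re (avgs Ss (avg S g) x) - Re (avgs Ss (avg S g) y) \<le> e)"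
    proof (rule Suc.IH)
      show "cont (avg S g)" by (rule cont_avg) (use S Suc.prems in auto)
      show "cmod (avg S g (y \<oplus> u) - avg S g y) \<le> e/3" if "u \<in> U" "y \<in> carrier G" for u y
        by (rule Re_avg_modulus[OF S(1-3) Uc]) (use Suc.prems that in auto)
      show "Re (avg S g x) - Re (avg S g y) \<le> e + real n * (e / real (3 * k))"
        if "x \<in> carrier G" "y \<in> carrier G" for x y
      proof -
        have *: "real (Suc n) * q = real n * q + q" for q by (simp add: algebra_simps)
        have "D - e / (3 * k) = e + real n * (e / real (3 * k))"
          using *[of "e / real (3 * k)"] unfolding D_def by linarith
        then show ?thesis using up[OF that(1)] lo[OF that(2)] De by linarith
      qed
    qed
    then obtain Ss where Ss: "avg_sets Ss" "\<forall>x\<in>carrier G. \<forall>y\<in>carrier G. Re (avgs Ss (avg S g) x) - Re (avgs Ss (avg S g) y) \<le> e" by blast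
    \<comment> \<open>\<open>S\<close> is put at the end of the list because the last set acts
      first.\<close>
    show ?case by (rule exI[of _ "Ss @ [S]"]) (use Ss S in \<open>simp add: avgs_append avg_sets_Cons\<close>)
  qed
  have "bounded ((\<lambda>x. f x) ` topspace T)"
    using image_compactin[OF _ f] compact_T
    by (simp add: compact_space_def compactin_euclidean_iff compact_imp_bounded)
  then obtain B where B: "\<And>x. x \<in> carrier G \<Longrightarrow> cmod (f x) \<le> B"
    by (auto simp: bounded_iff topspace_T)
  \<comment> \<open>Enough decrements to cover the initial oscillation, which is at most
    \<open>2 * B\<close>.\<close>
  obtain n :: nat where n: "of_nat n > 2 * B / (e / (3 * k))" using reals_Archimedean2 by blast
  have n': "2 * B < of_nat n * (e / (3 * k))" using n e k by (simp add: field_simps)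
  have "\<exists>Ss. avg_sets Ss \<and> (\<forall>x\<in>carrier G. \<forall>y\<in>carrier G. Re (avgs Ss f x) - Re (avgs Ss f y) \<le> e)"
  proof (rule main[of f n])
    show "cmod (f (y \<oplus> u) - f y) \<le> e/3" if "u \<in> U" "y \<in> carrier G" for u y
      using U(3)[OF that] by simp
    show "Re (f x) - Re (f y) \<le> e + real n * (e / real (3 * k))" if "x \<in> carrier G" "y \<in> carrier G" for x y
      using B[OF that(1)] B[OF that(2)] abs_Re_le_cmod[of "f x"] abs_Re_le_cmod[of "f y"] n' e by auto
  qed (use f in auto)
  with that show ?thesis by blast
qed

end

section \<open>Existence and properties of the invariant mean\<close>

context compact_ab_group
begin

definition good :: "'a set list \<Rightarrow> ('a \<Rightarrow> complex) \<Rightarrow> real \<Rightarrow> complex \<Rightarrow> bool" where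
  "good Ss f e m \<longleftrightarrow> avg_sets Ss \<and> (\<forall>x\<in>carrier G. cmod (avgs Ss f x - m) \<le> e)"

lemma good_left: "good Ss f e m \<Longrightarrow> avg_sets Rs \<Longrightarrow> good (Rs @ Ss) f e m"
  unfolding good_def avgs_append using avgs_closed_ball[of Rs _ "avgs Ss f" m e] by simp

lemma good_ok: "good Ss f e m \<Longrightarrow> avg_sets Ss"
  by (simp add: good_def)

lemma good_right: "good Ss f e m \<Longrightarrow> avg_sets Rs \<Longrightarrow> good (Ss @ Rs) f e m"
  using good_left[of Ss f e m Rs] avgs_commute[of Ss Rs _ f] unfolding good_def by (auto simp: avgs_append)

lemma good_cong: "good Ss f e m \<Longrightarrow> (\<And>x. x \<in> carrier G \<Longrightarrow> f x = g x) \<Longrightarrow> good Ss g e m"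
  unfolding good_def using avgs_cong[of Ss _ f g] by auto

text \<open>Uniqueness of the mean: averages commute, so the concatenated list approximates
  \<open>m\<close> and \<open>m'\<close> at the same time.\<close>

lemma good_dist: assumes "good Ss f e m" "good Rs f e' m'" shows "cmod (m - m') \<le> e + e'"
proof -
  have "good (Ss @ Rs) f e m" "good (Ss @ Rs) f e' m'"
    by (rule good_right[OF assms(1) good_ok[OF assms(2)]], rule good_left[OF assms(2) good_ok[OF assms(1)]])
  then have "cmod (avgs (Ss @ Rs) f \<zero> - m) \<le> e" "cmod (avgs (Ss @ Rs) f \<zero> - m') \<le> e'"
    by (auto simp: good_def)
  then show ?thesis
    using norm_triangle_sub[of "m - m'" "0"] norm_triangle_le_diff[of "avgs (Ss @ Rs) f \<zero> - m'" "avgs (Ss @ Rs) f \<zero> - m" "e + e'"]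
    by auto
qed

lemma good_real_exists:
  assumes f: "cont f" and e: "e > 0" and r: "\<And>x. cnj (f x) = f x"
  obtains Ss m where "good Ss f e m"
proof -
  obtain Ss where Ss: "avg_sets Ss" "\<And>x y. x \<in> carrier G \<Longrightarrow> y \<in> carrier G \<Longrightarrow> Re (avgs Ss f x) - Re (avgs Ss f y) \<le> e"
    using avgs_osc_Re[OF f e] by blast
  have cj: "avgs Ss f x = cnj (avgs Ss f x)" for x
    using fun_cong[OF avgs_cnj[of Ss f], of x] unfolding r .
  have im: "Im (avgs Ss f x) = 0" for x
    using arg_cong[OF cj[of x], of Im] by simp
  have "cmod (avgs Ss f x - avgs Ss f \<zero>) \<le> e" if "x \<in> carrier G" for x
  proof -
    have "cmod (avgs Ss f x - avgs Ss f \<zero>) = \<bar>Re (avgs Ss f x) - Re (avgs Ss f \<zero>)\<bar>"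
      by (simp add: cmod_eq_Re im)
    then show ?thesis using Ss(2)[OF that, of \<zero>] Ss(2)[OF _ that, of \<zero>] by auto
  qed
  then show ?thesis using Ss(1) by (intro that[of Ss "avgs Ss f \<zero>"]) (simp add: good_def)
qed

lemma good_exists:
  assumes f: "cont f" and e: "e > 0"
  obtains Ss m where "good Ss f e m"
proof -
  have a: "cont (\<lambda>x. complex_of_real (Re (f x)))" "cont (\<lambda>x. complex_of_real (Im (f x)))"
    by (rule continuous_map_lift1[OF f], intro continuous_intros)+
  obtain Ss m where 1: "good Ss (\<lambda>x. complex_of_real (Re (f x))) (e/2) m"
    using good_real_exists[OF a(1), of "e/2"] e by auto
  obtain Rs n where 2: "good Rs (\<lambda>x. complex_of_real (Im (f x))) (e/2) n"
    using good_real_exists[OF a(2), of "e/2"] e by auto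
  have 3: "good (Ss @ Rs) (\<lambda>x. complex_of_real (Re (f x))) (e/2) m"
          "good (Ss @ Rs) (\<lambda>x. complex_of_real (Im (f x))) (e/2) n"
    by (rule good_right[OF 1 good_ok[OF 2]], rule good_left[OF 2 good_ok[OF 1]])
  have "f = (\<lambda>x. complex_of_real (Re (f x)) + \<i> * complex_of_real (Im (f x)))"
    by (auto simp: complex_eq_iff)
  then have eq: "avgs (Ss @ Rs) f x = avgs (Ss @ Rs) (\<lambda>x. complex_of_real (Re (f x))) x 
      + \<i> * avgs (Ss @ Rs) (\<lambda>x. complex_of_real (Im (f x))) x" for x
    using avgs_add[of "Ss @ Rs" "\<lambda>x. complex_of_real (Re (f x))" "\<lambda>x. \<i> * complex_of_real (Im (f x))"]
      avgs_cmult[of "Ss @ Rs" \<i> "\<lambda>x. complex_of_real (Im (f x))"] by simp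
  have "cmod (avgs (Ss @ Rs) f x - (m + \<i> * n)) \<le> e" if x: "x \<in> carrier G" for x
  proof -
    have "avgs (Ss @ Rs) f x - (m + \<i> * n) = (avgs (Ss @ Rs) (\<lambda>x. complex_of_real (Re (f x))) x - m)
       + \<i> * (avgs (Ss @ Rs) (\<lambda>x. complex_of_real (Im (f x))) x - n)"
      unfolding eq by (simp add: algebra_simps)
    also have "cmod \<dots> \<le> e/2 + e/2"
      by (rule norm_triangle_le, rule add_mono) (use 3 x in \<open>auto simp: good_def norm_mult\<close>)
    finally show ?thesis by simp
  qed
  then show ?thesis using 3 by (intro that[of "Ss @ Rs" "m + \<i> * n"]) (auto simp: good_def)
qed

definition mean :: "('a \<Rightarrow> complex) \<Rightarrow> complex" where
  "mean f = (THE m. \<forall>e>0. \<exists>Ss. good Ss f e m)"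

lemma mean_eqI: assumes "\<And>e. e > 0 \<Longrightarrow> \<exists>Ss. good Ss f e m" shows "mean f = m"
  unfolding mean_def
proof (rule the_equality)
  fix m' assume m': "\<forall>e>0. \<exists>Ss. good Ss f e m'"
  have "cmod (m' - m) \<le> e" if e: "e > 0" for e
  proof -
    obtain Ss Rs where "good Ss f (e/2) m'" "good Rs f (e/2) m"
      using m' assms e by (meson half_gt_zero)
    from good_dist[OF this] show ?thesis by simp
  qed
  then have "cmod (m' - m) \<le> 0" by (rule field_le_epsilon[of _ 0, simplified])
  then show "m' = m" by simp
qed (use assms in auto)

text \<open>Approximate means for the errors \<open>1 / Suc n\<close> form a Cauchy sequence by
  \<open>good_dist\<close>, and their limit is approximated to every accuracy.\<close>

lemma mean_good: assumes f: "cont f" and e: "e > 0" shows "\<exists>Ss. good Ss f e (mean f)"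
proof -
  have "\<exists>Ss m. good Ss f (1 / Suc n) m" for n
  proof -
    obtain Ss m where "good Ss f (1 / Suc n) m" by (rule good_exists[OF f, of "1 / Suc n"]) auto
    then show ?thesis by blast
  qed
  then have "\<forall>n. \<exists>p. good (fst p) f (1 / Suc n) (snd p)" by simp
  from choice[OF this] obtain p where p: "\<And>n. good (fst (p n)) f (1 / Suc n) (snd (p n))" by blast
  define Ss m where "Ss n = fst (p n)" and "m n = snd (p n)" for n
  have S: "good (Ss n) f (1 / Suc n) (m n)" for n using p by (simp add: Ss_def m_def)
  have "Cauchy m"
  proof (rule metric_CauchyI)
    fix e :: real assume e: "e > 0"
    obtain N where N: "inverse (of_nat (Suc N)) < e/2" using reals_Archimedean[of "e/2"] e by auto
    have *: "1 / real (Suc n) < e/2" if "n \<ge> N" for n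
    proof -
      have "1 / real (Suc n) \<le> inverse (of_nat (Suc N))" using that by (simp add: field_simps)
      with N show ?thesis by linarith
    qed
    show "\<exists>N. \<forall>i\<ge>N. \<forall>j\<ge>N. dist (m i) (m j) < e"
    proof (intro exI[of _ N] allI impI)
      fix i j assume "i \<ge> N" "j \<ge> N"
      with *[of i] *[of j] good_dist[OF S[of i] S[of j]] show "dist (m i) (m j) < e" by (simp add: dist_norm)
    qed
  qed
  then obtain l where l: "m \<longlonglongrightarrow> l" using Cauchy_convergent convergent_def by blast
  have g: "\<exists>Ss. good Ss f e l" if e: "e > 0" for e
  proof -
    have ev1: "eventually (\<lambda>n. dist (m n) l < e/2) sequentially"
      using e by (intro tendstoD[OF l]) auto
    have ev2: "eventually (\<lambda>n. 1 / real (Suc n) < e/2) sequentially"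
      using order_tendstoD(2)[OF LIMSEQ_inverse_real_of_nat, of "e/2"] e by (simp add: inverse_eq_divide)
    obtain n where n: "dist (m n) l < e/2" "1 / real (Suc n) < e/2"
      using eventually_happens'[OF sequentially_bot eventually_conj[OF ev1 ev2]] by auto
    have "cmod (avgs (Ss n) f x - l) \<le> e" if x: "x \<in> carrier G" for x
    proof -
      have "cmod (avgs (Ss n) f x - m n) \<le> 1 / Suc n" using S x by (auto simp: good_def)
      with n show ?thesis using norm_triangle_ineq[of "avgs (Ss n) f x - m n" "m n - l"] by (simp add: dist_norm)
    qed
    then show ?thesis using S[of n] by (auto simp: good_def)
  qed
  then show ?thesis using mean_eqI[OF g] e by simp
qed

text \<open>Further averaging on either side preserves an approximation, so concatenating lists
  yields one list for finitely many functions. Additivity of the mean and Fubini both depend on such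
  a common list.\<close>

lemma mean_good_simul:
  assumes "finite \<Phi>" "\<And>f. f \<in> \<Phi> \<Longrightarrow> cont f" "e > 0"
  shows "\<exists>Ss. avg_sets Ss \<and> (\<forall>f\<in>\<Phi>. good Ss f e (mean f))"
  using assms(1,2)
proof (induction \<Phi> rule: finite_induct)
  case empty then show ?case by (intro exI[of _ "[]"]) auto
next
  case (insert f \<Phi>)
  then obtain Ss where Ss: "avg_sets Ss" "\<forall>f\<in>\<Phi>. good Ss f e (mean f)" by auto
  obtain Rs where Rs: "good Rs f e (mean f)" using mean_good[of f e] insert assms(3) by auto
  have "avg_sets Rs" using Rs by (auto simp: good_def)
  then show ?case using Ss Rs good_left good_right by (intro exI[of _ "Ss @ Rs"]) auto
qed

lemma mean_cong:
  assumes "\<And>x. x \<in> carrier G \<Longrightarrow> f x = g x" shows "mean f = mean g"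
proof -
  have "good Ss f e m = good Ss g e m" for Ss e m
    using good_cong[of Ss f e m g] good_cong[of Ss g e m f] assms by auto
  then show ?thesis by (simp add: mean_def)
qed

lemma mean_add: assumes "cont f" "cont g" shows "mean (\<lambda>x. f x + g x) = mean f + mean g"
proof (rule mean_eqI)
  fix e :: real assume e: "e > 0"
  obtain Ss where Ss: "avg_sets Ss" "good Ss f (e/2) (mean f)" "good Ss g (e/2) (mean g)"
    using mean_good_simul[of "{f, g}" "e/2"] assms e by auto
  have "cmod (avgs Ss (\<lambda>x. f x + g x) x - (mean f + mean g)) \<le> e" if x: "x \<in> carrier G" for x
  proof -
    have "avgs Ss (\<lambda>x. f x + g x) x - (mean f + mean g) = (avgs Ss f x - mean f) + (avgs Ss g x - mean g)"
      by (simp add: avgs_add)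
    also have "cmod \<dots> \<le> e/2 + e/2"
      by (rule norm_triangle_le, rule add_mono) (use Ss x in \<open>auto simp: good_def\<close>)
    finally show ?thesis by simp
  qed
  then show "\<exists>Ss. good Ss (\<lambda>x. f x + g x) e (mean f + mean g)" using Ss by (auto simp: good_def)
qed

lemma mean_const: "mean (\<lambda>x. c) = c"
proof (rule mean_eqI)
  fix e :: real assume "e > 0"
  then show "\<exists>Ss. good Ss (\<lambda>x. c) e c" by (intro exI[of _ "[]"]) (auto simp: good_def)
qed

lemma mean_cmult: assumes "cont f" shows "mean (\<lambda>x. c * f x) = c * mean f"
proof (cases "c = 0")
  case True then show ?thesis using mean_const[of 0] by simp
next
  case False
  show ?thesis
  proof (rule mean_eqI)
    fix e :: real assume e: "e > 0"
    obtain Ss where Ss: "good Ss f (e / cmod c) (mean f)" using mean_good[OF assms, of "e / cmod c"] e False by auto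
    have "cmod (avgs Ss (\<lambda>x. c * f x) x - c * mean f) \<le> e" if x: "x \<in> carrier G" for x
    proof -
      have "avgs Ss (\<lambda>x. c * f x) x - c * mean f = c * (avgs Ss f x - mean f)"
        by (simp add: avgs_cmult algebra_simps)
      also have "cmod \<dots> \<le> cmod c * (e / cmod c)"
        unfolding norm_mult by (rule mult_left_mono) (use Ss x in \<open>auto simp: good_def\<close>)
      finally show ?thesis using False by simp
    qed
    then show "\<exists>Ss. good Ss (\<lambda>x. c * f x) e (c * mean f)" using Ss by (auto simp: good_def)
  qed
qed

lemma mean_diff: assumes "cont f" "cont g" shows "mean (\<lambda>x. f x - g x) = mean f - mean g"
  using mean_add[OF assms(1) cont_cmult[OF assms(2), of "-1"]] mean_cmult[OF assms(2), of "-1"] by simp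

lemma mean_sum: "finite I \<Longrightarrow> (\<And>i. i \<in> I \<Longrightarrow> cont (f i)) \<Longrightarrow> mean (\<lambda>x. \<Sum>i\<in>I. f i x) = (\<Sum>i\<in>I. mean (f i))"
  by (induction I rule: finite_induct) (auto simp: mean_const mean_add cont_sum)

lemma mean_cnj: assumes "cont f" shows "mean (\<lambda>x. cnj (f x)) = cnj (mean f)"
proof (rule mean_eqI)
  fix e :: real assume e: "e > 0"
  obtain Ss where Ss: "good Ss f e (mean f)" using mean_good[OF assms e] by auto
  have "cmod (cnj z - cnj w) = cmod (z - w)" for z w by (metis complex_cnj_diff complex_mod_cnj)
  with Ss have "good Ss (\<lambda>x. cnj (f x)) e (cnj (mean f))" by (simp add: good_def avgs_cnj)
  then show "\<exists>Ss. good Ss (\<lambda>x. cnj (f x)) e (cnj (mean f))" ..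
qed

lemma mean_avg: assumes "cont f" "finite S" "S \<noteq> {}" "S \<subseteq> carrier G" shows "mean (avg S f) = mean f"
proof (rule mean_eqI)
  fix e :: real assume e: "e > 0"
  obtain Ss where Ss: "good Ss f e (mean f)" using mean_good[OF assms(1) e] by auto
  have "good (Ss @ [S]) f e (mean f)" by (rule good_right[OF Ss]) (use assms in \<open>auto simp: avg_sets_def\<close>)
  then have "good Ss (avg S f) e (mean f)" by (simp add: good_def avgs_append)
  then show "\<exists>Ss. good Ss (avg S f) e (mean f)" ..
qed

lemma mean_shift: assumes "cont f" "a \<in> carrier G" shows "mean (\<lambda>x. f (x \<oplus> a)) = mean f"
  using mean_avg[OF assms(1), of "{a}"] assms(2) by (simp add: avg_def[abs_def])

lemma avgs_reflect:
  assumes "avg_sets Ss" "x \<in> carrier G"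
  shows "avgs (map ((`) (\<lambda>x. \<ominus> x)) Ss) (\<lambda>x. f (\<ominus> x)) x = avgs Ss f (\<ominus> x)"
  using assms
proof (induction Ss arbitrary: x)
  case (Cons S Ss)
  have inj: "inj_on (\<lambda>x. \<ominus> x) S" using Cons.prems by (intro inj_onI) (metis minus_minus avg_sets_Cons subsetD)
  have "(\<Sum>a\<in>(\<lambda>x. \<ominus> x) ` S. avgs (map ((`) (\<lambda>x. \<ominus> x)) Ss) (\<lambda>x. f (\<ominus> x)) (x \<oplus> a)) = 
     (\<Sum>a\<in>S. avgs (map ((`) (\<lambda>x. \<ominus> x)) Ss) (\<lambda>x. f (\<ominus> x)) (x \<oplus> \<ominus> a))"
    using sum.reindex[OF inj] by simp
  also have "\<dots> = (\<Sum>a\<in>S. avgs Ss f (\<ominus> x \<oplus> a))"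
  proof (rule sum.cong[OF refl])
    fix a assume a: "a \<in> S"
    then have ac: "a \<in> carrier G" using Cons.prems by (auto simp: avg_sets_Cons)
    have "avgs (map ((`) (\<lambda>x. \<ominus> x)) Ss) (\<lambda>x. f (\<ominus> x)) (x \<oplus> \<ominus> a) = avgs Ss f (\<ominus> (x \<oplus> \<ominus> a))"
      by (rule Cons.IH) (use Cons.prems ac in \<open>auto simp: avg_sets_Cons\<close>)
    also have "\<ominus> (x \<oplus> \<ominus> a) = \<ominus> x \<oplus> a" using ac Cons.prems by (simp add: minus_add)
    finally show "avgs (map ((`) (\<lambda>x. \<ominus> x)) Ss) (\<lambda>x. f (\<ominus> x)) (x \<oplus> \<ominus> a) = avgs Ss f (\<ominus> x \<oplus> a)" .
  qed
  finally show ?case using card_image[OF inj] by (simp add: avg_def)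
qed simp

lemma mean_reflect: assumes "cont f" shows "mean (\<lambda>x. f (\<ominus> x)) = mean f"
proof (rule mean_eqI)
  fix e :: real assume e: "e > 0"
  obtain Ss where Ss: "good Ss f e (mean f)" using mean_good[OF assms e] by auto
  then have avg_sets: "avg_sets Ss" by (simp add: good_def)
  have "avg_sets (map ((`) (\<lambda>x. \<ominus> x)) Ss)" using avg_sets by (fastforce simp: avg_sets_def)
  then have "good (map ((`) (\<lambda>x. \<ominus> x)) Ss) (\<lambda>x. f (\<ominus> x)) e (mean f)"
    using Ss by (simp add: good_def avgs_reflect)
  then show "\<exists>Ss. good Ss (\<lambda>x. f (\<ominus> x)) e (mean f)" ..
qed

lemma mean_ball: assumes "cont f" "\<And>x. x \<in> carrier G \<Longrightarrow> cmod (f x - c) \<le> B" shows "cmod (mean f - c) \<le> B"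
proof (rule field_le_epsilon)
  fix e :: real assume e: "e > 0"
  obtain Ss where Ss: "good Ss f e (mean f)" using mean_good[OF assms(1) e] by auto
  then have "cmod (avgs Ss f \<zero> - mean f) \<le> e" "avg_sets Ss" by (auto simp: good_def)
  moreover have "cmod (avgs Ss f \<zero> - c) \<le> B"
    by (rule avgs_closed_ball) (use assms(2) calculation in auto)
  ultimately show "cmod (mean f - c) \<le> B + e"
    using norm_triangle_ineq[of "mean f - avgs Ss f \<zero>" "avgs Ss f \<zero> - c"] by (simp add: norm_minus_commute)
qed

lemma mean_dist:
  assumes "cont f" "cont g" "\<And>x. x \<in> carrier G \<Longrightarrow> cmod (f x - g x) \<le> B"
  shows "cmod (mean f - mean g) \<le> B"
  using mean_ball[of "\<lambda>x. f x - g x" 0 B] assms by (simp add: mean_diff cont_diff)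

lemma cont_bounded: assumes "cont f" obtains B where "B > 0" "\<And>x. x \<in> carrier G \<Longrightarrow> cmod (f x) \<le> B"
proof -
  have "bounded ((\<lambda>x. f x) ` topspace T)"
    using image_compactin[OF _ assms] compact_T
    by (simp add: compact_space_def compactin_euclidean_iff compact_imp_bounded)
  then show ?thesis using that unfolding bounded_pos by (auto simp: topspace_T)
qed

text \<open>Values in the interval from 0 to \<open>B\<close> lie in the disc of centre
  \<open>B\<close> and radius \<open>B\<close>. The mean lies in the same disc, hence in the right
  half plane.\<close>

lemma mean_nonneg:
  assumes f: "cont (\<lambda>x. complex_of_real (r x))" and r: "\<And>x. x \<in> carrier G \<Longrightarrow> r x \<ge> 0"
  shows "Re (mean (\<lambda>x. complex_of_real (r x))) \<ge> 0"
proof -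
  obtain B where B: "B > 0" "\<And>x. x \<in> carrier G \<Longrightarrow> cmod (complex_of_real (r x)) \<le> B" using cont_bounded[OF f] by blast
  have "cmod (mean (\<lambda>x. complex_of_real (r x)) - of_real B) \<le> B"
  proof (rule mean_ball[OF f])
    fix x assume x: "x \<in> carrier G"
    have "cmod (complex_of_real (r x) - of_real B) = \<bar>r x - B\<bar>"
      by (metis norm_of_real of_real_diff)
    then show "cmod (complex_of_real (r x) - of_real B) \<le> B" using B(2)[OF x] r[OF x] by auto
  qed
  then show ?thesis using abs_Re_le_cmod[of "mean (\<lambda>x. complex_of_real (r x)) - of_real B"] by auto
qed

lemma mean_real:
  assumes f: "cont (\<lambda>x. complex_of_real (r x))"
  shows "mean (\<lambda>x. complex_of_real (r x)) = of_real (Re (mean (\<lambda>x. complex_of_real (r x))))"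
proof -
  have "cnj (mean (\<lambda>x. complex_of_real (r x))) = mean (\<lambda>x. complex_of_real (r x))"
    using mean_cnj[OF f] by simp
  then show ?thesis by (simp add: complex_eq_iff)
qed

text \<open>Averaging over a finite cover by translates spreads the value at \<open>x0\<close> over
  the whole group: the result has the same mean and a positive lower bound everywhere.\<close>

lemma mean_pos:
  assumes f: "cont (\<lambda>x. complex_of_real (r x))" and r: "\<And>x. x \<in> carrier G \<Longrightarrow> r x \<ge> 0"
    and x0: "x0 \<in> carrier G" "r x0 > 0"
  shows "Re (mean (\<lambda>x. complex_of_real (r x))) > 0"
proof -
  let ?f = "\<lambda>x. complex_of_real (r x)"
  obtain U where U: "openin T U" "\<zero> \<in> U" "\<And>u y. u \<in> U \<Longrightarrow> y \<in> carrier G \<Longrightarrow> cmod (?f (y \<oplus> u) - ?f y) < r x0/2"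
    using unif_cont[OF f, of "r x0/2"] x0 by auto
  have Uc: "U \<subseteq> carrier G" using openin_subset[OF U(1)] by (simp add: topspace_T)
  obtain S where S: "finite S" "S \<noteq> {}" "S \<subseteq> carrier G"
    "\<And>y. y \<in> carrier G \<Longrightarrow> \<exists>a\<in>S. \<exists>u\<in>U. y = a \<oplus> u"
    using translate_cover[OF U(1,2)] by blast
  define k where "k = card S"
  have k: "k > 0" unfolding k_def using S by (simp add: card_gt_0_iff)
  \<comment> \<open>Among the \<open>k\<close> nonnegative summands, one is at least
    \<open>r x0 / 2\<close>.\<close>
  define c where "c = r x0 / 2 / k"
  have c: "c > 0" using k x0 by (simp add: c_def)
  define g where "g x = (\<Sum>a\<in>S. r (x \<oplus> a)) / k" for x
  have ag: "avg S ?f = (\<lambda>x. complex_of_real (g x))"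
    by (auto simp: avg_def g_def k_def)
  have cg: "cont (\<lambda>x. complex_of_real (g x))" unfolding ag[symmetric] by (rule cont_avg) (use S f in auto)
  have cg': "cont (\<lambda>x. complex_of_real (g x - c))" using cont_diff[OF cg cont_const[of "of_real c"]] by simp
  have "g x \<ge> c" if x: "x \<in> carrier G" for x
  proof -
    obtain a u where au: "a \<in> S" "u \<in> U" "x0 \<ominus> x = a \<oplus> u" using S(4) x x0 by (meson minus_closed)
    have cc: "a \<in> carrier G" "u \<in> carrier G" using au S Uc by auto
    have "x0 = x \<oplus> a \<oplus> u"
      using au(3) x x0 cc add_diff_cancel[of x x0] by (simp add: a_assoc)
    then have "cmod (?f x0 - ?f (x \<oplus> a)) < r x0/2"
      using U(3)[OF au(2), of "x \<oplus> a"] x cc by auto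
    then have "\<bar>r x0 - r (x \<oplus> a)\<bar> < r x0 / 2" by (metis norm_of_real of_real_diff)
    then have "r x0 / 2 \<le> r (x \<oplus> a)" unfolding abs_less_iff by linarith
    also have "\<dots> \<le> (\<Sum>a\<in>S. r (x \<oplus> a))" by (rule member_le_sum) (use S x r au in auto)
    finally show ?thesis unfolding g_def c_def by (intro divide_right_mono) auto
  qed
  then have "Re (mean (\<lambda>x. complex_of_real (g x - c))) \<ge> 0" by (intro mean_nonneg[OF cg']) auto
  then have "Re (mean (\<lambda>x. complex_of_real (g x))) \<ge> c"
    using mean_diff[OF cg cont_const[of "of_real c"]] by (simp add: mean_const)
  then show ?thesis using c mean_avg[OF f S(1-3)] unfolding ag by simp
qed

lemma cont_mean: assumes F: "cont2 F" shows "cont (\<lambda>x. mean (F x))"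
proof -
  have "openin T {x \<in> topspace T. mean (F x) \<in> W}" if W: "open W" for W
  proof (subst openin_subopen, intro ballI)
    fix x0 assume x0: "x0 \<in> {x \<in> topspace T. mean (F x) \<in> W}"
    then obtain e where e: "e > 0" "ball (mean (F x0)) e \<subseteq> W" 
      using W unfolding open_contains_ball by blast
    obtain U where U: "openin T U" "x0 \<in> U" "\<And>x y. x \<in> U \<Longrightarrow> y \<in> carrier G \<Longrightarrow> cmod (F x y - F x0 y) < e/2"
      using tube[OF F, of x0 "e/2"] x0 e by (auto simp: topspace_T)
    have "U \<subseteq> {x \<in> topspace T. mean (F x) \<in> W}"
    proof
      fix x assume x: "x \<in> U"
      then have xc: "x \<in> carrier G" using openin_subset[OF U(1)] by (auto simp: topspace_T)
      have "cmod (mean (F x) - mean (F x0)) \<le> e/2"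
        by (rule mean_dist) (use U(3)[OF x] x0 xc F in \<open>auto simp: topspace_T less_imp_le intro!: cont2_slice\<close>)
      then have "mean (F x) \<in> ball (mean (F x0)) e" using e by (simp add: dist_norm norm_minus_commute)
      then show "x \<in> {x \<in> topspace T. mean (F x) \<in> W}" using e xc by (auto simp: topspace_T)
    qed
    then show "\<exists>U. openin T U \<and> x0 \<in> U \<and> U \<subseteq> {x \<in> topspace T. mean (F x) \<in> W}" using U by blast
  qed
  then show ?thesis by (auto simp: continuous_map)
qed

text \<open>The finite case of Fubini; \<open>mean_fubini\<close> approximates the inner mean by
  averages of this kind.\<close>

lemma mean_avgs:
  assumes F: "cont2 F" and "avg_sets Ss" "y \<in> carrier G"
  shows "cont (\<lambda>x. avgs Ss (F x) y) \<and> mean (\<lambda>x. avgs Ss (F x) y) = avgs Ss (\<lambda>y. mean (\<lambda>x. F x y)) y"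
  using assms(2,3)
proof (induction Ss arbitrary: y)
  case Nil
  then show ?case using cont2_slice[OF cont2_swap[OF F], of y] by auto
next
  case (Cons S Ss)
  have S: "finite S" "S \<subseteq> carrier G" "avg_sets Ss" using Cons.prems by (auto simp: avg_sets_Cons)
  have IH: "cont (\<lambda>x. avgs Ss (F x) (y \<oplus> a))" 
      "mean (\<lambda>x. avgs Ss (F x) (y \<oplus> a)) = avgs Ss (\<lambda>y. mean (\<lambda>x. F x y)) (y \<oplus> a)" if "a \<in> S" for a
    using Cons.IH[of "y \<oplus> a"] S that Cons.prems by auto
  have c: "cont (\<lambda>x. \<Sum>a\<in>S. avgs Ss (F x) (y \<oplus> a))" by (intro cont_sum S IH)
  have "mean (\<lambda>x. inverse (of_nat (card S)) * (\<Sum>a\<in>S. avgs Ss (F x) (y \<oplus> a))) = 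
     inverse (of_nat (card S)) * (\<Sum>a\<in>S. avgs Ss (\<lambda>y. mean (\<lambda>x. F x y)) (y \<oplus> a))"
    using mean_cmult[OF c] mean_sum[OF S(1) IH(1)] IH(2) by simp
  then show ?case using cont_cmult[OF c, of "inverse (of_nat (card S))"] 
    by (simp add: avg_def divide_inverse mult.commute)
qed

text \<open>By compactness, finitely many slices of \<open>F\<close> approximate all slices
  uniformly. A list of averages that is good for these slices and for \<open>H\<close> thus computes
  every inner mean up to a uniform error, and finite averages commute with the mean.\<close>

lemma mean_fubini:
  assumes F: "cont2 F"
  shows "mean (\<lambda>x. mean (F x)) = mean (\<lambda>y. mean (\<lambda>x. F x y))"
proof -
  define H where "H y = mean (\<lambda>x. F x y)" for y
  have cH: "cont H" unfolding H_def by (rule cont_mean[OF cont2_swap[OF F]])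
  have "cmod (mean (\<lambda>x. mean (F x)) - mean H) \<le> e" if e: "e > 0" for e
  proof -
    \<comment> \<open>Three errors arise in replacing an inner mean by an average, one more in
      passing to the mean of \<open>H\<close>.\<close>
    define d where "d = e/4"
    have d: "d > 0" using e by (simp add: d_def)
    have "\<forall>x0\<in>carrier G. \<exists>U. openin T U \<and> x0 \<in> U \<and> (\<forall>x\<in>U. \<forall>y\<in>carrier G. cmod (F x y - F x0 y) < d)"
      using tube[OF F _ d] by metis
    then obtain U where U: "\<And>x0. x0 \<in> carrier G \<Longrightarrow> openin T (U x0)" "\<And>x0. x0 \<in> carrier G \<Longrightarrow> x0 \<in> U x0"
      "\<And>x0 x y. x0 \<in> carrier G \<Longrightarrow> x \<in> U x0 \<Longrightarrow> y \<in> carrier G \<Longrightarrow> cmod (F x y - F x0 y) < d"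
      by metis
    have "topspace T \<subseteq> \<Union>(U ` carrier G)" using U(2) by (auto simp: topspace_T)
    then obtain \<F> where \<F>: "finite \<F>" "\<F> \<subseteq> U ` carrier G" "topspace T \<subseteq> \<Union>\<F>"
      using compact_T U(1) unfolding compact_space_def compactin_def by (metis (no_types, lifting) image_iff)
    then obtain N where N: "finite N" "N \<subseteq> carrier G" "\<F> = U ` N" by (meson finite_subset_image)
    obtain Ss where Ss: "avg_sets Ss" "\<forall>f\<in>insert H (F ` N). good Ss f d (mean f)"
      using mean_good_simul[of "insert H (F ` N)" d] N cH cont2_slice[OF F] d by auto
    have near: "cmod (mean (F x) - avgs Ss (F x) \<zero>) \<le> 3 * d" if x: "x \<in> carrier G" for x
    proof -
      obtain x0 where x0: "x0 \<in> N" "x \<in> U x0" using \<F>(3) N(3) x by (auto simp: topspace_T)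
      then have x0c: "x0 \<in> carrier G" using N by auto
      have le: "cmod (F x y - F x0 y) \<le> d" if "y \<in> carrier G" for y using U(3)[OF x0c x0(2) that] by simp
      have 1: "cmod (mean (F x) - mean (F x0)) \<le> d"
        by (rule mean_dist) (use le cont2_slice[OF F] x x0c in auto)
      have 2: "cmod (mean (F x0) - avgs Ss (F x0) \<zero>) \<le> d" using Ss x0 by (auto simp: good_def norm_minus_commute)
      have "cmod (avgs Ss (\<lambda>y. F x y + (-1) * F x0 y) \<zero> - 0) \<le> d"
        by (rule avgs_closed_ball) (use le Ss in auto)
      then have 3: "cmod (avgs Ss (F x0) \<zero> - avgs Ss (F x) \<zero>) \<le> d"
        using avgs_add[of Ss "F x" "\<lambda>y. (-1) * F x0 y"] avgs_cmult[of Ss "-1" "F x0"]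
        by (simp add: norm_minus_commute)
      have "mean (F x) - avgs Ss (F x) \<zero> = (mean (F x) - mean (F x0)) + ((mean (F x0) - avgs Ss (F x0) \<zero>) + (avgs Ss (F x0) \<zero> - avgs Ss (F x) \<zero>))"
        by simp
      also have "cmod \<dots> \<le> d + (d + d)" by (intro norm_triangle_mono 1 2 3)
      finally show ?thesis by simp
    qed
    have A: "cont (\<lambda>x. avgs Ss (F x) \<zero>)" "mean (\<lambda>x. avgs Ss (F x) \<zero>) = avgs Ss H \<zero>"
      using mean_avgs[OF F Ss(1), of \<zero>] by (auto simp: H_def[abs_def])
    have "cmod (mean (\<lambda>x. mean (F x)) - avgs Ss H \<zero>) \<le> 3 * d"
      unfolding A(2)[symmetric] by (rule mean_dist[OF cont_mean[OF F] A(1) near])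
    moreover have "cmod (avgs Ss H \<zero> - mean H) \<le> d" using Ss by (auto simp: good_def)
    ultimately have "cmod (mean (\<lambda>x. mean (F x)) - mean H) \<le> 4 * d"
      using norm_triangle_ineq[of "mean (\<lambda>x. mean (F x)) - avgs Ss H \<zero>" "avgs Ss H \<zero> - mean H"] by simp
    then show ?thesis by (simp add: d_def)
  qed
  then have "cmod (mean (\<lambda>x. mean (F x)) - mean H) \<le> 0" by (rule field_le_epsilon[of _ 0, simplified])
  then show ?thesis by (simp add: H_def[abs_def])
qed

end

section \<open>Convolution\<close>

text \<open>\<open>t n\<close> stands for the squared norm of a convolution power with
  \<open>n + 1\<close> factors, hence the shifts by \<open>Suc\<close>. Log-convexity makes the
  ratios increase to a limit \<open>l\<close>, submultiplicativity keeps \<open>t n\<close> above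
  \<open>l ^ Suc n\<close>, and so the normalised sequence decreases to a limit that is at least
  1.\<close>

lemma log_convex_submult_limit:
  fixes t :: "nat \<Rightarrow> real"
  assumes pos: "\<And>n. t n > 0"
    and lc: "\<And>n. (t (Suc n))\<^sup>2 \<le> t n * t (Suc (Suc n))"
    and sm: "\<And>n m. t (Suc (n + m)) \<le> t n * t m"
  obtains l s where "l > 0" "s > 0" "(\<lambda>n. t n / l ^ Suc n) \<longlonglongrightarrow> s"
proof -
  define \<rho> where "\<rho> n = t (Suc n) / t n" for n
  have \<rho>pos: "\<rho> n > 0" for n using pos by (simp add: \<rho>_def)
  have tS: "t (Suc n) = \<rho> n * t n" for n using pos[of n] by (simp add: \<rho>_def)
  have inc: "incseq \<rho>"
  proof (rule incseq_SucI)
    fix n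
    have "t (Suc n) * t (Suc n) \<le> t (Suc (Suc n)) * t n" using lc[of n] by (simp add: power2_eq_square mult.commute)
    then show "\<rho> n \<le> \<rho> (Suc n)" unfolding \<rho>_def by (subst frac_le_eq) (use pos[of n] pos[of "Suc n"] in \<open>auto simp: divide_le_0_iff\<close>)
  qed
  have bd: "\<rho> n \<le> t 0" for n
    using sm[of n 0] pos[of n] by (simp add: \<rho>_def divide_le_eq mult.commute)
  obtain l where l: "\<rho> \<longlonglongrightarrow> l" "\<And>n. \<rho> n \<le> l"
    by (rule incseq_convergent[OF inc, of "t 0"]) (use bd in auto)
  have l0: "l > 0" using \<rho>pos[of 0] l(2)[of 0] by linarith
  have lower: "l ^ Suc n \<le> t n" for n
  proof (rule ccontr)
    assume "\<not> l ^ Suc n \<le> t n"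
    then have lt: "t n < l ^ Suc n" by simp
    have "root (Suc n) (t n) ^ Suc n = t n" using pos[of n] by (intro real_root_pow_pos2) auto
    then have "root (Suc n) (t n) ^ Suc n < l ^ Suc n" using lt by (simp only:)
    then have "root (Suc n) (t n) < l" using less_imp_le[OF l0] by (rule power_less_imp_less_base)
    \<comment> \<open>The ratios eventually exceed \<open>\<mu>\<close>, so \<open>t\<close> grows
      at least like powers of \<open>\<mu>\<close>; submultiplicativity bounds \<open>t\<close>
      along a progression by powers of \<open>t n\<close>, which is below
      \<open>\<mu> ^ Suc n\<close>. The quotient \<open>q < 1\<close> exposes the conflict.\<close>
    then obtain \<mu> where \<mu>: "root (Suc n) (t n) < \<mu>" "\<mu> < l" using dense by blast
    have \<mu>0: "\<mu> > 0" using \<mu>(1) pos[of n] by (meson less_trans real_root_gt_zero zero_less_Suc)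
    have "root (Suc n) (t n) ^ Suc n < \<mu> ^ Suc n"
      by (rule power_strict_mono[OF \<mu>(1)]) (use pos[of n] in \<open>auto intro: less_imp_le\<close>)
    then have tn: "t n < \<mu> ^ Suc n" by (simp only: \<open>root (Suc n) (t n) ^ Suc n = t n\<close>)
    have "eventually (\<lambda>k. \<rho> k > \<mu>) sequentially" using order_tendstoD(1)[OF l(1) \<mu>(2)] .
    then obtain N where N: "\<And>k. k \<ge> N \<Longrightarrow> \<rho> k > \<mu>" unfolding eventually_sequentially by blast
    have low: "t N * \<mu> ^ j \<le> t (N + j)" for j
    proof (induction j)
      case (Suc j)
      have "t N * \<mu> ^ Suc j = \<mu> * (t N * \<mu> ^ j)" by simp
      also have "\<dots> \<le> \<rho> (N + j) * t (N + j)"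
        using Suc N[of "N + j"] \<mu>0 pos[of N] by (intro mult_mono) auto
      also have "\<dots> = t (N + Suc j)" using tS[of "N + j"] by simp
      finally show ?case .
    qed simp
    have up: "t (Suc n * k + n) \<le> t n ^ Suc k" for k
    proof (induction k)
      case (Suc k)
      have "t (Suc n * Suc k + n) = t (Suc (n + (Suc n * k + n)))" by (simp add: algebra_simps)
      also have "\<dots> \<le> t n * t (Suc n * k + n)" by (rule sm)
      also have "\<dots> \<le> t n * t n ^ Suc k" using Suc pos[of n] by (intro mult_left_mono) auto
      finally show ?case by simp
    qed simp
    define q where "q = t n / \<mu> ^ Suc n"
    have q: "0 \<le> q" "q < 1" using tn \<mu>0 pos[of n] by (auto simp: q_def)
    define c where "c = t N / \<mu> ^ Suc N"
    have c: "c > 0" using pos[of N] \<mu>0 by (simp add: c_def)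
    have ge: "q ^ Suc k \<ge> c" if k: "k \<ge> N" for k
    proof -
      have kk: "Suc n * k + n \<ge> N" using k by (simp add: trans_le_add1 algebra_simps)
      have e: "(Suc n * k + n - N) + Suc N = Suc n * Suc k" using kk by (simp add: algebra_simps)
      have "t N * \<mu> ^ (Suc n * k + n - N) \<le> t (Suc n * k + n)" using low[of "Suc n * k + n - N"] kk by simp
      also have "\<dots> \<le> t n ^ Suc k" by (rule up)
      finally have 1: "t N * \<mu> ^ (Suc n * k + n - N) \<le> t n ^ Suc k" .
      have "c * \<mu> ^ (Suc n * Suc k) = t N * \<mu> ^ (Suc n * k + n - N)"
        unfolding e[symmetric] power_add c_def using \<mu>0 by simp
      with 1 have "c * (\<mu> ^ Suc n) ^ Suc k \<le> t n ^ Suc k" by (simp only: power_mult[symmetric])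
      then show ?thesis using \<mu>0 unfolding q_def power_divide by (subst pos_le_divide_eq) auto
    qed
    have "(\<lambda>k. q ^ Suc k) \<longlonglongrightarrow> 0" using LIMSEQ_power_zero[of q] q by (intro LIMSEQ_Suc) auto
    then have "c \<le> 0" by (rule LIMSEQ_le_const) (use ge in blast)
    with c show False by simp
  qed
  define r where "r n = t n / l ^ Suc n" for n
  have "r (Suc n) \<le> r n" for n
  proof -
    have "r (Suc n) = r n * (\<rho> n / l)" using l0 by (simp add: r_def tS mult_ac)
    also have "\<dots> \<le> r n * 1" using l(2)[of n] l0 pos[of n] by (intro mult_left_mono) (auto simp: r_def)
    finally show ?thesis by simp
  qed
  then have dec: "decseq r" by (rule decseq_SucI)
  have r1: "r n \<ge> 1" for n using lower[of n] l0 by (simp add: r_def)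
  obtain s where s: "r \<longlonglongrightarrow> s" "\<And>n. s \<le> r n" by (rule decseq_convergent[OF dec, of 1]) (use r1 in auto)
  have "s \<ge> 1" using s(1) r1 by (intro LIMSEQ_le_const) auto
  then show ?thesis using s l0 by (intro that[of l s]) (auto simp: r_def[abs_def])
qed

section \<open>The L2 norm of the mean, convolution and power iteration\<close>

context compact_ab_group
begin

definition n2 :: "('a \<Rightarrow> complex) \<Rightarrow> real" where
  "n2 f = Re (mean (\<lambda>x. complex_of_real ((cmod (f x))\<^sup>2)))"

lemma n2_eq: "cont f \<Longrightarrow> mean (\<lambda>x. complex_of_real ((cmod (f x))\<^sup>2)) = of_real (n2 f)"
  unfolding n2_def by (intro mean_real cont_norm2)

lemma n2_nonneg: "cont f \<Longrightarrow> n2 f \<ge> 0"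
  unfolding n2_def by (intro mean_nonneg cont_norm2) auto

lemma n2_pos: "cont f \<Longrightarrow> x \<in> carrier G \<Longrightarrow> f x \<noteq> 0 \<Longrightarrow> n2 f > 0"
  unfolding n2_def by (rule mean_pos[OF cont_norm2]) auto

lemma n2_le: assumes "cont f" "\<And>x. x \<in> carrier G \<Longrightarrow> (cmod (f x))\<^sup>2 \<le> B" shows "n2 f \<le> B"
proof -
  have "cmod (mean (\<lambda>x. complex_of_real ((cmod (f x))\<^sup>2)) - 0) \<le> B"
    by (rule mean_ball[OF cont_norm2[OF assms(1)]]) (use assms(2) in \<open>simp add: norm_power\<close>)
  then show ?thesis unfolding n2_def
    using complex_Re_le_cmod[of "mean (\<lambda>x. complex_of_real ((cmod (f x))\<^sup>2))"] by simp
qed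

lemma norm_diff_expand:
  "complex_of_real ((cmod (a - c * cnj b))\<^sup>2) =
    of_real ((cmod a)\<^sup>2) - (cnj c * (a * b) + c * cnj (a * b)) + of_real ((cmod c)\<^sup>2) * of_real ((cmod b)\<^sup>2)"
  by (simp only: complex_norm_square) (simp add: algebra_simps)

text \<open>The pairing \<open>mean (\<lambda>x. f x * g x)\<close> is bilinear, the form in which
  it occurs in convolutions; hence \<open>f\<close> is compared with multiples of the conjugate of
  \<open>g\<close>.\<close>

lemma n2_expand:
  assumes f: "cont f" and g: "cont g"
  shows "n2 (\<lambda>x. f x - c * cnj (g x)) = n2 f - 2 * Re (cnj c * mean (\<lambda>x. f x * g x)) + (cmod c)\<^sup>2 * n2 g"
proof -
  have fg: "cont (\<lambda>x. f x * g x)" by (rule cont_mult[OF f g])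
  have "mean (\<lambda>x. complex_of_real ((cmod (f x - c * cnj (g x)))\<^sup>2)) =
    of_real (n2 f) - (cnj c * mean (\<lambda>x. f x * g x) + c * cnj (mean (\<lambda>x. f x * g x))) + of_real ((cmod c)\<^sup>2) * of_real (n2 g)"
    unfolding norm_diff_expand
    by (simp only: mean_add mean_diff mean_cmult mean_cnj n2_eq f g fg cont_norm2 cont_add cont_diff cont_cmult cont_cnj)
  then show ?thesis unfolding n2_def[of "\<lambda>x. f x - c * cnj (g x)"] by simp
qed

lemma cauchy_schwarz:
  assumes f: "cont f" and g: "cont g"
  shows "(cmod (mean (\<lambda>x. f x * g x)))\<^sup>2 \<le> n2 f * n2 g"
proof -
  define w where "w = mean (\<lambda>x. f x * g x)"
  have nn: "0 \<le> n2 f - 2 * Re (cnj c * w) + (cmod c)\<^sup>2 * n2 g" for c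
    unfolding w_def n2_expand[OF f g, symmetric]
    by (intro n2_nonneg cont_diff f cont_cmult cont_cnj g)
  have cw: "Re (cnj (of_real s * w) * w) = s * (cmod w)\<^sup>2" for s
    unfolding cmod_power2 by (simp add: power2_eq_square algebra_simps)
  have A: "n2 f \<ge> 0" and B: "n2 g \<ge> 0" using n2_nonneg f g by auto
  show ?thesis
  proof (cases "n2 g = 0")
    case True
    have "w = 0"
    proof (rule ccontr)
      assume "w \<noteq> 0"
      then have "(cmod w)\<^sup>2 > 0" by simp
      \<comment> \<open>This multiple of \<open>w\<close> makes the linear term equal to
        \<open>2 * (n2 f + 1)\<close>, while the quadratic term vanishes.\<close>
      then show False
        using nn[of "of_real ((n2 f + 1) / (cmod w)\<^sup>2) * w"] A unfolding cw True by simp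
    qed
    then show ?thesis using True by (simp add: w_def)
  next
    case False
    then have B': "n2 g > 0" using B by simp
    have "0 \<le> n2 f - 2 * ((1 / n2 g) * (cmod w)\<^sup>2) + (cmod (of_real (1 / n2 g) * w))\<^sup>2 * n2 g"
      using nn[of "of_real (1 / n2 g) * w"] unfolding cw .
    also have "(cmod (of_real (1 / n2 g) * w))\<^sup>2 * n2 g = (1 / n2 g) * (cmod w)\<^sup>2"
      using B' by (simp add: norm_mult norm_divide power_mult_distrib power2_eq_square)
    finally have "(1 / n2 g) * (cmod w)\<^sup>2 \<le> n2 f" by simp
    then show ?thesis using B' by (simp add: w_def field_simps)
  qed
qed

definition conv :: "('a \<Rightarrow> complex) \<Rightarrow> ('a \<Rightarrow> complex) \<Rightarrow> 'a \<Rightarrow> complex" where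
  "conv f g x = mean (\<lambda>y. f (x \<ominus> y) * g y)"

lemma cont2_fst: "cont f \<Longrightarrow> cont2 (\<lambda>x y. f x)"
  by (rule cont2_comp[of f "\<lambda>x y. x"]) (auto intro: continuous_map_fst)

lemma cont2_snd: "cont f \<Longrightarrow> cont2 (\<lambda>x y. f y)"
  by (rule cont2_comp[of f "\<lambda>x y. y"]) (auto intro: continuous_map_snd)

lemma cont2_minus: "cont f \<Longrightarrow> cont2 (\<lambda>x y. f (x \<ominus> y))"
  by (rule cont2_comp[of f "\<lambda>x y. x \<ominus> y"]) (auto intro: minus_cont' continuous_map_fst continuous_map_snd)

lemma cont_conv: "cont f \<Longrightarrow> cont g \<Longrightarrow> cont (conv f g)"
  unfolding conv_def[abs_def] by (intro cont_mean cont2_mult cont2_minus cont2_snd)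

lemma cont_refl: "cont f \<Longrightarrow> x \<in> carrier G \<Longrightarrow> cont (\<lambda>y. f (x \<ominus> y))"
  by (rule cont_comp[of f "\<lambda>y. x \<ominus> y"]) (auto intro!: minus_cont' id_cont const_cont)

lemma cont_shift: "cont f \<Longrightarrow> a \<in> carrier G \<Longrightarrow> cont (\<lambda>y. f (y \<oplus> a))"
  by (rule cont_comp[of f "\<lambda>y. y \<oplus> a"]) (auto intro!: add_cont' id_cont const_cont)

lemma cont_shift': "cont f \<Longrightarrow> a \<in> carrier G \<Longrightarrow> cont (\<lambda>y. f (y \<ominus> a))"
  by (rule cont_comp[of f "\<lambda>y. y \<ominus> a"]) (auto intro!: minus_cont' id_cont const_cont)

lemma mean_refl: assumes "cont h" "x \<in> carrier G" shows "mean (\<lambda>y. h (x \<ominus> y)) = mean h"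
proof -
  have "mean (\<lambda>y. h (x \<ominus> y)) = mean (\<lambda>y. h (\<ominus> y \<oplus> x))"
    by (rule mean_cong) (use assms in \<open>simp add: a_minus_def a_comm\<close>)
  also have "\<dots> = mean (\<lambda>y. h (y \<oplus> x))" by (rule mean_reflect[OF cont_shift[OF assms]])
  also have "\<dots> = mean h" by (rule mean_shift[OF assms])
  finally show ?thesis .
qed

lemma conv_integrand: "cont f \<Longrightarrow> cont g \<Longrightarrow> x \<in> carrier G \<Longrightarrow> cont (\<lambda>y. f (x \<ominus> y) * g y)"
  by (intro cont_mult cont_refl)

text \<open>This bound turns L2 estimates into uniform ones. It takes the place of compactness of
  convolution operators and keeps all limits inside the continuous functions.\<close>

lemma conv_bound:
  assumes "cont f" "cont g" "x \<in> carrier G"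
  shows "(cmod (conv f g x))\<^sup>2 \<le> n2 f * n2 g"
proof -
  have "n2 (\<lambda>y. f (x \<ominus> y)) = n2 f"
    unfolding n2_def using mean_refl[OF cont_norm2[OF assms(1)] assms(3)] by simp
  then show ?thesis using cauchy_schwarz[OF cont_refl[OF assms(1,3)] assms(2)] by (simp add: conv_def)
qed

lemma conv_cong:
  assumes "x \<in> carrier G" "\<And>y. y \<in> carrier G \<Longrightarrow> f y = f' y" "\<And>y. y \<in> carrier G \<Longrightarrow> g y = g' y"
  shows "conv f g x = conv f' g' x"
  unfolding conv_def by (rule mean_cong) (use assms in auto)

lemma minus_minus_cancel: "x \<in> carrier G \<Longrightarrow> y \<in> carrier G \<Longrightarrow> x \<ominus> (x \<ominus> y) = y"
  by (simp add: a_minus_def minus_add a_assoc[symmetric] r_neg)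

lemma conv_comm: assumes "cont f" "cont g" "x \<in> carrier G" shows "conv f g x = conv g f x"
proof -
  have "conv f g x = mean (\<lambda>y. f (x \<ominus> (x \<ominus> y)) * g (x \<ominus> y))"
    unfolding conv_def by (rule mean_refl[OF conv_integrand[OF assms] assms(3), symmetric])
  also have "\<dots> = conv g f x" unfolding conv_def
    by (rule mean_cong) (use assms(3) in \<open>simp add: minus_minus_cancel mult.commute\<close>)
  finally show ?thesis .
qed

text \<open>Fubini exchanges the two means, and invariance under the shift by \<open>z\<close>
  brings the inner one into the form of a convolution.\<close>

lemma conv_assoc:
  assumes f: "cont f" and g: "cont g" and h: "cont h" and x: "x \<in> carrier G"
  shows "conv (conv f g) h x = conv f (conv g h) x"
proof -
  have c1: "cont (\<lambda>y. f (x \<ominus> y))" by (rule cont_refl[OF f x])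
  have c2: "cont2 (\<lambda>y z. f (x \<ominus> y) * (g (y \<ominus> z) * h z))"
    by (intro cont2_mult cont2_fst[OF c1] cont2_minus[OF g] cont2_snd[OF h])
  have "conv f (conv g h) x = mean (\<lambda>y. mean (\<lambda>z. f (x \<ominus> y) * (g (y \<ominus> z) * h z)))"
    unfolding conv_def
    by (rule mean_cong) (simp add: mean_cmult conv_integrand[OF g h])
  also have "\<dots> = mean (\<lambda>z. mean (\<lambda>y. f (x \<ominus> y) * (g (y \<ominus> z) * h z)))"
    by (rule mean_fubini[OF c2])
  also have "\<dots> = conv (conv f g) h x"
    unfolding conv_def
  proof (rule mean_cong)
    fix z assume z: "z \<in> carrier G"
    have cc: "cont (\<lambda>y. f (x \<ominus> y) * (g (y \<ominus> z) * h z))"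
      using cont2_slice[OF cont2_swap[OF c2] z] .
    have xz: "x \<ominus> z \<in> carrier G" using x z by simp
    have ci: "cont (\<lambda>y. f (x \<ominus> z \<ominus> y) * g y)" by (rule conv_integrand[OF f g xz])
    have "mean (\<lambda>y. f (x \<ominus> y) * (g (y \<ominus> z) * h z)) = mean (\<lambda>y. f (x \<ominus> (y \<oplus> z)) * (g (y \<oplus> z \<ominus> z) * h z))"
      by (rule mean_shift[OF cc z, symmetric])
    also have "\<dots> = mean (\<lambda>y. h z * (f (x \<ominus> z \<ominus> y) * g y))"
    proof (rule mean_cong)
      fix y assume y: "y \<in> carrier G"
      have "x \<ominus> (y \<oplus> z) = x \<ominus> z \<ominus> y" using x y z by (simp add: a_minus_def minus_add a_ac)
      moreover have "y \<oplus> z \<ominus> z = y" using y z by (simp add: a_minus_def a_assoc r_neg)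
      ultimately show "f (x \<ominus> (y \<oplus> z)) * (g (y \<oplus> z \<ominus> z) * h z) = h z * (f (x \<ominus> z \<ominus> y) * g y)" by simp
    qed
    also have "\<dots> = h z * mean (\<lambda>y. f (x \<ominus> z \<ominus> y) * g y)" by (rule mean_cmult[OF ci])
    finally show "mean (\<lambda>y. f (x \<ominus> y) * (g (y \<ominus> z) * h z)) = mean (\<lambda>y. f (x \<ominus> z \<ominus> y) * g y) * h z"
      by simp
  qed
  finally show ?thesis by simp
qed

lemma conv_diff_left:
  assumes "cont f" "cont f'" "cont g" "x \<in> carrier G"
  shows "conv (\<lambda>x. f x - f' x) g x = conv f g x - conv f' g x"
  unfolding conv_def left_diff_distrib by (rule mean_diff) (intro conv_integrand assms)+

lemma conv_add_left:
  assumes "cont f" "cont f'" "cont g" "x \<in> carrier G"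
  shows "conv (\<lambda>x. f x + f' x) g x = conv f g x + conv f' g x"
  unfolding conv_def distrib_right by (rule mean_add) (intro conv_integrand assms)+

lemma conv_cmult_left:
  assumes "cont f" "cont g" "x \<in> carrier G"
  shows "conv (\<lambda>x. c * f x) g x = c * conv f g x"
  unfolding conv_def mult.assoc by (rule mean_cmult) (intro conv_integrand assms)

lemma conv_cmult_right:
  assumes "cont f" "cont g" "x \<in> carrier G"
  shows "conv f (\<lambda>x. c * g x) x = c * conv f g x"
  using conv_cmult_left[OF assms(2,1,3), of c] conv_comm[OF assms(1) cont_cmult[OF assms(2), of c] assms(3)] 
    conv_comm[OF assms] by simp

text \<open>The condition under which convolution with \<open>f\<close> is self-adjoint for the L2
  inner product.\<close>

definition herm :: "('a \<Rightarrow> complex) \<Rightarrow> bool" where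
  "herm f \<longleftrightarrow> (\<forall>x\<in>carrier G. f (\<ominus> x) = cnj (f x))"

lemma hermD: "herm f \<Longrightarrow> x \<in> carrier G \<Longrightarrow> f (\<ominus> x) = cnj (f x)"
  by (simp add: herm_def)

lemma herm_conv:
  assumes f: "cont f" and g: "cont g" and "herm f" "herm g"
  shows "herm (conv f g)"
  unfolding herm_def
proof
  fix x assume x: "x \<in> carrier G"
  have nx: "\<ominus> x \<in> carrier G" using x by simp
  have "conv f g (\<ominus> x) = mean (\<lambda>y. f (\<ominus> x \<ominus> (\<ominus> y)) * g (\<ominus> y))"
    unfolding conv_def by (rule mean_reflect[OF conv_integrand[OF f g nx], symmetric])
  also have "\<dots> = mean (\<lambda>y. cnj (f (x \<ominus> y) * g y))"
  proof (rule mean_cong)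
    fix y assume y: "y \<in> carrier G"
    have "\<ominus> x \<ominus> (\<ominus> y) = \<ominus> (x \<ominus> y)" using x y by (simp add: a_minus_def minus_add)
    then show "f (\<ominus> x \<ominus> (\<ominus> y)) * g (\<ominus> y) = cnj (f (x \<ominus> y) * g y)"
      using hermD[OF assms(3), of "x \<ominus> y"] hermD[OF assms(4) y] x y by simp
  qed
  also have "\<dots> = cnj (conv f g x)" unfolding conv_def by (rule mean_cnj[OF conv_integrand[OF f g x]])
  finally show "conv f g (\<ominus> x) = cnj (conv f g x)" .
qed

text \<open>The value at \<open>\<zero>\<close> of a convolution is an L2 inner product, so norms
  and inner products of convolution powers can be read off from their values at
  \<open>\<zero>\<close>.\<close>

lemma conv_zero: assumes "herm f" shows "conv f g \<zero> = mean (\<lambda>y. cnj (f y) * g y)"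
  unfolding conv_def by (rule mean_cong) (use hermD[OF assms(1)] in \<open>simp add: a_minus_def\<close>)

lemma conv_self_zero: assumes "herm f" "cont f" shows "conv f f \<zero> = of_real (n2 f)"
proof -
  have "(\<lambda>y. cnj (f y) * f y) = (\<lambda>y. complex_of_real ((cmod (f y))\<^sup>2))"
    by (simp only: complex_norm_square) (simp add: mult.commute)
  then show ?thesis using n2_eq[OF assms(2)] by (simp add: conv_zero assms)
qed

lemma n2_diff_herm:
  assumes "cont f" "cont g" "herm f" "conv f g \<zero> = of_real c"
  shows "n2 (\<lambda>x. f x - g x) = n2 f - 2 * c + n2 g"
proof -
  have "n2 (\<lambda>x. f x - g x) = n2 (\<lambda>x. g x - 1 * cnj (cnj (f x)))"
    unfolding n2_def by (simp add: norm_minus_commute)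
  also have "\<dots> = n2 g - 2 * Re (mean (\<lambda>x. cnj (f x) * g x)) + n2 (\<lambda>x. cnj (f x))"
    using n2_expand[OF assms(2) cont_cnj[OF assms(1)], of 1] by (simp add: mult.commute)
  also have "mean (\<lambda>x. cnj (f x) * g x) = of_real c" using conv_zero[OF assms(3)] assms(4) by simp
  also have "n2 (\<lambda>x. cnj (f x)) = n2 f" by (simp add: n2_def)
  finally show ?thesis by simp
qed

lemma conv_lim_left:
  assumes f: "\<And>n. cont (F n)" "cont f" and g: "cont g" and x: "x \<in> carrier G"
    and lim: "\<And>e. e > 0 \<Longrightarrow> eventually (\<lambda>n. \<forall>x\<in>carrier G. cmod (F n x - f x) < e) sequentially"
  shows "(\<lambda>n. conv (F n) g x) \<longlonglongrightarrow> conv f g x"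
proof (rule tendstoI)
  fix e :: real assume e: "e > 0"
  obtain B where B: "B > 0" "\<And>x. x \<in> carrier G \<Longrightarrow> cmod (g x) \<le> B" using cont_bounded[OF g] by blast
  have "e / (2 * B) > 0" using e B by simp
  from lim[OF this] show "eventually (\<lambda>n. dist (conv (F n) g x) (conv f g x) < e) sequentially"
  proof eventually_elim
    case (elim n)
    have "cmod (conv (F n) g x - conv f g x) \<le> e / (2 * B) * B"
      unfolding conv_def
    proof (rule mean_dist)
      fix y assume y: "y \<in> carrier G"
      have "cmod (F n (x \<ominus> y) * g y - f (x \<ominus> y) * g y) = cmod (F n (x \<ominus> y) - f (x \<ominus> y)) * cmod (g y)"
        by (simp flip: norm_mult add: algebra_simps)
      also have "\<dots> \<le> e / (2 * B) * B"
        using elim x y B e by (intro mult_mono) (auto intro: less_imp_le)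
      finally show "cmod (F n (x \<ominus> y) * g y - f (x \<ominus> y) * g y) \<le> e / (2 * B) * B" .
    qed (intro conv_integrand f g x)+
    also have "\<dots> < e" using B e by simp
    finally show ?case by (simp add: dist_norm)
  qed
qed

text \<open>Erhard Schmidt's power iteration: the normalised even convolution powers of \<open>\<eta>\<close> converge
  uniformly to the orthogonal projection onto a top eigenspace of convolution with \<open>\<eta> * \<eta>\<close>.\<close>

lemma schmidt_idempotent:
  assumes \<eta>: "cont \<eta>" "herm \<eta>" and x0: "x0 \<in> carrier G" "\<eta> x0 \<noteq> 0"
  obtains \<psi> l where "l > 0" "cont \<psi>" "herm \<psi>" "\<psi> \<zero> \<noteq> 0"
    "\<And>x. x \<in> carrier G \<Longrightarrow> conv \<psi> \<psi> x = \<psi> x"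
    "\<And>x. x \<in> carrier G \<Longrightarrow> conv (conv \<eta> \<eta>) \<psi> x = of_real l * \<psi> x"
    "\<And>e x. cont e \<Longrightarrow> (\<And>x. x \<in> carrier G \<Longrightarrow> conv \<eta> e x = \<eta> x) \<Longrightarrow> x \<in> carrier G \<Longrightarrow> conv \<psi> e x = \<psi> x"
proof -
  \<comment> \<open>\<open>pw n\<close> has \<open>n + 1\<close> factors, so the product of
    \<open>pw a\<close> and \<open>pw b\<close> is \<open>pw (Suc (a + b))\<close>.\<close>
  define pw where "pw n = ((conv \<eta>) ^^ n) \<eta>" for n
  have pw0: "pw 0 = \<eta>" and pwS: "pw (Suc n) = conv \<eta> (pw n)" for n by (auto simp: pw_def)
  have cpw: "cont (pw n)" for n by (induction n) (auto simp: pw0 pwS \<eta> intro: cont_conv)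
  have hpw: "herm (pw n)" for n by (induction n) (auto simp: pw0 pwS \<eta> cpw intro!: herm_conv)
  have pw_add: "conv (pw a) (pw b) x = pw (Suc (a + b)) x" if "x \<in> carrier G" for a b x
    using that
  proof (induction a arbitrary: x)
    case (Suc a)
    have "conv (pw (Suc a)) (pw b) x = conv \<eta> (conv (pw a) (pw b)) x"
      unfolding pwS by (rule conv_assoc) (use cpw \<eta> Suc in auto)
    also have "\<dots> = conv \<eta> (pw (Suc (a + b))) x" by (rule conv_cong) (use Suc in auto)
    finally show ?case by (simp add: pwS)
  qed (simp add: pw0 pwS)
  define t where "t n = n2 (pw n)" for n
  have t_pw: "pw (Suc (n + n)) \<zero> = of_real (t n)" for n
    using conv_self_zero[OF hpw cpw, of n] pw_add[of \<zero> n n] by (simp add: t_def)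
  \<comment> \<open>Cauchy-Schwarz for \<open>pw n\<close> and \<open>pw (Suc (Suc n))\<close>,
    whose inner product has the same total number of factors as the squared norm of
    \<open>pw (Suc n)\<close>.\<close>
  have lc: "(t (Suc n))\<^sup>2 \<le> t n * t (Suc (Suc n))" for n
  proof -
    have "conv (pw n) (pw (Suc (Suc n))) \<zero> = of_real (t (Suc n))"
      using pw_add[of \<zero> n "Suc (Suc n)"] t_pw[of "Suc n"] by simp
    then show ?thesis using conv_bound[OF cpw cpw, of \<zero> n "Suc (Suc n)"] by (simp add: t_def)
  qed
  have sm: "t (Suc (n + m)) \<le> t n * t m" for n m
    unfolding t_def using conv_bound[OF cpw[of n] cpw[of m]] pw_add[of _ n m] by (intro n2_le cpw) auto
  \<comment> \<open>Log-convexity propagates positivity from two consecutive terms;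
    \<open>t 1\<close> is positive because \<open>pw 1 \<zero>\<close> equals
    \<open>t 0\<close>.\<close>
  have pos: "t n > 0" for n
  proof (induction n rule: induct_nat_012)
    case 0 show ?case unfolding t_def pw0 by (rule n2_pos[OF \<eta>(1) x0])
  next
    case 1
    have "t 0 > 0" unfolding t_def pw0 by (rule n2_pos[OF \<eta>(1) x0])
    then have "pw 1 \<zero> \<noteq> 0" using t_pw[of 0] by simp
    then show ?case unfolding t_def by (intro n2_pos[OF cpw, of \<zero>]) auto
  next
    case (ge2 n)
    have "0 < (t (Suc n))\<^sup>2" using ge2 by simp
    also have "\<dots> \<le> t n * t (Suc (Suc n))" by (rule lc)
    finally show ?case using ge2 by (simp add: zero_less_mult_iff)
  qed
  obtain l s where l: "l > 0" "s > 0" "(\<lambda>n. t n / l ^ Suc n) \<longlonglongrightarrow> s"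
    using log_convex_submult_limit[OF pos lc sm] by blast
  define r where "r n = t n / l ^ Suc n" for n
  have r: "r \<longlonglongrightarrow> s" using l(3) by (simp add: r_def[abs_def])
  \<comment> \<open>The number of factors is even, so eigenvalues of opposite sign and equal modulus
    cannot make the sequence oscillate; dividing by powers of \<open>l\<close> normalises the top
    eigenvalue to 1.\<close>
  define u where "u n x = of_real (inverse (l ^ Suc n)) * pw (Suc (n + n)) x" for n x
  have cu: "cont (u n)" for n unfolding u_def[abs_def] by (rule cont_cmult[OF cpw])
  have hu: "herm (u n)" for n using hpw[of "Suc (n + n)"] by (simp add: herm_def u_def)
  have u_add: "conv (u n) (u m) x = u (Suc (n + m)) x" if x: "x \<in> carrier G" for n m x
  proof -
    have "conv (u n) (u m) x = of_real (inverse (l ^ Suc n)) * (of_real (inverse (l ^ Suc m)) * conv (pw (Suc (n + n))) (pw (Suc (m + m))) x)"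
      unfolding u_def[abs_def] 
      by (simp only: conv_cmult_left[OF cpw cont_cmult[OF cpw] x] conv_cmult_right[OF cpw cpw x])
    also have "\<dots> = u (Suc (n + m)) x"
      unfolding pw_add[OF x] u_def using l(1) by (simp add: power_add add_ac)
    finally show ?thesis .
  qed
  have u0: "u n \<zero> = of_real (r n)" for n
    by (simp add: u_def t_pw r_def field_simps)
  have n2u: "n2 (u n) = r (Suc (n + n))" for n
  proof -
    have "of_real (n2 (u n)) = complex_of_real (r (Suc (n + n)))"
      using conv_self_zero[OF hu cu, of n] u_add[of \<zero> n n] u0 by simp
    then show ?thesis using of_real_eq_iff by blast
  qed
  \<comment> \<open>Tends to \<open>s - 2 * s + s = 0\<close>, which is the Cauchy property in the
    L2 norm.\<close>
  have n2diff: "n2 (\<lambda>x. u n x - u m x) = r (Suc (n + n)) - 2 * r (Suc (n + m)) + r (Suc (m + m))" for n m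
    unfolding n2u[symmetric] by (rule n2_diff_herm[OF cu cu hu]) (simp add: u_add u0)
  \<comment> \<open>One further convolution with \<open>u 0\<close> upgrades the L2 estimate to a
    uniform one.\<close>
  have bound: "(cmod (u (Suc n) x - u (Suc m) x))\<^sup>2 \<le> (n2 (u 0)) * n2 (\<lambda>x. u n x - u m x)" if x: "x \<in> carrier G" for n m x
  proof -
    have "conv (\<lambda>x. u n x - u m x) (u 0) x = u (Suc n) x - u (Suc m) x"
      by (subst conv_diff_left[OF cu cu cu x]) (simp add: u_add x)
    then show ?thesis using conv_bound[OF cont_diff[OF cu cu] cu x, of n m 0] by (simp add: mult.commute)
  qed
  have Cau: "\<exists>N. \<forall>m n x. N \<le> m \<longrightarrow> N \<le> n \<longrightarrow> x \<in> topspace T \<longrightarrow> dist (u (Suc m) x) (u (Suc n) x) < e" if e: "e > 0" for e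
  proof -
    define A where "A = n2 (u 0) + 1"
    have A: "A > 0" using n2_nonneg[OF cu, of 0] by (simp add: A_def)
    define d where "d = e\<^sup>2 / A / 4"
    have d: "d > 0" using e A by (simp add: d_def)
    obtain N where N: "\<And>n. n \<ge> N \<Longrightarrow> \<bar>r n - s\<bar> < d" using LIMSEQ_D[OF r d] by auto
    show ?thesis
    proof (intro exI allI impI)
      fix m n x assume mn: "N \<le> m" "N \<le> n" "x \<in> topspace T"
      have "n2 (\<lambda>x. u m x - u n x) < 4 * d"
        unfolding n2diff using N[of "Suc (m + m)"] N[of "Suc (m + n)"] N[of "Suc (n + n)"] mn by linarith
      then have "A * n2 (\<lambda>x. u m x - u n x) < A * (4 * d)" using A by (intro mult_strict_left_mono)
      moreover have "n2 (u 0) * n2 (\<lambda>x. u m x - u n x) \<le> A * n2 (\<lambda>x. u m x - u n x)"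
        by (intro mult_right_mono n2_nonneg cont_diff cu) (simp add: A_def)
      moreover have "A * (4 * d) = e\<^sup>2" using A by (simp add: d_def)
      ultimately have "(cmod (u (Suc m) x - u (Suc n) x))\<^sup>2 < e\<^sup>2"
        using bound[of x m n] mn by (simp add: topspace_T)
      then have "cmod (u (Suc m) x - u (Suc n) x) < e" using less_imp_le[OF e] by (rule power2_less_imp_less)
      then show "dist (u (Suc m) x) (u (Suc n) x) < e" by (simp add: dist_norm)
    qed
  qed
  have mc: "Met_TC.mcomplete TYPE(complex)" by (simp add: complete_UNIV)
  obtain \<psi> where \<psi>: "cont \<psi>" and lim0: "\<And>e. e > 0 \<Longrightarrow> eventually (\<lambda>n. \<forall>x\<in>topspace T. dist (u (Suc n) x) (\<psi> x) < e) sequentially"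
    by (rule Met_TC.continuous_map_uniformly_Cauchy_limit[OF mc, of T "\<lambda>n. u (Suc n)"]) (use cu Cau in auto)
  have lim1: "eventually (\<lambda>n. \<forall>x\<in>carrier G. cmod (u (Suc n) x - \<psi> x) < e) sequentially" if "e > 0" for e
    using lim0[OF that] by (simp add: dist_norm topspace_T)
  have lim: "(\<lambda>n. u n x) \<longlonglongrightarrow> \<psi> x" if x: "x \<in> carrier G" for x
  proof (rule LIMSEQ_imp_Suc, rule tendstoI)
    fix e :: real assume "e > 0"
    from lim0[OF this] show "eventually (\<lambda>n. dist (u (Suc n) x) (\<psi> x) < e) sequentially"
      by eventually_elim (use x in \<open>simp add: topspace_T\<close>)
  qed
  have conv_u: "conv \<psi> (u m) x = conv (u m) \<psi> x" if "x \<in> carrier G" for m x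
    by (rule conv_comm[OF \<psi> cu that])
  \<comment> \<open>Multiplying by \<open>u m\<close> merely shifts the index of the sequence, so
    the limit absorbs every \<open>u m\<close>; idempotence and the eigenvalue equation both follow
    from this.\<close>
  have eq1: "conv \<psi> (u m) x = \<psi> x" if x: "x \<in> carrier G" for m x
  proof -
    have "(\<lambda>n. conv (u (Suc n)) (u m) x) \<longlonglongrightarrow> conv \<psi> (u m) x"
      by (rule conv_lim_left[OF cu \<psi> cu x lim1])
    moreover have "(\<lambda>n. conv (u (Suc n)) (u m) x) \<longlonglongrightarrow> \<psi> x"
      using LIMSEQ_ignore_initial_segment[OF lim[OF x], of "Suc (Suc m)"] by (simp add: u_add[OF x] add_ac)
    ultimately show ?thesis by (rule LIMSEQ_unique)
  qed
  have idem: "conv \<psi> \<psi> x = \<psi> x" if x: "x \<in> carrier G" for x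
  proof -
    have "(\<lambda>n. conv (u (Suc n)) \<psi> x) \<longlonglongrightarrow> conv \<psi> \<psi> x"
      by (rule conv_lim_left[OF cu \<psi> \<psi> x lim1])
    then have "(\<lambda>n. \<psi> x) \<longlonglongrightarrow> conv \<psi> \<psi> x" by (simp only: conv_u[OF x, symmetric] eq1[OF x])
    then show ?thesis by (simp add: LIMSEQ_const_iff)
  qed
  have eig: "conv (conv \<eta> \<eta>) \<psi> x = of_real l * \<psi> x" if x: "x \<in> carrier G" for x
  proof -
    have "conv (u 0) \<psi> x = \<psi> x" using eq1[OF x, of 0] conv_u[OF x, of 0] by simp
    moreover have "u 0 = (\<lambda>x. of_real (inverse l) * conv \<eta> \<eta> x)" by (simp add: u_def[abs_def] pwS pw0)
    ultimately have "of_real (inverse l) * conv (conv \<eta> \<eta>) \<psi> x = \<psi> x"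
      using conv_cmult_left[OF cont_conv[OF \<eta>(1) \<eta>(1)] \<psi> x] by simp
    then show ?thesis using l(1) by (simp add: field_simps)
  qed
  have h\<psi>: "herm \<psi>" unfolding herm_def
  proof
    fix x assume x: "x \<in> carrier G"
    have "(\<lambda>n. u n (\<ominus> x)) \<longlonglongrightarrow> cnj (\<psi> x)" using tendsto_cnj[OF lim[OF x]] by (simp only: hermD[OF hu x])
    with lim[OF a_inv_closed[OF x]] show "\<psi> (\<ominus> x) = cnj (\<psi> x)" by (rule LIMSEQ_unique)
  qed
  have "\<psi> \<zero> = of_real s" 
    by (rule LIMSEQ_unique[OF lim[OF zero_closed, unfolded u0] tendsto_of_real[OF r]])
  then have \<psi>0: "\<psi> \<zero> \<noteq> 0" using l by simp
  have abs: "conv \<psi> e x = \<psi> x" if e: "cont e" "\<And>x. x \<in> carrier G \<Longrightarrow> conv \<eta> e x = \<eta> x" and x: "x \<in> carrier G" for e x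
  proof -
    have pe: "conv (pw n) e x = pw n x" if "x \<in> carrier G" for n x using that
    proof (induction n arbitrary: x)
      case (Suc n)
      have "conv (pw (Suc n)) e x = conv \<eta> (conv (pw n) e) x" unfolding pwS by (rule conv_assoc[OF \<eta>(1) cpw e(1) Suc.prems])
      also have "\<dots> = conv \<eta> (pw n) x" by (rule conv_cong) (use Suc in auto)
      finally show ?case by (simp add: pwS)
    qed (simp add: pw0 e)
    have "conv (u n) e x = u n x" for n
      unfolding u_def[abs_def] by (simp only: conv_cmult_left[OF cpw e(1) x] pe[OF x])
    with conv_lim_left[OF cu \<psi> e(1) x lim1] have "(\<lambda>n. u (Suc n) x) \<longlonglongrightarrow> conv \<psi> e x"
      by (simp only:)
    then show ?thesis using LIMSEQ_Suc[OF lim[OF x]] by (rule LIMSEQ_unique)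
  qed
  show ?thesis by (rule that[OF l(1) \<psi> h\<psi> \<psi>0 idem eig abs])
qed

end

section \<open>Characters of compact abelian groups\<close>

context compact_ab_group
begin

lemma add_minus_swap: "x \<in> carrier G \<Longrightarrow> y \<in> carrier G \<Longrightarrow> a \<in> carrier G \<Longrightarrow> x \<ominus> y \<oplus> a = x \<oplus> a \<ominus> y"
  by (simp add: a_minus_def a_ac)

lemma conv_shift_left:
  "a \<in> carrier G \<Longrightarrow> x \<in> carrier G \<Longrightarrow> conv (\<lambda>y. f (y \<oplus> a)) g x = conv f g (x \<oplus> a)"
  unfolding conv_def by (rule mean_cong) (simp add: add_minus_swap)

text \<open>Convolution with such an \<open>e\<close> is an orthogonal projection that commutes with
  translations; the number \<open>n2 e\<close>, which equals \<open>e \<zero>\<close>, plays the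
  role of its rank.\<close>

definition herm_idem :: "('a \<Rightarrow> complex) \<Rightarrow> bool" where
  "herm_idem e \<longleftrightarrow> cont e \<and> herm e \<and> (\<forall>x\<in>carrier G. conv e e x = e x)"

lemma herm_idem_zero: "herm_idem e \<Longrightarrow> e \<zero> = of_real (n2 e)"
  using conv_self_zero[of e] by (auto simp: herm_idem_def)

lemma herm_idem_bound:
  assumes "herm_idem e" "x \<in> carrier G" shows "cmod (e x) \<le> n2 e"
proof -
  have "(cmod (e x))\<^sup>2 \<le> n2 e * n2 e" using conv_bound[of e e x] assms by (simp add: herm_idem_def)
  then have "(cmod (e x))\<^sup>2 \<le> (n2 e)\<^sup>2" by (simp only: power2_eq_square[of "n2 e"])
  moreover have "0 \<le> n2 e" using n2_nonneg[of e] assms(1) by (simp add: herm_idem_def)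
  ultimately show ?thesis by (rule power2_le_imp_le)
qed

text \<open>The pointwise bound of \<open>e\<close> by \<open>n2 e\<close> gives
  \<open>n2 e \<le> (n2 e)\<^sup>2\<close>. The resulting gap between 0 and 1 limits how often an
  idempotent can be split, so that a minimal one can be recognised by an integer.\<close>

lemma herm_idem_ge1:
  assumes e: "herm_idem e" and x: "x \<in> carrier G" "e x \<noteq> 0" shows "n2 e \<ge> 1"
proof -
  have c: "cont e" using e by (simp add: herm_idem_def)
  have p: "n2 e > 0" by (rule n2_pos[OF c x])
  have "n2 e \<le> (n2 e)\<^sup>2"
    by (rule n2_le[OF c], rule power_mono[OF herm_idem_bound[OF e]]) simp_all
  then show ?thesis using p by (simp add: power2_eq_square)
qed

text \<open>An idempotent whose value at zero is minimal spans a one-dimensional translation-invariant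
  space: every hermitian \<open>R\<close> absorbed by it has a square proportional to it, and polarising with
  \<open>R + e\<close> makes \<open>R\<close> itself, hence every translate of \<open>e\<close>, proportional to \<open>e\<close>.\<close>

lemma minimal_idempotent_character:
  assumes \<theta>: "cont \<theta>"
    and e: "herm_idem e" "e \<zero> \<noteq> 0" "\<And>x. x \<in> carrier G \<Longrightarrow> conv \<theta> e x = l0 * e x"
    and l0: "l0 \<noteq> 0"
    and min: "\<And>e' l. herm_idem e' \<Longrightarrow> e' \<zero> \<noteq> 0 \<Longrightarrow> (\<And>x. x \<in> carrier G \<Longrightarrow> conv \<theta> e' x = l * e' x) \<Longrightarrow> l \<noteq> 0
          \<Longrightarrow> nat \<lfloor>n2 e\<rfloor> \<le> nat \<lfloor>n2 e'\<rfloor>"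
    and a: "a \<in> carrier G"
  obtains \<mu> where "\<And>x. x \<in> carrier G \<Longrightarrow> e (x \<oplus> a) = \<mu> * e x"
proof -
  have ce: "cont e" and he: "herm e" and ie: "\<And>x. x \<in> carrier G \<Longrightarrow> conv e e x = e x"
    using e(1) by (auto simp: herm_idem_def)
  have sq: "\<exists>l. \<forall>x\<in>carrier G. conv R R x = l * e x"
    if cR: "cont R" and hR: "herm R" and Re: "\<And>x. x \<in> carrier G \<Longrightarrow> conv R e x = R x" for R
  proof (cases "\<forall>x\<in>carrier G. R x = 0")
    case True
    have "conv R R x = 0" if "x \<in> carrier G" for x
    proof -
      have "conv R R x = conv (\<lambda>_. 0) (\<lambda>_. 0) x" by (rule conv_cong) (use that True in auto)
      then show ?thesis by (simp add: conv_def mean_const)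
    qed
    then show ?thesis by (intro exI[of _ 0]) simp
  next
    case False
    then obtain x0 where x0: "x0 \<in> carrier G" "R x0 \<noteq> 0" by auto
    obtain \<psi> l where \<psi>: "cont \<psi>" "herm \<psi>" "\<psi> \<zero> \<noteq> 0" "\<And>x. x \<in> carrier G \<Longrightarrow> conv \<psi> \<psi> x = \<psi> x"
      "\<And>x. x \<in> carrier G \<Longrightarrow> conv (conv R R) \<psi> x = of_real l * \<psi> x"
      "\<And>e x. cont e \<Longrightarrow> (\<And>x. x \<in> carrier G \<Longrightarrow> conv R e x = R x) \<Longrightarrow> x \<in> carrier G \<Longrightarrow> conv \<psi> e x = \<psi> x"
      by (rule schmidt_idempotent[OF cR hR x0]) blast
    have \<psi>e: "conv \<psi> e x = \<psi> x" if "x \<in> carrier G" for x by (rule \<psi>(6)[OF ce Re that])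
    have e\<psi>: "conv e \<psi> x = \<psi> x" if "x \<in> carrier G" for x
      using conv_comm[OF ce \<psi>(1) that] \<psi>e[OF that] by simp
    have I\<psi>: "herm_idem \<psi>" using \<psi> by (simp add: herm_idem_def)
    have \<theta>\<psi>: "conv \<theta> \<psi> x = l0 * \<psi> x" if x: "x \<in> carrier G" for x
    proof -
      have "conv \<theta> \<psi> x = conv \<theta> (conv e \<psi>) x" by (rule conv_cong) (use x e\<psi> in auto)
      also have "\<dots> = conv (conv \<theta> e) \<psi> x" by (rule conv_assoc[OF \<theta> ce \<psi>(1) x, symmetric])
      also have "\<dots> = conv (\<lambda>x. l0 * e x) \<psi> x" by (rule conv_cong) (use x e(3) in auto)
      also have "\<dots> = l0 * \<psi> x" by (simp add: conv_cmult_left[OF ce \<psi>(1) x] e\<psi>[OF x])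
      finally show ?thesis .
    qed
    \<comment> \<open>The complement of \<open>\<psi>\<close> in \<open>e\<close> is again a
      hermitian idempotent. If it were nonzero it would contribute at least 1 to
      \<open>n2 e\<close>, and \<open>\<psi>\<close> would have a smaller integer part than the
      minimal one.\<close>
    define d where "d x = e x - \<psi> x" for x
    have cd: "cont d" unfolding d_def[abs_def] by (rule cont_diff[OF ce \<psi>(1)])
    have hd: "herm d" using he \<psi>(2) by (simp add: herm_def d_def)
    have dd: "conv d d x = d x" if x: "x \<in> carrier G" for x
    proof -
      have 1: "conv d e y = d y" if y: "y \<in> carrier G" for y
        unfolding d_def[abs_def] conv_diff_left[OF ce \<psi>(1) ce y] ie[OF y] \<psi>e[OF y] ..
      have 2: "conv d \<psi> y = 0" if y: "y \<in> carrier G" for y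
        unfolding d_def[abs_def] conv_diff_left[OF ce \<psi>(1) \<psi>(1) y] \<psi>(4)[OF y] e\<psi>[OF y] by simp
      have "conv d d x = conv e d x - conv \<psi> d x"
        using conv_diff_left[OF ce \<psi>(1) cd x] by (simp only: d_def[symmetric])
      then show ?thesis using 1[OF x] 2[OF x] by (simp add: conv_comm[OF ce cd x] conv_comm[OF \<psi>(1) cd x])
    qed
    have Id: "herm_idem d" using cd hd dd by (simp add: herm_idem_def)
    have eq: "\<psi> x = e x" if x: "x \<in> carrier G" for x
    proof (rule ccontr)
      assume "\<psi> x \<noteq> e x"
      then have "n2 d \<ge> 1" by (intro herm_idem_ge1[OF Id x]) (simp add: d_def)
      moreover have "complex_of_real (n2 e) = of_real (n2 d + n2 \<psi>)"
        using herm_idem_zero[OF Id] herm_idem_zero[OF I\<psi>] herm_idem_zero[OF e(1)] by (simp add: d_def algebra_simps)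
      then have "n2 e = n2 d + n2 \<psi>" using of_real_eq_iff by blast
      ultimately have "n2 \<psi> + 1 \<le> n2 e" by linarith
      then have "\<lfloor>n2 \<psi>\<rfloor> + 1 \<le> \<lfloor>n2 e\<rfloor>" by linarith
      moreover have "\<lfloor>n2 \<psi>\<rfloor> \<ge> 0" using n2_nonneg[OF \<psi>(1)] by simp
      ultimately show False using min[OF I\<psi> \<psi>(3) \<theta>\<psi> l0] by linarith
    qed
    have "conv R R x = of_real l * e x" if x: "x \<in> carrier G" for x
    proof -
      have "conv R R x = conv R (conv R e) x" by (rule conv_cong) (use x Re in auto)
      also have "\<dots> = conv (conv R R) e x" by (rule conv_assoc[OF cR cR ce x, symmetric])
      also have "\<dots> = conv (conv R R) \<psi> x" by (rule conv_cong) (use x eq in auto)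
      finally show ?thesis using \<psi>(5)[OF x] eq[OF x] by simp
    qed
    then show ?thesis by blast
  qed
  have prp: "\<exists>k. \<forall>x\<in>carrier G. R x = k * e x"
    if cR: "cont R" and hR: "herm R" and Re: "\<And>x. x \<in> carrier G \<Longrightarrow> conv R e x = R x" for R
  proof -
    define S where "S x = R x + e x" for x
    have cS: "cont S" unfolding S_def[abs_def] by (rule cont_add[OF cR ce])
    have hS: "herm S" using hR he by (simp add: herm_def S_def)
    have Se: "conv S e x = S x" if x: "x \<in> carrier G" for x
      unfolding S_def[abs_def] conv_add_left[OF cR ce ce x] Re[OF x] ie[OF x] ..
    obtain l where l: "\<And>x. x \<in> carrier G \<Longrightarrow> conv R R x = l * e x" using sq[OF cR hR Re] by blast
    obtain l' where l': "\<And>x. x \<in> carrier G \<Longrightarrow> conv S S x = l' * e x" using sq[OF cS hS Se] by blast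
    have "R x = ((l' - l - 1) / 2) * e x" if x: "x \<in> carrier G" for x
    proof -
      have "conv S S x = conv R S x + conv e S x"
        using conv_add_left[OF cR ce cS x] by (simp only: S_def[symmetric])
      also have "conv R S x = conv R R x + conv e R x"
        using conv_add_left[OF cR ce cR x] conv_comm[OF cR cS x] by (simp only: S_def[symmetric])
      also have "conv e R x = R x" using conv_comm[OF ce cR x] Re[OF x] by simp
      also have "conv e S x = S x" using conv_comm[OF ce cS x] Se[OF x] by simp
      finally have "l' * e x = l * e x + R x + S x" unfolding l[OF x] l'[OF x] .
      then have "l' * e x = l * e x + R x + (R x + e x)" by (simp only: S_def)
      then show ?thesis by (simp add: field_simps)
    qed
    then show ?thesis by blast
  qed
  have na: "\<ominus> a \<in> carrier G" using a by simp
  \<comment> \<open>A single translate of \<open>e\<close> need not be hermitian, but these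
    combinations of opposite translates are; \<open>c = 1\<close> and \<open>c = \<i>\<close>
    together isolate one translate.\<close>
  have tr: "\<exists>k. \<forall>x\<in>carrier G. c * e (x \<oplus> a) + cnj c * e (x \<ominus> a) = k * e x" for c
  proof (rule prp)
    have c1: "cont (\<lambda>x. e (x \<oplus> a))" by (rule cont_shift[OF ce a])
    have c2: "cont (\<lambda>x. e (x \<ominus> a))" by (rule cont_shift'[OF ce a])
    show "cont (\<lambda>x. c * e (x \<oplus> a) + cnj c * e (x \<ominus> a))" by (intro cont_add cont_cmult c1 c2)
    show "herm (\<lambda>x. c * e (x \<oplus> a) + cnj c * e (x \<ominus> a))"
      unfolding herm_def
    proof
      fix x assume x: "x \<in> carrier G"
      have "\<ominus> x \<oplus> a = \<ominus> (x \<ominus> a)" "\<ominus> x \<ominus> a = \<ominus> (x \<oplus> a)" using x a by (simp_all add: a_minus_def minus_add)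
      then show "c * e (\<ominus> x \<oplus> a) + cnj c * e (\<ominus> x \<ominus> a) = cnj (c * e (x \<oplus> a) + cnj c * e (x \<ominus> a))"
        using hermD[OF he, of "x \<ominus> a"] hermD[OF he, of "x \<oplus> a"] x a by simp
    qed
    fix x assume x: "x \<in> carrier G"
    have "conv (\<lambda>x. e (x \<oplus> a)) e x = e (x \<oplus> a)" "conv (\<lambda>x. e (x \<ominus> a)) e x = e (x \<ominus> a)"
      unfolding a_minus_def conv_shift_left[OF a x] conv_shift_left[OF na x] using ie a na x by auto
    then show "conv (\<lambda>x. c * e (x \<oplus> a) + cnj c * e (x \<ominus> a)) e x = c * e (x \<oplus> a) + cnj c * e (x \<ominus> a)"
      by (simp only: conv_add_left[OF cont_cmult[OF c1] cont_cmult[OF c2] ce x] conv_cmult_left[OF c1 ce x] conv_cmult_left[OF c2 ce x])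
  qed
  obtain k1 where k1: "\<And>x. x \<in> carrier G \<Longrightarrow> 1 * e (x \<oplus> a) + cnj 1 * e (x \<ominus> a) = k1 * e x" using tr[of 1] by blast
  obtain k2 where k2: "\<And>x. x \<in> carrier G \<Longrightarrow> \<i> * e (x \<oplus> a) + cnj \<i> * e (x \<ominus> a) = k2 * e x" using tr[of \<i>] by blast
  show ?thesis
  proof (rule that[of "(k1 - \<i> * k2) / 2"])
    fix x assume x: "x \<in> carrier G"
    have "(k1 - \<i> * k2) * e x = k1 * e x - \<i> * (k2 * e x)" by (simp add: algebra_simps)
    also have "\<dots> = (e (x \<oplus> a) + e (x \<ominus> a)) - \<i> * (\<i> * e (x \<oplus> a) - \<i> * e (x \<ominus> a))"
      unfolding k1[OF x, symmetric] k2[OF x, symmetric] by simp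
    also have "\<dots> = 2 * e (x \<oplus> a)" by (simp add: algebra_simps)
    finally show "e (x \<oplus> a) = (k1 - \<i> * k2) / 2 * e x" by simp
  qed
qed

definition character :: "('a \<Rightarrow> complex) \<Rightarrow> bool" where
  "character \<phi> \<longleftrightarrow> cont \<phi> \<and> (\<forall>x\<in>carrier G. \<forall>y\<in>carrier G. \<phi> (x \<oplus> y) = \<phi> x * \<phi> y) \<and> (\<forall>x\<in>carrier G. cmod (\<phi> x) = 1)"

text \<open>\<open>\<eta>\<close> is designed so that convolution with it annihilates every function
  invariant under \<open>x0\<close>. A minimal idempotent in an eigenspace with nonzero eigenvalue
  is a multiple of a character, and triviality of that character at \<open>x0\<close> would make the
  idempotent invariant under \<open>x0\<close>.\<close>

theorem characters_separate:
  assumes T2: "Hausdorff_space T" and x0: "x0 \<in> carrier G" "x0 \<noteq> \<zero>"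
  obtains \<phi> where "character \<phi>" "\<phi> x0 \<noteq> 1"
proof -
  have norm: "normal_space T" using compact_Hausdorff_or_regular_imp_normal_space[OF compact_T] T2 by blast
  have "closedin T {x0}" "closedin T {\<zero>}" using T2 x0 by (auto intro!: closedin_Hausdorff_singleton simp: topspace_T)
  moreover have "disjnt {x0} {\<zero>}" using x0 by auto
  ultimately obtain f where f: "continuous_map T (top_of_set {0..1::real}) f" "f ` {x0} \<subseteq> {0}" "f ` {\<zero>} \<subseteq> {1}"
    by (rule Urysohn_lemma[OF norm, of "{x0}" "{\<zero>}" 0 1]) auto
  have cf: "continuous_map T euclidean f" using f(1) by (simp add: continuous_map_in_subtopology)
  \<comment> \<open>The product makes the Urysohn function even, so that \<open>\<eta>\<close> below
    is hermitian.\<close>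
  define g where "g y = complex_of_real (f y * f (\<ominus> y))" for y
  have cg: "cont g" unfolding g_def[abs_def]
  proof (rule continuous_map_lift1[OF continuous_map_lift2[where h = "(*)", OF cf]])
    show "continuous_map T euclidean (\<lambda>x. f (\<ominus> x))" using continuous_map_compose[OF neg_cont cf] by (simp add: o_def)
  qed (intro continuous_intros)+
  have nz: "\<ominus> \<zero> = \<zero>" using r_neg[OF zero_closed] l_zero[OF a_inv_closed[OF zero_closed]] by simp
  have g0: "g \<zero> = 1" "g x0 = 0" "g (\<ominus> x0) = 0" using f x0 by (auto simp: g_def nz)
  have gneg: "g (\<ominus> y) = g y" if "y \<in> carrier G" for y using that by (simp add: g_def)
  have greal: "cnj (g y) = g y" for y by (simp add: g_def)
  \<comment> \<open>The second difference of \<open>g\<close> with step \<open>x0\<close>. It is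
    nonzero since \<open>\<eta> \<zero> = 2\<close>, as \<open>g\<close> vanishes at
    \<open>x0\<close> and at its negative.\<close>
  define \<eta> where "\<eta> y = 2 * g y - (g (y \<oplus> x0) + g (y \<oplus> \<ominus> x0))" for y
  have nx0: "\<ominus> x0 \<in> carrier G" using x0 by simp
  have c1: "cont (\<lambda>y. g (y \<oplus> x0))" and c2: "cont (\<lambda>y. g (y \<oplus> \<ominus> x0))" by (rule cont_shift[OF cg x0(1)], rule cont_shift[OF cg nx0])
  have c\<eta>: "cont \<eta>" unfolding \<eta>_def[abs_def] by (intro cont_diff cont_add cont_cmult cg c1 c2)
  have h\<eta>: "herm \<eta>" unfolding herm_def
  proof
    fix y assume y: "y \<in> carrier G"
    have "\<ominus> y \<oplus> x0 = \<ominus> (y \<oplus> \<ominus> x0)" "\<ominus> y \<oplus> \<ominus> x0 = \<ominus> (y \<oplus> x0)" using y x0 by (simp_all add: minus_add)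
    then show "\<eta> (\<ominus> y) = cnj (\<eta> y)" using gneg[OF y] gneg[of "y \<oplus> x0"] gneg[of "y \<oplus> \<ominus> x0"] y x0 
      by (simp add: \<eta>_def greal)
  qed
  have \<eta>0: "\<eta> \<zero> \<noteq> 0" using g0 x0 by (simp add: \<eta>_def)
  define \<theta> where "\<theta> = conv \<eta> \<eta>"
  have c\<theta>: "cont \<theta>" unfolding \<theta>_def by (rule cont_conv[OF c\<eta> c\<eta>])
  define I where "I e \<longleftrightarrow> herm_idem e \<and> e \<zero> \<noteq> 0 \<and> (\<exists>l. l \<noteq> 0 \<and> (\<forall>x\<in>carrier G. conv \<theta> e x = l * e x))" for e
  obtain \<psi> l where "l > 0" "cont \<psi>" "herm \<psi>" "\<psi> \<zero> \<noteq> 0" "\<And>x. x \<in> carrier G \<Longrightarrow> conv \<psi> \<psi> x = \<psi> x"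
      "\<And>x. x \<in> carrier G \<Longrightarrow> conv (conv \<eta> \<eta>) \<psi> x = of_real l * \<psi> x"
    by (rule schmidt_idempotent[OF c\<eta> h\<eta> _ \<eta>0]) auto
  then have "I \<psi>" unfolding I_def herm_idem_def \<theta>_def by (auto intro!: exI[of _ "of_real l"])
  \<comment> \<open>Minimality of the integer part of \<open>n2\<close> is enough, because a proper
    summand takes away at least 1.\<close>
  then obtain e where e: "I e" "\<And>e'. I e' \<Longrightarrow> nat \<lfloor>n2 e\<rfloor> \<le> nat \<lfloor>n2 e'\<rfloor>"
    using ex_has_least_nat[of I \<psi> "\<lambda>e. nat \<lfloor>n2 e\<rfloor>"] by blast
  from e(1) obtain l0 where e0: "herm_idem e" "e \<zero> \<noteq> 0" "l0 \<noteq> 0" "\<And>x. x \<in> carrier G \<Longrightarrow> conv \<theta> e x = l0 * e x"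
    by (auto simp: I_def)
  have ce: "cont e" using e0(1) by (simp add: herm_idem_def)
  have mult: "e (x \<oplus> a) * e \<zero> = e a * e x" if a: "a \<in> carrier G" and x: "x \<in> carrier G" for x a
  proof -
    obtain \<mu> where \<mu>: "\<And>x. x \<in> carrier G \<Longrightarrow> e (x \<oplus> a) = \<mu> * e x"
    proof (rule minimal_idempotent_character[OF c\<theta> e0(1,2,4,3) _ a])
      show "nat \<lfloor>n2 e\<rfloor> \<le> nat \<lfloor>n2 e'\<rfloor>" if "herm_idem e'" "e' \<zero> \<noteq> 0" "\<And>x. x \<in> carrier G \<Longrightarrow> conv \<theta> e' x = l * e' x" "l \<noteq> 0" for e' l
        by (rule e(2)) (use that in \<open>auto simp: I_def\<close>)
    qed auto
    show ?thesis using \<mu>[OF x] \<mu>[OF zero_closed] a by simp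
  qed
  define \<phi> where "\<phi> x = e x / e \<zero>" for x
  have \<phi>mult: "\<phi> (x \<oplus> y) = \<phi> x * \<phi> y" if "x \<in> carrier G" "y \<in> carrier G" for x y
    using mult[OF that(2,1)] e0(2) by (simp add: \<phi>_def field_simps)
  have \<phi>le: "cmod (\<phi> x) \<le> 1" if "x \<in> carrier G" for x
  proof -
    have "cmod (e \<zero>) = n2 e" using herm_idem_zero[OF e0(1)] n2_nonneg[OF ce] by simp
    then show ?thesis using herm_idem_bound[OF e0(1) that] e0(2) n2_nonneg[OF ce]
      by (simp add: \<phi>_def norm_divide divide_le_eq)
  qed
  have \<phi>1: "cmod (\<phi> x) = 1" if x: "x \<in> carrier G" for x
  proof -
    have "\<phi> x * \<phi> (\<ominus> x) = 1" using \<phi>mult[of x "\<ominus> x"] x e0(2) by (simp add: r_neg \<phi>_def)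
    then have "cmod (\<phi> x) * cmod (\<phi> (\<ominus> x)) = 1" by (metis norm_mult norm_one)
    moreover have "cmod (\<phi> x) * cmod (\<phi> (\<ominus> x)) \<le> cmod (\<phi> x) * 1"
      using \<phi>le[of "\<ominus> x"] x by (intro mult_left_mono) auto
    ultimately show ?thesis using \<phi>le[OF x] by linarith
  qed
  have c\<phi>: "cont \<phi>" unfolding \<phi>_def[abs_def] divide_inverse by (intro cont_mult ce cont_const)
  have "\<phi> x0 \<noteq> 1"
  proof
    assume "\<phi> x0 = 1"
    then have ex: "e (y \<oplus> x0) = e y" if "y \<in> carrier G" for y
      using mult[OF x0(1) that] e0(2) by (simp add: \<phi>_def)
    have ex': "e (y \<oplus> \<ominus> x0) = e y" if "y \<in> carrier G" for y
      using ex[of "y \<oplus> \<ominus> x0"] that x0 by (simp add: a_assoc l_neg)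
    have inv: "conv (\<lambda>y. g (y \<oplus> b)) e x = conv g e x"
      if b: "b \<in> carrier G" and eb: "\<And>y. y \<in> carrier G \<Longrightarrow> e (y \<oplus> b) = e y" and x: "x \<in> carrier G" for b x
    proof -
      have xb: "x \<oplus> b \<in> carrier G" using x b by simp
      have "conv (\<lambda>y. g (y \<oplus> b)) e x = conv e g (x \<oplus> b)" 
        unfolding conv_shift_left[OF b x] by (rule conv_comm[OF cg ce xb])
      also have "\<dots> = conv (\<lambda>y. e (y \<oplus> b)) g x" by (rule conv_shift_left[OF b x, symmetric])
      also have "\<dots> = conv e g x" by (rule conv_cong) (use x eb in auto)
      also have "\<dots> = conv g e x" by (rule conv_comm[OF ce cg x])
      finally show ?thesis .
    qed
    have z: "conv \<eta> e x = 0" if x: "x \<in> carrier G" for x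
      unfolding \<eta>_def[abs_def]
      by (simp add: conv_diff_left[OF cont_cmult[OF cg] cont_add[OF c1 c2] ce x] conv_cmult_left[OF cg ce x]
          conv_add_left[OF c1 c2 ce x] inv[OF x0(1) ex x] inv[OF nx0 ex' x])
    have "conv \<theta> e \<zero> = conv \<eta> (conv \<eta> e) \<zero>" unfolding \<theta>_def by (rule conv_assoc[OF c\<eta> c\<eta> ce zero_closed])
    also have "\<dots> = conv \<eta> (\<lambda>_. 0) \<zero>" by (rule conv_cong) (use z in auto)
    also have "\<dots> = 0" by (simp add: conv_def mean_const)
    finally show False using e0(2,3) e0(4)[OF zero_closed] by simp
  qed
  then show ?thesis using that[of \<phi>] c\<phi> \<phi>mult \<phi>1 by (simp add: character_def)
qed

end

section \<open>Closed subgroups of real vector groups\<close>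

lemma pointwise_convergent_subseq:
  fixes y :: "nat \<Rightarrow> nat \<Rightarrow> real"
  assumes b: "\<And>n i. i < m \<Longrightarrow> \<bar>y n i\<bar> \<le> B"
  shows "\<exists>r w. strict_mono (r :: nat \<Rightarrow> nat) \<and> (\<forall>i<m. (\<lambda>n. y (r n) i) \<longlonglongrightarrow> w i)"
  using b
proof (induction m)
  case 0
  have "strict_mono (\<lambda>n::nat. n)" by (simp add: strict_mono_def)
  then show ?case by blast
next
  case (Suc m)
  then obtain r w where r: "strict_mono (r :: nat \<Rightarrow> nat)" "\<And>i. i < m \<Longrightarrow> (\<lambda>n. y (r n) i) \<longlonglongrightarrow> w i"
    by (metis less_SucI)
  have "bounded (range (\<lambda>n. y (r n) m))" unfolding bounded_iff using Suc.prems[of m] by auto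
  then obtain l q where q: "strict_mono (q :: nat \<Rightarrow> nat)" "((\<lambda>n. y (r n) m) \<circ> q) \<longlonglongrightarrow> l"
    using bounded_imp_convergent_subsequence by blast
  have "(\<lambda>n. y ((r \<circ> q) n) i) \<longlonglongrightarrow> (w(m := l)) i" if "i < Suc m" for i
  proof (cases "i = m")
    case True then show ?thesis using q(2) by (simp add: o_def)
  next
    case False
    then have "i < m" using that by simp
    from LIMSEQ_subseq_LIMSEQ[OF r(2)[OF this] q(1)] False show ?thesis by (simp add: o_def)
  qed
  then show ?case using strict_mono_o[OF r(1) q(1)] by blast
qed

lemma int_multiple_mem:
  fixes L :: "('i \<Rightarrow> real) set"
  assumes sub: "\<And>x y. x \<in> L \<Longrightarrow> y \<in> L \<Longrightarrow> (\<lambda>i. x i - y i) \<in> L" and x: "x \<in> L"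
  shows "(\<lambda>i. of_int k * x i) \<in> L"
proof -
  have z: "(\<lambda>i. 0) \<in> L" using sub[OF x x] by simp
  have neg: "(\<lambda>i. - y i) \<in> L" if "y \<in> L" for y using sub[OF z that] by simp
  have n: "(\<lambda>i. of_nat n * x i) \<in> L" for n
  proof (induction n)
    case (Suc n)
    from sub[OF Suc neg[OF x]] show ?case by (simp add: algebra_simps)
  qed (use z in simp)
  show ?thesis
  proof (cases k rule: int_cases2)
    case (nonneg n) then show ?thesis using n[of n] by simp
  next
    case (nonpos n) then show ?thesis using neg[OF n[of n]] by simp
  qed
qed

text \<open>Nonzero vectors of \<open>L\<close> that shrink to 0 have, after normalisation, a limit
  direction \<open>w\<close>, and integer multiples of them approximate every real multiple of
  \<open>w\<close>. Vectors are functions on the naturals that vanish from \<open>m\<close>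
  on.\<close>

lemma closed_subgroup_line:
  fixes L :: "(nat \<Rightarrow> real) set"
  assumes sub: "\<And>x y. x \<in> L \<Longrightarrow> y \<in> L \<Longrightarrow> (\<lambda>i. x i - y i) \<in> L"
    and cl: "\<And>f x. (\<And>n. f n \<in> L) \<Longrightarrow> (\<And>i. (\<lambda>n. f n i) \<longlonglongrightarrow> x i) \<Longrightarrow> x \<in> L"
    and supp: "\<And>x i. x \<in> L \<Longrightarrow> i \<ge> m \<Longrightarrow> x i = 0"
    and nd: "\<And>e. e > 0 \<Longrightarrow> \<exists>x\<in>L. (\<exists>i<m. x i \<noteq> 0) \<and> (\<forall>i<m. \<bar>x i\<bar> < e)"
  obtains w where "\<exists>i<m. w i \<noteq> 0" "\<And>t. (\<lambda>i. t * w i) \<in> L"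
proof -
  define N where "N x = (\<Sum>i<m. \<bar>x i\<bar>)" for x :: "nat \<Rightarrow> real"
  have Ni: "\<bar>x i\<bar> \<le> N x" if "i < m" for x i
    unfolding N_def using that by (intro member_le_sum) auto
  have ex: "\<exists>x\<in>L. N x > 0 \<and> N x < e" if e: "e > 0" for e
  proof -
    have "e / (m + 1) > 0" using e by simp
    from nd[OF this] obtain x i where x: "x \<in> L" "i < m" "x i \<noteq> 0" "\<forall>i<m. \<bar>x i\<bar> < e / (m + 1)" by blast
    have "N x \<le> (\<Sum>i<m. e / (m + 1))" unfolding N_def using x by (intro sum_mono) (auto intro: less_imp_le)
    also have "\<dots> < e" using e by (simp add: field_simps)
    finally show ?thesis using Ni[OF x(2), of x] x by (intro bexI[of _ x]) auto
  qed
  have "\<exists>x\<in>L. N x > 0 \<and> N x < inverse (of_nat (Suc n))" for n by (rule ex) simp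
  then obtain x where x: "\<And>n. x n \<in> L" "\<And>n. N (x n) > 0" "\<And>n. N (x n) < inverse (of_nat (Suc n))" by metis
  have Nx: "(\<lambda>n. N (x n)) \<longlonglongrightarrow> 0"
  proof (rule Lim_null_comparison[OF _ LIMSEQ_inverse_real_of_nat], intro always_eventually allI)
    fix n show "norm (N (x n)) \<le> inverse (real (Suc n))" using x(2,3)[of n] by simp
  qed
  define y where "y n i = x n i / N (x n)" for n i
  have "\<bar>y n i\<bar> \<le> 1" if "i < m" for n i
    using Ni[OF that, of "x n"] x(2)[of n] by (simp add: y_def)
  from pointwise_convergent_subseq[of m y 1, OF this] obtain r w0 where
    r: "strict_mono (r :: nat \<Rightarrow> nat)" "\<And>i. i < m \<Longrightarrow> (\<lambda>n. y (r n) i) \<longlonglongrightarrow> w0 i" by blast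
  define w where "w i = (if i < m then w0 i else 0)" for i
  have y0: "y n i = 0" if "i \<ge> m" for n i using supp[OF x(1) that] by (simp add: y_def)
  have w: "(\<lambda>n. y (r n) i) \<longlonglongrightarrow> w i" for i
    using r(2)[of i] y0[of i] by (cases "i < m") (auto simp: w_def)
  have "(\<lambda>n. \<Sum>i<m. \<bar>y (r n) i\<bar>) \<longlonglongrightarrow> (\<Sum>i<m. \<bar>w i\<bar>)"
    by (intro tendsto_intros w)
  moreover have "(\<Sum>i<m. \<bar>y n i\<bar>) = 1" for n
    using x(2)[of n] by (simp add: y_def sum_divide_distrib[symmetric] N_def[symmetric])
  ultimately have "(\<Sum>i<m. \<bar>w i\<bar>) = 1" by (simp add: LIMSEQ_const_iff)
  then have nz: "\<exists>i<m. w i \<noteq> 0" by (metis (mono_tags, lifting) abs_zero lessThan_iff sum.neutral zero_neq_one)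
  \<comment> \<open>The integer is chosen so that the multiple has length \<open>t\<close> up to the
    length of one short vector.\<close>
  have "(\<lambda>i. t * w i) \<in> L" for t
  proof (rule cl)
    fix n show "(\<lambda>i. of_int \<lfloor>t / N (x (r n))\<rfloor> * x (r n) i) \<in> L"
      by (rule int_multiple_mem[OF sub x(1)])
  next
    fix i
    define k where "k n = of_int \<lfloor>t / N (x (r n))\<rfloor> * N (x (r n))" for n
    have Nr: "(\<lambda>n. N (x (r n))) \<longlonglongrightarrow> 0" using LIMSEQ_subseq_LIMSEQ[OF Nx r(1)] by (simp add: o_def)
    have kb: "\<bar>k n - t\<bar> \<le> N (x (r n))" for n
    proof -
      define p where "p = N (x (r n))"
      have p: "p > 0" using x(2) by (simp add: p_def)
      have "of_int \<lfloor>t / p\<rfloor> \<le> t / p" "t / p < of_int \<lfloor>t / p\<rfloor> + 1" by linarith+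
      then have "of_int \<lfloor>t / p\<rfloor> * p \<le> t" "t < (of_int \<lfloor>t / p\<rfloor> + 1) * p"
        using p by (simp_all only: pos_le_divide_eq pos_divide_less_eq)
      then show ?thesis by (simp add: k_def p_def[symmetric] algebra_simps abs_le_iff)
    qed
    have "(\<lambda>n. k n - t) \<longlonglongrightarrow> 0"
      by (rule Lim_null_comparison[OF _ Nr]) (use kb in \<open>auto intro!: always_eventually\<close>)
    then have "k \<longlonglongrightarrow> t" by (simp add: LIM_zero_iff)
    from tendsto_mult[OF this w[of i]]
    show "(\<lambda>n. of_int \<lfloor>t / N (x (r n))\<rfloor> * x (r n) i) \<longlonglongrightarrow> t * w i"
    proof (rule Lim_transform_eventually)
      show "eventually (\<lambda>n. k n * y (r n) i = of_int \<lfloor>t / N (x (r n))\<rfloor> * x (r n) i) sequentially"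
      proof (intro always_eventually allI)
        fix n
        have "N (x (r n)) \<noteq> 0" using x(2)[of "r n"] by simp
        then show "k n * y (r n) i = of_int \<lfloor>t / N (x (r n))\<rfloor> * x (r n) i" by (simp add: k_def y_def)
      qed
    qed
  qed
  with nz show ?thesis by (rule that)
qed

text \<open>The circle is unrolled by \<open>cis\<close>, which gives a closed subgroup of the
  plane. If its vertical part is not discrete, the whole circle over 0 lies in
  \<open>\<Gamma>\<close> and \<open>a = 0\<close> works. Otherwise the subgroup itself is still not
  discrete, and the line in it cannot be vertical; its slope is \<open>a\<close>.\<close>

lemma closed_subgroup_real_circle:
  fixes \<Gamma> :: "(real \<times> complex) set"
  assumes diff: "\<And>s t z w. (s, z) \<in> \<Gamma> \<Longrightarrow> (t, w) \<in> \<Gamma> \<Longrightarrow> (s - t, z / w) \<in> \<Gamma>"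
    and cl: "closed \<Gamma>"
    and circ: "\<And>t z. (t, z) \<in> \<Gamma> \<Longrightarrow> cmod z = 1"
    and onto: "\<And>t. \<exists>z. (t, z) \<in> \<Gamma>"
  obtains a where "\<And>t. (t, cis (a * t)) \<in> \<Gamma>"
proof -
  \<comment> \<open>The unrolled subgroup, with plane vectors as functions supported on the indices
    0 and 1; \<open>L True\<close> is its vertical part.\<close>
  define L where "L P = {x :: nat \<Rightarrow> real. (x 0, cis (x 1)) \<in> \<Gamma> \<and> (\<forall>i\<ge>2. x i = 0) \<and> (P \<longrightarrow> x 0 = 0)}" for P
  have Lsub: "(\<lambda>i. x i - y i) \<in> L P" if "x \<in> L P" "y \<in> L P" for x y P
    using that diff by (auto simp: L_def cis_divide[symmetric])
  have Lcl: "x \<in> L P" if f: "\<And>n. f n \<in> L P" and lim: "\<And>i. (\<lambda>n. f n i) \<longlonglongrightarrow> x i" for f x P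
  proof -
    have m: "(f n 0, cis (f n 1)) \<in> \<Gamma>" for n using f[of n] by (simp add: L_def)
    have "(\<lambda>n. cis (f n 1)) \<longlonglongrightarrow> cis (x 1)" unfolding cis_conv_exp
      by (intro tendsto_intros lim)
    then have "(\<lambda>n. (f n 0, cis (f n 1))) \<longlonglongrightarrow> (x 0, cis (x 1))"
      by (intro tendsto_Pair lim)
    from closed_sequentially[OF cl m this] have 1: "(x 0, cis (x 1)) \<in> \<Gamma>" .
    have 2: "x i = 0" if "i \<ge> 2" for i
    proof -
      have "f n i = 0" for n using f[of n] that by (simp add: L_def)
      with lim[of i] show ?thesis by (simp add: LIMSEQ_const_iff)
    qed
    have 3: "x 0 = 0" if P
    proof -
      have "f n 0 = 0" for n using f[of n] that by (simp add: L_def)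
      with lim[of 0] show ?thesis by (simp add: LIMSEQ_const_iff)
    qed
    show ?thesis using 1 2 3 by (simp add: L_def)
  qed
  have Lsupp: "x i = 0" if "x \<in> L P" "i \<ge> 2" for x i P using that by (simp add: L_def)
  show ?thesis
  proof (cases "\<forall>e>0. \<exists>x\<in>L True. (\<exists>i<2. x i \<noteq> 0) \<and> (\<forall>i<2. \<bar>x i\<bar> < e)")
    case True
    obtain w where w: "\<exists>i<2. w i \<noteq> 0" "\<And>t. (\<lambda>i. t * w i) \<in> L True"
      by (rule closed_subgroup_line[of "L True" 2]) (use Lsub Lcl Lsupp True in blast)+
    have w0: "w 0 = 0" using w(2)[of 1] by (simp add: L_def)
    then have w1: "w 1 \<noteq> 0" using w(1) by (auto simp: less_2_cases_iff)
    have vert: "(0, z) \<in> \<Gamma>" if "cmod z = 1" for z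
    proof -
      have "(0, cis (Arg z / w 1 * w 1)) \<in> \<Gamma>" using w(2)[of "Arg z / w 1"] w0 by (simp add: L_def)
      moreover have "z \<noteq> 0" using that by auto
      ultimately show ?thesis using w1 cis_Arg[of z] that by (simp add: sgn_div_norm)
    qed
    show ?thesis
    proof (rule that[of 0])
      fix t
      obtain z where z: "(t, z) \<in> \<Gamma>" using onto by blast
      then have z1: "cmod z = 1" by (rule circ)
      then have "z \<noteq> 0" by auto
      then show "(t, cis (0 * t)) \<in> \<Gamma>" using diff[OF z vert[OF z1]] by simp
    qed
  next
    case False
    then obtain e0 where e0: "e0 > 0" "\<And>x. x \<in> L True \<Longrightarrow> (\<exists>i<2. x i \<noteq> 0) \<Longrightarrow> \<not> (\<forall>i<2. \<bar>x i\<bar> < e0)" by blast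
    have "\<forall>t. \<exists>z. (t, z) \<in> \<Gamma>" using onto by blast
    from choice[OF this] obtain zz where zz: "\<And>t. (t, zz t) \<in> \<Gamma>" by blast
    \<comment> \<open>Circle values over times tending to 0 have a convergent subsequence. Quotients
      of successive terms then give elements of \<open>\<Gamma>\<close> near the identity whose
      times are nonzero.\<close>
    define z where "z n = zz (inverse (real (Suc n)))" for n
    have z: "(inverse (real (Suc n)), z n) \<in> \<Gamma>" for n unfolding z_def by (rule zz)
    have zn: "cmod (z n) = 1" for n using circ[OF z] .
    have "bounded (range z)" unfolding bounded_iff using zn by auto
    then obtain l q where q: "strict_mono (q :: nat \<Rightarrow> nat)" "(z \<circ> q) \<longlonglongrightarrow> l"
      using bounded_imp_convergent_subsequence by blast
    have "(\<lambda>n. cmod (z (q n))) \<longlonglongrightarrow> cmod l" using tendsto_norm[OF q(2)] by (simp add: o_def)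
    then have l: "cmod l = 1" by (simp add: zn LIMSEQ_const_iff)
    then have l0: "l \<noteq> 0" by auto
    define v where "v n = z (q n) / z (q (Suc n))" for n
    have "(\<lambda>n. z (q n)) \<longlonglongrightarrow> l" "(\<lambda>n. z (q (Suc n))) \<longlonglongrightarrow> l"
      using q(2) LIMSEQ_Suc[OF q(2)] by (auto simp: o_def)
    then have "v \<longlonglongrightarrow> l / l" unfolding v_def[abs_def] using l0 by (intro tendsto_divide) auto
    then have "v \<longlonglongrightarrow> 1" using l0 by simp
    moreover have "isCont Arg 1" by (intro continuous_at_Arg) auto
    ultimately have "(\<lambda>n. Arg (v n)) \<longlonglongrightarrow> Arg 1" by (rule isCont_tendsto_compose[rotated])
    then have argl: "(\<lambda>n. Arg (v n)) \<longlonglongrightarrow> 0" by simp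
    define s where "s n = inverse (real (Suc (q n))) - inverse (real (Suc (q (Suc n))))" for n
    have sl: "s \<longlonglongrightarrow> 0 - 0"
      unfolding s_def[abs_def]
      using LIMSEQ_subseq_LIMSEQ[OF LIMSEQ_inverse_real_of_nat q(1)] 
      by (intro tendsto_diff LIMSEQ_Suc[of "\<lambda>n. inverse (real (Suc (q n)))"]) (simp_all add: o_def)
    have sn: "s n \<noteq> 0" for n
    proof -
      have "q n < q (Suc n)" using q(1) by (simp add: strict_mono_def)
      then show ?thesis by (simp add: s_def)
    qed
    have sv: "(s n, v n) \<in> \<Gamma>" for n unfolding s_def v_def by (rule diff[OF z z])
    have nd: "\<exists>x\<in>L False. (\<exists>i<2. x i \<noteq> 0) \<and> (\<forall>i<2. \<bar>x i\<bar> < e)" if e: "e > 0" for e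
    proof -
      have 1: "eventually (\<lambda>n. \<bar>s n\<bar> < e) sequentially" "eventually (\<lambda>n. \<bar>Arg (v n)\<bar> < e) sequentially"
        using tendstoD[OF sl, of e] tendstoD[OF argl, of e] e by (simp_all add: dist_norm)
      obtain n where n: "\<bar>s n\<bar> < e" "\<bar>Arg (v n)\<bar> < e"
        using eventually_happens'[OF sequentially_bot eventually_conj[OF 1]] by auto
      have v1: "cmod (v n) = 1" by (rule circ[OF sv])
      then have "v n \<noteq> 0" by auto
      then have "cis (Arg (v n)) = v n" using cis_Arg[of "v n"] v1 by (simp add: sgn_div_norm)
      then have "(\<lambda>i. if i = 0 then s n else if i = 1 then Arg (v n) else 0) \<in> L False"
        using sv[of n] by (simp add: L_def)
      then show ?thesis
        by (rule bexI[rotated]) (use n sn[of n] e in \<open>auto simp: less_2_cases_iff intro!: exI[of _ "0::nat"]\<close>)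
    qed
    obtain w where w: "\<exists>i<2. w i \<noteq> 0" "\<And>t. (\<lambda>i. t * w i) \<in> L False"
      by (rule closed_subgroup_line[of "L False" 2]) (use Lsub Lcl Lsupp nd in blast)+
    \<comment> \<open>A vertical line would contain a vertical vector of length
      \<open>e0 / 2\<close>, against the choice of \<open>e0\<close>.\<close>
    have w0: "w 0 \<noteq> 0"
    proof
      assume w0: "w 0 = 0"
      then have w1: "w 1 \<noteq> 0" using w(1) by (auto simp: less_2_cases_iff)
      define x where "x i = (e0 / 2 / \<bar>w 1\<bar>) * w i" for i :: nat
      have "x \<in> L True" using w(2)[of "e0 / 2 / \<bar>w 1\<bar>"] w0 by (simp add: L_def x_def[abs_def])
      moreover have "x 1 \<noteq> 0" using w1 e0(1) by (simp add: x_def)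
      moreover have "\<forall>i<2. \<bar>x i\<bar> < e0" using w0 w1 e0(1) by (auto simp: x_def less_2_cases_iff abs_mult)
      ultimately show False using e0(2)[of x] by (metis one_less_numeral_iff semiring_norm(76))
    qed
    show ?thesis
    proof (rule that[of "w 1 / w 0"])
      fix t
      show "(t, cis (w 1 / w 0 * t)) \<in> \<Gamma>" using w(2)[of "t / w 0"] w0 by (simp add: L_def mult.commute)
    qed
  qed
qed

section \<open>Lifting one-parameter subgroups\<close>

locale hausdorff_ab_group = abelian_group G for G :: "('a, 'm) ring_scheme" (structure) +
  fixes T :: "'a topology"
  assumes topspace_T: "topspace T = carrier G"
    and hausdorff_T: "Hausdorff_space T"
    and add_cont: "continuous_map (prod_topology T T) T (\<lambda>(x, y). x \<oplus> y)"
    and neg_cont: "continuous_map T T (\<lambda>x. \<ominus> x)"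
begin

lemma add_cont': 
  assumes "continuous_map Y T f" "continuous_map Y T g"
  shows "continuous_map Y T (\<lambda>x. f x \<oplus> g x)"
proof -
  have "continuous_map Y (prod_topology T T) (\<lambda>x. (f x, g x))"
    using assms by (simp add: continuous_map_paired)
  from continuous_map_compose[OF this add_cont] show ?thesis by (simp add: o_def)
qed

lemma neg_cont': "continuous_map Y T f \<Longrightarrow> continuous_map Y T (\<lambda>x. \<ominus> f x)"
  using continuous_map_compose[OF _ neg_cont] by (auto simp: o_def)

lemma minus_cont': "continuous_map Y T f \<Longrightarrow> continuous_map Y T g \<Longrightarrow> continuous_map Y T (\<lambda>x. f x \<ominus> g x)"
  unfolding a_minus_def by (intro add_cont' neg_cont')

definition subgp :: "'a set \<Rightarrow> bool" where
  "subgp S \<longleftrightarrow> S \<subseteq> carrier G \<and> \<zero> \<in> S \<and> (\<forall>x\<in>S. \<forall>y\<in>S. x \<ominus> y \<in> S)"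

lemma subgpD:
  assumes "subgp S"
  shows "S \<subseteq> carrier G" "\<zero> \<in> S" "\<And>x y. x \<in> S \<Longrightarrow> y \<in> S \<Longrightarrow> x \<ominus> y \<in> S"
    "\<And>x. x \<in> S \<Longrightarrow> \<ominus> x \<in> S" "\<And>x y. x \<in> S \<Longrightarrow> y \<in> S \<Longrightarrow> x \<oplus> y \<in> S"
proof -
  show 1: "S \<subseteq> carrier G" "\<zero> \<in> S" "\<And>x y. x \<in> S \<Longrightarrow> y \<in> S \<Longrightarrow> x \<ominus> y \<in> S"
    using assms by (auto simp: subgp_def)
  show 2: "\<ominus> x \<in> S" if "x \<in> S" for x
  proof -
    have "x \<in> carrier G" using that 1 by auto
    then have "\<zero> \<ominus> x = \<ominus> x" by (simp add: a_minus_def)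
    with 1(3)[OF 1(2) that] show ?thesis by simp
  qed
  show "x \<oplus> y \<in> S" if "x \<in> S" "y \<in> S" for x y
  proof -
    have "x \<in> carrier G" "y \<in> carrier G" using that 1 by auto
    then have "x \<ominus> (\<ominus> y) = x \<oplus> y" by (simp add: a_minus_def)
    with 1(3)[OF that(1) 2[OF that(2)]] show ?thesis by simp
  qed
qed

lemma chain_least:
  assumes "finite F" "F \<noteq> {}" "\<And>S S'. S \<in> F \<Longrightarrow> S' \<in> F \<Longrightarrow> S \<subseteq> S' \<or> S' \<subseteq> S"
  shows "\<exists>S\<in>F. \<forall>S'\<in>F. S \<subseteq> (S'::'b set)"
  using assms
proof (induction F rule: finite_ne_induct)
  case (insert S F)
  have "\<exists>S\<in>F. \<forall>S'\<in>F. S \<subseteq> S'" by (rule insert.IH) (rule insert.prems, simp_all)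
  then obtain S0 where S0: "S0 \<in> F" "\<And>S'. S' \<in> F \<Longrightarrow> S0 \<subseteq> S'" by blast
  have "S \<subseteq> S0 \<or> S0 \<subseteq> S" using insert.prems[of S S0] S0(1) by simp
  then show ?case
  proof
    assume "S \<subseteq> S0"
    then show ?case using S0(2) by (intro bexI[of _ S]) auto
  next
    assume "S0 \<subseteq> S"
    then show ?case using S0 by (intro bexI[of _ S0]) auto
  qed
qed auto

text \<open>Zorn's lemma gives a minimal closed subgroup \<open>S\<close> that still maps onto the reals; a character
  that is nontrivial on \<open>S \<inter> ker \<tau>\<close> would cut out a smaller one, so \<open>\<tau>\<close> is bijective on \<open>S\<close>.\<close>

theorem one_parameter_lift:
  fixes \<tau> :: "'a \<Rightarrow> real" and h :: "'a \<Rightarrow> 'c" and Gc :: "('c, 'm2) ring_scheme"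
  assumes A: "subgp A" "closedin T A"
    and \<tau>: "continuous_map (subtopology T A) euclidean \<tau>" "\<And>x y. x \<in> A \<Longrightarrow> y \<in> A \<Longrightarrow> \<tau> (x \<ominus> y) = \<tau> x - \<tau> y"
    and onto: "\<And>t. \<exists>x\<in>A. \<tau> x = t"
    and proper: "\<And>r. compactin T {x \<in> A. \<bar>\<tau> x\<bar> \<le> r}"
    and Gc: "compact_ab_group Gc Tc" "Hausdorff_space Tc"
    and h: "continuous_map (subtopology T A) Tc h" "\<And>x y. x \<in> A \<Longrightarrow> y \<in> A \<Longrightarrow> h (x \<oplus> y) = h x \<oplus>\<^bsub>Gc\<^esub> h y"
    and inj: "\<And>x. x \<in> A \<Longrightarrow> \<tau> x = 0 \<Longrightarrow> h x = \<zero>\<^bsub>Gc\<^esub> \<Longrightarrow> x = \<zero>"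
  obtains \<gamma> where "continuous_map euclidean T \<gamma>" "\<And>t. \<gamma> t \<in> A" "\<And>t. \<tau> (\<gamma> t) = t"
    "\<And>s t. \<gamma> (s + t) = \<gamma> s \<oplus> \<gamma> t"
proof -
  interpret C: compact_ab_group Gc Tc by (rule Gc)
  define \<S> where "\<S> = {S. S \<subseteq> A \<and> subgp S \<and> closedin T S \<and> (\<forall>t. \<exists>x\<in>S. \<tau> x = t)}"
  have AS: "A \<in> \<S>" using A onto by (auto simp: \<S>_def)
  have cl_sub: "closedin T {x \<in> A. p (\<tau> x)}" if "closed {t. p t}" for p
  proof -
    have "closedin (subtopology T A) {x \<in> topspace (subtopology T A). \<tau> x \<in> {t. p t}}"
      by (rule closedin_continuous_map_preimage[OF \<tau>(1)]) (use that in simp)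
    moreover have "topspace (subtopology T A) = A" using closedin_subset[OF A(2)] by auto
    ultimately have "closedin (subtopology T A) {x \<in> A. p (\<tau> x)}" by (simp only: mem_Collect_eq)
    then show ?thesis using closedin_trans_full[OF _ A(2)] by blast
  qed
  have chain: "\<exists>u\<in>\<S>. \<forall>a\<in>\<C>. u \<subseteq> a" if \<C>: "\<C> \<in> Chains (relation_of (\<lambda>x y. y \<subseteq> x) \<S>)" for \<C>
  proof (cases "\<C> = {}")
    case True then show ?thesis using AS by blast
  next
    case False
    have C1: "\<C> \<subseteq> \<S>" and C2: "\<And>S S'. S \<in> \<C> \<Longrightarrow> S' \<in> \<C> \<Longrightarrow> S \<subseteq> S' \<or> S' \<subseteq> S"
      using \<C> by (auto simp: Chains_def relation_of_def)
    define U where "U = \<Inter>\<C>"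
    have U1: "U \<subseteq> A" using False C1 by (auto simp: U_def \<S>_def)
    have U2: "subgp U" unfolding subgp_def
    proof (intro conjI ballI)
      show "U \<subseteq> carrier G" using U1 A by (auto simp: subgp_def)
      show "\<zero> \<in> U" using C1 by (auto simp: U_def \<S>_def subgp_def)
      show "x \<ominus> y \<in> U" if "x \<in> U" "y \<in> U" for x y
        using that C1 subgpD(3) unfolding U_def \<S>_def by blast
    qed
    have U3: "closedin T U" unfolding U_def using False C1 by (auto simp: \<S>_def)
    \<comment> \<open>The fibres over \<open>t\<close> are nested closed subsets of the compact slab
      \<open>K\<close>, so the intersection of the chain still meets the fibre.\<close>
    have U4: "\<exists>x\<in>U. \<tau> x = t" for t
    proof -
      define K where "K = {x \<in> A. \<bar>\<tau> x\<bar> \<le> \<bar>t\<bar>}"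
      define \<D> where "\<D> = (\<lambda>S. S \<inter> {x \<in> A. \<tau> x = t}) ` \<C>"
      have "K \<inter> \<Inter>\<D> \<noteq> {}"
      proof -
        have "\<forall>D\<in>\<D>. closedin T D"
        proof
          fix D assume "D \<in> \<D>"
          then obtain S where S: "S \<in> \<C>" "D = S \<inter> {x \<in> A. \<tau> x = t}" by (auto simp: \<D>_def)
          have "closedin T S" using S C1 by (auto simp: \<S>_def)
          moreover have "closedin T {x \<in> A. \<tau> x = t}" by (rule cl_sub) simp
          ultimately show "closedin T D" unfolding S(2) by (rule closedin_Int)
        qed
        moreover have "\<forall>\<F>. finite \<F> \<and> \<F> \<subseteq> \<D> \<longrightarrow> K \<inter> \<Inter>\<F> \<noteq> {}"
        proof (intro allI impI)
          fix \<F> assume F: "finite \<F> \<and> \<F> \<subseteq> \<D>"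
          then obtain \<F>' where F': "finite \<F>'" "\<F>' \<subseteq> \<C>" "\<F> = (\<lambda>S. S \<inter> {x \<in> A. \<tau> x = t}) ` \<F>'"
            unfolding \<D>_def by (meson finite_subset_image)
          show "K \<inter> \<Inter>\<F> \<noteq> {}"
          proof (cases "\<F>' = {}")
            case True
            obtain x where "x \<in> A" "\<tau> x = t" using onto by blast
            then show ?thesis using True F' by (auto simp: K_def)
          next
            case ne: False
            have "\<exists>S\<in>\<F>'. \<forall>S'\<in>\<F>'. S \<subseteq> S'"
              by (rule chain_least[OF F'(1) ne]) (rule C2, (use F'(2) in auto))
            then obtain S where S: "S \<in> \<F>'" "\<And>S'. S' \<in> \<F>' \<Longrightarrow> S \<subseteq> S'" by blast
            have "S \<in> \<S>" using S(1) F'(2) C1 by blast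
            then have "\<exists>x\<in>S. \<tau> x = t" "S \<subseteq> A" by (simp_all add: \<S>_def)
            then obtain x where x: "x \<in> S" "\<tau> x = t" "x \<in> A" by blast
            then have "x \<in> K \<inter> \<Inter>\<F>" using S(2) F'(3) by (auto simp: K_def)
            then show ?thesis by blast
          qed
        qed
        ultimately have fip: "(\<forall>D\<in>\<D>. closedin T D) \<and> (\<forall>\<F>. finite \<F> \<and> \<F> \<subseteq> \<D> \<longrightarrow> K \<inter> \<Inter>\<F> \<noteq> {})"
          by (rule conjI)
        have Kc: "compactin T K" unfolding K_def by (rule proper)
        show ?thesis by (rule mp[OF spec[OF conjunct2[OF iffD1[OF compactin_fip Kc]]] fip])
      qed
      then obtain x where "x \<in> K" "x \<in> \<Inter>\<D>" by blast
      then have "x \<in> U" "\<tau> x = t" using False by (auto simp: \<D>_def U_def)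
      then show ?thesis by blast
    qed
    have "U \<in> \<S>" using U1 U2 U3 U4 by (simp add: \<S>_def)
    then show ?thesis by (rule bexI[rotated]) (auto simp: U_def)
  qed
  have po: "partial_order_on \<S> (relation_of (\<lambda>x y. y \<subseteq> x) \<S>)"
    by (rule partial_order_on_relation_ofI) auto
  obtain S where S: "S \<in> \<S>" "\<And>R. R \<in> \<S> \<Longrightarrow> R \<subseteq> S \<Longrightarrow> R = S"
    using predicate_Zorn[OF po chain] by blast
  have SA: "S \<subseteq> A" and Sg: "subgp S" and Scl: "closedin T S" and Son: "\<And>t. \<exists>x\<in>S. \<tau> x = t"
    using S(1) by (auto simp: \<S>_def)
  have Scompact: "compactin T {x \<in> S \<inter> U. \<bar>\<tau> x\<bar> \<le> r}" if "closedin T U" for r U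
  proof (rule closed_compactin[OF proper[of r]])
    show "{x \<in> S \<inter> U. \<bar>\<tau> x\<bar> \<le> r} \<subseteq> {x \<in> A. \<bar>\<tau> x\<bar> \<le> r}" using SA by auto
    have "closedin T {x \<in> A. \<bar>\<tau> x\<bar> \<le> r}" by (rule cl_sub) (intro closed_Collect_le continuous_intros)
    then have "closedin T (S \<inter> U \<inter> {x \<in> A. \<bar>\<tau> x\<bar> \<le> r})" using Scl that by (intro closedin_Int)
    moreover have "S \<inter> U \<inter> {x \<in> A. \<bar>\<tau> x\<bar> \<le> r} = {x \<in> S \<inter> U. \<bar>\<tau> x\<bar> \<le> r}" using SA by auto
    ultimately show "closedin T {x \<in> S \<inter> U. \<bar>\<tau> x\<bar> \<le> r}" by simp
  qed
  have topA: "topspace (subtopology T A) = A" using closedin_subset[OF A(2)] by auto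
  have hC: "h x \<in> carrier Gc" if "x \<in> A" for x
    using continuous_map_funspace[OF h(1)] that topA by (auto simp: C.topspace_T)
  have hdiff: "h (x \<ominus> y) \<oplus>\<^bsub>Gc\<^esub> h y = h x" if "x \<in> A" "y \<in> A" for x y
  proof -
    have xy: "x \<in> carrier G" "y \<in> carrier G" using that A(1) by (auto simp: subgp_def)
    have "x \<ominus> y \<oplus> y = x" using xy by (simp add: a_minus_def a_assoc l_neg)
    then show ?thesis using h(2)[OF subgpD(3)[OF A(1) that] that(2)] by simp
  qed
  have kerS: "x = \<zero>" if x: "x \<in> S" "\<tau> x = 0" for x
  proof (rule ccontr)
    assume nz: "x \<noteq> \<zero>"
    then have hx: "h x \<noteq> \<zero>\<^bsub>Gc\<^esub>" using inj x SA by blast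
    have "h x \<in> carrier Gc" using hC x SA by blast
    \<comment> \<open>The character is taken on \<open>Gc\<close> and pulled back along
      \<open>h\<close>, so it is multiplicative on all of \<open>A\<close>. A character of the
      kernel of \<open>\<tau>\<close> alone would first have to be extended.\<close>
    from C.characters_separate[OF Gc(2) this hx] obtain \<phi> where \<phi>: "C.character \<phi>" "\<phi> (h x) \<noteq> 1" by blast
    have \<phi>m: "\<phi> (u \<oplus>\<^bsub>Gc\<^esub> v) = \<phi> u * \<phi> v" if "u \<in> carrier Gc" "v \<in> carrier Gc" for u v
      using \<phi>(1) that by (simp add: C.character_def)
    have \<phi>1: "cmod (\<phi> u) = 1" if "u \<in> carrier Gc" for u
      using \<phi>(1) that by (simp add: C.character_def)
    define q where "q y = \<phi> (h y)" for y
    have qc: "continuous_map (subtopology T A) euclidean q"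
      using continuous_map_compose[OF h(1), of euclidean \<phi>] \<phi>(1) by (simp add: q_def[abs_def] o_def C.character_def)
    have q1: "cmod (q y) = 1" if "y \<in> A" for y using \<phi>1 hC that by (simp add: q_def)
    have qd: "q (y \<ominus> z) = q y / q z" if "y \<in> A" "z \<in> A" for y z
    proof -
      have "q (y \<ominus> z) * q z = q y" unfolding q_def
        by (subst \<phi>m[symmetric]) (use hdiff hC that subgpD(3)[OF A(1)] in auto)
      moreover have "q z \<noteq> 0" using q1[OF that(2)] by auto
      ultimately show ?thesis by (simp add: field_simps)
    qed
    define \<Gamma> where "\<Gamma> = (\<lambda>y. (\<tau> y, q y)) ` S"
    \<comment> \<open>Convergent times are bounded, and the part of \<open>S\<close> over a bounded
      interval is compact, so the limit is attained.\<close>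
    have "closed \<Gamma>"
    proof (rule closed_sequential_limits[THEN iffD2], intro allI impI, elim conjE)
      fix f l assume f: "\<forall>n. f n \<in> \<Gamma>" "f \<longlonglongrightarrow> l"
      then have "(\<lambda>n. fst (f n)) \<longlonglongrightarrow> fst l" by (intro tendsto_fst)
      then have "bounded (range (\<lambda>n. fst (f n)))" using convergent_imp_bounded by blast
      then obtain r where r: "\<And>n. \<bar>fst (f n)\<bar> \<le> r" unfolding bounded_iff by auto
      define K where "K = {x \<in> S \<inter> topspace T. \<bar>\<tau> x\<bar> \<le> r}"
      have "compactin T K" unfolding K_def by (rule Scompact) simp
      then have "compactin (subtopology T A) K" using SA by (auto simp: compactin_subtopology K_def)
      moreover have "continuous_map (subtopology T A) (prod_topology euclidean euclidean) (\<lambda>y. (\<tau> y, q y))"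
        by (rule continuous_map_pairedI[OF \<tau>(1) qc])
      ultimately have "compact ((\<lambda>y. (\<tau> y, q y)) ` K)"
        using image_compactin by (fastforce simp: compactin_euclidean_iff)
      moreover have "f n \<in> (\<lambda>y. (\<tau> y, q y)) ` K" for n
        using f(1)[rule_format, of n] r[of n] closedin_subset[OF Scl] by (auto simp: \<Gamma>_def K_def)
      ultimately have "l \<in> (\<lambda>y. (\<tau> y, q y)) ` K" using closed_sequentially[OF compact_imp_closed] f(2) by blast
      then show "l \<in> \<Gamma>" by (auto simp: \<Gamma>_def K_def)
    qed
    moreover have "(s - t, z / w) \<in> \<Gamma>" if st: "(s, z) \<in> \<Gamma>" "(t, w) \<in> \<Gamma>" for s t z w
    proof -
      obtain y y' where "y \<in> S" "y' \<in> S" "s = \<tau> y" "z = q y" "t = \<tau> y'" "w = q y'" using st by (auto simp: \<Gamma>_def)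
      moreover from this SA have "y \<in> A" "y' \<in> A" by auto
      ultimately have "(s - t, z / w) = (\<tau> (y \<ominus> y'), q (y \<ominus> y'))" "y \<ominus> y' \<in> S"
        using subgpD(3)[OF Sg, of y y'] by (simp_all add: qd \<tau>(2))
      then show ?thesis unfolding \<Gamma>_def by (rule image_eqI)
    qed
    moreover have "cmod z = 1" if "(t, z) \<in> \<Gamma>" for t z using that q1 SA by (auto simp: \<Gamma>_def)
    moreover have "\<exists>z. (t, z) \<in> \<Gamma>" for t using Son[of t] by (auto simp: \<Gamma>_def)
    ultimately obtain a where a: "\<And>t. (t, cis (a * t)) \<in> \<Gamma>"
      using closed_subgroup_real_circle[of \<Gamma>] by blast
    \<comment> \<open>\<open>E\<close> still maps onto the reals, so minimality gives
      \<open>E = S\<close>; on elements with \<open>\<tau>\<close> equal to 0 this forces the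
      character to be 1.\<close>
    define E where "E = {y \<in> S. q y = cis (a * \<tau> y)}"
    have "E \<in> \<S>"
      unfolding \<S>_def mem_Collect_eq
    proof (intro conjI allI)
      show "E \<subseteq> A" using SA by (auto simp: E_def)
      have z: "\<zero> \<in> S" "\<zero> \<in> A" using subgpD Sg A by auto
      have z0: "\<zero> \<ominus> \<zero> = \<zero>" by (simp add: a_minus_def r_neg)
      have "\<tau> \<zero> = 0" using \<tau>(2)[OF z(2) z(2)] z0 by simp
      moreover have "q \<zero> = 1" using qd[OF z(2) z(2)] z0 q1[OF z(2)] by (metis divide_self_if norm_zero zero_neq_one)
      ultimately have "\<zero> \<in> E" using z by (simp add: E_def)
      moreover have "y \<ominus> y' \<in> E" if "y \<in> E" "y' \<in> E" for y y'
      proof -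
        have "y \<in> S" "y' \<in> S" "y \<in> A" "y' \<in> A" using that SA by (auto simp: E_def)
        then show ?thesis using that subgpD(3)[OF Sg, of y y']
          by (simp add: E_def qd \<tau>(2) cis_divide right_diff_distrib)
      qed
      ultimately show "subgp E" using subgpD(1)[OF Sg] by (auto simp: subgp_def E_def)
      have "continuous_map (subtopology T A) euclidean (\<lambda>y. q y - cis (a * \<tau> y))"
      proof (rule continuous_map_lift2[OF qc \<tau>(1)])
        show "continuous_on UNIV (\<lambda>p::complex \<times> real. fst p - cis (a * snd p))"
          unfolding cis_conv_exp by (intro continuous_intros)
      qed
      then have "closedin (subtopology T A) {y \<in> topspace (subtopology T A). q y - cis (a * \<tau> y) \<in> {0}}"
        by (rule closedin_continuous_map_preimage) simp
      then have "closedin T {y \<in> A. q y - cis (a * \<tau> y) \<in> {0}}"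
        unfolding topA using closedin_trans_full[OF _ A(2)] by blast
      then have "closedin T (S \<inter> {y \<in> A. q y - cis (a * \<tau> y) \<in> {0}})" by (rule closedin_Int[OF Scl])
      moreover have "S \<inter> {y \<in> A. q y - cis (a * \<tau> y) \<in> {0}} = E" using SA by (auto simp: E_def)
      ultimately show "closedin T E" by simp
      show "\<exists>x\<in>E. \<tau> x = t" for t using a[of t] by (auto simp: \<Gamma>_def E_def)
    qed
    then have "E = S" by (rule S(2)) (auto simp: E_def)
    with x(1) have "x \<in> E" by simp
    then have "q x = 1" using x(2) by (simp add: E_def)
    with \<phi>(2) show False by (simp add: q_def)
  qed
  have injS: "x = y" if "x \<in> S" "y \<in> S" "\<tau> x = \<tau> y" for x y
  proof -
    have "x \<ominus> y = \<zero>" using kerS[OF subgpD(3)[OF Sg that(1,2)]] \<tau>(2)[of x y] that SA by auto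
    moreover have "x \<in> carrier G" "y \<in> carrier G" using that subgpD(1)[OF Sg] by auto
    moreover from this have "x \<ominus> y \<oplus> y = x" by (simp add: a_minus_def a_assoc l_neg)
    ultimately show ?thesis by simp
  qed
  obtain \<gamma> where \<gamma>: "\<And>t. \<gamma> t \<in> S" "\<And>t. \<tau> (\<gamma> t) = t" using Son by metis
  have \<gamma>u: "\<gamma> (\<tau> y) = y" if "y \<in> S" for y using injS[OF \<gamma>(1) that] \<gamma>(2) by simp
  have \<tau>add: "\<tau> (x \<oplus> y) = \<tau> x + \<tau> y" if "x \<in> S" "y \<in> S" for x y
  proof -
    have xy: "x \<in> carrier G" "y \<in> carrier G" using that subgpD(1)[OF Sg] by auto
    have "x \<oplus> y \<ominus> y = x" using xy by (simp add: a_minus_def a_assoc r_neg)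
    moreover have "x \<oplus> y \<in> A" "y \<in> A" using subgpD(5)[OF Sg that] that SA by auto
    ultimately show ?thesis using \<tau>(2)[of "x \<oplus> y" y] by simp
  qed
  have \<gamma>add: "\<gamma> (s + t) = \<gamma> s \<oplus> \<gamma> t" for s t
    by (rule injS[OF \<gamma>(1) subgpD(5)[OF Sg \<gamma>(1) \<gamma>(1)]]) (simp add: \<tau>add \<gamma>)
  \<comment> \<open>Continuity of the inverse of \<open>\<tau>\<close>: the parts of
    \<open>S\<close> over bounded intervals are compact, so \<open>\<tau>\<close> carries closed
    sets to closed sets.\<close>
  have "closed {t. \<gamma> t \<in> U}" if U: "closedin T U" for U
  proof (rule closed_sequential_limits[THEN iffD2], intro allI impI, elim conjE)
    fix f l assume f: "\<forall>n. f n \<in> {t. \<gamma> t \<in> U}" "f \<longlonglongrightarrow> l"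
    have "bounded (range f)" using f(2) convergent_imp_bounded by blast
    then obtain r where r: "\<And>n. \<bar>f n\<bar> \<le> r" unfolding bounded_iff by auto
    define K where "K = {x \<in> S \<inter> U. \<bar>\<tau> x\<bar> \<le> r}"
    have "compactin T K" unfolding K_def by (rule Scompact[OF U])
    then have "compactin (subtopology T A) K" using SA by (auto simp: compactin_subtopology K_def)
    then have "compact (\<tau> ` K)" using image_compactin[OF _ \<tau>(1)] by (simp add: compactin_euclidean_iff)
    moreover have "f n \<in> \<tau> ` K" for n
    proof (rule image_eqI)
      show "f n = \<tau> (\<gamma> (f n))" by (simp add: \<gamma>)
      show "\<gamma> (f n) \<in> K" using f(1)[rule_format, of n] r[of n] \<gamma> by (simp add: K_def)
    qed
    ultimately have "l \<in> \<tau> ` K" using closed_sequentially[OF compact_imp_closed] f(2) by blast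
    then show "l \<in> {t. \<gamma> t \<in> U}" using \<gamma>u by (auto simp: K_def)
  qed
  then have "continuous_map euclidean T \<gamma>"
    unfolding continuous_map_closedin using \<gamma>(1) subgpD(1)[OF Sg] by (auto simp: topspace_T)
  then show ?thesis using \<gamma> \<gamma>add SA by (intro that[of \<gamma>]) auto
qed

end

section \<open>Linear algebra over a number field\<close>

text \<open>Basis extraction from an arbitrary set \<open>X0\<close> with arbitrary coordinate
  functions: each further coordinate costs at most one extra vector \<open>y\<close>, whose residue
  \<open>\<rho>\<close> serves as pivot. The field is \<open>F\<close> when the discrete part is
  treated and the reals when the lattice part is.\<close>

lemma finite_coordinate_spanning:
  fixes \<phi> :: "'j \<Rightarrow> 'x \<Rightarrow> 'k::field"
  assumes "finite J"
  shows "\<exists>B. finite B \<and> B \<subseteq> X0 \<and> (\<forall>x\<in>X0. \<exists>c. \<forall>j\<in>J. \<phi> j x = (\<Sum>b\<in>B. c b * \<phi> j b))"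
  using assms
proof (induction J rule: finite_induct)
  case empty
  show ?case by (intro exI[of _ "{}"]) auto
next
  case (insert m J)
  then obtain B where B: "finite B" "B \<subseteq> X0" "\<And>x. x \<in> X0 \<Longrightarrow> \<exists>c. \<forall>j\<in>J. \<phi> j x = (\<Sum>b\<in>B. c b * \<phi> j b)"
    by blast
  show ?case
  proof (cases "\<forall>x\<in>X0. \<exists>c. \<forall>j\<in>insert m J. \<phi> j x = (\<Sum>b\<in>B. c b * \<phi> j b)")
    case True
    then show ?thesis using B by blast
  next
    case False
    then obtain y where y: "y \<in> X0" "\<And>c. \<not> (\<forall>j\<in>insert m J. \<phi> j y = (\<Sum>b\<in>B. c b * \<phi> j b))" by blast
    obtain cy where cy: "\<And>j. j \<in> J \<Longrightarrow> \<phi> j y = (\<Sum>b\<in>B. cy b * \<phi> j b)" using B(3)[OF y(1)] by blast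
    define \<rho> where "\<rho> = \<phi> m y - (\<Sum>b\<in>B. cy b * \<phi> m b)"
    have \<rho>: "\<rho> \<noteq> 0" using y(2)[of cy] cy by (auto simp: \<rho>_def)
    have yB: "y \<notin> B"
    proof
      assume yB: "y \<in> B"
      have "\<phi> j y = (\<Sum>b\<in>B. (if b = y then 1 else 0) * \<phi> j b)" for j
      proof -
        have "(\<Sum>b\<in>B. (if b = y then 1 else 0) * \<phi> j b) = (\<Sum>b\<in>B. if b = y then \<phi> j b else 0)"
          by (rule sum.cong) auto
        then show ?thesis using B(1) yB by simp
      qed
      then show False using y(2)[of "\<lambda>b. if b = y then 1 else 0"] by blast
    qed
    have "\<exists>c. \<forall>j\<in>insert m J. \<phi> j x = (\<Sum>b\<in>insert y B. c b * \<phi> j b)" if x: "x \<in> X0" for x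
    proof -
      obtain cx where cx: "\<And>j. j \<in> J \<Longrightarrow> \<phi> j x = (\<Sum>b\<in>B. cx b * \<phi> j b)" using B(3)[OF x] by blast
      define t where "t = (\<phi> m x - (\<Sum>b\<in>B. cx b * \<phi> m b)) / \<rho>"
      define c where "c b = (if b = y then t else cx b - t * cy b)" for b
      have sum: "(\<Sum>b\<in>insert y B. c b * \<phi> j b) = t * (\<phi> j y - (\<Sum>b\<in>B. cy b * \<phi> j b)) + (\<Sum>b\<in>B. cx b * \<phi> j b)" for j
      proof -
        have "(\<Sum>b\<in>B. c b * \<phi> j b) = (\<Sum>b\<in>B. cx b * \<phi> j b - t * (cy b * \<phi> j b))"
          using yB by (intro sum.cong) (auto simp: c_def algebra_simps)
        also have "\<dots> = (\<Sum>b\<in>B. cx b * \<phi> j b) - t * (\<Sum>b\<in>B. cy b * \<phi> j b)"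
          by (simp add: sum_subtractf sum_distrib_left)
        finally show ?thesis using B(1) yB by (simp add: c_def algebra_simps)
      qed
      have "\<phi> m x = (\<Sum>b\<in>insert y B. c b * \<phi> m b)"
        unfolding sum \<rho>_def[symmetric] using \<rho> by (simp add: t_def)
      moreover have "\<phi> j x = (\<Sum>b\<in>insert y B. c b * \<phi> j b)" if "j \<in> J" for j
        unfolding sum using cy[OF that] cx[OF that] by simp
      ultimately show ?thesis by blast
    qed
    then show ?thesis using B y(1) by (intro exI[of _ "insert y B"]) auto
  qed
qed

text \<open>The separability idempotent \<open>\<Sum>e\<in>B. e \<otimes> D e\<close> of a number field over the rationals,
  obtained from a basis \<open>B\<close> and its dual basis \<open>D\<close> for the trace form.\<close>

lemma separability_idempotent:
  assumes "number_field TYPE('f::field_char_0)"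
  obtains B :: "'f::field_char_0 set" and D :: "'f \<Rightarrow> 'f" and M :: "'f \<Rightarrow> 'f \<Rightarrow> 'f \<Rightarrow> rat" where
    "finite B" "(\<Sum>e\<in>B. e * D e) = 1"
    "\<And>\<beta> e. e \<in> B \<Longrightarrow> \<beta> * e = (\<Sum>k\<in>B. of_rat (M \<beta> k e) * k)"
    "\<And>\<beta> k. k \<in> B \<Longrightarrow> D k * \<beta> = (\<Sum>e\<in>B. of_rat (M \<beta> k e) * D e)"
proof -
  let ?s = "\<lambda>(q::rat) (x::'f). of_rat q * x"
  interpret V: vector_space ?s
    by unfold_locales (auto simp: algebra_simps of_rat_add of_rat_mult)
  obtain S :: "'f set" where S: "finite S" "V.span S = UNIV"
    using assms unfolding number_field_def by blast
  obtain B where B: "B \<subseteq> S" "V.independent B" "S \<subseteq> V.span B"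
    using V.maximal_independent_subset by blast
  have fB: "finite B" using B(1) S(1) finite_subset by blast
  have sB: "V.span B = UNIV" using V.span_mono[OF B(3)] S(2) by (simp add: V.span_span top.extremum_unique)
  interpret FV: finite_dimensional_vector_space ?s B
    by unfold_locales (use fB B sB in auto)
  define c where "c x b = V.representation B x b" for x b
  have c_add: "c (x + y) b = c x b + c y b" and c_scale: "c (of_rat q * x) b = q * c x b" for x y b q
    unfolding c_def using V.representation_add[OF B(2), of y x] V.representation_scale[OF B(2), of x q] sB by auto
  have c_zero: "c 0 b = 0" for b unfolding c_def by (simp add: V.representation_zero)
  have c_sum: "c (\<Sum>i\<in>I. of_rat (q i) * f i) b = (\<Sum>i\<in>I. q i * c (f i) b)" for I :: "'f set" and q f b
    by (induction I rule: infinite_finite_induct) (auto simp: c_zero c_add c_scale)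
  have c_basis: "c b b' = (if b = b' then 1 else 0)" if "b \<in> B" for b b'
    unfolding c_def using V.representation_basis[OF B(2) that] by auto
  have expand: "x = (\<Sum>b\<in>B. of_rat (c x b) * b)" for x
    unfolding c_def using V.sum_representation_eq[OF B(2), of x B] sB fB by auto
  \<comment> \<open>The field trace. Its form is nondegenerate because a nonzero \<open>x\<close>
    times its inverse has trace \<open>card B\<close>, which is nonzero in characteristic 0.\<close>
  define tr where "tr x = (\<Sum>b\<in>B. c (x * b) b)" for x
  have tr_add: "tr (x + y) = tr x + tr y" for x y by (simp add: tr_def algebra_simps c_add sum.distrib)
  have tr_scale: "tr (of_rat q * x) = q * tr x" for x q
    by (simp add: tr_def mult.assoc c_scale sum_distrib_left)
  have tr_sum: "tr (\<Sum>i\<in>I. of_rat (q i) * f i) = (\<Sum>i\<in>I. q i * tr (f i))" for I :: "'f set" and q f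
  proof (induction I rule: infinite_finite_induct)
    case (insert i I) then show ?case by (simp add: tr_add tr_scale)
  qed (simp_all add: tr_def c_zero)
  have B0: "B \<noteq> {}"
  proof
    assume "B = {}"
    then have "(UNIV :: 'f set) = {0}" using sB by simp
    then have "(1::'f) \<in> {0}" by blast
    then show False by simp
  qed
  have tr1: "tr 1 \<noteq> 0" unfolding tr_def using B0 fB by (simp add: c_basis)
  \<comment> \<open>Encodes the functional \<open>tr (x * b)\<close> of \<open>b\<close> by its
    values on \<open>B\<close>. Injectivity gives surjectivity by dimension, and the preimages of
    the basis vectors form the dual basis.\<close>
  define \<Phi> where "\<Phi> x = (\<Sum>b\<in>B. of_rat (tr (x * b)) * b)" for x
  have c\<Phi>: "c (\<Phi> x) b = tr (x * b)" if "b \<in> B" for x b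
  proof -
    have "c (\<Phi> x) b = (\<Sum>b'\<in>B. tr (x * b') * c b' b)" unfolding \<Phi>_def c_sum ..
    also have "\<dots> = (\<Sum>b'\<in>B. if b' = b then tr (x * b') else 0)" by (rule sum.cong) (auto simp: c_basis)
    also have "\<dots> = tr (x * b)" using fB that by simp
    finally show ?thesis .
  qed
  have nondeg: "x = 0" if "\<And>b. b \<in> B \<Longrightarrow> tr (x * b) = 0" for x
  proof (rule ccontr)
    assume x: "x \<noteq> 0"
    have "x * inverse x = (\<Sum>b\<in>B. of_rat (c (inverse x) b) * (x * b))"
      using arg_cong[OF expand[of "inverse x"], of "\<lambda>y. x * y"] by (simp add: sum_distrib_left mult_ac)
    then have "tr (x * inverse x) = (\<Sum>b\<in>B. c (inverse x) b * tr (x * b))" by (simp only: tr_sum)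
    then have "tr 1 = (\<Sum>b\<in>B. c (inverse x) b * tr (x * b))" using x by simp
    also have "\<dots> = 0" using that by simp
    finally show False using tr1 by simp
  qed
  have lin: "Vector_Spaces.linear ?s ?s \<Phi>"
  proof unfold_locales
    have 1: "tr ((x + y) * b) = tr (x * b) + tr (y * b)" for x y b by (simp only: distrib_right tr_add)
    have 2: "tr (of_rat q * x * b) = q * tr (x * b)" for q x b by (simp only: mult.assoc tr_scale)
    have 3: "of_rat (tr ((x + y) * b)) * b = of_rat (tr (x * b)) * b + of_rat (tr (y * b)) * b" for x y b :: 'f
      unfolding 1 of_rat_add by (rule distrib_right)
    show "\<Phi> (x + y) = \<Phi> x + \<Phi> y" for x y
      unfolding \<Phi>_def 3 by (rule sum.distrib)
    have 4: "of_rat (tr (of_rat q * x * b)) * b = of_rat q * (of_rat (tr (x * b)) * b)" for q and x b :: 'f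
      unfolding 2 of_rat_mult by (rule mult.assoc)
    show "\<Phi> (of_rat q * x) = of_rat q * \<Phi> x" for q x
      unfolding \<Phi>_def 4 by (rule sum_distrib_left[symmetric])
  qed
  have inj: "inj \<Phi>"
  proof (rule injI)
    fix x y assume e: "\<Phi> x = \<Phi> y"
    have "tr ((x - y) * b) = 0" if "b \<in> B" for b
    proof -
      have "tr (x * b) = tr (y * b)" using c\<Phi>[OF that] e by metis
      moreover have "tr (x * b) = tr ((x - y) * b) + tr (y * b)"
        by (subst tr_add[symmetric]) (simp add: algebra_simps)
      ultimately show ?thesis by simp
    qed
    then show "x = y" using nondeg[of "x - y"] by simp
  qed
  have "surj \<Phi>" by (rule FV.linear_inj_imp_surj[OF lin inj])
  then have "\<forall>e. \<exists>x. \<Phi> x = e" by (metis surjD)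
  then obtain D where D: "\<And>e. \<Phi> (D e) = e" by metis
  have trD: "tr (D e * b) = c e b" if "b \<in> B" for e b using c\<Phi>[OF that, of "D e"] D by simp
  have trDy: "tr (D e * y) = c y e" if e: "e \<in> B" for e y
  proof -
    have "D e * y = (\<Sum>b\<in>B. of_rat (c y b) * (D e * b))"
      using arg_cong[OF expand[of y], of "\<lambda>y. D e * y"] by (simp add: sum_distrib_left mult_ac)
    then have "tr (D e * y) = (\<Sum>b\<in>B. c y b * tr (D e * b))" using tr_sum by simp
    also have "\<dots> = (\<Sum>b\<in>B. if b = e then c y b else 0)"
      by (rule sum.cong) (use e in \<open>auto simp: trD c_basis\<close>)
    also have "\<dots> = c y e" using fB e by simp
    finally show ?thesis .
  qed
  \<comment> \<open>The matrix of multiplication by \<open>\<beta>\<close> in the basis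
    \<open>B\<close>; on the dual basis the same matrix acts transposed.\<close>
  define M where "M \<beta> k e = c (\<beta> * e) k" for \<beta> k e
  show ?thesis
  proof (rule that[of B D M])
    show "finite B" by (rule fB)
    show "\<beta> * e = (\<Sum>k\<in>B. of_rat (M \<beta> k e) * k)" for \<beta> e
      unfolding M_def by (rule expand)
    have "(\<Sum>e\<in>B. e * D e) - 1 = 0"
    proof (rule nondeg)
      fix b assume b: "b \<in> B"
      have "tr ((\<Sum>e\<in>B. e * D e) * b) = (\<Sum>e\<in>B. tr (D e * (b * e)))"
        using tr_sum[of "\<lambda>_. 1" "\<lambda>e. D e * (b * e)" B] by (simp add: sum_distrib_left sum_distrib_right mult_ac)
      also have "\<dots> = (\<Sum>e\<in>B. c (b * e) e)" by (rule sum.cong) (auto simp: trDy)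
      also have "\<dots> = tr b" by (simp add: tr_def)
      finally have "tr ((\<Sum>e\<in>B. e * D e) * b) = tr b" .
      moreover have "tr ((\<Sum>e\<in>B. e * D e) * b) = tr (((\<Sum>e\<in>B. e * D e) - 1) * b) + tr b"
        by (subst tr_add[symmetric]) (simp add: algebra_simps)
      ultimately show "tr (((\<Sum>e\<in>B. e * D e) - 1) * b) = 0" by simp
    qed
    then show "(\<Sum>e\<in>B. e * D e) = 1" by simp
    fix \<beta> k assume k: "k \<in> B"
    let ?R = "\<Sum>e\<in>B. of_rat (M \<beta> k e) * D e"
    have "D k * \<beta> - ?R = 0"
    proof (rule nondeg)
      fix b assume b: "b \<in> B"
      have 1: "tr (D k * \<beta> * b) = M \<beta> k b" using trDy[OF k, of "\<beta> * b"] by (simp add: M_def mult.assoc)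
      have "?R * b = (\<Sum>e\<in>B. of_rat (M \<beta> k e) * (D e * b))" by (simp add: sum_distrib_right mult.assoc)
      then have "tr (?R * b) = (\<Sum>e\<in>B. M \<beta> k e * tr (D e * b))" using tr_sum by simp
      also have "\<dots> = (\<Sum>e\<in>B. if e = b then M \<beta> k e else 0)"
        by (rule sum.cong) (use b in \<open>auto simp: trD c_basis\<close>)
      also have "\<dots> = M \<beta> k b" using fB b by simp
      finally have 2: "tr (?R * b) = M \<beta> k b" .
      have "tr (D k * \<beta> * b) = tr ((D k * \<beta> - ?R) * b) + tr (?R * b)"
        by (subst tr_add[symmetric]) (simp add: algebra_simps)
      with 1 2 show "tr ((D k * \<beta> - ?R) * b) = 0" by simp
    qed
    then show "D k * \<beta> = ?R" by simp
  qed
qed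

section \<open>Topological modules over \<open>F\<close> and complements of subspaces\<close>

locale lca =
  fixes G :: "('f::field_char_0, 'a) topmod" (structure)
  assumes lca: "lca_object G"
begin

lemma field_rec_simps [simp]:
  "carrier (field_rec :: 'f ring) = UNIV" "x \<oplus>\<^bsub>(field_rec :: 'f ring)\<^esub> y = x + y" "x \<otimes>\<^bsub>(field_rec :: 'f ring)\<^esub> y = x * y"
  "\<one>\<^bsub>(field_rec :: 'f ring)\<^esub> = 1" "\<zero>\<^bsub>(field_rec :: 'f ring)\<^esub> = 0"
  by (auto simp: ring_of_type_algebra_def)

lemma module_G: "Module.module (field_rec :: 'f ring) G" using lca by (simp add: lca_object_def)

sublocale hausdorff_ab_group G "topo G"
proof -
  interpret M: Module.module "field_rec :: 'f ring" G by (rule module_G)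
  show "hausdorff_ab_group G (topo G)"
    using lca by unfold_locales (auto simp: lca_object_def)
qed

lemma smult_closed [simp, intro]: "x \<in> carrier G \<Longrightarrow> \<alpha> \<odot> x \<in> carrier G"
  using Module.module.smult_closed[OF module_G] by simp

lemma smult_l_distr: "x \<in> carrier G \<Longrightarrow> (\<alpha> + \<beta>) \<odot> x = \<alpha> \<odot> x \<oplus> \<beta> \<odot> x"
  using Module.module.smult_l_distr[OF module_G, of \<alpha> \<beta> x] by simp

lemma smult_r_distr: "x \<in> carrier G \<Longrightarrow> y \<in> carrier G \<Longrightarrow> \<alpha> \<odot> (x \<oplus> y) = \<alpha> \<odot> x \<oplus> \<alpha> \<odot> y"
  using Module.module.smult_r_distr[OF module_G, of \<alpha> x y] by simp

lemma smult_assoc: "x \<in> carrier G \<Longrightarrow> (\<alpha> * \<beta>) \<odot> x = \<alpha> \<odot> (\<beta> \<odot> x)"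
  using Module.module.smult_assoc1[OF module_G, of \<alpha> \<beta> x] by simp

lemma smult_one [simp]: "x \<in> carrier G \<Longrightarrow> 1 \<odot> x = x"
  using Module.module.smult_one[OF module_G, of x] by simp

lemma smult_zero [simp]: "x \<in> carrier G \<Longrightarrow> 0 \<odot> x = \<zero>"
  using Module.module.smult_l_null[OF module_G, of x] by simp

lemma smult_r_null [simp]: "\<alpha> \<odot> \<zero> = \<zero>"
  using Module.module.smult_r_null[OF module_G, of \<alpha>] by simp

lemma smult_neg: "x \<in> carrier G \<Longrightarrow> \<alpha> \<odot> (\<ominus> x) = \<ominus> (\<alpha> \<odot> x)"
  using Module.module.smult_r_minus[OF module_G, of \<alpha> x] by simp

lemma smult_minus1: "x \<in> carrier G \<Longrightarrow> (- 1) \<odot> x = \<ominus> x"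
proof -
  assume x: "x \<in> carrier G"
  have "(-1) \<odot> x \<oplus> x = \<zero>" using smult_l_distr[OF x, of "-1" 1] x by simp
  then show ?thesis using x by (metis minus_equality smult_closed)
qed

lemma smult_cont: "continuous_map (topo G) (topo G) (\<lambda>x. \<alpha> \<odot> x)"
  using lca by (simp add: lca_object_def)

lemma smult_cont': "continuous_map Y (topo G) f \<Longrightarrow> continuous_map Y (topo G) (\<lambda>x. \<alpha> \<odot> f x)"
  using continuous_map_compose[OF _ smult_cont] by (auto simp: o_def)

lemma smult_finsum: "f \<in> A \<rightarrow> carrier G \<Longrightarrow> \<alpha> \<odot> (\<Oplus>i\<in>A. f i) = (\<Oplus>i\<in>A. \<alpha> \<odot> f i)"
proof (induction A rule: infinite_finite_induct)
  case (insert a A)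
  then have "f \<in> A \<rightarrow> carrier G" "f a \<in> carrier G" by auto
  then show ?case using insert by (simp add: finsum_insert smult_r_distr Pi_def)
qed (simp_all add: finsum_infinite)

lemma sum_smult: "x \<in> carrier G \<Longrightarrow> (\<Sum>i\<in>A. c i) \<odot> x = (\<Oplus>i\<in>A. c i \<odot> x)"
proof (induction A rule: infinite_finite_induct)
  case (insert a A)
  then show ?case by (simp add: finsum_insert smult_l_distr Pi_def)
qed (simp_all add: finsum_infinite)

lemma finsum_swap:
  assumes "finite A" "finite B" "\<And>a b. a \<in> A \<Longrightarrow> b \<in> B \<Longrightarrow> f a b \<in> carrier G"
  shows "(\<Oplus>a\<in>A. \<Oplus>b\<in>B. f a b) = (\<Oplus>b\<in>B. \<Oplus>a\<in>A. f a b)"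
  using assms(1,3)
proof (induction A rule: finite_induct)
  case empty
  have "(\<Oplus>b\<in>B. \<zero>) = \<zero>" by simp
  then show ?case by simp
next
  case (insert a A)
  have "(\<Oplus>a\<in>insert a A. \<Oplus>b\<in>B. f a b) = (\<Oplus>b\<in>B. f a b) \<oplus> (\<Oplus>a\<in>A. \<Oplus>b\<in>B. f a b)"
    using insert by (subst finsum_insert) (auto intro!: finsum_closed)
  also have "\<dots> = (\<Oplus>b\<in>B. f a b) \<oplus> (\<Oplus>b\<in>B. \<Oplus>a\<in>A. f a b)" using insert by simp
  also have "\<dots> = (\<Oplus>b\<in>B. f a b \<oplus> (\<Oplus>a\<in>A. f a b))"
    using insert by (subst finsum_addf) (auto intro!: finsum_closed)
  also have "\<dots> = (\<Oplus>b\<in>B. \<Oplus>a\<in>insert a A. f a b)"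
    using insert by (intro finsum_cong) (auto simp: simp_implies_def finsum_insert Pi_def intro!: finsum_closed)
  finally show ?case .
qed

definition fsub :: "'a set \<Rightarrow> bool" where
  "fsub S \<longleftrightarrow> subgp S \<and> (\<forall>\<alpha>. \<forall>x\<in>S. \<alpha> \<odot> x \<in> S)"

lemma fsubD:
  assumes "fsub S"
  shows "subgp S" "S \<subseteq> carrier G" "\<zero> \<in> S" "\<And>x y. x \<in> S \<Longrightarrow> y \<in> S \<Longrightarrow> x \<ominus> y \<in> S"
    "\<And>x. x \<in> S \<Longrightarrow> \<ominus> x \<in> S" "\<And>x y. x \<in> S \<Longrightarrow> y \<in> S \<Longrightarrow> x \<oplus> y \<in> S" "\<And>\<alpha> x. x \<in> S \<Longrightarrow> \<alpha> \<odot> x \<in> S"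
proof -
  show s: "subgp S" "\<And>\<alpha> x. x \<in> S \<Longrightarrow> \<alpha> \<odot> x \<in> S" using assms by (auto simp: fsub_def)
qed (use assms subgpD[of S] in \<open>simp_all add: fsub_def\<close>)

lemma fsubI:
  assumes "S \<subseteq> carrier G" "\<zero> \<in> S" "\<And>x y. x \<in> S \<Longrightarrow> y \<in> S \<Longrightarrow> x \<oplus> y \<in> S" "\<And>\<alpha> x. x \<in> S \<Longrightarrow> \<alpha> \<odot> x \<in> S"
  shows "fsub S"
proof -
  have "x \<ominus> y \<in> S" if "x \<in> S" "y \<in> S" for x y
  proof -
    have "(-1) \<odot> y \<in> S" by (rule assms(4)[OF that(2)])
    then have "\<ominus> y \<in> S" using smult_minus1 that(2) assms(1) by auto
    then show ?thesis unfolding a_minus_def by (rule assms(3)[OF that(1)])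
  qed
  then show ?thesis using assms by (auto simp: fsub_def subgp_def)
qed

lemma fsub_finsum: "fsub S \<Longrightarrow> (\<And>i. i \<in> A \<Longrightarrow> f i \<in> S) \<Longrightarrow> (\<Oplus>i\<in>A. f i) \<in> S"
proof (induction A rule: infinite_finite_induct)
  case (insert a A)
  then have "f \<in> A \<rightarrow> carrier G" "f a \<in> carrier G" using fsubD(2) by auto
  then show ?case using insert fsubD(6) by (simp add: finsum_insert)
qed (simp_all add: finsum_infinite fsubD)

lemma fsub_sum: assumes "fsub S" "fsub R" shows "fsub {x \<oplus> y | x y. x \<in> S \<and> y \<in> R}"
proof (rule fsubI)
  note S = fsubD[OF assms(1)] and R = fsubD[OF assms(2)]
  have c: "x \<in> carrier G" if "x \<in> S" for x using S(2) that by auto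
  have c': "x \<in> carrier G" if "x \<in> R" for x using R(2) that by auto
  show "{x \<oplus> y | x y. x \<in> S \<and> y \<in> R} \<subseteq> carrier G" using c c' by auto
  show "\<zero> \<in> {x \<oplus> y | x y. x \<in> S \<and> y \<in> R}" using S(3) R(3) by force
  show "u \<oplus> v \<in> {x \<oplus> y | x y. x \<in> S \<and> y \<in> R}" if uv: "u \<in> {x \<oplus> y | x y. x \<in> S \<and> y \<in> R}" "v \<in> {x \<oplus> y | x y. x \<in> S \<and> y \<in> R}" for u v
  proof -
    obtain x y x' y' where e: "x \<in> S" "y \<in> R" "x' \<in> S" "y' \<in> R" "u = x \<oplus> y" "v = x' \<oplus> y'" using uv by blast
    then have "u \<oplus> v = (x \<oplus> x') \<oplus> (y \<oplus> y')" using c c' by (simp add: a_ac)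
    then show ?thesis using e S(6) R(6) by blast
  qed
  show "\<alpha> \<odot> u \<in> {x \<oplus> y | x y. x \<in> S \<and> y \<in> R}" if uv: "u \<in> {x \<oplus> y | x y. x \<in> S \<and> y \<in> R}" for \<alpha> u
  proof -
    obtain x y where e: "x \<in> S" "y \<in> R" "u = x \<oplus> y" using uv by blast
    then have "\<alpha> \<odot> u = \<alpha> \<odot> x \<oplus> \<alpha> \<odot> y" using c c' by (simp add: smult_r_distr)
    then show ?thesis using e S(7) R(7) by blast
  qed
qed

text \<open>The vectors of \<open>B\<close> are treated one at a time: a vector outside the sum of
  \<open>D\<close> and \<open>H\<close> spans a line that meets this sum in zero, and the line is
  added to \<open>D\<close>. The argument is algebraic; discreteness comes later, from openness of
  \<open>H\<close>.\<close>

lemma complement_step: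
  assumes H: "fsub H" and K: "fsub K" "H \<subseteq> K" and "finite B" "B \<subseteq> K"
  shows "\<exists>D E. fsub D \<and> D \<subseteq> K \<and> finite E \<and> E \<subseteq> D \<and> (\<forall>x\<in>D. \<exists>c. x = (\<Oplus>e\<in>E. c e \<odot> e)) \<and> D \<inter> H = {\<zero>} \<and>
     B \<subseteq> {x \<oplus> y | x y. x \<in> D \<and> y \<in> H}"
  using assms(4,5)
proof (induction B rule: finite_induct)
  case empty
  have "fsub {\<zero>}" by (rule fsubI) auto
  then show ?case using fsubD(3)[OF H] fsubD(3)[OF K(1)] by (intro exI[of _ "{\<zero>}"] exI[of _ "{}"]) auto
next
  case (insert b B)
  then obtain D E where DE: "fsub D" "D \<subseteq> K" "finite E" "E \<subseteq> D" "\<And>x. x \<in> D \<Longrightarrow> \<exists>c. x = (\<Oplus>e\<in>E. c e \<odot> e)" "D \<inter> H = {\<zero>}"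
     "B \<subseteq> {x \<oplus> y | x y. x \<in> D \<and> y \<in> H}" by auto
  let ?S = "{x \<oplus> y | x y. x \<in> D \<and> y \<in> H}"
  have S: "fsub ?S" by (rule fsub_sum[OF DE(1) H])
  have bK: "b \<in> K" and bc: "b \<in> carrier G" using insert.prems fsubD(2)[OF K(1)] by auto
  have Dc: "x \<in> carrier G" if "x \<in> D" for x using that fsubD(2)[OF DE(1)] by auto
  show ?case
  proof (cases "b \<in> ?S")
    case True
    then show ?thesis using DE by (intro exI[of _ D] exI[of _ E]) auto
  next
    case False
    define F where "F = range (\<lambda>\<alpha>. \<alpha> \<odot> b)"
    have F: "fsub F"
      unfolding F_def
    proof (rule fsubI)
      show "\<zero> \<in> range (\<lambda>\<alpha>. \<alpha> \<odot> b)" using bc by (intro range_eqI[of _ _ 0]) simp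
      show "x \<oplus> y \<in> range (\<lambda>\<alpha>. \<alpha> \<odot> b)" if "x \<in> range (\<lambda>\<alpha>. \<alpha> \<odot> b)" "y \<in> range (\<lambda>\<alpha>. \<alpha> \<odot> b)" for x y
        using that bc by (auto simp: smult_l_distr[symmetric])
      show "\<alpha> \<odot> x \<in> range (\<lambda>\<alpha>. \<alpha> \<odot> b)" if "x \<in> range (\<lambda>\<alpha>. \<alpha> \<odot> b)" for \<alpha> x
        using that bc by (auto simp: smult_assoc[symmetric])
    qed (use bc in auto)
    define D' where "D' = {x \<oplus> y | x y. x \<in> D \<and> y \<in> F}"
    have D': "fsub D'" unfolding D'_def by (rule fsub_sum[OF DE(1) F])
    have bF: "b \<in> F" unfolding F_def using bc by (intro range_eqI[of _ _ 1]) simp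
    have DD': "D \<subseteq> D'"
    proof
      fix x assume x: "x \<in> D"
      then have "x = x \<oplus> \<zero>" using Dc by simp
      then show "x \<in> D'" unfolding D'_def using x fsubD(3)[OF F] by blast
    qed
    have bD': "b \<in> D'"
    proof -
      have "b = \<zero> \<oplus> b" using bc by simp
      then show ?thesis unfolding D'_def using bF fsubD(3)[OF DE(1)] by blast
    qed
    have HS: "H \<subseteq> ?S"
    proof
      fix y assume y: "y \<in> H"
      then have "y \<in> carrier G" using fsubD(2)[OF H] by auto
      then have "y = \<zero> \<oplus> y" by simp
      then show "y \<in> ?S" using y fsubD(3)[OF DE(1)] by blast
    qed
    have DS: "D \<subseteq> ?S"
    proof
      fix y assume y: "y \<in> D"
      then have "y = y \<oplus> \<zero>" using Dc by simp
      then show "y \<in> ?S" using y fsubD(3)[OF H] by blast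
    qed
    have bE: "b \<notin> E" using False DE(4) DS by auto
    show ?thesis
    proof (rule exI[of _ D'], rule exI[of _ "insert b E"], intro conjI ballI)
      show "fsub D'" by (rule D')
      show "D' \<subseteq> K" unfolding D'_def F_def using DE(2) bK fsubD(6,7)[OF K(1)] by auto
      show "finite (insert b E)" using DE(3) by simp
      show "insert b E \<subseteq> D'" using bD' DD' DE(4) by auto
      show "\<exists>c. x = (\<Oplus>e\<in>insert b E. c e \<odot> e)" if "x \<in> D'" for x
      proof -
        obtain d \<alpha> where d: "d \<in> D" "x = d \<oplus> \<alpha> \<odot> b" using \<open>x \<in> D'\<close> by (auto simp: D'_def F_def)
        obtain c where c: "d = (\<Oplus>e\<in>E. c e \<odot> e)" using DE(5)[OF d(1)] by blast
        have Ec: "e \<in> carrier G" if "e \<in> E" for e using that DE(4) Dc by auto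
        have "(\<Oplus>e\<in>insert b E. (c(b := \<alpha>)) e \<odot> e) = \<alpha> \<odot> b \<oplus> (\<Oplus>e\<in>E. (c(b := \<alpha>)) e \<odot> e)"
          using bE DE(3) Ec bc by (subst finsum_insert) auto
        also have "(\<Oplus>e\<in>E. (c(b := \<alpha>)) e \<odot> e) = d" unfolding c
          by (rule finsum_cong) (use bE Ec in \<open>auto simp: simp_implies_def\<close>)
        finally have "x = (\<Oplus>e\<in>insert b E. (c(b := \<alpha>)) e \<odot> e)" using d Dc[OF d(1)] bc by (simp add: a_comm)
        then show ?thesis by blast
      qed
      show "D' \<inter> H = {\<zero>}"
      proof (intro subset_antisym subsetI)
        fix x assume x: "x \<in> D' \<inter> H"
        then obtain d \<alpha> where d: "d \<in> D" "x = d \<oplus> \<alpha> \<odot> b" by (auto simp: D'_def F_def)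
        have "\<alpha> = 0"
        proof (rule ccontr)
          assume \<alpha>: "\<alpha> \<noteq> 0"
          have "x \<ominus> d = \<alpha> \<odot> b" using d Dc[OF d(1)] bc by (simp add: a_minus_def a_ac r_neg2)
          moreover have "x \<ominus> d \<in> ?S" using x d HS DS fsubD(4)[OF S] by blast
          ultimately have "inverse \<alpha> \<odot> (\<alpha> \<odot> b) \<in> ?S" using fsubD(7)[OF S] by simp
          moreover have "inverse \<alpha> \<odot> (\<alpha> \<odot> b) = b" using \<alpha> bc by (simp add: smult_assoc[symmetric])
          ultimately show False using False by simp
        qed
        then have "x = d" using d bc Dc by simp
        then show "x \<in> {\<zero>}" using DE(6) x d by auto
      qed (use fsubD(3)[OF D'] fsubD(3)[OF H] in auto)
      have "?S \<subseteq> {x \<oplus> y | x y. x \<in> D' \<and> y \<in> H}" using DD' by blast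
      moreover have "b \<in> {x \<oplus> y | x y. x \<in> D' \<and> y \<in> H}"
      proof -
        have "b = b \<oplus> \<zero>" using bc by simp
        then show ?thesis using bD' fsubD(3)[OF H] by blast
      qed
      ultimately show "insert b B \<subseteq> {x \<oplus> y | x y. x \<in> D' \<and> y \<in> H}" using DE(7) by blast
    qed
  qed
qed

text \<open>The condition \<open>gen\<close> expresses that \<open>B\<close> and \<open>H\<close>
  generate \<open>K\<close>. Phrased through an arbitrary \<open>S\<close>, it can be verified in
  several stages without describing the generated subspace.\<close>

lemma complement_finite:
  assumes H: "fsub H" and K: "fsub K" "H \<subseteq> K" and B: "finite B" "B \<subseteq> K"
    and gen: "\<And>S. fsub S \<Longrightarrow> B \<subseteq> S \<Longrightarrow> H \<subseteq> S \<Longrightarrow> K \<subseteq> S"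
  obtains D E where "fsub D" "D \<subseteq> K" "finite E" "E \<subseteq> D" "\<And>x. x \<in> D \<Longrightarrow> \<exists>c. x = (\<Oplus>e\<in>E. c e \<odot> e)" "D \<inter> H = {\<zero>}"
     "\<And>x. x \<in> K \<Longrightarrow> \<exists>d\<in>D. \<exists>y\<in>H. x = d \<oplus> y"
proof -
  obtain D E where DE: "fsub D" "D \<subseteq> K" "finite E" "E \<subseteq> D" "\<And>x. x \<in> D \<Longrightarrow> \<exists>c. x = (\<Oplus>e\<in>E. c e \<odot> e)" "D \<inter> H = {\<zero>}"
     "B \<subseteq> {x \<oplus> y | x y. x \<in> D \<and> y \<in> H}"
    using complement_step[OF H K B] by auto
  have HS: "H \<subseteq> {x \<oplus> y | x y. x \<in> D \<and> y \<in> H}"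
  proof
    fix y assume y: "y \<in> H"
    then have "y \<in> carrier G" using fsubD(2)[OF H] by auto
    then have "y = \<zero> \<oplus> y" by simp
    then show "y \<in> {x \<oplus> y | x y. x \<in> D \<and> y \<in> H}" using y fsubD(3)[OF DE(1)] by blast
  qed
  have "K \<subseteq> {x \<oplus> y | x y. x \<in> D \<and> y \<in> H}" by (rule gen[OF fsub_sum[OF DE(1) H] DE(7) HS])
  then have "\<exists>d\<in>D. \<exists>y\<in>H. x = d \<oplus> y" if "x \<in> K" for x using that by blast
  with DE(1-6) show ?thesis by (rule that)
qed

end

section \<open>Morphisms, embeddings and averaging over the field\<close>

lemma lca_morphismD:
  assumes "lca_morphism G G' f"
  shows "\<And>x. x \<in> carrier G \<Longrightarrow> f x \<in> carrier G'"
    "\<And>x y. x \<in> carrier G \<Longrightarrow> y \<in> carrier G \<Longrightarrow> f (x \<oplus>\<^bsub>G\<^esub> y) = f x \<oplus>\<^bsub>G'\<^esub> f y"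
    "\<And>\<alpha> x. x \<in> carrier G \<Longrightarrow> f (\<alpha> \<odot>\<^bsub>G\<^esub> x) = \<alpha> \<odot>\<^bsub>G'\<^esub> f x"
    "continuous_map (topo G) (topo G') f"
  using assms by (auto simp: lca_morphism_def hom_def Pi_def)

lemma lca_morphismI:
  assumes "\<And>x. x \<in> carrier G \<Longrightarrow> f x \<in> carrier G'"
    "\<And>x y. x \<in> carrier G \<Longrightarrow> y \<in> carrier G \<Longrightarrow> f (x \<oplus>\<^bsub>G\<^esub> y) = f x \<oplus>\<^bsub>G'\<^esub> f y"
    "\<And>\<alpha> x. x \<in> carrier G \<Longrightarrow> f (\<alpha> \<odot>\<^bsub>G\<^esub> x) = \<alpha> \<odot>\<^bsub>G'\<^esub> f x"
    "continuous_map (topo G) (topo G') f"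
  shows "lca_morphism G G' f"
  using assms by (auto simp: lca_morphism_def hom_def Pi_def)

lemma embedding_simps:
  fixes \<nu> :: "'f::field_char_0 \<Rightarrow> complex"
  assumes "\<nu> \<in> arch_embeddings"
  shows "\<nu> (x + y) = \<nu> x + \<nu> y" "\<nu> (x * y) = \<nu> x * \<nu> y" "\<nu> 1 = 1" "\<nu> 0 = 0" "\<nu> (sum g I) = (\<Sum>i\<in>I. \<nu> (g i))"
    "\<nu> (of_int k) = of_int k" "\<nu> (of_rat q) = of_rat q"
proof -
  show add: "\<nu> (x + y) = \<nu> x + \<nu> y" and mult: "\<nu> (x * y) = \<nu> x * \<nu> y" and one: "\<nu> 1 = 1" for x y
    using assms by (auto simp: arch_embeddings_def ring_hom_def ring_of_type_algebra_def)
  show zero: "\<nu> 0 = 0" using add[of 0 0] by simp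
  show "\<nu> (sum g I) = (\<Sum>i\<in>I. \<nu> (g i))"
    by (induction I rule: infinite_finite_induct) (auto simp: add zero)
  have neg: "\<nu> (- x) = - \<nu> x" for x using add[of x "-x"] zero by (simp add: eq_neg_iff_add_eq_0 add.commute)
  have nat: "\<nu> (of_nat m) = of_nat m" for m by (induction m) (auto simp: zero add one)
  show int: "\<nu> (of_int k) = of_int k" for k by (cases k rule: int_cases2) (auto simp: nat neg)
  show "\<nu> (of_rat q) = of_rat q"
  proof (cases q)
    case (Fract a b)
    then have b: "b \<noteq> 0" and q: "q = of_int a / of_int b" by (simp_all add: Fract_of_int_quotient)
    have "of_rat q * of_int b = (of_int a :: 'f)" using b by (simp add: q of_rat_divide)
    then have "\<nu> (of_rat q) * of_int b = of_int a" using mult[of "of_rat q" "of_int b"] int by metis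
    then show ?thesis using b by (simp add: q of_rat_divide field_simps)
  qed
qed

context lca
begin

lemma finsum_cont:
  assumes "finite B" "\<And>e. e \<in> B \<Longrightarrow> continuous_map Y (topo G) (f e)"
  shows "continuous_map Y (topo G) (\<lambda>x. \<Oplus>e\<in>B. f e x)"
  using assms
proof (induction B rule: finite_induct)
  case empty
  then show ?case by (simp add: topspace_T)
next
  case (insert a B)
  have c: "f e x \<in> carrier G" if "e \<in> insert a B" "x \<in> topspace Y" for e x
    using continuous_map_funspace[OF insert.prems[OF that(1)]] that(2) by (auto simp: topspace_T)
  have "continuous_map Y (topo G) (\<lambda>x. f a x \<oplus> (\<Oplus>e\<in>B. f e x))"
    by (rule add_cont'[OF insert.prems[OF insertI1] insert.IH[OF insert.prems[OF insertI2]]])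
  then show ?case
  proof (rule continuous_map_eq)
    fix x assume x: "x \<in> topspace Y"
    show "f a x \<oplus> (\<Oplus>e\<in>B. f e x) = (\<Oplus>e\<in>insert a B. f e x)"
      using insert.hyps c x by (subst finsum_insert) auto
  qed
qed

text \<open>Averaging with the separability idempotent turns an additive map on \<open>S\<close> into an
  \<open>F\<close>-linear one.\<close>

lemma linearize:
  fixes \<nu> :: "'f \<Rightarrow> complex" and S :: "complex set"
  assumes nf: "number_field TYPE('f)" and \<nu>: "\<nu> \<in> arch_embeddings"
    and Sadd: "\<And>x y. x \<in> S \<Longrightarrow> y \<in> S \<Longrightarrow> x + y \<in> S" and S0: "0 \<in> S"
    and S\<nu>: "\<And>\<alpha> x. x \<in> S \<Longrightarrow> \<nu> \<alpha> * x \<in> S"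
    and K: "fsub K" and sK: "\<And>x. x \<in> S \<Longrightarrow> s x \<in> K"
    and sadd: "\<And>x y. x \<in> S \<Longrightarrow> y \<in> S \<Longrightarrow> s (x + y) = s x \<oplus> s y"
    and scont: "continuous_map (top_of_set S) (topo G) s"
    and P: "\<And>x y. x \<in> K \<Longrightarrow> y \<in> K \<Longrightarrow> P (x \<oplus> y) = P x + P y" "\<And>\<alpha> x. x \<in> K \<Longrightarrow> P (\<alpha> \<odot> x) = \<nu> \<alpha> * P x"
    and Ps: "\<And>x. x \<in> S \<Longrightarrow> P (s x) = x"
  obtains s' where "\<And>x. x \<in> S \<Longrightarrow> s' x \<in> K" "\<And>x y. x \<in> S \<Longrightarrow> y \<in> S \<Longrightarrow> s' (x + y) = s' x \<oplus> s' y"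
    "\<And>\<alpha> x. x \<in> S \<Longrightarrow> s' (\<nu> \<alpha> * x) = \<alpha> \<odot> s' x" "continuous_map (top_of_set S) (topo G) s'"
    "\<And>x. x \<in> S \<Longrightarrow> P (s' x) = x"
proof -
  note \<nu>s = embedding_simps[OF \<nu>]
  note Ks = fsubD[OF K]
  have sc: "s x \<in> carrier G" if "x \<in> S" for x using sK[OF that] Ks(2) by auto
  have Sint: "of_int k * x \<in> S" if "x \<in> S" for k x using S\<nu>[OF that, of "of_int k"] \<nu>s(6) by simp
  have Srat: "of_rat q * x \<in> S" if "x \<in> S" for q x using S\<nu>[OF that, of "of_rat q"] \<nu>s(7) by simp
  have s0: "s 0 = \<zero>"
  proof -
    have "s 0 \<oplus> \<zero> = s 0 \<oplus> s 0" using sadd[OF S0 S0] sc[OF S0] by simp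
    then show ?thesis using sc[OF S0] by simp
  qed
  have snat: "s (of_nat m * x) = of_nat m \<odot> s x" if x: "x \<in> S" for m x
  proof (induction m)
    case (Suc m)
    have "s (of_nat (Suc m) * x) = s (x + of_nat m * x)" by (simp add: algebra_simps)
    also have "\<dots> = s x \<oplus> s (of_nat m * x)" using sadd[OF x Sint[OF x, of "int m"]] by simp
    also have "\<dots> = of_nat (Suc m) \<odot> s x" using Suc smult_l_distr[OF sc[OF x], of 1 "of_nat m"] sc[OF x] by simp
    finally show ?case .
  qed (use s0 sc[OF x] in simp)
  have sneg: "s (- x) = \<ominus> s x" if x: "x \<in> S" for x
  proof -
    have mx: "- x \<in> S" using Sint[OF x, of "-1"] by simp
    have "s (- x) \<oplus> s x = \<zero>" using sadd[OF mx x] s0 by simp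
    then show ?thesis using minus_equality sc[OF x] sc[OF mx] by metis
  qed
  have sint: "s (of_int k * x) = of_int k \<odot> s x" if x: "x \<in> S" for k x
  proof (cases k rule: int_cases2)
    case (nonneg m) then show ?thesis using snat[OF x, of m] by simp
  next
    case (nonpos m)
    have "s (of_int k * x) = s (- (of_nat m * x))" by (simp add: nonpos)
    also have "\<dots> = \<ominus> (of_nat m \<odot> s x)" using sneg[OF Sint[OF x, of "int m"]] snat[OF x, of m] by simp
    also have "\<dots> = (-1) \<odot> (of_nat m \<odot> s x)" using sc[OF x] by (simp add: smult_minus1)
    also have "\<dots> = of_int k \<odot> s x" using sc[OF x] by (simp add: smult_assoc[symmetric] nonpos)
    finally show ?thesis .
  qed
  \<comment> \<open>Integer scalars are invertible on \<open>G\<close>, so additivity already forces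
    rational linearity.\<close>
  have srat: "s (of_rat q * x) = of_rat q \<odot> s x" if x: "x \<in> S" for q x
  proof (cases q)
    case (Fract a b)
    then have b: "b \<noteq> 0" and q: "q = of_int a / of_int b" by (simp_all add: Fract_of_int_quotient)
    have e1: "of_int b * (of_rat q * x) = of_int a * x" using b by (simp add: q of_rat_divide)
    have "of_int b \<odot> s (of_rat q * x) = of_int a \<odot> s x"
      using sint[OF Srat[OF x], of b q] sint[OF x, of a] unfolding e1 by simp
    then have "inverse (of_int b) \<odot> (of_int b \<odot> s (of_rat q * x)) = inverse (of_int b) \<odot> (of_int a \<odot> s x)" by simp
    then have "(inverse (of_int b) * of_int b) \<odot> s (of_rat q * x) = (inverse (of_int b) * of_int a) \<odot> s x"
      using sc[OF x] sc[OF Srat[OF x]] by (simp only: smult_assoc)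
    moreover have "inverse (of_int b) * of_int b = (1::'f)" "inverse (of_int b) * of_int a = (of_rat q :: 'f)"
      using b by (simp_all add: q of_rat_divide field_simps)
    ultimately show ?thesis using sc[OF Srat[OF x]] by simp
  qed
  have Ssum: "(\<Sum>j\<in>J. of_rat (m j) * y j) \<in> S" if "\<And>j. j \<in> J \<Longrightarrow> y j \<in> S" for J :: "'f set" and m y
    using that by (induction J rule: infinite_finite_induct) (auto simp: S0 intro!: Sadd Srat)
  have ssum: "s (\<Sum>j\<in>J. of_rat (m j) * y j) = (\<Oplus>j\<in>J. of_rat (m j) \<odot> s (y j))"
    if "\<And>j. j \<in> J \<Longrightarrow> y j \<in> S" for J :: "'f set" and m y
    using that
  proof (induction J rule: infinite_finite_induct)
    case (insert a J)
    have ay: "y a \<in> S" and Jy: "\<And>j. j \<in> J \<Longrightarrow> y j \<in> S" using insert.prems by auto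
    have "s (\<Sum>j\<in>insert a J. of_rat (m j) * y j) = of_rat (m a) \<odot> s (y a) \<oplus> (\<Oplus>j\<in>J. of_rat (m j) \<odot> s (y j))"
      using insert sadd[OF Srat[OF ay] Ssum[OF Jy]] srat[OF ay] by simp
    also have "\<dots> = (\<Oplus>j\<in>insert a J. of_rat (m j) \<odot> s (y j))"
      using insert.hyps sc ay Jy by (subst finsum_insert) auto
    finally show ?case .
  qed (simp_all add: s0 finsum_infinite)
  obtain B D M where BD: "finite B" "(\<Sum>e\<in>B. e * D e) = (1::'f)"
    "\<And>\<beta> e. e \<in> B \<Longrightarrow> \<beta> * e = (\<Sum>k\<in>B. of_rat (M \<beta> k e) * k)"
    "\<And>\<beta> k. k \<in> B \<Longrightarrow> D k * \<beta> = (\<Sum>e\<in>B. of_rat (M \<beta> k e) * D e)"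
    using separability_idempotent[OF nf] by blast
  \<comment> \<open>The separability idempotent acts with one factor outside and one inside
    \<open>s\<close>. Its centrality gives linearity over \<open>F\<close>, and the relation
    \<open>(\<Sum>e\<in>B. e * D e) = 1\<close> keeps \<open>s'\<close> a section of
    \<open>P\<close>.\<close>
  define s' where "s' x = (\<Oplus>e\<in>B. e \<odot> s (\<nu> (D e) * x))" for x
  have tc: "e \<odot> s (\<nu> (D e) * x) \<in> carrier G" if "x \<in> S" for e x
    using sc[OF S\<nu>[OF that]] by simp
  show ?thesis
  proof (rule that[of s'])
    show "s' x \<in> K" if "x \<in> S" for x
      unfolding s'_def by (rule fsub_finsum[OF K]) (use that Ks(7) sK S\<nu> in blast)
    show "s' (x + y) = s' x \<oplus> s' y" if "x \<in> S" "y \<in> S" for x y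
    proof -
      have "s' (x + y) = (\<Oplus>e\<in>B. e \<odot> s (\<nu> (D e) * x) \<oplus> e \<odot> s (\<nu> (D e) * y))"
        unfolding s'_def
        by (rule finsum_cong) (use that in \<open>auto simp: simp_implies_def distrib_left sadd S\<nu> smult_r_distr sc\<close>)
      also have "\<dots> = s' x \<oplus> s' y" unfolding s'_def by (rule finsum_addf) (use tc that in auto)
      finally show ?thesis .
    qed
    \<comment> \<open>Inside \<open>s\<close>, the scalar \<open>\<beta>\<close> is expanded on the
      dual basis; the rational coefficients pass through \<open>s\<close>, and after the sums are
      exchanged the same matrix expands \<open>\<beta> * e\<close> on the basis.\<close>
    show "s' (\<nu> \<beta> * x) = \<beta> \<odot> s' x" if x: "x \<in> S" for \<beta> x
    proof -
      have cc: "s (\<nu> (D e) * x) \<in> carrier G" for e by (rule sc[OF S\<nu>[OF x]])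
      have "s' (\<nu> \<beta> * x) = (\<Oplus>k\<in>B. \<Oplus>e\<in>B. (k * of_rat (M \<beta> k e)) \<odot> s (\<nu> (D e) * x))"
        unfolding s'_def
      proof (rule finsum_cong'[OF refl])
        show "(\<lambda>k. \<Oplus>e\<in>B. (k * of_rat (M \<beta> k e)) \<odot> s (\<nu> (D e) * x)) \<in> B \<rightarrow> carrier G"
          using cc by (auto intro!: finsum_closed)
        fix k assume k: "k \<in> B"
        have "\<nu> (D k) * (\<nu> \<beta> * x) = \<nu> (D k * \<beta>) * x" by (simp add: \<nu>s)
        also have "\<dots> = (\<Sum>e\<in>B. of_rat (M \<beta> k e) * (\<nu> (D e) * x))"
          unfolding BD(4)[OF k] by (simp add: \<nu>s sum_distrib_right mult.assoc)
        finally have "s (\<nu> (D k) * (\<nu> \<beta> * x)) = (\<Oplus>e\<in>B. of_rat (M \<beta> k e) \<odot> s (\<nu> (D e) * x))"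
          using ssum[of B "\<lambda>e. \<nu> (D e) * x" "M \<beta> k"] S\<nu>[OF x] by simp
        then have "k \<odot> s (\<nu> (D k) * (\<nu> \<beta> * x)) = (\<Oplus>e\<in>B. k \<odot> (of_rat (M \<beta> k e) \<odot> s (\<nu> (D e) * x)))"
          using cc by (simp add: smult_finsum Pi_def)
        then show "k \<odot> s (\<nu> (D k) * (\<nu> \<beta> * x)) = (\<Oplus>e\<in>B. (k * of_rat (M \<beta> k e)) \<odot> s (\<nu> (D e) * x))"
          using cc by (simp add: smult_assoc)
      qed
      also have "\<dots> = (\<Oplus>e\<in>B. \<Oplus>k\<in>B. (k * of_rat (M \<beta> k e)) \<odot> s (\<nu> (D e) * x))"
        by (rule finsum_swap[OF BD(1) BD(1)]) (use cc in auto)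
      also have "\<dots> = (\<Oplus>e\<in>B. \<beta> \<odot> (e \<odot> s (\<nu> (D e) * x)))"
      proof (rule finsum_cong'[OF refl])
        show "(\<lambda>e. \<beta> \<odot> (e \<odot> s (\<nu> (D e) * x))) \<in> B \<rightarrow> carrier G"
          using cc by auto
        fix e assume e: "e \<in> B"
        have "\<beta> \<odot> (e \<odot> s (\<nu> (D e) * x)) = (\<beta> * e) \<odot> s (\<nu> (D e) * x)" using cc by (simp add: smult_assoc)
        also have "\<dots> = (\<Oplus>k\<in>B. (of_rat (M \<beta> k e) * k) \<odot> s (\<nu> (D e) * x))"
          unfolding BD(3)[OF e] by (rule sum_smult[OF cc])
        finally show "(\<Oplus>k\<in>B. (k * of_rat (M \<beta> k e)) \<odot> s (\<nu> (D e) * x)) = \<beta> \<odot> (e \<odot> s (\<nu> (D e) * x))"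
          by (simp add: mult.commute)
      qed
      also have "\<dots> = \<beta> \<odot> s' x" unfolding s'_def by (rule smult_finsum[symmetric]) (use cc in auto)
      finally show ?thesis .
    qed
    show "continuous_map (top_of_set S) (topo G) s'"
      unfolding s'_def[abs_def]
    proof (rule finsum_cont[OF BD(1)])
      fix e assume "e \<in> B"
      have "continuous_map (top_of_set S) (top_of_set S) (\<lambda>x. \<nu> (D e) * x)"
        using S\<nu> by (auto simp: continuous_map_in_subtopology intro!: continuous_intros)
      from continuous_map_compose[OF this scont]
      show "continuous_map (top_of_set S) (topo G) (\<lambda>x. e \<odot> s (\<nu> (D e) * x))"
        by (intro smult_cont') (simp add: o_def)
    qed
    show "P (s' x) = x" if x: "x \<in> S" for x
    proof -
      have mem: "e \<odot> s (\<nu> (D e) * x) \<in> K" for e by (rule Ks(7)[OF sK[OF S\<nu>[OF x]]])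
      have P0: "P \<zero> = 0" using P(1)[OF Ks(3) Ks(3)] by simp
      have "P (\<Oplus>e\<in>A. e \<odot> s (\<nu> (D e) * x)) = (\<Sum>e\<in>A. \<nu> (e * D e) * x)" if "finite A" for A
        using that
      proof (induction A rule: finite_induct)
        case (insert a A)
        have "(\<Oplus>e\<in>insert a A. e \<odot> s (\<nu> (D e) * x)) = a \<odot> s (\<nu> (D a) * x) \<oplus> (\<Oplus>e\<in>A. e \<odot> s (\<nu> (D e) * x))"
          using insert.hyps tc[OF x] by (subst finsum_insert) auto
        then have "P (\<Oplus>e\<in>insert a A. e \<odot> s (\<nu> (D e) * x)) = P (a \<odot> s (\<nu> (D a) * x)) + P (\<Oplus>e\<in>A. e \<odot> s (\<nu> (D e) * x))"
          using P(1)[OF mem fsub_finsum[OF K mem]] by simp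
        also have "P (a \<odot> s (\<nu> (D a) * x)) = \<nu> (a * D a) * x"
          using P(2)[OF sK[OF S\<nu>[OF x]]] Ps[OF S\<nu>[OF x]] by (simp add: \<nu>s)
        finally show ?case using insert by simp
      qed (simp add: P0)
      from this[OF BD(1)] have "P (s' x) = \<nu> (\<Sum>e\<in>B. e * D e) * x"
        unfolding s'_def by (simp add: \<nu>s sum_distrib_right)
      then show ?thesis by (simp add: BD(2) \<nu>s)
    qed
  qed
qed

end

section \<open>Closed submodules in archimedean, adelic and discrete coordinates\<close>

definition arch_field :: "('f::field_char_0 \<Rightarrow> complex) \<Rightarrow> complex set" where
  "arch_field \<nu> = (if range \<nu> \<subseteq> \<real> then \<real> else UNIV)"

lemma arch_field_closed:
  shows "x \<in> arch_field \<nu> \<Longrightarrow> y \<in> arch_field \<nu> \<Longrightarrow> x + y \<in> arch_field \<nu>" "0 \<in> arch_field \<nu>"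
    "x \<in> arch_field \<nu> \<Longrightarrow> \<nu> \<alpha> * x \<in> arch_field \<nu>"
  by (auto simp: arch_field_def image_subset_iff)

text \<open>Coordinates on \<open>G\<close> pulled back from the archimedean, adelic and discrete
  summands. In place of an isomorphism only joint injectivity and compactness of the boxes over
  \<open>C\<close> and zero are recorded, together with a closed submodule \<open>K\<close> to be
  analysed.\<close>

locale lca_coords = lca G for G :: "('f::field_char_0, 'a) topmod" (structure) +
  fixes n :: nat and \<nu> :: "nat \<Rightarrow> 'f \<Rightarrow> complex" and p :: "nat \<Rightarrow> 'a \<Rightarrow> complex"
    and Hm :: "('f, 'h) topmod" and C :: "'h set" and h :: "'a \<Rightarrow> 'h"
    and Dm :: "('f, 'd) topmod" and dd :: "'a \<Rightarrow> 'd" and K :: "'a set"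
  assumes nf: "number_field TYPE('f)"
    and \<nu>: "\<And>i. i < n \<Longrightarrow> \<nu> i \<in> arch_embeddings"
    and p_cont: "\<And>i. i < n \<Longrightarrow> continuous_map (topo G) euclidean (p i)"
    and p_add: "\<And>i x y. i < n \<Longrightarrow> x \<in> carrier G \<Longrightarrow> y \<in> carrier G \<Longrightarrow> p i (x \<oplus> y) = p i x + p i y"
    and p_smult: "\<And>i \<alpha> x. i < n \<Longrightarrow> x \<in> carrier G \<Longrightarrow> p i (\<alpha> \<odot> x) = \<nu> i \<alpha> * p i x"
    and p_S: "\<And>i x. i < n \<Longrightarrow> x \<in> carrier G \<Longrightarrow> p i x \<in> arch_field (\<nu> i)"
    and Hm: "lca_object Hm" and C: "submodule C integers_rec Hm" "compactin (topo Hm) C" "openin (topo Hm) C"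
    and HC: "carrier Hm = (\<Union>m\<in>{1::nat..}. (\<lambda>x. (1 / of_nat m) \<odot>\<^bsub>Hm\<^esub> x) ` C)"
    and h: "lca_morphism G Hm h"
    and Dm: "lca_object Dm" "finite_dim_discrete Dm"
    and dd: "lca_morphism G Dm dd"
    and coords_inj: "\<And>x. x \<in> carrier G \<Longrightarrow> (\<And>i. i < n \<Longrightarrow> p i x = 0) \<Longrightarrow> h x = \<zero>\<^bsub>Hm\<^esub> \<Longrightarrow> dd x = \<zero>\<^bsub>Dm\<^esub> \<Longrightarrow> x = \<zero>"
    and coords_proper: "\<And>r. compactin (topo G) {x \<in> carrier G. (\<forall>i<n. cmod (p i x) \<le> r) \<and> h x \<in> C \<and> dd x = \<zero>\<^bsub>Dm\<^esub>}"
    and K: "fsub K" "closedin (topo G) K"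
begin

sublocale Hm: lca Hm by unfold_locales (rule Hm)
sublocale Dm: lca Dm by unfold_locales (rule Dm)

lemmas h_simps = lca_morphismD[OF h] and dd_simps = lca_morphismD[OF dd]

lemma cC: "x \<in> C \<Longrightarrow> x \<in> carrier Hm"
  using C(3) openin_subset Hm.topspace_T by blast

lemma C_closed: "\<zero>\<^bsub>Hm\<^esub> \<in> C" "x \<in> C \<Longrightarrow> y \<in> C \<Longrightarrow> x \<oplus>\<^bsub>Hm\<^esub> y \<in> C" "x \<in> C \<Longrightarrow> of_int k \<odot>\<^bsub>Hm\<^esub> x \<in> C"
  "x \<in> C \<Longrightarrow> \<ominus>\<^bsub>Hm\<^esub> x \<in> C" "algebraic_int \<alpha> \<Longrightarrow> x \<in> C \<Longrightarrow> \<alpha> \<odot>\<^bsub>Hm\<^esub> x \<in> C"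
proof -
  have sg: "subgroup C (add_monoid Hm)" using C(1) by (simp add: submodule_def)
  show "\<zero>\<^bsub>Hm\<^esub> \<in> C" using subgroup.one_closed[OF sg] by simp
  show "x \<in> C \<Longrightarrow> y \<in> C \<Longrightarrow> x \<oplus>\<^bsub>Hm\<^esub> y \<in> C" using subgroup.m_closed[OF sg] by simp
  show *: "algebraic_int \<alpha> \<Longrightarrow> x \<in> C \<Longrightarrow> \<alpha> \<odot>\<^bsub>Hm\<^esub> x \<in> C" for \<alpha> x
    using submodule.smult_closed[OF C(1), of \<alpha> x] by (simp add: integers_rec_def)
  show **: "x \<in> C \<Longrightarrow> of_int k \<odot>\<^bsub>Hm\<^esub> x \<in> C" for k x by (rule *) simp
  show "x \<in> C \<Longrightarrow> \<ominus>\<^bsub>Hm\<^esub> x \<in> C" using **[of x "-1"] cC Hm.smult_minus1 by simp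
qed

lemma p_zero: "i < n \<Longrightarrow> p i \<zero> = 0"
  using p_add[of i \<zero> \<zero>] by simp

lemma p_neg: "i < n \<Longrightarrow> x \<in> carrier G \<Longrightarrow> p i (\<ominus> x) = - p i x"
  using p_add[of i "\<ominus> x" x] p_zero by (simp add: l_neg eq_neg_iff_add_eq_0)

lemma p_minus: "i < n \<Longrightarrow> x \<in> carrier G \<Longrightarrow> y \<in> carrier G \<Longrightarrow> p i (x \<ominus> y) = p i x - p i y"
  by (simp add: a_minus_def p_add p_neg)

lemma h_zero: "h \<zero> = \<zero>\<^bsub>Hm\<^esub>" and dd_zero: "dd \<zero> = \<zero>\<^bsub>Dm\<^esub>"
  using h_simps(3)[OF zero_closed, of 0] dd_simps(3)[OF zero_closed, of 0] h_simps(1) dd_simps(1) by simp_all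

lemma h_neg: "x \<in> carrier G \<Longrightarrow> h (\<ominus> x) = \<ominus>\<^bsub>Hm\<^esub> h x"
  using h_simps(3)[of x "-1"] h_simps(1) by (simp add: smult_minus1 Hm.smult_minus1)

lemma dd_neg: "x \<in> carrier G \<Longrightarrow> dd (\<ominus> x) = \<ominus>\<^bsub>Dm\<^esub> dd x"
  using dd_simps(3)[of x "-1"] dd_simps(1) by (simp add: smult_minus1 Dm.smult_minus1)

lemma h_minus: "x \<in> carrier G \<Longrightarrow> y \<in> carrier G \<Longrightarrow> h (x \<ominus> y) = h x \<ominus>\<^bsub>Hm\<^esub> h y"
  by (simp add: a_minus_def h_simps h_neg)

lemma dd_minus: "x \<in> carrier G \<Longrightarrow> y \<in> carrier G \<Longrightarrow> dd (x \<ominus> y) = dd x \<ominus>\<^bsub>Dm\<^esub> dd y"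
  by (simp add: a_minus_def dd_simps dd_neg)

lemma Dm_discrete: "topo Dm = discrete_topology (carrier Dm)"
  using Dm(2) by (simp add: finite_dim_discrete_def)

definition ker0 :: "nat set \<Rightarrow> 'a set" where
  "ker0 I = {x \<in> K. \<forall>i\<in>I. p i x = 0}"

text \<open>\<open>C\<close> is only assumed stable under algebraic integers, so this is a subgroup
  rather than an \<open>F\<close>-subspace. Bounded parts of it are compact, hence its archimedean
  image is closed.\<close>

definition lat :: "nat set \<Rightarrow> 'a set" where
  "lat I = {x \<in> ker0 I. h x \<in> C \<and> dd x = \<zero>\<^bsub>Dm\<^esub>}"

text \<open>The intersection of \<open>K\<close> with the summand \<open>Hm\<close>, seen through
  the coordinates; it becomes the adelic part of the kernel.\<close>

definition adel :: "'a set" where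
  "adel = {x \<in> K. (\<forall>i<n. p i x = 0) \<and> dd x = \<zero>\<^bsub>Dm\<^esub>}"

lemma Kc: "x \<in> K \<Longrightarrow> x \<in> carrier G" using fsubD(2)[OF K(1)] by auto

lemma ker0_fsub: assumes "I \<subseteq> {..<n}" shows "fsub (ker0 I)"
proof (rule fsubI)
  have i: "i < n" if "i \<in> I" for i using that assms by auto
  show "ker0 I \<subseteq> carrier G" using Kc by (auto simp: ker0_def)
  show "\<zero> \<in> ker0 I" using fsubD(3)[OF K(1)] i by (auto simp: ker0_def p_zero)
  show "x \<oplus> y \<in> ker0 I" if "x \<in> ker0 I" "y \<in> ker0 I" for x y
    using that fsubD(6)[OF K(1)] i Kc by (auto simp: ker0_def p_add)
  show "\<alpha> \<odot> x \<in> ker0 I" if "x \<in> ker0 I" for \<alpha> x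
    using that fsubD(7)[OF K(1)] i Kc by (auto simp: ker0_def p_smult)
qed

lemma adel_fsub: "fsub adel"
proof (rule fsubI)
  show "adel \<subseteq> carrier G" using Kc by (auto simp: adel_def)
  show "\<zero> \<in> adel" using fsubD(3)[OF K(1)] by (auto simp: adel_def p_zero dd_zero)
  show "x \<oplus> y \<in> adel" if "x \<in> adel" "y \<in> adel" for x y
    using that fsubD(6)[OF K(1)] Kc by (auto simp: adel_def p_add dd_simps)
  show "\<alpha> \<odot> x \<in> adel" if "x \<in> adel" for \<alpha> x
    using that fsubD(7)[OF K(1)] Kc by (auto simp: adel_def p_smult dd_simps)
qed

lemma lat_subgp: assumes "I \<subseteq> {..<n}" shows "subgp (lat I)"
proof -
  note F = fsubD[OF ker0_fsub[OF assms]]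
  have c: "x \<in> carrier G" if "x \<in> ker0 I" for x using that F(2) by auto
  have "x \<ominus> y \<in> lat I" if "x \<in> lat I" "y \<in> lat I" for x y
  proof -
    have xy: "x \<in> ker0 I" "y \<in> ker0 I" "h x \<in> C" "h y \<in> C" "dd x = \<zero>\<^bsub>Dm\<^esub>" "dd y = \<zero>\<^bsub>Dm\<^esub>" using that by (auto simp: lat_def)
    have hxy: "h (x \<ominus> y) = h x \<ominus>\<^bsub>Hm\<^esub> h y" "dd (x \<ominus> y) = dd x \<ominus>\<^bsub>Dm\<^esub> dd y"
      by (rule h_minus dd_minus; use c xy in simp)+
    have "h (x \<ominus> y) \<in> C" using C_closed(2)[OF xy(3) C_closed(4)[OF xy(4)]] unfolding hxy unfolding a_minus_def .
    moreover have "dd (x \<ominus> y) = \<zero>\<^bsub>Dm\<^esub>" unfolding hxy unfolding a_minus_def xy by (simp add: Dm.r_neg)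
    ultimately show ?thesis using F(4)[OF xy(1,2)] by (simp add: lat_def)
  qed
  then show ?thesis using F(2,3) C_closed(1) by (auto simp: subgp_def lat_def h_zero dd_zero)
qed

lemma lat_int: "I \<subseteq> {..<n} \<Longrightarrow> x \<in> lat I \<Longrightarrow> of_int k \<odot> x \<in> lat I"
  using fsubD(2,7)[OF ker0_fsub[of I]] C_closed(3) by (auto simp: lat_def h_simps dd_simps subset_iff)

lemma ker0_closed: assumes "I \<subseteq> {..<n}" shows "closedin (topo G) (ker0 I)"
proof -
  have "finite I" using assms finite_subset by blast
  then show ?thesis using assms
  proof (induction I rule: finite_induct)
    case empty
    then show ?case using K(2) by (simp add: ker0_def)
  next
    case (insert i I)
    have "closedin (topo G) {x \<in> topspace (topo G). p i x \<in> {0}}"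
      by (rule closedin_continuous_map_preimage[OF p_cont]) (use insert.prems in auto)
    then have "closedin (topo G) (ker0 I \<inter> {x \<in> topspace (topo G). p i x \<in> {0}})"
      using insert by (intro closedin_Int) auto
    moreover have "ker0 I \<inter> {x \<in> topspace (topo G). p i x \<in> {0}} = ker0 (insert i I)"
      using Kc by (auto simp: ker0_def topspace_T)
    ultimately show ?case by simp
  qed
qed

lemma dd_ker_clopen: "openin (topo G) {x \<in> carrier G. dd x = \<zero>\<^bsub>Dm\<^esub>}" "closedin (topo G) {x \<in> carrier G. dd x = \<zero>\<^bsub>Dm\<^esub>}"
  using openin_continuous_map_preimage[OF dd_simps(4), of "{\<zero>\<^bsub>Dm\<^esub>}"]
    closedin_continuous_map_preimage[OF dd_simps(4), of "{\<zero>\<^bsub>Dm\<^esub>}"]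
  by (simp_all add: Dm_discrete topspace_T)

lemma C_closedin: "closedin (topo Hm) C"
  by (rule compactin_imp_closedin[OF Hm.hausdorff_T C(2)])

lemma h_C_clopen: "openin (topo G) {x \<in> carrier G. h x \<in> C}" "closedin (topo G) {x \<in> carrier G. h x \<in> C}"
  using openin_continuous_map_preimage[OF h_simps(4) C(3)] closedin_continuous_map_preimage[OF h_simps(4) C_closedin]
  by (simp_all add: topspace_T)

lemma lat_closed: assumes "I \<subseteq> {..<n}" shows "closedin (topo G) (lat I)"
proof -
  have "closedin (topo G) (ker0 I \<inter> ({x \<in> carrier G. h x \<in> C} \<inter> {x \<in> carrier G. dd x = \<zero>\<^bsub>Dm\<^esub>}))"
    by (intro closedin_Int ker0_closed assms h_C_clopen dd_ker_clopen)
  moreover have "ker0 I \<inter> ({x \<in> carrier G. h x \<in> C} \<inter> {x \<in> carrier G. dd x = \<zero>\<^bsub>Dm\<^esub>}) = lat I"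
    using fsubD(2)[OF ker0_fsub[OF assms]] by (auto simp: lat_def)
  ultimately show ?thesis by simp
qed

lemma adel_closed: "closedin (topo G) adel"
proof -
  have "closedin (topo G) (ker0 {..<n} \<inter> {x \<in> carrier G. dd x = \<zero>\<^bsub>Dm\<^esub>})"
    by (intro closedin_Int ker0_closed dd_ker_clopen) simp
  moreover have "ker0 {..<n} \<inter> {x \<in> carrier G. dd x = \<zero>\<^bsub>Dm\<^esub>} = adel"
    using Kc by (auto simp: ker0_def adel_def)
  ultimately show ?thesis by simp
qed

lemma lat_compact: assumes "I \<subseteq> {..<n}" "closedin (topo G) U" "U \<subseteq> lat I" "\<And>x i. x \<in> U \<Longrightarrow> i < n \<Longrightarrow> cmod (p i x) \<le> r"
  shows "compactin (topo G) U"
proof (rule closed_compactin[OF coords_proper[of r] _ assms(2)])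
  show "U \<subseteq> {x \<in> carrier G. (\<forall>i<n. cmod (p i x) \<le> r) \<and> h x \<in> C \<and> dd x = \<zero>\<^bsub>Dm\<^esub>}"
    using assms(3,4) fsubD(2)[OF ker0_fsub[OF assms(1)]] by (auto simp: lat_def)
qed

lemma p_ball_open: "\<And>m. m \<le> n \<Longrightarrow> openin (topo G) {x \<in> carrier G. \<forall>i<m. cmod (p i x - z i) < e}"
proof -
  fix m show "m \<le> n \<Longrightarrow> openin (topo G) {x \<in> carrier G. \<forall>i<m. cmod (p i x - z i) < e}"
  proof (induction m)
    case 0
    have "openin (topo G) (topspace (topo G))" by simp
    then show ?case by (simp add: topspace_T)
  next
    case (Suc m)
    have "openin (topo G) {x \<in> topspace (topo G). p m x \<in> ball (z m) e}"
      by (rule openin_continuous_map_preimage[OF p_cont]) (use Suc.prems in auto)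
    then have "openin (topo G) ({x \<in> carrier G. \<forall>i<m. cmod (p i x - z i) < e} \<inter> {x \<in> topspace (topo G). p m x \<in> ball (z m) e})"
      using Suc by (intro openin_Int) auto
    moreover have "{x \<in> carrier G. \<forall>i<m. cmod (p i x - z i) < e} \<inter> {x \<in> topspace (topo G). p m x \<in> ball (z m) e}
       = {x \<in> carrier G. \<forall>i<Suc m. cmod (p i x - z i) < e}"
      by (auto simp: topspace_T less_Suc_eq dist_norm norm_minus_commute)
    ultimately show ?case by simp
  qed
qed

lemma p_cball_closed: "\<And>m. m \<le> n \<Longrightarrow> closedin (topo G) {x \<in> carrier G. \<forall>i<m. cmod (p i x) \<le> r}"
proof -
  fix m show "m \<le> n \<Longrightarrow> closedin (topo G) {x \<in> carrier G. \<forall>i<m. cmod (p i x) \<le> r}"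
  proof (induction m)
    case 0
    have "closedin (topo G) (topspace (topo G))" by simp
    then show ?case by (simp add: topspace_T)
  next
    case (Suc m)
    have "closedin (topo G) {x \<in> topspace (topo G). p m x \<in> cball 0 r}"
      by (rule closedin_continuous_map_preimage[OF p_cont]) (use Suc.prems in auto)
    then have "closedin (topo G) ({x \<in> carrier G. \<forall>i<m. cmod (p i x) \<le> r} \<inter> {x \<in> topspace (topo G). p m x \<in> cball 0 r})"
      using Suc by (intro closedin_Int) auto
    moreover have "{x \<in> carrier G. \<forall>i<m. cmod (p i x) \<le> r} \<inter> {x \<in> topspace (topo G). p m x \<in> cball 0 r}
       = {x \<in> carrier G. \<forall>i<Suc m. cmod (p i x) \<le> r}"
      by (auto simp: topspace_T less_Suc_eq)
    ultimately show ?case by simp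
  qed
qed

text \<open>The archimedean image of \<open>lat I\<close> is closed: a convergent sequence of values
  is bounded, hence lifts into a compact part of \<open>lat I\<close>. Small nonzero values then
  produce a line by \<open>closed_subgroup_line\<close>.\<close>

lemma lat_line:
  assumes I: "I \<subseteq> {..<n}"
    and nd: "\<forall>e>0. \<exists>x\<in>lat I. (\<exists>i<n. p i x \<noteq> 0) \<and> (\<forall>i<n. cmod (p i x) < e)"
  obtains w i0 where "i0 < n" "w i0 \<noteq> (0::complex)" "\<And>t. \<exists>x\<in>lat I. \<forall>i<n. p i x = of_real t * w i"
proof -
  \<comment> \<open>Index \<open>2 * i\<close> carries the real part and \<open>Suc (2 * i)\<close>
    the imaginary part of coordinate \<open>i\<close>.\<close>
  define Q where "Q x j = (if j < 2 * n then if even j then Re (p (j div 2) x) else Im (p (j div 2) x) else 0)" for x and j :: nat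
  define L where "L = Q ` lat I"
  note sub = subgpD[OF lat_subgp[OF I]]
  have latc: "x \<in> carrier G" if "x \<in> lat I" for x using sub(1) that by auto
  have Qsub: "(\<lambda>j. u j - v j) \<in> L" if uv: "u \<in> L" "v \<in> L" for u v
  proof -
    obtain x y where xy: "x \<in> lat I" "y \<in> lat I" "u = Q x" "v = Q y" using uv by (auto simp: L_def)
    have "(\<lambda>j. Q x j - Q y j) = Q (x \<ominus> y)"
      using latc[OF xy(1)] latc[OF xy(2)] by (auto simp: Q_def fun_eq_iff p_minus less_mult_imp_div_less mult.commute)
    then show ?thesis using xy sub(3)[OF xy(1,2)] by (simp add: L_def)
  qed
  have Qre: "\<bar>Re (p i x)\<bar> \<le> r \<and> \<bar>Im (p i x)\<bar> \<le> r" if "i < n" "\<And>j. j < 2 * n \<Longrightarrow> \<bar>Q x j\<bar> \<le> r" for i x r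
    using that(2)[of "2 * i"] that(2)[of "Suc (2 * i)"] that(1) by (auto simp: Q_def)
  have Qcont: "continuous_map (topo G) euclidean Q"
    unfolding euclidean_product_topology[symmetric] continuous_map_componentwise_UNIV
  proof
    fix j
    show "continuous_map (topo G) euclidean (\<lambda>x. Q x j)"
    proof (cases "j < 2 * n")
      case True
      then have "j div 2 < n" by auto
      from p_cont[OF this] have "continuous_map (topo G) euclidean (\<lambda>x. Re (p (j div 2) x))"
        "continuous_map (topo G) euclidean (\<lambda>x. Im (p (j div 2) x))"
        by (auto intro!: continuous_map_lift1[where h = Re] continuous_map_lift1[where h = Im] continuous_intros)
      with True show ?thesis by (simp add: Q_def)
    qed (simp add: Q_def)
  qed
  have Lcl: "y \<in> L" if f: "\<And>m. f m \<in> L" and lim: "\<And>j. (\<lambda>m. f m j) \<longlonglongrightarrow> y j" for f y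
  proof -
    have "\<exists>b. \<forall>m. \<bar>f m j\<bar> \<le> b" for j
    proof -
      have "bounded (range (\<lambda>m. f m j))" using lim[of j] convergent_imp_bounded by blast
      then show ?thesis unfolding bounded_iff by auto
    qed
    then obtain b where b: "\<And>m j. \<bar>f m j\<bar> \<le> b j" by metis
    define r where "r = (\<Sum>j<2*n. b j)"
    have bpos: "b j \<ge> 0" for j using b[of 0 j] by linarith
    have r: "\<bar>f m j\<bar> \<le> r" if "j < 2 * n" for m j
    proof -
      have "b j \<le> r" unfolding r_def using that bpos by (intro member_le_sum) auto
      with b[of m j] show ?thesis by linarith
    qed
    define Z where "Z = lat I \<inter> {x \<in> carrier G. \<forall>i<n. cmod (p i x) \<le> r + r}"
    have Z: "compactin (topo G) Z"
      unfolding Z_def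
    proof (rule lat_compact[OF I])
      show "closedin (topo G) (lat I \<inter> {x \<in> carrier G. \<forall>i<n. cmod (p i x) \<le> r + r})"
        by (intro closedin_Int lat_closed I p_cball_closed) simp
    qed auto
    have "compact (Q ` Z)" using image_compactin[OF Z Qcont] by (simp add: compactin_euclidean_iff)
    then have cl: "closed (Q ` Z)" by (rule compact_imp_closed)
    have fZ: "f m \<in> Q ` Z" for m
    proof -
      obtain x where x: "x \<in> lat I" "f m = Q x" using f[of m] by (auto simp: L_def)
      have "cmod (p i x) \<le> r + r" if "i < n" for i
      proof -
        have "\<bar>Re (p i x)\<bar> \<le> r \<and> \<bar>Im (p i x)\<bar> \<le> r" by (rule Qre[OF that]) (use r[of _ m] x(2) in simp)
        then show ?thesis using cmod_le[of "p i x"] by linarith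
      qed
      then show ?thesis using x latc by (auto simp: Z_def)
    qed
    have "limitin (product_topology (\<lambda>i. euclidean) UNIV) f y sequentially"
      unfolding limitin_componentwise using lim by (simp add: limitin_canonical_iff)
    then have "f \<longlonglongrightarrow> y" by (simp add: euclidean_product_topology limitin_canonical_iff)
    from closed_sequentially[OF cl fZ this] show ?thesis by (auto simp: L_def Z_def)
  qed
  have Lsupp: "u j = 0" if "u \<in> L" "j \<ge> 2 * n" for u j using that by (auto simp: L_def Q_def)
  have Lnd: "\<exists>u\<in>L. (\<exists>j<2 * n. u j \<noteq> 0) \<and> (\<forall>j<2 * n. \<bar>u j\<bar> < e)" if e: "e > 0" for e
  proof -
    obtain x i where x: "x \<in> lat I" "i < n" "p i x \<noteq> 0" "\<And>i. i < n \<Longrightarrow> cmod (p i x) < e" using nd[rule_format, OF e] by blast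
    have 1: "\<exists>j<2 * n. Q x j \<noteq> 0"
    proof (rule ccontr)
      assume "\<not> (\<exists>j<2 * n. Q x j \<noteq> 0)"
      then have "\<bar>Re (p i x)\<bar> \<le> 0 \<and> \<bar>Im (p i x)\<bar> \<le> 0" by (intro Qre[OF x(2)]) auto
      with x(3) show False by (simp add: complex_eq_iff)
    qed
    have 2: "\<bar>Q x j\<bar> < e" if "j < 2 * n" for j
    proof -
      have "j div 2 < n" using that by auto
      from x(4)[OF this] show ?thesis
        using that abs_Re_le_cmod[of "p (j div 2) x"] abs_Im_le_cmod[of "p (j div 2) x"] by (auto simp: Q_def)
    qed
    show ?thesis using 1 2 x(1) by (intro bexI[of _ "Q x"]) (auto simp: L_def)
  qed
  have "\<exists>w. (\<exists>j<2 * n. w j \<noteq> 0) \<and> (\<forall>t. (\<lambda>j. t * w j) \<in> L)"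
  proof (rule closed_subgroup_line[of L "2 * n"])
    show "y \<in> L" if "\<And>m. f m \<in> L" "\<And>j. (\<lambda>m. f m j) \<longlonglongrightarrow> y j" for f y
      by (rule Lcl[of f]) (fact that)+
  qed (use Qsub Lsupp Lnd in blast)+
  then obtain w where w: "\<exists>j<2*n. w j \<noteq> 0" "\<And>t. (\<lambda>j. t * w j) \<in> L" by blast
  define wc where "wc i = Complex (w (2 * i)) (w (Suc (2 * i)))" for i
  obtain j where j: "j < 2 * n" "w j \<noteq> 0" using w(1) by blast
  show ?thesis
  proof (rule that[of "j div 2" wc])
    show "j div 2 < n" using j by auto
    show "wc (j div 2) \<noteq> 0" using j by (cases "even j") (auto simp: wc_def complex_eq_iff elim!: evenE oddE)
    fix t
    obtain x where x: "x \<in> lat I" "(\<lambda>j. t * w j) = Q x" using w(2)[of t] by (auto simp: L_def)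
    have "p i x = of_real t * wc i" if "i < n" for i
      using fun_cong[OF x(2), of "2 * i"] fun_cong[OF x(2), of "Suc (2 * i)"] that
      by (simp add: Q_def wc_def complex_eq_iff)
    then show "\<exists>x\<in>lat I. \<forall>i<n. p i x = of_real t * wc i" using x(1) by blast
  qed
qed

text \<open>The lift takes place in the preimage \<open>A\<close> of the real line through
  \<open>w\<close>, with time \<open>\<tau>\<close> read off at a coordinate \<open>i0\<close> where
  \<open>w\<close> does not vanish. The elements of \<open>A\<close> at time 0 are embedded in the
  compact group \<open>C\<close> by \<open>h\<close>.\<close>

lemma lat_one_parameter:
  assumes I: "I \<subseteq> {..<n}"
    and nd: "\<forall>e>0. \<exists>x\<in>lat I. (\<exists>i<n. p i x \<noteq> 0) \<and> (\<forall>i<n. cmod (p i x) < e)"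
  obtains w i0 \<gamma> where "i0 < n" "w i0 \<noteq> (0::complex)" "\<And>t. \<gamma> t \<in> lat I" "\<And>t i. i < n \<Longrightarrow> p i (\<gamma> t) = of_real t * w i"
    "continuous_map euclidean (topo G) \<gamma>" "\<And>s t. \<gamma> (s + t) = \<gamma> s \<oplus> \<gamma> t"
proof -
  obtain w i0 where w: "i0 < n" "w i0 \<noteq> (0::complex)" "\<And>t. \<exists>x\<in>lat I. \<forall>i<n. p i x = of_real t * w i"
    by (rule lat_line[OF I nd]) (rule that; assumption)
  note sub = subgpD[OF lat_subgp[OF I]]
  have latc: "x \<in> carrier G" if "x \<in> lat I" for x using sub(1) that by auto
  define \<tau> where "\<tau> x = Re (p i0 x / w i0)" for x
  define A where "A = {x \<in> lat I. \<forall>i<n. p i x = of_real (\<tau> x) * w i}"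
  have \<tau>c: "continuous_map (topo G) euclidean \<tau>"
    unfolding \<tau>_def by (rule continuous_map_lift1[OF p_cont[OF w(1)]]) (use w(2) in \<open>auto intro!: continuous_intros\<close>)
  have \<tau>m: "\<tau> (x \<ominus> y) = \<tau> x - \<tau> y" if "x \<in> carrier G" "y \<in> carrier G" for x y
    using that w(1) by (simp add: \<tau>_def p_minus diff_divide_distrib)
  have \<tau>w: "\<tau> x = t" if "p i0 x = of_real t * w i0" for x t using that w(2) by (simp add: \<tau>_def)
  have Asub: "subgp A"
    unfolding subgp_def
  proof (intro conjI ballI)
    show "A \<subseteq> carrier G" using latc by (auto simp: A_def)
    show "\<zero> \<in> A" using sub(2) w(1) by (simp add: A_def p_zero \<tau>_def)
    show "x \<ominus> y \<in> A" if "x \<in> A" "y \<in> A" for x y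
    proof -
      have xy: "x \<in> lat I" "y \<in> lat I" "x \<in> carrier G" "y \<in> carrier G" using that latc by (auto simp: A_def)
      then show ?thesis using that sub(3)[OF xy(1,2)] by (simp add: A_def p_minus \<tau>m algebra_simps)
    qed
  qed
  have Acl: "closedin (topo G) A"
  proof -
    have "closedin (topo G) {x \<in> lat I. \<forall>i<m. p i x = of_real (\<tau> x) * w i}" if "m \<le> n" for m
      using that
    proof (induction m)
      case 0 then show ?case using lat_closed[OF I] by simp
    next
      case (Suc m)
      have "continuous_map (topo G) euclidean (\<lambda>x. p m x - of_real (\<tau> x) * w m)"
        by (rule continuous_map_lift2[OF p_cont \<tau>c, where h = "\<lambda>u v. u - of_real v * w m"]) (use Suc.prems in \<open>auto intro!: continuous_intros\<close>)
      then have "closedin (topo G) {x \<in> topspace (topo G). p m x - of_real (\<tau> x) * w m \<in> {0}}"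
        by (rule closedin_continuous_map_preimage) simp
      then have "closedin (topo G) ({x \<in> lat I. \<forall>i<m. p i x = of_real (\<tau> x) * w i} \<inter> {x \<in> topspace (topo G). p m x - of_real (\<tau> x) * w m \<in> {0}})"
        using Suc by (intro closedin_Int) auto
      moreover have "{x \<in> lat I. \<forall>i<m. p i x = of_real (\<tau> x) * w i} \<inter> {x \<in> topspace (topo G). p m x - of_real (\<tau> x) * w m \<in> {0}}
         = {x \<in> lat I. \<forall>i<Suc m. p i x = of_real (\<tau> x) * w i}"
        using latc by (auto simp: topspace_T less_Suc_eq)
      ultimately show ?case by simp
    qed
    from this[of n] show ?thesis by (simp add: A_def)
  qed
  have AI: "A \<subseteq> lat I" by (auto simp: A_def)
  define TC where "TC = subtopology (topo Hm) C"
  have grp: "compact_ab_group (Hm\<lparr>carrier := C\<rparr>) TC"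
  proof -
    have ag: "abelian_group (Hm\<lparr>carrier := C\<rparr>)"
    proof (rule abelian_groupI)
      fix x assume "x \<in> carrier (Hm\<lparr>carrier := C\<rparr>)"
      then show "\<exists>y\<in>carrier (Hm\<lparr>carrier := C\<rparr>). y \<oplus>\<^bsub>Hm\<lparr>carrier := C\<rparr>\<^esub> x = \<zero>\<^bsub>Hm\<lparr>carrier := C\<rparr>\<^esub>"
        using C_closed(4)[of x] cC Hm.l_neg by auto
    qed (use cC C_closed(1,2) in \<open>auto simp: Hm.a_ac\<close>)
    have inv: "\<ominus>\<^bsub>Hm\<lparr>carrier := C\<rparr>\<^esub> x = \<ominus>\<^bsub>Hm\<^esub> x" if "x \<in> C" for x
    proof -
      interpret S: abelian_group "Hm\<lparr>carrier := C\<rparr>" by (rule ag)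
      have "\<ominus>\<^bsub>Hm\<^esub> x \<oplus>\<^bsub>Hm\<lparr>carrier := C\<rparr>\<^esub> x = \<zero>\<^bsub>Hm\<lparr>carrier := C\<rparr>\<^esub>" using cC[OF that] by (simp add: Hm.l_neg)
      then show ?thesis using S.minus_equality[of "\<ominus>\<^bsub>Hm\<^esub> x" x] that C_closed(4)[OF that] by simp
    qed
    have tC: "topspace TC = C" unfolding TC_def using cC Hm.topspace_T by auto
    have cadd: "continuous_map (prod_topology TC TC) TC (\<lambda>(x, y). x \<oplus>\<^bsub>Hm\<^esub> y)"
      unfolding TC_def
    proof (rule continuous_map_into_subtopology)
      show "continuous_map (prod_topology (subtopology (topo Hm) C) (subtopology (topo Hm) C)) (topo Hm) (\<lambda>(x, y). x \<oplus>\<^bsub>Hm\<^esub> y)"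
        unfolding prod_topology_subtopology by (intro continuous_map_from_subtopology Hm.add_cont)
      show "(\<lambda>(x, y). x \<oplus>\<^bsub>Hm\<^esub> y) \<in> topspace (prod_topology (subtopology (topo Hm) C) (subtopology (topo Hm) C)) \<rightarrow> C"
        using C_closed(2) by auto
    qed
    have cneg: "continuous_map TC TC (\<lambda>x. \<ominus>\<^bsub>Hm\<lparr>carrier := C\<rparr>\<^esub> x)"
    proof (rule continuous_map_eq[of _ _ "\<lambda>x. \<ominus>\<^bsub>Hm\<^esub> x"])
      show "continuous_map TC TC (\<lambda>x. \<ominus>\<^bsub>Hm\<^esub> x)" unfolding TC_def
        by (rule continuous_map_into_subtopology) (use C_closed(4) in \<open>auto intro!: continuous_map_from_subtopology Hm.neg_cont\<close>)
    qed (use tC inv in auto)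
    have "compact_space TC" unfolding TC_def using C(2) by (simp add: compact_space_subtopology)
    then show ?thesis unfolding compact_ab_group_def compact_ab_group_axioms_def
      using ag tC cadd cneg by simp
  qed
  have T2: "Hausdorff_space TC" unfolding TC_def by (rule Hausdorff_space_subtopology[OF Hm.hausdorff_T])
  have hc: "continuous_map (subtopology (topo G) A) TC h" unfolding TC_def
    by (rule continuous_map_into_subtopology)
       (use AI in \<open>auto simp: lat_def intro!: continuous_map_from_subtopology h_simps(4)\<close>)
  obtain \<gamma> where \<gamma>: "continuous_map euclidean (topo G) \<gamma>" "\<And>t. \<gamma> t \<in> A" "\<And>t. \<tau> (\<gamma> t) = t"
    "\<And>s t. \<gamma> (s + t) = \<gamma> s \<oplus> \<gamma> t"
  proof (rule one_parameter_lift[OF Asub Acl _ _ _ _ grp T2 hc])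
    show "continuous_map (subtopology (topo G) A) euclidean \<tau>" by (rule continuous_map_from_subtopology[OF \<tau>c])
    show "\<tau> (x \<ominus> y) = \<tau> x - \<tau> y" if "x \<in> A" "y \<in> A" for x y using that AI latc \<tau>m by blast
    show "\<exists>x\<in>A. \<tau> x = t" for t
    proof -
      obtain x where x: "x \<in> lat I" "\<forall>i<n. p i x = of_real t * w i" using w(3) by blast
      then have "\<tau> x = t" using \<tau>w w(1) by blast
      then show ?thesis using x by (intro bexI[of _ x]) (auto simp: A_def)
    qed
    show "compactin (topo G) {x \<in> A. \<bar>\<tau> x\<bar> \<le> r}" for r
    proof (rule lat_compact[OF I, of _ "\<bar>r\<bar> * (\<Sum>i<n. cmod (w i))"])
      have "closedin (topo G) {x \<in> topspace (topo G). \<tau> x \<in> {-r..r}}"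
        by (rule closedin_continuous_map_preimage[OF \<tau>c]) simp
      then have "closedin (topo G) (A \<inter> {x \<in> topspace (topo G). \<tau> x \<in> {-r..r}})" by (rule closedin_Int[OF Acl])
      moreover have "A \<inter> {x \<in> topspace (topo G). \<tau> x \<in> {-r..r}} = {x \<in> A. \<bar>\<tau> x\<bar> \<le> r}"
        using AI latc by (auto simp: topspace_T abs_le_iff)
      ultimately show "closedin (topo G) {x \<in> A. \<bar>\<tau> x\<bar> \<le> r}" by simp
      fix x i assume x: "x \<in> {x \<in> A. \<bar>\<tau> x\<bar> \<le> r}" and i: "i < n"
      have "cmod (p i x) = \<bar>\<tau> x\<bar> * cmod (w i)" using x i by (simp add: A_def norm_mult)
      also have "\<dots> \<le> \<bar>r\<bar> * (\<Sum>i<n. cmod (w i))"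
        using x i by (intro mult_mono member_le_sum) auto
      finally show "cmod (p i x) \<le> \<bar>r\<bar> * (\<Sum>i<n. cmod (w i))" .
    qed (use AI in auto)
    show "h (x \<oplus> y) = h x \<oplus>\<^bsub>Hm\<lparr>carrier := C\<rparr>\<^esub> h y" if "x \<in> A" "y \<in> A" for x y
    proof -
      have "x \<in> carrier G" "y \<in> carrier G" using that AI latc by auto
      then show ?thesis by (simp add: h_simps)
    qed
    show "x = \<zero>" if x: "x \<in> A" "\<tau> x = 0" "h x = \<zero>\<^bsub>Hm\<lparr>carrier := C\<rparr>\<^esub>" for x
    proof (rule coords_inj)
      show "x \<in> carrier G" using x AI latc by auto
      show "p i x = 0" if "i < n" for i using x that by (simp add: A_def)
      show "h x = \<zero>\<^bsub>Hm\<^esub>" using x by simp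
      show "dd x = \<zero>\<^bsub>Dm\<^esub>" using x AI by (auto simp: lat_def)
    qed
  qed (rule that; assumption)
  have "p i (\<gamma> t) = of_real t * w i" if "i < n" for i t
  proof -
    have "p i (\<gamma> t) = of_real (\<tau> (\<gamma> t)) * w i" using \<gamma>(2)[of t] that unfolding A_def by blast
    then show ?thesis by (simp add: \<gamma>(3))
  qed
  with w \<gamma> AI show ?thesis by (intro that[of i0 w \<gamma>]) auto
qed

end

section \<open>Sections over archimedean coordinates\<close>

context lca_coords
begin

text \<open>Coordinates outside \<open>I\<close> are left unconstrained: \<open>K\<close> may lie
  diagonally, so the image of a section need not be a coordinate axis.\<close>

definition sect :: "nat set \<Rightarrow> (nat \<Rightarrow> complex \<Rightarrow> 'a) \<Rightarrow> bool" where
  "sect I s \<longleftrightarrow> (\<forall>i\<in>I. continuous_map (top_of_set (arch_field (\<nu> i))) (topo G) (s i) \<and>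
     (\<forall>x\<in>arch_field (\<nu> i). s i x \<in> K \<and> (\<forall>y\<in>arch_field (\<nu> i). s i (x + y) = s i x \<oplus> s i y) \<and>
        (\<forall>\<alpha>. s i (\<nu> i \<alpha> * x) = \<alpha> \<odot> s i x) \<and> (\<forall>j\<in>I. p j (s i x) = (if j = i then x else 0))))"

lemma sectD:
  assumes "sect I s" "i \<in> I"
  shows "continuous_map (top_of_set (arch_field (\<nu> i))) (topo G) (s i)"
    "x \<in> arch_field (\<nu> i) \<Longrightarrow> s i x \<in> K"
    "x \<in> arch_field (\<nu> i) \<Longrightarrow> y \<in> arch_field (\<nu> i) \<Longrightarrow> s i (x + y) = s i x \<oplus> s i y"
    "x \<in> arch_field (\<nu> i) \<Longrightarrow> s i (\<nu> i \<alpha> * x) = \<alpha> \<odot> s i x"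
    "x \<in> arch_field (\<nu> i) \<Longrightarrow> j \<in> I \<Longrightarrow> p j (s i x) = (if j = i then x else 0)"
  using assms unfolding sect_def by blast+

text \<open>The vectors \<open>u\<close> and \<open>\<nu> \<alpha> * u\<close> span the completion over the reals.\<close>

lemma arch_field_coordinates:
  assumes u: "u \<in> arch_field \<nu>'" "u \<noteq> 0"
  shows "\<exists>\<alpha> (a :: complex \<Rightarrow> real) (b :: complex \<Rightarrow> real). (\<forall>x y. a (x + y) = a x + a y) \<and> (\<forall>x y. b (x + y) = b x + b y) \<and>
    continuous_on UNIV a \<and> continuous_on UNIV b \<and>
    (\<forall>x\<in>arch_field \<nu>'. of_real (a x) * u + \<nu>' \<alpha> * (of_real (b x) * u) = x)"
proof (cases "range \<nu>' \<subseteq> \<real>")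
  case True
  have uR: "u \<in> \<real>" using u True by (simp add: arch_field_def)
  show ?thesis
  \<comment> \<open>At a real place one vector is enough: the second coefficient is 0, and any
    \<open>\<alpha>\<close> will do.\<close>
  proof (rule exI[of _ undefined], rule exI[of _ "\<lambda>x. Re (x / u)"], rule exI[of _ "\<lambda>x. 0"], intro conjI)
    show "\<forall>x\<in>arch_field \<nu>'. complex_of_real (Re (x / u)) * u + \<nu>' undefined * (of_real 0 * u) = x"
    proof
      fix x assume "x \<in> arch_field \<nu>'"
      then have "x / u \<in> \<real>" using True uR by (simp add: arch_field_def)
      then show "complex_of_real (Re (x / u)) * u + \<nu>' undefined * (of_real 0 * u) = x" using u(2) by simp
    qed
    show "continuous_on UNIV (\<lambda>x. Re (x / u))" using u(2) by (intro continuous_intros) auto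
  qed (auto simp: add_divide_distrib)
next
  case False
  then obtain \<alpha> where \<alpha>: "\<nu>' \<alpha> \<notin> \<real>" by blast
  define \<beta> where "\<beta> = \<nu>' \<alpha>"
  have \<beta>: "Im \<beta> \<noteq> 0" using \<alpha> by (simp add: \<beta>_def complex_is_Real_iff)
  \<comment> \<open>\<open>a\<close> and \<open>b\<close> solve
    \<open>x / u = a x + b x * \<beta>\<close> by comparing imaginary and then real parts.\<close>
  define b where "b x = Im (x / u) / Im \<beta>" for x
  define a where "a x = Re (x / u) - b x * Re \<beta>" for x
  have b_add: "b (x + y) = b x + b y" for x y by (simp only: b_def add_divide_distrib plus_complex.sel)
  show ?thesis
  proof (rule exI[of _ \<alpha>], rule exI[of _ a], rule exI[of _ b], intro conjI)
    show "\<forall>x y. b (x + y) = b x + b y" using b_add by blast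
    show "\<forall>x y. a (x + y) = a x + a y"
      unfolding a_def b_add add_divide_distrib plus_complex.sel by (simp add: algebra_simps)
    show cb: "continuous_on UNIV b" unfolding b_def using u(2) \<beta> by (intro continuous_intros) auto
    show "continuous_on UNIV a" unfolding a_def using u(2) by (intro continuous_intros cb) auto
    show "\<forall>x\<in>arch_field \<nu>'. of_real (a x) * u + \<nu>' \<alpha> * (of_real (b x) * u) = x"
    proof
      fix x
      have "of_real (a x) + \<beta> * of_real (b x) = x / u"
        using \<beta> by (simp add: complex_eq_iff a_def) (simp add: b_def)
      then have "(of_real (a x) + \<beta> * of_real (b x)) * u = x" using u(2) by simp
      then show "of_real (a x) * u + \<nu>' \<alpha> * (of_real (b x) * u) = x" by (simp add: \<beta>_def algebra_simps)
    qed
  qed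
qed

text \<open>The lifted line lies in \<open>ker0 I\<close> and has a nonzero coordinate
  \<open>i0\<close>, which is therefore outside \<open>I\<close>. It gives an additive section over
  \<open>i0\<close>, made linear by \<open>linearize\<close>, after which the old sections are
  adjusted to the new coordinate.\<close>

lemma extend_section:
  assumes I: "I \<subseteq> {..<n}" and s: "sect I s"
    and nd: "\<forall>e>0. \<exists>x\<in>lat I. (\<exists>i<n. p i x \<noteq> 0) \<and> (\<forall>i<n. cmod (p i x) < e)"
  shows "\<exists>i s'. i < n \<and> i \<notin> I \<and> sect (insert i I) s'"
proof -
  obtain w i0 \<gamma> where w: "i0 < n" "w i0 \<noteq> (0::complex)" and \<gamma>: "\<And>t. \<gamma> t \<in> lat I" "\<And>t i. i < n \<Longrightarrow> p i (\<gamma> t) = of_real t * w i"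
    "continuous_map euclidean (topo G) \<gamma>" "\<And>s t. \<gamma> (s + t) = \<gamma> s \<oplus> \<gamma> t"
    by (rule lat_one_parameter[OF I nd]) (rule that; assumption)
  note F = ker0_fsub[OF I]
  note Fs = fsubD[OF F]
  have \<gamma>k: "\<gamma> t \<in> ker0 I" for t using \<gamma>(1)[of t] by (simp add: lat_def)
  have kc: "x \<in> carrier G" if "x \<in> ker0 I" for x using that Fs(2) by auto
  have i0I: "i0 \<notin> I"
  proof
    assume "i0 \<in> I"
    then have "p i0 (\<gamma> 1) = 0" using \<gamma>k[of 1] by (simp add: ker0_def)
    then show False using \<gamma>(2)[OF w(1), of 1] w(2) by simp
  qed
  define S where "S = arch_field (\<nu> i0)"
  have uS: "w i0 \<in> arch_field (\<nu> i0)" using p_S[OF w(1) kc[OF \<gamma>k[of 1]]] \<gamma>(2)[OF w(1), of 1] by simp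
  obtain \<alpha> a b where ab: "\<forall>x y. a (x + y) = a x + a y" "\<forall>x y. b (x + y) = b x + b y"
    "continuous_on UNIV a" "continuous_on UNIV (b :: complex \<Rightarrow> real)"
    "\<forall>x\<in>S. of_real (a x) * w i0 + \<nu> i0 \<alpha> * (of_real (b x) * w i0) = x"
    using arch_field_coordinates[OF uS w(2)] unfolding S_def by (elim exE conjE)
  \<comment> \<open>The line covers one real direction; its multiple by \<open>\<alpha>\<close>
    covers the other one at a complex place. The result is additive but need not be linear over
    \<open>F\<close>.\<close>
  define s0 where "s0 x = \<gamma> (a x) \<oplus> \<alpha> \<odot> \<gamma> (b x)" for x
  note Scl = arch_field_closed[where \<nu> = "\<nu> i0", folded S_def]
  have s0k: "s0 x \<in> ker0 I" for x unfolding s0_def by (intro Fs(6,7) \<gamma>k)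
  obtain s1 where s1: "\<And>x. x \<in> S \<Longrightarrow> s1 x \<in> ker0 I" "\<And>x y. x \<in> S \<Longrightarrow> y \<in> S \<Longrightarrow> s1 (x + y) = s1 x \<oplus> s1 y"
    "\<And>\<alpha> x. x \<in> S \<Longrightarrow> s1 (\<nu> i0 \<alpha> * x) = \<alpha> \<odot> s1 x" "continuous_map (top_of_set S) (topo G) s1"
    "\<And>x. x \<in> S \<Longrightarrow> p i0 (s1 x) = x"
  proof (rule linearize[OF nf \<nu>[OF w(1)], of S "ker0 I" s0 "p i0"])
    show "s0 (x + y) = s0 x \<oplus> s0 y" for x y
    proof -
      have c: "\<gamma> t \<in> carrier G" for t by (rule kc[OF \<gamma>k])
      show ?thesis using c by (simp add: s0_def ab \<gamma>(4) smult_r_distr a_ac)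
    qed
    show "continuous_map (top_of_set S) (topo G) s0"
    proof -
      have ca: "continuous_map (top_of_set S) euclidean a" "continuous_map (top_of_set S) euclidean b"
        using ab(3,4) by (auto intro: continuous_on_subset)
      have "continuous_map (top_of_set S) (topo G) (\<lambda>x. \<gamma> (a x))" "continuous_map (top_of_set S) (topo G) (\<lambda>x. \<gamma> (b x))"
        using continuous_map_compose[OF ca(1) \<gamma>(3)] continuous_map_compose[OF ca(2) \<gamma>(3)] by (simp_all add: o_def)
      then show ?thesis unfolding s0_def[abs_def] by (intro add_cont' smult_cont')
    qed
    show "p i0 (s0 x) = x" if "x \<in> S" for x
      using ab(5)[rule_format, OF that] kc[OF \<gamma>k] by (simp add: s0_def p_add p_smult w(1) \<gamma>(2))
    show "p i0 (x \<oplus> y) = p i0 x + p i0 y" if "x \<in> ker0 I" "y \<in> ker0 I" for x y using that kc w(1) by (simp add: p_add)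
    show "p i0 (\<beta> \<odot> x) = \<nu> i0 \<beta> * p i0 x" if "x \<in> ker0 I" for \<beta> x using that kc w(1) by (simp add: p_smult)
  qed (use Scl F s0k in blast)+
  have pS: "p i0 x \<in> S" if "x \<in> carrier G" for x unfolding S_def by (rule p_S[OF w(1) that])
  have pcS: "continuous_map (topo G) (top_of_set S) (p i0)"
    using p_cont[OF w(1)] pS by (auto simp: continuous_map_in_subtopology topspace_T)
  have s1K: "s1 x \<in> K" and s1c: "s1 x \<in> carrier G" and s1p: "\<And>j. j \<in> I \<Longrightarrow> p j (s1 x) = 0" if "x \<in> S" for x
    using s1(1)[OF that] Kc by (auto simp: ker0_def)
  have s1neg: "s1 (- x) = \<ominus> s1 x" if "x \<in> S" for x
  proof -
    have "s1 (\<nu> i0 (of_int (-1)) * x) = of_int (-1) \<odot> s1 x" by (rule s1(3)[OF that])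
    then show ?thesis using embedding_simps(6)[OF \<nu>[OF w(1)], of "-1"] s1c[OF that] by (simp add: smult_minus1)
  qed
  \<comment> \<open>As in Gram-Schmidt, the old sections lose their \<open>i0\<close> coordinate.
    The coordinates in \<open>I\<close> are unchanged because \<open>s1\<close> takes values in
    \<open>ker0 I\<close>.\<close>
  define s' where "s' j x = (if j = i0 then s1 x else s j x \<ominus> s1 (p i0 (s j x)))" for j x
  have "sect (insert i0 I) s'"
    unfolding sect_def
  proof (intro ballI conjI allI)
    fix i assume i: "i \<in> insert i0 I"
    show "continuous_map (top_of_set (arch_field (\<nu> i))) (topo G) (s' i)"
    proof (cases "i = i0")
      case True then show ?thesis using s1(4) by (simp add: s'_def[abs_def] S_def)
    next
      case False
      then have iI: "i \<in> I" using i by simp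
      note c = sectD(1)[OF s iI]
      have "continuous_map (top_of_set (arch_field (\<nu> i))) (topo G) (\<lambda>x. s1 (p i0 (s i x)))"
        using continuous_map_compose[OF continuous_map_compose[OF c pcS] s1(4)] by (simp add: o_def)
      from minus_cont'[OF c this] False show ?thesis by (simp add: s'_def[abs_def])
    qed
    fix x assume x: "x \<in> arch_field (\<nu> i)"
    have sc: "s i x \<in> K" "s i x \<in> carrier G" "p i0 (s i x) \<in> S" if "i \<in> I" "x \<in> arch_field (\<nu> i)" for i x
      using sectD(2)[OF s that] Kc pS by auto
    show "s' i x \<in> K"
    proof (cases "i = i0")
      case True then show ?thesis using s1K x by (simp add: s'_def S_def)
    next
      case False
      then have iI: "i \<in> I" using i by simp
      then show ?thesis using False sc[OF iI x] s1K fsubD(4)[OF K(1)] by (simp add: s'_def)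
    qed
    show "s' i (x + y) = s' i x \<oplus> s' i y" if y: "y \<in> arch_field (\<nu> i)" for y
    proof (cases "i = i0")
      case True then show ?thesis using s1(2) x y by (simp add: s'_def S_def)
    next
      case False
      then have iI: "i \<in> I" using i by simp
      note cx = sc[OF iI x] and cy = sc[OF iI y]
      have "s1 (p i0 (s i x) + p i0 (s i y)) = s1 (p i0 (s i x)) \<oplus> s1 (p i0 (s i y))" by (rule s1(2)[OF cx(3) cy(3)])
      then show ?thesis using False cx cy s1c[OF cx(3)] s1c[OF cy(3)] sectD(3)[OF s iI x y]
        by (simp add: s'_def p_add w(1) a_minus_def minus_add a_ac)
    qed
    show "s' i (\<nu> i \<beta> * x) = \<beta> \<odot> s' i x" for \<beta>
    proof (cases "i = i0")
      case True then show ?thesis using s1(3) x by (simp add: s'_def S_def)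
    next
      case False
      then have iI: "i \<in> I" using i by simp
      note cx = sc[OF iI x]
      show ?thesis using False cx s1c[OF cx(3)] sectD(4)[OF s iI x] s1(3)[OF cx(3)]
        by (simp add: s'_def p_smult w(1) a_minus_def smult_r_distr smult_neg)
    qed
    show "p j (s' i x) = (if j = i then x else 0)" if j: "j \<in> insert i0 I" for j
    proof (cases "i = i0")
      case True
      then have xS: "x \<in> S" using x by (simp add: S_def)
      show ?thesis using True j s1(5)[OF xS] s1p[OF xS] by (auto simp: s'_def)
    next
      case False
      then have iI: "i \<in> I" using i by simp
      note cx = sc[OF iI x]
      have jn: "j < n" using j I w(1) by auto
      have "p j (s' i x) = p j (s i x) - p j (s1 (p i0 (s i x)))"
        using False p_minus[OF jn cx(2) s1c[OF cx(3)]] by (simp add: s'_def)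
      moreover have "p j (s1 (p i0 (s i x))) = (if j = i0 then p i0 (s i x) else 0)"
        using s1(5)[OF cx(3)] s1p[OF cx(3)] j by auto
      ultimately show ?thesis using j False sectD(5)[OF s iI x] i0I by auto
    qed
  qed
  then show ?thesis using w(1) i0I by blast
qed

text \<open>Only finitely many \<open>I\<close> are available. At a maximal one
  \<open>extend_section\<close> cannot apply, which says that nonzero archimedean values of
  \<open>lat I\<close> stay away from 0.\<close>

lemma maximal_section:
  obtains I s e where "I \<subseteq> {..<n}" "sect I s" "e > 0"
    "\<forall>x\<in>lat I. (\<forall>i<n. cmod (p i x) < e) \<longrightarrow> (\<forall>i<n. p i x = 0)"
proof -
  define \<I> where "\<I> = {I. I \<subseteq> {..<n} \<and> (\<exists>s. sect I s)}"
  have "finite \<I>" by (rule finite_subset[of _ "Pow {..<n}"]) (auto simp: \<I>_def)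
  moreover have "{} \<in> \<I>" by (auto simp: \<I>_def sect_def)
  ultimately obtain I where I: "I \<in> \<I>" "\<And>J. J \<in> \<I> \<Longrightarrow> I \<subseteq> J \<Longrightarrow> I = J"
    using finite_has_maximal[of \<I>] by blast
  then obtain s where s: "I \<subseteq> {..<n}" "sect I s" by (auto simp: \<I>_def)
  have "\<not> (\<forall>e>0. \<exists>x\<in>lat I. (\<exists>i<n. p i x \<noteq> 0) \<and> (\<forall>i<n. cmod (p i x) < e))"
  proof
    assume "\<forall>e>0. \<exists>x\<in>lat I. (\<exists>i<n. p i x \<noteq> 0) \<and> (\<forall>i<n. cmod (p i x) < e)"
    from extend_section[OF s this] obtain i s' where "i < n" "i \<notin> I" "sect (insert i I) s'" by blast
    then have "insert i I \<in> \<I>" using s by (auto simp: \<I>_def)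
    from I(2)[OF this] \<open>i \<notin> I\<close> show False by blast
  qed
  then obtain e where e: "e > 0" "\<And>x. x \<in> lat I \<Longrightarrow> (\<exists>i<n. p i x \<noteq> 0) \<Longrightarrow> \<not> (\<forall>i<n. cmod (p i x) < e)" by blast
  show ?thesis by (rule that[OF s e(1)]) (use e(2) in blast)
qed

section \<open>Finite generation modulo the adelic part\<close>

lemma dd_spanning:
  obtains B where "finite B" "B \<subseteq> ker0 I" "\<forall>x\<in>ker0 I. \<exists>c. dd x = (\<Oplus>\<^bsub>Dm\<^esub>b\<in>B. c b \<odot>\<^bsub>Dm\<^esub> dd b)"
proof -
  obtain E where E: "finite E" "E \<subseteq> carrier Dm" "\<forall>x\<in>carrier Dm. \<exists>c. x = (\<Oplus>\<^bsub>Dm\<^esub>b\<in>E. c b \<odot>\<^bsub>Dm\<^esub> b)"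
    using Dm(2) by (auto simp: finite_dim_discrete_def)
  have kc: "x \<in> carrier G" if "x \<in> ker0 I" for x using that Kc by (auto simp: ker0_def)
  \<comment> \<open>\<open>\<kappa>\<close> is a mere choice of coefficients, not a linear map,
    since \<open>E\<close> may be dependent; \<open>finite_coordinate_spanning\<close> allows
    arbitrary coordinate functions.\<close>
  from bchoice[OF E(3)] obtain \<kappa> where \<kappa>: "\<And>x. x \<in> carrier Dm \<Longrightarrow> x = (\<Oplus>\<^bsub>Dm\<^esub>b\<in>E. \<kappa> x b \<odot>\<^bsub>Dm\<^esub> b)" by blast
  obtain B where B: "finite B" "B \<subseteq> ker0 I" "\<And>x. x \<in> ker0 I \<Longrightarrow> \<exists>c. \<forall>j\<in>E. \<kappa> (dd x) j = (\<Sum>b\<in>B. c b * \<kappa> (dd b) j)"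
    using finite_coordinate_spanning[OF E(1), of "ker0 I" "\<lambda>j x. \<kappa> (dd x) j"] by blast
  have "\<exists>c. dd x = (\<Oplus>\<^bsub>Dm\<^esub>b\<in>B. c b \<odot>\<^bsub>Dm\<^esub> dd b)" if x: "x \<in> ker0 I" for x
  proof -
    obtain c where c: "\<And>j. j \<in> E \<Longrightarrow> \<kappa> (dd x) j = (\<Sum>b\<in>B. c b * \<kappa> (dd b) j)" using B(3)[OF x] by blast
    have Ec: "j \<in> carrier Dm" if "j \<in> E" for j using that E(2) by auto
    have Bc: "dd b \<in> carrier Dm" if "b \<in> B" for b using that B(2) kc dd_simps(1) by auto
    have "dd x = (\<Oplus>\<^bsub>Dm\<^esub>j\<in>E. \<kappa> (dd x) j \<odot>\<^bsub>Dm\<^esub> j)" by (rule \<kappa>) (use kc[OF x] dd_simps(1) in auto)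
    also have "\<dots> = (\<Oplus>\<^bsub>Dm\<^esub>j\<in>E. \<Oplus>\<^bsub>Dm\<^esub>b\<in>B. (c b * \<kappa> (dd b) j) \<odot>\<^bsub>Dm\<^esub> j)"
    proof (rule Dm.finsum_cong'[OF refl])
      show "(\<lambda>j. \<Oplus>\<^bsub>Dm\<^esub>b\<in>B. (c b * \<kappa> (dd b) j) \<odot>\<^bsub>Dm\<^esub> j) \<in> E \<rightarrow> carrier Dm" using Ec by (auto intro!: Dm.finsum_closed)
      show "\<kappa> (dd x) j \<odot>\<^bsub>Dm\<^esub> j = (\<Oplus>\<^bsub>Dm\<^esub>b\<in>B. (c b * \<kappa> (dd b) j) \<odot>\<^bsub>Dm\<^esub> j)" if "j \<in> E" for j
        unfolding c[OF that] by (rule Dm.sum_smult[OF Ec[OF that]])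
    qed
    also have "\<dots> = (\<Oplus>\<^bsub>Dm\<^esub>b\<in>B. \<Oplus>\<^bsub>Dm\<^esub>j\<in>E. (c b * \<kappa> (dd b) j) \<odot>\<^bsub>Dm\<^esub> j)"
      by (rule Dm.finsum_swap[OF E(1) B(1)]) (use Ec in auto)
    also have "\<dots> = (\<Oplus>\<^bsub>Dm\<^esub>b\<in>B. c b \<odot>\<^bsub>Dm\<^esub> dd b)"
    proof (rule Dm.finsum_cong'[OF refl])
      show "(\<lambda>b. c b \<odot>\<^bsub>Dm\<^esub> dd b) \<in> B \<rightarrow> carrier Dm" using Bc by auto
      fix b assume b: "b \<in> B"
      have "(\<Oplus>\<^bsub>Dm\<^esub>j\<in>E. (c b * \<kappa> (dd b) j) \<odot>\<^bsub>Dm\<^esub> j) = (\<Oplus>\<^bsub>Dm\<^esub>j\<in>E. c b \<odot>\<^bsub>Dm\<^esub> (\<kappa> (dd b) j \<odot>\<^bsub>Dm\<^esub> j))"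
        by (rule Dm.finsum_cong'[OF refl]) (use Ec in \<open>auto simp: Dm.smult_assoc\<close>)
      also have "\<dots> = c b \<odot>\<^bsub>Dm\<^esub> (\<Oplus>\<^bsub>Dm\<^esub>j\<in>E. \<kappa> (dd b) j \<odot>\<^bsub>Dm\<^esub> j)"
        by (rule Dm.smult_finsum[symmetric]) (use Ec in auto)
      also have "\<dots> = c b \<odot>\<^bsub>Dm\<^esub> dd b" using \<kappa>[OF Bc[OF b]] by simp
      finally show "(\<Oplus>\<^bsub>Dm\<^esub>j\<in>E. (c b * \<kappa> (dd b) j) \<odot>\<^bsub>Dm\<^esub> j) = c b \<odot>\<^bsub>Dm\<^esub> dd b" .
    qed
    finally show ?thesis by blast
  qed
  then show ?thesis by (intro that[OF B(1,2)]) blast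
qed

text \<open>Elements of \<open>lat I\<close> whose archimedean values differ by less than
  \<open>e\<close> have equal values, by \<open>disc\<close> applied to the difference. A finite
  subcover of the compact bounded part then leaves finitely many values.\<close>

lemma lat_finite_classes:
  assumes I: "I \<subseteq> {..<n}" and e: "e > 0"
    and disc: "\<forall>x\<in>lat I. (\<forall>i<n. cmod (p i x) < e) \<longrightarrow> (\<forall>i<n. p i x = 0)"
  obtains B where "finite B" "B \<subseteq> lat I"
    "\<forall>x\<in>lat I. (\<forall>i<n. cmod (p i x) \<le> R) \<longrightarrow> (\<exists>b\<in>B. \<forall>i<n. p i x = p i b)"
proof -
  note sub = subgpD[OF lat_subgp[OF I]]
  have latc: "x \<in> carrier G" if "x \<in> lat I" for x using sub(1) that by auto
  define Z where "Z = lat I \<inter> {x \<in> carrier G. \<forall>i<n. cmod (p i x) \<le> R}"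
  have Z: "compactin (topo G) Z" unfolding Z_def
  proof (rule lat_compact[OF I])
    show "closedin (topo G) (lat I \<inter> {x \<in> carrier G. \<forall>i<n. cmod (p i x) \<le> R})"
      by (intro closedin_Int lat_closed I p_cball_closed) simp
  qed auto
  define U where "U b = {x \<in> carrier G. \<forall>i<n. cmod (p i x - p i b) < e}" for b
  have "openin (topo G) V" if "V \<in> U ` Z" for V using that p_ball_open[of n] by (auto simp: U_def)
  moreover have "Z \<subseteq> \<Union>(U ` Z)"
  proof
    fix x assume x: "x \<in> Z"
    then have "x \<in> U x" using e by (auto simp: U_def Z_def)
    then show "x \<in> \<Union>(U ` Z)" using x by blast
  qed
  ultimately obtain \<F> where \<F>: "finite \<F>" "\<F> \<subseteq> U ` Z" "Z \<subseteq> \<Union>\<F>"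
    using Z unfolding compactin_def by meson
  then obtain B where B: "finite B" "B \<subseteq> Z" "\<F> = U ` B" by (meson finite_subset_image)
  show ?thesis
  proof (rule that[OF B(1)])
    show "B \<subseteq> lat I" using B(2) by (auto simp: Z_def)
    show "\<forall>x\<in>lat I. (\<forall>i<n. cmod (p i x) \<le> R) \<longrightarrow> (\<exists>b\<in>B. \<forall>i<n. p i x = p i b)"
    proof (intro ballI impI)
    fix x assume x: "x \<in> lat I" "\<forall>i<n. cmod (p i x) \<le> R"
    then have "x \<in> Z" using latc by (auto simp: Z_def)
    then obtain b where b: "b \<in> B" "x \<in> U b" using \<F>(3) B(3) by auto
    have bl: "b \<in> lat I" using b(1) B(2) by (auto simp: Z_def)
    have "p i (x \<ominus> b) = 0" if "i < n" for i
      by (rule disc[rule_format, OF sub(3)[OF x(1) bl] _ that]) (use b(2) latc[OF x(1)] latc[OF bl] in \<open>auto simp: p_minus U_def\<close>)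
    then have "p i x = p i b" if "i < n" for i using p_minus[OF that latc[OF x(1)] latc[OF bl]] that by auto
    then show "\<exists>b\<in>B. \<forall>i<n. p i x = p i b" using b(1) by blast
    qed
  qed
qed

text \<open>The argument that discrete subgroups of real vector spaces are finitely generated: after
  subtracting integer parts with respect to a real spanning set taken from \<open>lat I\<close>,
  only bounded elements remain, and these have finitely many archimedean values. Elements with equal
  values differ by an element of \<open>adel\<close>.\<close>

lemma lat_generated:
  assumes I: "I \<subseteq> {..<n}" and e: "e > 0"
    and disc: "\<forall>x\<in>lat I. (\<forall>i<n. cmod (p i x) < e) \<longrightarrow> (\<forall>i<n. p i x = 0)"
  obtains B where "finite B" "B \<subseteq> lat I" "\<forall>S. fsub S \<longrightarrow> B \<subseteq> S \<longrightarrow> adel \<subseteq> S \<longrightarrow> lat I \<subseteq> S"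
proof -
  note sub = subgpD[OF lat_subgp[OF I]]
  have latc: "x \<in> carrier G" if "x \<in> lat I" for x using sub(1) that by auto
  \<comment> \<open>Real and imaginary parts are separated so that the coefficients \<open>c\<close>
    are real and have integer parts.\<close>
  define q where "q j x = (if snd j then Re (p (fst j) x) else Im (p (fst j) x))" for j :: "nat \<times> bool" and x
  obtain B2 where B2: "finite B2" "B2 \<subseteq> lat I"
    "\<And>x. x \<in> lat I \<Longrightarrow> \<exists>c. \<forall>j\<in>{..<n} \<times> UNIV. q j x = (\<Sum>b\<in>B2. c b * q j b)"
    using finite_coordinate_spanning[of "{..<n} \<times> (UNIV :: bool set)" "lat I" q] by auto
  \<comment> \<open>Bounds every coordinate of every combination of \<open>B2\<close> with
    coefficients between 0 and 1.\<close>
  define R where "R = (\<Sum>i<n. \<Sum>b\<in>B2. cmod (p i b))"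
  obtain B3 where B3: "finite B3" "B3 \<subseteq> lat I"
    "\<forall>x\<in>lat I. (\<forall>i<n. cmod (p i x) \<le> R) \<longrightarrow> (\<exists>b\<in>B3. \<forall>i<n. p i x = p i b)"
    by (rule lat_finite_classes[OF I e disc, of R]) (rule that; assumption)
  show ?thesis
  proof (rule that[of "B2 \<union> B3"])
    show "\<forall>S. fsub S \<longrightarrow> B2 \<union> B3 \<subseteq> S \<longrightarrow> adel \<subseteq> S \<longrightarrow> lat I \<subseteq> S"
    proof (intro allI impI subsetI)
      fix S assume S: "fsub S" "B2 \<union> B3 \<subseteq> S" "adel \<subseteq> S"
      note Ss = fsubD[OF S(1)]
      fix x assume x: "x \<in> lat I"
      obtain c where c: "\<And>j. j \<in> {..<n} \<times> UNIV \<Longrightarrow> q j x = (\<Sum>b\<in>B2. c b * q j b)" using B2(3)[OF x] by blast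
      have px: "p i x = (\<Sum>b\<in>B2. of_real (c b) * p i b)" if "i < n" for i
        using c[of "(i, True)"] c[of "(i, False)"] that by (simp add: q_def complex_eq_iff)
      define f where "f b = of_int \<lfloor>c b\<rfloor> \<odot> b" for b
      have fl: "f b \<in> lat I" if "b \<in> B2" for b unfolding f_def by (rule lat_int[OF I]) (use that B2 in auto)
      have fsum: "(\<Oplus>b\<in>A. f b) \<in> lat I \<and> (\<forall>i<n. p i (\<Oplus>b\<in>A. f b) = (\<Sum>b\<in>A. of_int \<lfloor>c b\<rfloor> * p i b))"
        if "finite A" "A \<subseteq> B2" for A
        using that
      proof (induction A rule: finite_induct)
        case empty
        then show ?case using sub(2) by (simp add: p_zero)
      next
        case (insert a A)
        have a: "f a \<in> lat I" "a \<in> carrier G" using fl insert.prems B2(2) latc by auto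
        have IH: "(\<Oplus>b\<in>A. f b) \<in> lat I" "\<And>i. i < n \<Longrightarrow> p i (\<Oplus>b\<in>A. f b) = (\<Sum>b\<in>A. of_int \<lfloor>c b\<rfloor> * p i b)"
          using insert by auto
        have "(\<Oplus>b\<in>insert a A. f b) = f a \<oplus> (\<Oplus>b\<in>A. f b)"
          using insert fl latc by (subst finsum_insert) auto
        moreover have "p i (f a) = of_int \<lfloor>c a\<rfloor> * p i a" if "i < n" for i
          using that a(2) embedding_simps(6)[OF \<nu>[OF that]] by (simp add: f_def p_smult)
        ultimately show ?case
          using sub(5)[OF a(1) IH(1)] IH(2) latc[OF a(1)] latc[OF IH(1)] insert.hyps by (simp add: p_add)
      qed
      define y where "y = (\<Oplus>b\<in>B2. f b)"
      have y: "y \<in> lat I" "\<And>i. i < n \<Longrightarrow> p i y = (\<Sum>b\<in>B2. of_int \<lfloor>c b\<rfloor> * p i b)"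
        using fsum[OF B2(1)] by (auto simp: y_def)
      have yS: "y \<in> S" unfolding y_def f_def by (rule fsub_finsum[OF S(1)]) (use S(2) Ss(7) in auto)
      define z where "z = x \<ominus> y"
      have z: "z \<in> lat I" unfolding z_def by (rule sub(3)[OF x y(1)])
      have "cmod (p i z) \<le> R" if i: "i < n" for i
      proof -
        have "p i z = (\<Sum>b\<in>B2. (of_real (c b) - of_int \<lfloor>c b\<rfloor>) * p i b)"
          unfolding z_def using p_minus[OF i latc[OF x] latc[OF y(1)]] px[OF i] y(2)[OF i]
          by (simp add: sum_subtractf left_diff_distrib)
        also have "cmod \<dots> \<le> (\<Sum>b\<in>B2. cmod (p i b))"
        proof (rule sum_norm_le)
          fix b
          have "cmod (complex_of_real (c b) - of_int \<lfloor>c b\<rfloor>) = \<bar>c b - of_int \<lfloor>c b\<rfloor>\<bar>"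
            by (metis norm_of_real of_real_diff of_real_of_int_eq)
          also have "\<dots> \<le> 1" by linarith
          finally show "cmod ((complex_of_real (c b) - of_int \<lfloor>c b\<rfloor>) * p i b) \<le> cmod (p i b)"
            by (simp add: norm_mult mult_left_le_one_le)
        qed
        also have "\<dots> \<le> R" unfolding R_def using i by (intro member_le_sum) (auto intro: sum_nonneg)
        finally show ?thesis .
      qed
      then obtain b where b: "b \<in> B3" "\<forall>i<n. p i z = p i b" using B3(3) z by blast
      have bl: "b \<in> lat I" using b B3 by auto
      have "z \<ominus> b \<in> lat I" by (rule sub(3)[OF z bl])
      moreover have "\<forall>i<n. p i (z \<ominus> b) = 0" using b(2) latc[OF z] latc[OF bl] by (simp add: p_minus)
      ultimately have "z \<ominus> b \<in> adel" by (simp add: adel_def lat_def ker0_def)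
      then have zb: "z \<ominus> b \<in> S" "b \<in> S" "y \<in> S" using S b yS by auto
      have "x = (z \<ominus> b \<oplus> b) \<oplus> y"
        using latc[OF x] latc[OF y(1)] latc[OF z] latc[OF bl] by (simp add: z_def a_minus_def a_assoc l_neg)
      then show "x \<in> S" using Ss(6) zb by metis
    qed
  qed (use B2 B3 in auto)
qed

text \<open>Modulo \<open>adel\<close> the space \<open>ker0 I\<close> is finite-dimensional:
  subtract a lift of the \<open>dd\<close> value, multiply by an integer to bring the
  \<open>Hm\<close> coordinate into \<open>C\<close>, and use generators of \<open>lat I\<close>.
  The gap \<open>e\<close> around 0 makes \<open>adel\<close> open in \<open>ker0 I\<close>, so that
  an algebraic complement is automatically a topological one.\<close>

theorem closed_submodule_structure:
  obtains I s D E where "I \<subseteq> {..<n}" "sect I s" "fsub D" "D \<subseteq> ker0 I" "finite E" "E \<subseteq> D"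
    "\<forall>x\<in>D. \<exists>c. x = (\<Oplus>e\<in>E. c e \<odot> e)" "D \<inter> adel = {\<zero>}"
    "\<forall>x\<in>ker0 I. \<exists>d\<in>D. \<exists>y\<in>adel. x = d \<oplus> y"
    "openin (subtopology (topo G) (ker0 I)) adel"
proof -
  obtain I s e where I: "I \<subseteq> {..<n}" and s: "sect I s" and e: "e > 0"
    and disc: "\<forall>x\<in>lat I. (\<forall>i<n. cmod (p i x) < e) \<longrightarrow> (\<forall>i<n. p i x = 0)"
    by (rule maximal_section) (rule that; assumption)
  note F = ker0_fsub[OF I]
  note Fs = fsubD[OF F]
  have kc: "x \<in> carrier G" if "x \<in> ker0 I" for x using that Fs(2) by auto
  have latk: "lat I \<subseteq> ker0 I" by (auto simp: lat_def)
  have adk: "adel \<subseteq> ker0 I" using I by (auto simp: adel_def ker0_def)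
  obtain B1 where B1: "finite B1" "B1 \<subseteq> ker0 I" "\<forall>x\<in>ker0 I. \<exists>c. dd x = (\<Oplus>\<^bsub>Dm\<^esub>b\<in>B1. c b \<odot>\<^bsub>Dm\<^esub> dd b)"
    by (rule dd_spanning[of I]) (rule that; assumption)
  obtain B2 where B2: "finite B2" "B2 \<subseteq> lat I" "\<forall>S. fsub S \<longrightarrow> B2 \<subseteq> S \<longrightarrow> adel \<subseteq> S \<longrightarrow> lat I \<subseteq> S"
    by (rule lat_generated[OF I e disc]) (rule that; assumption)
  have gen: "ker0 I \<subseteq> S" if S: "fsub S" "B1 \<union> B2 \<subseteq> S" "adel \<subseteq> S" for S
  proof
    note Ss = fsubD[OF S(1)]
    fix x assume x: "x \<in> ker0 I"
    obtain c where c: "dd x = (\<Oplus>\<^bsub>Dm\<^esub>b\<in>B1. c b \<odot>\<^bsub>Dm\<^esub> dd b)" using B1(3) x by blast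
    \<comment> \<open>A combination of \<open>B1\<close> with the same \<open>dd\<close> value as
      \<open>x\<close>; the difference \<open>z\<close> has trivial discrete component.\<close>
    define y where "y = (\<Oplus>b\<in>B1. c b \<odot> b)"
    have yS: "y \<in> S" unfolding y_def by (rule fsub_finsum[OF S(1)]) (use S(2) Ss(7) in auto)
    have yk: "y \<in> ker0 I" unfolding y_def by (rule fsub_finsum[OF F]) (use B1(2) Fs(7) in auto)
    have ddsum: "dd (\<Oplus>b\<in>A. c b \<odot> b) = (\<Oplus>\<^bsub>Dm\<^esub>b\<in>A. c b \<odot>\<^bsub>Dm\<^esub> dd b)" if "finite A" "A \<subseteq> B1" for A
      using that
    proof (induction A rule: finite_induct)
      case empty then show ?case by (simp add: dd_zero)
    next
      case (insert a A)
      have cc: "b \<in> carrier G" "dd b \<in> carrier Dm" if "b \<in> insert a A" for b using that insert.prems B1(2) kc dd_simps(1) by auto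
      have 1: "(\<Oplus>b\<in>insert a A. c b \<odot> b) = c a \<odot> a \<oplus> (\<Oplus>b\<in>A. c b \<odot> b)"
        using insert.hyps cc by (subst finsum_insert) auto
      have 2: "(\<Oplus>\<^bsub>Dm\<^esub>b\<in>insert a A. c b \<odot>\<^bsub>Dm\<^esub> dd b) = c a \<odot>\<^bsub>Dm\<^esub> dd a \<oplus>\<^bsub>Dm\<^esub> (\<Oplus>\<^bsub>Dm\<^esub>b\<in>A. c b \<odot>\<^bsub>Dm\<^esub> dd b)"
        using insert.hyps cc by (subst Dm.finsum_insert) auto
      have "(\<Oplus>b\<in>A. c b \<odot> b) \<in> carrier G" using cc by (intro finsum_closed) auto
      then show ?case unfolding 1 2 using insert cc by (simp add: dd_simps)
    qed
    have "dd y = dd x" unfolding y_def c using ddsum[OF B1(1)] by simp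
    define z where "z = x \<ominus> y"
    have zk: "z \<in> ker0 I" unfolding z_def by (rule Fs(4)[OF x yk])
    have "dd z = dd x \<ominus>\<^bsub>Dm\<^esub> dd y" unfolding z_def by (rule dd_minus[OF kc[OF x] kc[OF yk]])
    then have ddz: "dd z = \<zero>\<^bsub>Dm\<^esub>" using \<open>dd y = dd x\<close> dd_simps(1)[OF kc[OF x]] by (simp add: a_minus_def Dm.r_neg)
    have "h z \<in> carrier Hm" by (rule h_simps(1)[OF kc[OF zk]])
    \<comment> \<open>Multiplication by \<open>m\<close> moves the \<open>Hm\<close> coordinate into
      \<open>C\<close>; dividing by \<open>m\<close> afterwards stays in \<open>S\<close>, which is
      an \<open>F\<close>-subspace.\<close>
    then obtain m u where m: "m \<ge> (1::nat)" "u \<in> C" "h z = (1 / of_nat m) \<odot>\<^bsub>Hm\<^esub> u" unfolding HC by auto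
    have "h (of_nat m \<odot> z) = of_nat m \<odot>\<^bsub>Hm\<^esub> ((1 / of_nat m) \<odot>\<^bsub>Hm\<^esub> u)"
      using h_simps(3)[OF kc[OF zk]] m(3) by simp
    also have "\<dots> = u" using m cC[OF m(2)] by (simp add: Hm.smult_assoc[symmetric])
    finally have "h (of_nat m \<odot> z) \<in> C" using m(2) by simp
    moreover have "dd (of_nat m \<odot> z) = \<zero>\<^bsub>Dm\<^esub>" using dd_simps(3)[OF kc[OF zk]] ddz by simp
    ultimately have "of_nat m \<odot> z \<in> lat I" using Fs(7)[OF zk] by (simp add: lat_def)
    then have "of_nat m \<odot> z \<in> S" using B2(3) S by blast
    then have "inverse (of_nat m) \<odot> (of_nat m \<odot> z) \<in> S" by (rule Ss(7))
    moreover have "inverse (of_nat m) \<odot> (of_nat m \<odot> z) = z" using m kc[OF zk] by (simp add: smult_assoc[symmetric])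
    ultimately have "z \<oplus> y \<in> S" using Ss(6) yS by simp
    moreover have "z \<oplus> y = x" unfolding z_def using kc[OF x] kc[OF yk] by (simp add: a_minus_def a_assoc l_neg)
    ultimately show "x \<in> S" by simp
  qed
  obtain D E where DE: "fsub D" "D \<subseteq> ker0 I" "finite E" "E \<subseteq> D" "\<And>x. x \<in> D \<Longrightarrow> \<exists>c. x = (\<Oplus>e\<in>E. c e \<odot> e)" "D \<inter> adel = {\<zero>}"
     "\<And>x. x \<in> ker0 I \<Longrightarrow> \<exists>d\<in>D. \<exists>y\<in>adel. x = d \<oplus> y"
  proof (rule complement_finite[OF adel_fsub F adk, of "B1 \<union> B2"])
    show "ker0 I \<subseteq> S" if "fsub S" "B1 \<union> B2 \<subseteq> S" "adel \<subseteq> S" for S by (rule gen[OF that])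
  qed (use B1 B2 latk in auto)
  have "openin (subtopology (topo G) (ker0 I)) adel"
  proof (rule openin_subopen[THEN iffD2], intro ballI)
    fix x assume x: "x \<in> adel"
    have xc: "x \<in> carrier G" using x Kc by (auto simp: adel_def)
    \<comment> \<open>Elements of \<open>ker0 I\<close> in this neighbourhood of
      \<open>\<zero>\<close> lie in \<open>lat I\<close> with archimedean values below the gap
      \<open>e\<close>, hence in \<open>adel\<close>.\<close>
    define N where "N = {y \<in> carrier G. h y \<in> C} \<inter> {y \<in> carrier G. dd y = \<zero>\<^bsub>Dm\<^esub>} \<inter> {y \<in> carrier G. \<forall>i<n. cmod (p i y - 0) < e}"
    have N: "openin (topo G) N" unfolding N_def by (intro openin_Int h_C_clopen dd_ker_clopen p_ball_open) simp
    define V where "V = {y \<in> topspace (topo G). y \<ominus> x \<in> N}"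
    have V: "openin (topo G) V" unfolding V_def
      by (rule openin_continuous_map_preimage[OF _ N], rule minus_cont') (use xc topspace_T in auto)
    have xV: "x \<in> V" using xc e C_closed(1) by (simp add: V_def N_def topspace_T a_minus_def r_neg h_zero dd_zero p_zero)
    have "V \<inter> ker0 I \<subseteq> adel"
    proof
      fix y assume y: "y \<in> V \<inter> ker0 I"
      have yx: "y \<ominus> x \<in> ker0 I" using Fs(4) y x adk by blast
      then have yl: "y \<ominus> x \<in> lat I" using y by (simp add: lat_def V_def N_def)
      have "\<forall>i<n. cmod (p i (y \<ominus> x)) < e" using y by (simp add: V_def N_def)
      then have "\<forall>i<n. p i (y \<ominus> x) = 0" by (rule mp[OF bspec[OF disc yl]])
      then have "y \<ominus> x \<in> adel" using yl by (simp add: adel_def lat_def ker0_def)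
      from fsubD(6)[OF adel_fsub this x] have "y \<ominus> x \<oplus> x \<in> adel" .
      moreover have "y \<ominus> x \<oplus> x = y" using xc kc y by (simp add: a_minus_def a_assoc l_neg)
      ultimately show "y \<in> adel" by simp
    qed
    moreover have "openin (subtopology (topo G) (ker0 I)) (V \<inter> ker0 I)" using V by (auto simp: openin_subtopology)
    ultimately show "\<exists>W. openin (subtopology (topo G) (ker0 I)) W \<and> x \<in> W \<and> W \<subseteq> adel"
      using xV x adk by blast
  qed
  moreover have "\<forall>x\<in>D. \<exists>c. x = (\<Oplus>e\<in>E. c e \<odot> e)" "\<forall>x\<in>ker0 I. \<exists>d\<in>D. \<exists>y\<in>adel. x = d \<oplus> y"
    using DE(5,7) by blast+
  ultimately show ?thesis by (intro that[OF I s DE(1-4) _ DE(6)])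
qed

end

section \<open>Kernels\<close>

lemma direct_sum_simps [simp]:
  "carrier (direct_sum G H) = carrier G \<times> carrier H"
  "\<zero>\<^bsub>direct_sum G H\<^esub> = (\<zero>\<^bsub>G\<^esub>, \<zero>\<^bsub>H\<^esub>)"
  "u \<oplus>\<^bsub>direct_sum G H\<^esub> v = (fst u \<oplus>\<^bsub>G\<^esub> fst v, snd u \<oplus>\<^bsub>H\<^esub> snd v)"
  "\<alpha> \<odot>\<^bsub>direct_sum G H\<^esub> u = (\<alpha> \<odot>\<^bsub>G\<^esub> fst u, \<alpha> \<odot>\<^bsub>H\<^esub> snd u)"
  "topo (direct_sum G H) = prod_topology (topo G) (topo H)"
  by (auto simp: direct_sum_def split_beta)

lemma arch_module_simps [simp]:
  "carrier (arch_module \<nu>) = arch_field \<nu>" "\<zero>\<^bsub>arch_module \<nu>\<^esub> = 0" "x \<oplus>\<^bsub>arch_module \<nu>\<^esub> y = x + y"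
  "\<alpha> \<odot>\<^bsub>arch_module \<nu>\<^esub> x = \<nu> \<alpha> * x" "topo (arch_module \<nu>) = top_of_set (arch_field \<nu>)"
  by (auto simp: arch_module_def arch_field_def Let_def)

lemma list_direct_sum_simps [simp]:
  "carrier (list_direct_sum Gs) = (\<Pi>\<^sub>E i\<in>{..<length Gs}. carrier (Gs ! i))"
  "\<zero>\<^bsub>list_direct_sum Gs\<^esub> = (\<lambda>i\<in>{..<length Gs}. \<zero>\<^bsub>Gs ! i\<^esub>)"
  "u \<oplus>\<^bsub>list_direct_sum Gs\<^esub> v = (\<lambda>i\<in>{..<length Gs}. u i \<oplus>\<^bsub>Gs ! i\<^esub> v i)"
  "\<alpha> \<odot>\<^bsub>list_direct_sum Gs\<^esub> u = (\<lambda>i\<in>{..<length Gs}. \<alpha> \<odot>\<^bsub>Gs ! i\<^esub> u i)"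
  "topo (list_direct_sum Gs) = product_topology (\<lambda>i. topo (Gs ! i)) {..<length Gs}"
  by (auto simp: list_direct_sum_def Let_def)

text \<open>For the zero set of a morphism this is exactly \<open>lca_kernel\<close>.\<close>

definition submod :: "('f::field_char_0, 'a) topmod \<Rightarrow> 'a set \<Rightarrow> ('f, 'a) topmod" where
  "submod G S = G\<lparr>carrier := S, topo := subtopology (topo G) S\<rparr>"

lemma submod_simps [simp]:
  "carrier (submod G S) = S" "\<zero>\<^bsub>submod G S\<^esub> = \<zero>\<^bsub>G\<^esub>" "x \<oplus>\<^bsub>submod G S\<^esub> y = x \<oplus>\<^bsub>G\<^esub> y"
  "\<alpha> \<odot>\<^bsub>submod G S\<^esub> x = \<alpha> \<odot>\<^bsub>G\<^esub> x" "topo (submod G S) = subtopology (topo G) S"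
  by (simp_all add: submod_def)

lemma (in abelian_group) add_cancel_middle:
  "a \<in> carrier G \<Longrightarrow> b \<in> carrier G \<Longrightarrow> c \<in> carrier G \<Longrightarrow> a \<oplus> b \<oplus> (\<ominus> b \<oplus> c) = a \<oplus> c"
  by (simp add: a_assoc r_neg2)

lemma (in abelian_group) add_minus_cancel_left:
  "a \<in> carrier G \<Longrightarrow> b \<in> carrier G \<Longrightarrow> a \<oplus> b \<ominus> a = b"
  by (simp add: a_minus_def a_comm[of a b] a_assoc r_neg)

section \<open>Closed submodules as objects, and internal direct sums\<close>

context lca
begin

lemma submod_abelian_group: assumes "subgp S" shows "abelian_group (submod G S)"
proof (rule abelian_groupI)
  note Ss = subgpD[OF assms]
  have c: "x \<in> carrier G" if "x \<in> S" for x using that Ss(1) by auto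
  fix x assume "x \<in> carrier (submod G S)"
  then show "\<exists>y\<in>carrier (submod G S). y \<oplus>\<^bsub>submod G S\<^esub> x = \<zero>\<^bsub>submod G S\<^esub>"
    using Ss(4)[of x] c l_neg by auto
qed (use subgpD[OF assms] in \<open>auto simp: a_ac subset_iff\<close>)

text \<open>The inverse in a record is selected inside its carrier, so it has to be identified again
  after the carrier shrinks.\<close>

lemma submod_neg: assumes "subgp S" "x \<in> S" shows "\<ominus>\<^bsub>submod G S\<^esub> x = \<ominus> x"
proof -
  interpret S: abelian_group "submod G S" by (rule submod_abelian_group[OF assms(1)])
  have "x \<in> carrier G" using assms subgpD(1) by auto
  then have "\<ominus> x \<oplus>\<^bsub>submod G S\<^esub> x = \<zero>\<^bsub>submod G S\<^esub>" by (simp add: l_neg)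
  then show ?thesis using S.minus_equality[of "\<ominus> x" x] assms subgpD(4)[OF assms] by simp
qed

lemma submod_module: assumes "fsub S" shows "Module.module (field_rec :: 'f ring) (submod G S)"
proof (rule moduleI)
  note Ss = fsubD[OF assms]
  have c: "x \<in> carrier G" if "x \<in> S" for x using that Ss(2) by auto
  show "cring (field_rec :: 'f ring)" by (rule cring_from_type_algebra)
  show "abelian_group (submod G S)" by (rule submod_abelian_group[OF Ss(1)])
  show "a \<odot>\<^bsub>submod G S\<^esub> x \<in> carrier (submod G S)" if "x \<in> carrier (submod G S)" for a x
    using that Ss(7) by simp
  show "(a \<oplus>\<^bsub>field_rec\<^esub> b) \<odot>\<^bsub>submod G S\<^esub> x = a \<odot>\<^bsub>submod G S\<^esub> x \<oplus>\<^bsub>submod G S\<^esub> b \<odot>\<^bsub>submod G S\<^esub> x"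
    if "x \<in> carrier (submod G S)" for a b x using that c by (simp add: smult_l_distr)
  show "a \<odot>\<^bsub>submod G S\<^esub> (x \<oplus>\<^bsub>submod G S\<^esub> y) = a \<odot>\<^bsub>submod G S\<^esub> x \<oplus>\<^bsub>submod G S\<^esub> a \<odot>\<^bsub>submod G S\<^esub> y"
    if "x \<in> carrier (submod G S)" "y \<in> carrier (submod G S)" for a x y using that c by (simp add: smult_r_distr)
  show "(a \<otimes>\<^bsub>field_rec\<^esub> b) \<odot>\<^bsub>submod G S\<^esub> x = a \<odot>\<^bsub>submod G S\<^esub> (b \<odot>\<^bsub>submod G S\<^esub> x)"
    if "x \<in> carrier (submod G S)" for a b x using that c by (simp add: smult_assoc)
  show "\<one>\<^bsub>(field_rec :: 'f ring)\<^esub> \<odot>\<^bsub>submod G S\<^esub> x = x" if "x \<in> carrier (submod G S)" for x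
    using that c by simp
qed

lemma submod_lca: assumes S: "fsub S" "closedin (topo G) S" shows "lca_object (submod G S)"
proof -
  note Ss = fsubD[OF S(1)]
  have t: "topspace (topo (submod G S)) = S" using Ss(2) by (auto simp: topspace_T)
  have add: "continuous_map (prod_topology (topo (submod G S)) (topo (submod G S))) (topo (submod G S)) (\<lambda>(x, y). x \<oplus>\<^bsub>submod G S\<^esub> y)"
    unfolding submod_simps
  proof (rule continuous_map_into_subtopology)
    show "continuous_map (prod_topology (subtopology (topo G) S) (subtopology (topo G) S)) (topo G) (\<lambda>(x, y). x \<oplus> y)"
      unfolding prod_topology_subtopology by (intro continuous_map_from_subtopology add_cont)
  qed (use Ss(6) in auto)
  have neg: "continuous_map (topo (submod G S)) (topo (submod G S)) (\<lambda>x. \<ominus>\<^bsub>submod G S\<^esub> x)"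
  proof (rule continuous_map_eq[of _ _ "\<lambda>x. \<ominus> x"])
    show "continuous_map (topo (submod G S)) (topo (submod G S)) (\<lambda>x. \<ominus> x)"
      unfolding submod_simps
      by (rule continuous_map_into_subtopology) (use Ss(5) in \<open>auto intro!: continuous_map_from_subtopology neg_cont\<close>)
  qed (use submod_neg[OF Ss(1)] in auto)
  have sm: "continuous_map (topo (submod G S)) (topo (submod G S)) (\<lambda>x. \<alpha> \<odot>\<^bsub>submod G S\<^esub> x)" for \<alpha>
    unfolding submod_simps
    by (rule continuous_map_into_subtopology) (use Ss(7) in \<open>auto intro!: continuous_map_from_subtopology smult_cont\<close>)
  have "locally_compact_space (topo G)" using lca by (simp add: lca_object_def)
  then have lc: "locally_compact_space (topo (submod G S))"
    unfolding submod_simps using S(2) by (rule locally_compact_space_closed_subset)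
  have T2: "Hausdorff_space (topo (submod G S))"
    unfolding submod_simps by (rule Hausdorff_space_subtopology[OF hausdorff_T])
  show ?thesis unfolding lca_object_def
    by (intro conjI allI submod_module[OF S(1)] add neg sm lc T2) (use t in simp)
qed

lemma submod_finsum:
  assumes S: "fsub S" and "finite A" "\<And>i. i \<in> A \<Longrightarrow> f i \<in> S"
  shows "finsum (submod G S) f A = (\<Oplus>i\<in>A. f i)"
  using assms(2,3)
proof (induction A rule: finite_induct)
  case empty
  interpret S: abelian_group "submod G S" by (rule submod_abelian_group[OF fsubD(1)[OF S]])
  show ?case by simp
next
  case (insert a A)
  interpret S: abelian_group "submod G S" by (rule submod_abelian_group[OF fsubD(1)[OF S]])
  have c: "f i \<in> carrier G" if "i \<in> insert a A" for i using insert.prems[OF that] fsubD(2)[OF S] by auto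
  have "finsum (submod G S) f (insert a A) = f a \<oplus>\<^bsub>submod G S\<^esub> finsum (submod G S) f A"
    using insert by (intro S.finsum_insert) auto
  moreover have "(\<Oplus>i\<in>insert a A. f i) = f a \<oplus> (\<Oplus>i\<in>A. f i)"
    using insert.hyps c by (intro finsum_insert) auto
  ultimately show ?case using insert by simp
qed

text \<open>Only a continuous decomposition of each element is supplied. Linearity of
  \<open>a\<close> and \<open>b\<close> follows from uniqueness of the decomposition, as
  \<open>A\<close> and \<open>B\<close> meet in zero.\<close>

lemma internal_direct_sum:
  assumes X: "fsub Y" and A: "fsub A" "A \<subseteq> Y" and B: "fsub B" "B \<subseteq> Y"
    and ab: "\<And>x. x \<in> Y \<Longrightarrow> a x \<in> A" "\<And>x. x \<in> Y \<Longrightarrow> b x \<in> B" "\<And>x. x \<in> Y \<Longrightarrow> a x \<oplus> b x = x"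
    and AB: "A \<inter> B = {\<zero>}"
    and cont: "continuous_map (subtopology (topo G) Y) (topo G) a" "continuous_map (subtopology (topo G) Y) (topo G) b"
  shows "lca_isomorphic (submod G Y) (direct_sum (submod G A) (submod G B))"
proof -
  note Xs = fsubD[OF X] and As = fsubD[OF A(1)] and Bs = fsubD[OF B(1)]
  have ca: "x \<in> carrier G" if "x \<in> A" for x using that As(2) by auto
  have cb: "x \<in> carrier G" if "x \<in> B" for x using that Bs(2) by auto
  have uniq: "u = u' \<and> v = v'" if uv: "u \<in> A" "v \<in> B" "u' \<in> A" "v' \<in> B" "u \<oplus> v = u' \<oplus> v'" for u v u' v'
  proof -
    have c: "u \<in> carrier G" "v \<in> carrier G" "u' \<in> carrier G" "v' \<in> carrier G" using uv ca cb by auto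
    have "u \<ominus> u' = u \<oplus> v \<oplus> (\<ominus> v \<oplus> \<ominus> u')" using c by (simp add: a_minus_def add_cancel_middle)
    also have "\<dots> = v' \<oplus> u' \<oplus> (\<ominus> u' \<oplus> \<ominus> v)"
      unfolding uv(5) using c by (simp only: a_comm[of u' v'] a_comm[of "\<ominus> v" "\<ominus> u'"] a_inv_closed)
    also have "\<dots> = v' \<ominus> v" using c by (simp add: a_minus_def add_cancel_middle)
    finally have e: "u \<ominus> u' = v' \<ominus> v" .
    have "u \<ominus> u' \<in> A \<inter> B" using As(4)[OF uv(1,3)] Bs(4)[OF uv(4,2)] e by simp
    then have z: "u \<ominus> u' = \<zero>" "v' \<ominus> v = \<zero>" using AB e by auto
    have "u = u \<ominus> u' \<oplus> u'" "v' = v' \<ominus> v \<oplus> v" using c by (simp_all add: a_minus_def a_assoc l_neg)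
    then show ?thesis using z c by simp
  qed
  show ?thesis
    unfolding lca_isomorphic_def
  proof (intro exI conjI ballI)
    show "lca_morphism (submod G Y) (direct_sum (submod G A) (submod G B)) (\<lambda>x. (a x, b x))"
    proof (rule lca_morphismI)
      fix x y assume "x \<in> carrier (submod G Y)" "y \<in> carrier (submod G Y)"
      then have x: "x \<in> Y" and y: "y \<in> Y" by auto
      have "a (x \<oplus> y) = a x \<oplus> a y \<and> b (x \<oplus> y) = b x \<oplus> b y"
      proof (rule uniq)
        have "x \<oplus> y = (a x \<oplus> b x) \<oplus> (a y \<oplus> b y)" using ab(3) x y by simp
        also have "\<dots> = (a x \<oplus> a y) \<oplus> (b x \<oplus> b y)" using ab(1,2)[OF x] ab(1,2)[OF y] ca cb by (simp add: a_ac)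
        finally show "a (x \<oplus> y) \<oplus> b (x \<oplus> y) = (a x \<oplus> a y) \<oplus> (b x \<oplus> b y)" unfolding ab(3)[OF Xs(6)[OF x y]] .
      qed (use ab x y Xs(6) As(6) Bs(6) in auto)
      then show "(a (x \<oplus>\<^bsub>submod G Y\<^esub> y), b (x \<oplus>\<^bsub>submod G Y\<^esub> y)) = (a x, b x) \<oplus>\<^bsub>direct_sum (submod G A) (submod G B)\<^esub> (a y, b y)"
        by simp
    next
      fix \<alpha> x assume "x \<in> carrier (submod G Y)"
      then have x: "x \<in> Y" by auto
      have "a (\<alpha> \<odot> x) = \<alpha> \<odot> a x \<and> b (\<alpha> \<odot> x) = \<alpha> \<odot> b x"
      proof (rule uniq)
        have "\<alpha> \<odot> x = \<alpha> \<odot> (a x \<oplus> b x)" using ab(3) x by simp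
        also have "\<dots> = \<alpha> \<odot> a x \<oplus> \<alpha> \<odot> b x" using ab(1,2)[OF x] ca cb by (simp add: smult_r_distr)
        finally show "a (\<alpha> \<odot> x) \<oplus> b (\<alpha> \<odot> x) = \<alpha> \<odot> a x \<oplus> \<alpha> \<odot> b x" unfolding ab(3)[OF Xs(7)[OF x]] .
      qed (use ab x Xs(7) As(7) Bs(7) in auto)
      then show "(a (\<alpha> \<odot>\<^bsub>submod G Y\<^esub> x), b (\<alpha> \<odot>\<^bsub>submod G Y\<^esub> x)) = \<alpha> \<odot>\<^bsub>direct_sum (submod G A) (submod G B)\<^esub> (a x, b x)"
        by simp
    next
      show "continuous_map (topo (submod G Y)) (topo (direct_sum (submod G A) (submod G B))) (\<lambda>x. (a x, b x))"
        unfolding direct_sum_simps submod_simps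
        by (intro continuous_map_pairedI continuous_map_into_subtopology cont) (use ab in auto)
    qed (use ab in auto)
    show "lca_morphism (direct_sum (submod G A) (submod G B)) (submod G Y) (\<lambda>u. fst u \<oplus> snd u)"
    proof (rule lca_morphismI)
      show "continuous_map (topo (direct_sum (submod G A) (submod G B))) (topo (submod G Y)) (\<lambda>u. fst u \<oplus> snd u)"
        unfolding direct_sum_simps submod_simps
      proof (intro continuous_map_into_subtopology add_cont')
        show "continuous_map (prod_topology (subtopology (topo G) A) (subtopology (topo G) B)) (topo G) fst"
          using continuous_map_fst continuous_map_into_fulltopology by blast
        show "continuous_map (prod_topology (subtopology (topo G) A) (subtopology (topo G) B)) (topo G) snd"
          using continuous_map_snd continuous_map_into_fulltopology by blast
        show "(\<lambda>u. fst u \<oplus> snd u) \<in> topspace (prod_topology (subtopology (topo G) A) (subtopology (topo G) B)) \<rightarrow> Y"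
          using A(2) B(2) by (auto intro!: Xs(6))
      qed
    qed (use A(2) B(2) ca cb in \<open>auto simp: smult_r_distr a_ac intro!: Xs(6)\<close>)
    show "fst (a x, b x) \<oplus> snd (a x, b x) = x" if "x \<in> carrier (submod G Y)" for x
      using that ab(3) by simp
    fix y assume "y \<in> carrier (direct_sum (submod G A) (submod G B))"
    then obtain u v where y: "y = (u, v)" "u \<in> A" "v \<in> B" by auto
    have uvX: "u \<oplus> v \<in> Y" using y A(2) B(2) Xs(6) by auto
    have "a (u \<oplus> v) = u \<and> b (u \<oplus> v) = v"
      by (rule uniq[OF ab(1,2)[OF uvX] y(2,3)]) (rule ab(3)[OF uvX])
    then show "(a (fst y \<oplus> snd y), b (fst y \<oplus> snd y)) = y" using y by simp
  qed
qed

end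

lemma finite_dim_discrete_lca:
  assumes "finite_dim_discrete D" shows "lca_object D"
proof -
  have m: "Module.module field_rec D" and t: "topo D = discrete_topology (carrier D)"
    using assms by (auto simp: finite_dim_discrete_def)
  interpret M: Module.module field_rec D by (rule m)
  show ?thesis unfolding lca_object_def t
    using m by (auto simp: prod_topology_discrete_topology[symmetric] locally_compact_space_discrete_topology
        ring_of_type_algebra_def intro!: M.smult_closed)
qed

section \<open>Decomposition of a closed submodule\<close>

context lca_coords
begin

text \<open>\<open>K\<close> is the internal sum of the image of \<open>\<sigma>\<close>, of
  \<open>adel\<close> and of \<open>D\<close>. The first two form the quasi-adelic block
  \<open>Q\<close>, the third is the finite-dimensional discrete part.\<close>

theorem closed_submodule_qab_fd: "lca_qab_fd (submod G K)"
proof -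
  obtain I s D E where I: "I \<subseteq> {..<n}" and s: "sect I s" and DE: "fsub D" "D \<subseteq> ker0 I" "finite E" "E \<subseteq> D"
    "\<forall>x\<in>D. \<exists>c. x = (\<Oplus>e\<in>E. c e \<odot> e)" "D \<inter> adel = {\<zero>}"
    "\<forall>x\<in>ker0 I. \<exists>d\<in>D. \<exists>y\<in>adel. x = d \<oplus> y"
    and adopen: "openin (subtopology (topo G) (ker0 I)) adel"
    by (rule closed_submodule_structure) (rule that; assumption)
  note F = ker0_fsub[OF I]
  note Fs = fsubD[OF F] and Ks = fsubD[OF K(1)] and Ds = fsubD[OF DE(1)] and As = fsubD[OF adel_fsub]
  have kc: "x \<in> carrier G" if "x \<in> ker0 I" for x using that Fs(2) by auto
  have kK: "ker0 I \<subseteq> K" by (auto simp: ker0_def)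
  have adk: "adel \<subseteq> ker0 I" using I by (auto simp: adel_def ker0_def)
  define L where "L = sorted_list_of_set I"
  define m where "m = length L"
  have fI: "finite I" using I finite_subset by blast
  have LI: "set L = I" "distinct L" using fI by (auto simp: L_def)
  have LkI: "L ! k \<in> I" if "k < m" for k using that LI by (auto simp: m_def)
  have Lkn: "L ! k < n" if "k < m" for k using LkI[OF that] I by auto
  define V where "V = list_direct_sum (map arch_module (map \<nu> L))"
  have Vc: "carrier V = (\<Pi>\<^sub>E k\<in>{..<m}. arch_field (\<nu> (L ! k)))" unfolding V_def by (auto simp: m_def intro!: PiE_cong)
  have Vadd: "u \<oplus>\<^bsub>V\<^esub> v = (\<lambda>k\<in>{..<m}. u k + v k)" for u v by (auto simp: V_def m_def fun_eq_iff restrict_def)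
  have Vsm: "\<alpha> \<odot>\<^bsub>V\<^esub> u = (\<lambda>k\<in>{..<m}. \<nu> (L ! k) \<alpha> * u k)" for \<alpha> u by (auto simp: V_def m_def fun_eq_iff restrict_def)
  have Vt: "topo V = product_topology (\<lambda>k. topo (map arch_module (map \<nu> L) ! k)) {..<m}" by (simp add: V_def m_def)
  have Vtk: "topo (map arch_module (map \<nu> L) ! k) = top_of_set (arch_field (\<nu> (L ! k)))" if "k < m" for k
    using that by (simp add: m_def)
  \<comment> \<open>\<open>\<sigma>\<close> embeds the archimedean summand by the sections,
    \<open>\<rho>\<close> reads off the coordinates in \<open>I\<close>; \<open>\<rho>\<close> after
    \<open>\<sigma>\<close> is the identity.\<close>
  define \<sigma> where "\<sigma> v = (\<Oplus>k\<in>{..<m}. s (L ! k) (v k))" for v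
  define \<rho> where "\<rho> x = (\<lambda>k\<in>{..<m}. p (L ! k) x)" for x
  have sK: "s (L ! k) (v k) \<in> K" and sc: "s (L ! k) (v k) \<in> carrier G" if "v \<in> carrier V" "k < m" for v k
    using sectD(2)[OF s LkI[OF that(2)], of "v k"] that Kc by (auto simp: Vc)
  have \<sigma>K: "\<sigma> v \<in> K" if "v \<in> carrier V" for v unfolding \<sigma>_def by (rule fsub_finsum[OF K(1)]) (use sK[OF that] in auto)
  have \<sigma>c: "\<sigma> v \<in> carrier G" if "v \<in> carrier V" for v using \<sigma>K[OF that] Kc by blast
  have \<rho>V: "\<rho> x \<in> carrier V" if "x \<in> carrier G" for x using p_S[OF Lkn that] by (auto simp: \<rho>_def Vc)
  have \<sigma>add: "\<sigma> (u \<oplus>\<^bsub>V\<^esub> v) = \<sigma> u \<oplus> \<sigma> v" if uv: "u \<in> carrier V" "v \<in> carrier V" for u v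
  proof -
    have "\<sigma> (u \<oplus>\<^bsub>V\<^esub> v) = (\<Oplus>k\<in>{..<m}. s (L ! k) (u k) \<oplus> s (L ! k) (v k))"
      unfolding \<sigma>_def
    proof (rule finsum_cong'[OF refl])
      fix k assume "k \<in> {..<m}"
      then have k: "k < m" by simp
      then have "u k \<in> arch_field (\<nu> (L ! k))" "v k \<in> arch_field (\<nu> (L ! k))" using uv by (auto simp: Vc)
      then show "s (L ! k) ((u \<oplus>\<^bsub>V\<^esub> v) k) = s (L ! k) (u k) \<oplus> s (L ! k) (v k)"
        using sectD(3)[OF s LkI[OF k]] k by (simp add: Vadd)
    qed (use sc uv in auto)
    also have "\<dots> = \<sigma> u \<oplus> \<sigma> v" unfolding \<sigma>_def by (rule finsum_addf) (use sc uv in auto)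
    finally show ?thesis .
  qed
  have \<sigma>sm: "\<sigma> (\<alpha> \<odot>\<^bsub>V\<^esub> u) = \<alpha> \<odot> \<sigma> u" if u: "u \<in> carrier V" for u \<alpha>
  proof -
    have "\<sigma> (\<alpha> \<odot>\<^bsub>V\<^esub> u) = (\<Oplus>k\<in>{..<m}. \<alpha> \<odot> s (L ! k) (u k))"
      unfolding \<sigma>_def
    proof (rule finsum_cong'[OF refl])
      fix k assume "k \<in> {..<m}"
      then have k: "k < m" by simp
      then have "u k \<in> arch_field (\<nu> (L ! k))" using u by (auto simp: Vc)
      then show "s (L ! k) ((\<alpha> \<odot>\<^bsub>V\<^esub> u) k) = \<alpha> \<odot> s (L ! k) (u k)"
        using sectD(4)[OF s LkI[OF k]] k by (simp add: Vsm)
    qed (use sc u in auto)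
    also have "\<dots> = \<alpha> \<odot> \<sigma> u" unfolding \<sigma>_def by (rule smult_finsum[symmetric]) (use sc u in auto)
    finally show ?thesis .
  qed
  have \<sigma>cont: "continuous_map (topo V) (topo G) \<sigma>"
    unfolding \<sigma>_def[abs_def]
  proof (rule finsum_cont)
    fix k assume "k \<in> {..<m}"
    then have k: "k < m" by simp
    have "continuous_map (topo V) (topo (map arch_module (map \<nu> L) ! k)) (\<lambda>v. v k)"
      unfolding Vt using k by (intro continuous_map_product_projection) simp
    then have c: "continuous_map (topo V) (top_of_set (arch_field (\<nu> (L ! k)))) (\<lambda>v. v k)" unfolding Vtk[OF k] .
    from continuous_map_compose[OF c sectD(1)[OF s LkI[OF k]]]
    show "continuous_map (topo V) (topo G) (\<lambda>v. s (L ! k) (v k))" by (simp add: o_def)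
  qed simp
  have \<rho>cont: "continuous_map (topo G) (topo V) \<rho>"
    unfolding Vt continuous_map_componentwise
  proof (intro conjI ballI)
    fix k assume "k \<in> {..<m}"
    then have k: "k < m" by simp
    have "continuous_map (topo G) (top_of_set (arch_field (\<nu> (L ! k)))) (p (L ! k))"
      using p_cont[OF Lkn[OF k]] p_S[OF Lkn[OF k]] by (auto simp: continuous_map_in_subtopology topspace_T)
    then show "continuous_map (topo G) (topo (map arch_module (map \<nu> L) ! k)) (\<lambda>x. \<rho> x k)"
      unfolding Vtk[OF k] using k by (simp add: \<rho>_def)
  qed (auto simp: \<rho>_def)
  have \<rho>add: "\<rho> (x \<oplus> y) = \<rho> x \<oplus>\<^bsub>V\<^esub> \<rho> y" if "x \<in> carrier G" "y \<in> carrier G" for x y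
    using that by (auto simp: \<rho>_def Vadd fun_eq_iff restrict_def p_add Lkn)
  have \<rho>sm: "\<rho> (\<alpha> \<odot> x) = \<alpha> \<odot>\<^bsub>V\<^esub> \<rho> x" if "x \<in> carrier G" for x \<alpha>
    using that by (auto simp: \<rho>_def Vsm fun_eq_iff restrict_def p_smult Lkn)
  have p\<sigma>: "p (L ! j) (\<sigma> v) = v j" if v: "v \<in> carrier V" and j: "j < m" for v j
  proof -
    have "p (L ! j) (\<Oplus>k\<in>A. s (L ! k) (v k)) = (\<Sum>k\<in>A. p (L ! j) (s (L ! k) (v k)))" if "finite A" "A \<subseteq> {..<m}" for A
      using that
    proof (induction A rule: finite_induct)
      case empty then show ?case by (simp add: p_zero Lkn[OF j])
    next
      case (insert a A)
      have c: "s (L ! k) (v k) \<in> carrier G" if "k \<in> insert a A" for k using that insert.prems sc[OF v] by auto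
      have "(\<Oplus>k\<in>insert a A. s (L ! k) (v k)) = s (L ! a) (v a) \<oplus> (\<Oplus>k\<in>A. s (L ! k) (v k))"
        using insert.hyps c by (subst finsum_insert) auto
      moreover have "(\<Oplus>k\<in>A. s (L ! k) (v k)) \<in> carrier G" using c by (intro finsum_closed) auto
      ultimately show ?case using insert c by (simp add: p_add Lkn[OF j])
    qed
    from this[of "{..<m}"] have "p (L ! j) (\<sigma> v) = (\<Sum>k<m. p (L ! j) (s (L ! k) (v k)))" by (simp add: \<sigma>_def)
    also have "\<dots> = (\<Sum>k<m. if k = j then v k else 0)"
    proof (rule sum.cong[OF refl])
      fix k assume "k \<in> {..<m}"
      then have k: "k < m" by simp
      then have "v k \<in> arch_field (\<nu> (L ! k))" using v by (auto simp: Vc)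
      then have "p (L ! j) (s (L ! k) (v k)) = (if L ! j = L ! k then v k else 0)"
        using sectD(5)[OF s LkI[OF k] _ LkI[OF j]] by simp
      moreover have "L ! j = L ! k \<longleftrightarrow> k = j" using LI(2) k j by (auto simp: nth_eq_iff_index_eq m_def)
      ultimately show "p (L ! j) (s (L ! k) (v k)) = (if k = j then v k else 0)" by simp
    qed
    also have "\<dots> = v j" using j by simp
    finally show ?thesis .
  qed
  have V_arb: "v k = undefined" if "v \<in> carrier V" "\<not> k < m" for v k
    by (rule PiE_arb[OF that(1)[unfolded Vc]]) (use that(2) in simp)
  have \<rho>\<sigma>: "\<rho> (\<sigma> v) = v" if v: "v \<in> carrier V" for v
  proof
    fix k show "\<rho> (\<sigma> v) k = v k"
      using p\<sigma>[OF v, of k] V_arb[OF v, of k] by (cases "k < m") (simp_all add: \<rho>_def)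
  qed
  \<comment> \<open>On \<open>K\<close> this is the projection onto \<open>ker0 I\<close> along the
    image of \<open>\<sigma>\<close>.\<close>
  define \<pi> where "\<pi> x = x \<ominus> \<sigma> (\<rho> x)" for x
  have \<pi>k: "\<pi> x \<in> ker0 I" if x: "x \<in> K" for x
  proof -
    have xc: "x \<in> carrier G" by (rule Kc[OF x])
    have "p i (\<pi> x) = 0" if i: "i \<in> I" for i
    proof -
      obtain k where k: "k < m" "i = L ! k" using i LI by (metis in_set_conv_nth m_def)
      have "p i (\<pi> x) = p i x - p i (\<sigma> (\<rho> x))"
        unfolding \<pi>_def using I i xc \<sigma>c[OF \<rho>V[OF xc]] by (intro p_minus) auto
      also have "p i (\<sigma> (\<rho> x)) = p i x" using p\<sigma>[OF \<rho>V[OF xc] k(1)] k by (simp add: \<rho>_def)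
      finally show ?thesis by simp
    qed
    moreover have "\<pi> x \<in> K" unfolding \<pi>_def by (rule Ks(4)[OF x \<sigma>K[OF \<rho>V[OF xc]]])
    ultimately show ?thesis by (simp add: ker0_def)
  qed
  have \<pi>cont: "continuous_map (topo G) (topo G) \<pi>"
  proof -
    have "continuous_map (topo G) (topo G) (\<lambda>x. x \<ominus> \<sigma> (\<rho> x))"
      using continuous_map_compose[OF \<rho>cont \<sigma>cont] by (intro minus_cont') (simp_all add: o_def)
    then show ?thesis by (simp add: \<pi>_def[abs_def])
  qed
  have \<pi>add: "\<pi> (x \<oplus> y) = \<pi> x \<oplus> \<pi> y" if "x \<in> carrier G" "y \<in> carrier G" for x y
    using that \<sigma>c[OF \<rho>V[OF that(1)]] \<sigma>c[OF \<rho>V[OF that(2)]]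
    by (simp add: \<pi>_def \<rho>add \<sigma>add \<rho>V a_minus_def minus_add a_ac)
  have \<pi>sm: "\<pi> (\<alpha> \<odot> x) = \<alpha> \<odot> \<pi> x" if "x \<in> carrier G" for x \<alpha>
    using that \<sigma>c[OF \<rho>V[OF that]] by (simp add: \<pi>_def \<rho>sm \<sigma>sm \<rho>V a_minus_def smult_r_distr smult_neg)
  have V0: "\<zero>\<^bsub>V\<^esub> = (\<lambda>k\<in>{..<m}. 0)" by (auto simp: V_def m_def fun_eq_iff restrict_def)
  have V0c: "\<zero>\<^bsub>V\<^esub> \<in> carrier V" using arch_field_closed(2) by (auto simp: V0 Vc)
  have \<sigma>0: "\<sigma> \<zero>\<^bsub>V\<^esub> = \<zero>"
  proof -
    have "0 \<odot>\<^bsub>V\<^esub> \<zero>\<^bsub>V\<^esub> = \<zero>\<^bsub>V\<^esub>" by (auto simp: V0 Vsm fun_eq_iff restrict_def)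
    then show ?thesis using \<sigma>sm[OF V0c, of 0] \<sigma>c[OF V0c] by simp
  qed
  have \<rho>0: "\<rho> x = \<zero>\<^bsub>V\<^esub>" if "x \<in> ker0 I" for x using that LkI by (auto simp: \<rho>_def V0 ker0_def fun_eq_iff restrict_def)
  have \<pi>id: "\<pi> x = x" if "x \<in> ker0 I" for x using kc[OF that] by (simp add: \<pi>_def \<rho>0[OF that] \<sigma>0 a_minus_def minus_equality)
  have \<pi>\<sigma>: "\<pi> (\<sigma> v) = \<zero>" if "v \<in> carrier V" for v using \<sigma>c[OF that] by (simp add: \<pi>_def \<rho>\<sigma>[OF that] a_minus_def r_neg)
  have "\<forall>x\<in>ker0 I. \<exists>d. d \<in> D \<and> x \<ominus> d \<in> adel"
  proof
    fix x assume x: "x \<in> ker0 I"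
    obtain d y where dy: "d \<in> D" "y \<in> adel" "x = d \<oplus> y" using DE(7) x by blast
    have "d \<in> carrier G" "y \<in> carrier G" using dy Ds(2) As(2) by auto
    then have "x \<ominus> d = y" unfolding dy(3) by (rule add_minus_cancel_left)
    then show "\<exists>d. d \<in> D \<and> x \<ominus> d \<in> adel" using dy by blast
  qed
  \<comment> \<open>The component in \<open>D\<close> along \<open>adel\<close>. Its fibres are
    cosets of \<open>adel\<close>, which are open in \<open>ker0 I\<close>, so it is locally
    constant and therefore continuous.\<close>
  from bchoice[OF this] obtain \<delta> where \<delta>: "\<And>x. x \<in> ker0 I \<Longrightarrow> \<delta> x \<in> D" "\<And>x. x \<in> ker0 I \<Longrightarrow> x \<ominus> \<delta> x \<in> adel" by blast
  have \<delta>u: "\<delta> x = d" if x: "x \<in> ker0 I" and d: "d \<in> D" "x \<ominus> d \<in> adel" for x d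
  proof -
    have c: "x \<in> carrier G" "d \<in> carrier G" "\<delta> x \<in> carrier G" using kc[OF x] d \<delta>(1)[OF x] Ds(2) by auto
    have "(x \<ominus> d) \<ominus> (x \<ominus> \<delta> x) = \<ominus> d \<oplus> x \<oplus> (\<ominus> x \<oplus> \<delta> x)"
      using c by (simp add: a_minus_def minus_add a_comm[of x "\<ominus> d"])
    also have "\<dots> = \<delta> x \<ominus> d" 
      using c add_cancel_middle[of "\<ominus> d" x "\<delta> x"] a_comm[of "\<ominus> d" "\<delta> x"] by (simp add: a_minus_def)
    finally have "\<delta> x \<ominus> d = (x \<ominus> d) \<ominus> (x \<ominus> \<delta> x)" by simp
    then have "\<delta> x \<ominus> d \<in> D \<inter> adel" using As(4)[OF d(2) \<delta>(2)[OF x]] Ds(4)[OF \<delta>(1)[OF x] d(1)] by simp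
    then have "\<delta> x \<ominus> d = \<zero>" using DE(6) by auto
    moreover have "\<delta> x = \<delta> x \<ominus> d \<oplus> d" using c by (simp add: a_minus_def a_assoc l_neg)
    ultimately show ?thesis using c by simp
  qed
  have coset: "openin (subtopology (topo G) (ker0 I)) {x \<in> ker0 I. x \<ominus> d \<in> adel}" if d: "d \<in> D" for d
  proof -
    have tk: "topspace (subtopology (topo G) (ker0 I)) = ker0 I" using Fs(2) by (auto simp: topspace_T)
    have dk: "d \<in> ker0 I" using d DE(2) by auto
    have "continuous_map (subtopology (topo G) (ker0 I)) (subtopology (topo G) (ker0 I)) (\<lambda>x. x \<ominus> d)"
    proof (rule continuous_map_into_subtopology)
      show "continuous_map (subtopology (topo G) (ker0 I)) (topo G) (\<lambda>x. x \<ominus> d)"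
        by (intro continuous_map_from_subtopology minus_cont') (use kc[OF dk] topspace_T in auto)
    qed (use Fs(4)[OF _ dk] in auto)
    from openin_continuous_map_preimage[OF this adopen] show ?thesis unfolding tk .
  qed
  have \<delta>cont: "continuous_map (subtopology (topo G) (ker0 I)) (topo G) \<delta>"
    unfolding continuous_map_def
  proof (intro conjI allI impI)
    have tk: "topspace (subtopology (topo G) (ker0 I)) = ker0 I" using Fs(2) by (auto simp: topspace_T)
    show "\<delta> \<in> topspace (subtopology (topo G) (ker0 I)) \<rightarrow> topspace (topo G)"
      unfolding tk topspace_T using \<delta>(1) Ds(2) by auto
    fix U assume "openin (topo G) U"
    have "{x \<in> ker0 I. \<delta> x \<in> U} = (\<Union>d\<in>D \<inter> U. {x \<in> ker0 I. x \<ominus> d \<in> adel})"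
      using \<delta> \<delta>u by blast
    moreover have "openin (subtopology (topo G) (ker0 I)) (\<Union>d\<in>D \<inter> U. {x \<in> ker0 I. x \<ominus> d \<in> adel})"
      using coset by (intro openin_Union) auto
    ultimately show "openin (subtopology (topo G) (ker0 I)) {x \<in> topspace (subtopology (topo G) (ker0 I)). \<delta> x \<in> U}"
      unfolding tk by simp
  qed
  \<comment> \<open>Equals the image of \<open>\<sigma>\<close> plus \<open>adel\<close>; written
    through the continuous map \<open>\<pi>\<close> it is visibly closed.\<close>
  define Q where "Q = {x \<in> K. \<pi> x \<in> adel}"
  have Qf: "fsub Q"
  proof (rule fsubI)
    show "Q \<subseteq> carrier G" using Kc by (auto simp: Q_def)
    show "\<zero> \<in> Q" using \<pi>id[OF Fs(3)] Ks(3) As(3) by (simp add: Q_def)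
    show "x \<oplus> y \<in> Q" if "x \<in> Q" "y \<in> Q" for x y using that Ks(6) As(6) Kc by (simp add: Q_def \<pi>add)
    show "\<alpha> \<odot> x \<in> Q" if "x \<in> Q" for \<alpha> x using that Ks(7) As(7) Kc by (simp add: Q_def \<pi>sm)
  qed
  have Qcl: "closedin (topo G) Q"
  proof -
    have "closedin (topo G) (K \<inter> {x \<in> topspace (topo G). \<pi> x \<in> adel})"
      by (intro closedin_Int K(2) closedin_continuous_map_preimage[OF \<pi>cont] adel_closed)
    moreover have "K \<inter> {x \<in> topspace (topo G). \<pi> x \<in> adel} = Q" using Kc by (auto simp: Q_def topspace_T)
    ultimately show ?thesis by simp
  qed
  have QK: "Q \<subseteq> K" by (auto simp: Q_def)
  have DK: "D \<subseteq> K" using DE(2) kK by auto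
  have \<pi>cK: "continuous_map (subtopology (topo G) K) (subtopology (topo G) (ker0 I)) \<pi>"
    by (rule continuous_map_into_subtopology[OF continuous_map_from_subtopology[OF \<pi>cont]]) (use \<pi>k in auto)
  have iso1: "lca_isomorphic (submod G K) (direct_sum (submod G Q) (submod G D))"
  proof (rule internal_direct_sum[OF K(1) Qf QK DE(1) DK, of "\<lambda>x. x \<ominus> \<delta> (\<pi> x)" "\<lambda>x. \<delta> (\<pi> x)"])
    have cc: "x \<in> carrier G" "\<delta> (\<pi> x) \<in> carrier G" "\<delta> (\<pi> x) \<in> D" if "x \<in> K" for x
      using that Kc \<delta>(1)[OF \<pi>k] Ds(2) by auto
    show "\<delta> (\<pi> x) \<in> D" if "x \<in> K" for x by (rule cc(3)[OF that])
    show "x \<ominus> \<delta> (\<pi> x) \<oplus> \<delta> (\<pi> x) = x" if "x \<in> K" for x using cc[OF that] by (simp add: a_minus_def a_assoc l_neg)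
    show "x \<ominus> \<delta> (\<pi> x) \<in> Q" if x: "x \<in> K" for x
    proof -
      have dk: "\<delta> (\<pi> x) \<in> ker0 I" using cc(3)[OF x] DE(2) by auto
      have ndk: "\<ominus> \<delta> (\<pi> x) \<in> ker0 I" by (rule Fs(5)[OF dk])
      have "\<pi> (x \<ominus> \<delta> (\<pi> x)) = \<pi> x \<ominus> \<delta> (\<pi> x)"
        unfolding a_minus_def using \<pi>add[OF cc(1)[OF x] kc[OF ndk]] \<pi>id[OF ndk] by simp
      then have "\<pi> (x \<ominus> \<delta> (\<pi> x)) \<in> adel" using \<delta>(2)[OF \<pi>k[OF x]] by simp
      moreover have "x \<ominus> \<delta> (\<pi> x) \<in> K" using Ks(4)[OF x] dk kK by auto
      ultimately show ?thesis by (simp add: Q_def)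
    qed
    show "Q \<inter> D = {\<zero>}"
    proof (intro subset_antisym subsetI)
      fix x assume x: "x \<in> Q \<inter> D"
      then have "x \<in> ker0 I" using DE(2) by auto
      then have "x \<in> adel" using \<pi>id x by (simp add: Q_def)
      then show "x \<in> {\<zero>}" using DE(6) x by auto
    qed (use fsubD(3)[OF Qf] Ds(3) in auto)
    show c: "continuous_map (subtopology (topo G) K) (topo G) (\<lambda>x. \<delta> (\<pi> x))"
      using continuous_map_compose[OF \<pi>cK \<delta>cont] by (simp add: o_def)
    show "continuous_map (subtopology (topo G) K) (topo G) (\<lambda>x. x \<ominus> \<delta> (\<pi> x))"
      by (intro minus_cont' c continuous_map_from_subtopology) simp
  qed
  have Dfd: "finite_dim_discrete (submod G D)"
    unfolding finite_dim_discrete_def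
  proof (intro conjI)
    show "Module.module field_rec (submod G D)" by (rule submod_module[OF DE(1)])
    show "\<exists>B. finite B \<and> B \<subseteq> carrier (submod G D) \<and>
      (\<forall>x\<in>carrier (submod G D). \<exists>c :: 'a \<Rightarrow> 'f. x = (\<Oplus>\<^bsub>submod G D\<^esub>b\<in>B. c b \<odot>\<^bsub>submod G D\<^esub> b))"
    proof (intro exI[of _ E] conjI ballI)
      fix x assume "x \<in> carrier (submod G D)"
      then obtain c where c: "x = (\<Oplus>e\<in>E. c e \<odot> e)" using DE(5) by auto
      have "(\<Oplus>\<^bsub>submod G D\<^esub>b\<in>E. c b \<odot> b) = (\<Oplus>e\<in>E. c e \<odot> e)"
        by (rule submod_finsum[OF DE(1,3)]) (use DE(4) Ds(7) in auto)
      then show "\<exists>c :: 'a \<Rightarrow> 'f. x = (\<Oplus>\<^bsub>submod G D\<^esub>b\<in>E. c b \<odot>\<^bsub>submod G D\<^esub> b)"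
        unfolding c by (intro exI[of _ c]) simp
    qed (use DE in auto)
    have "discrete_topology D = subtopology (topo G) D"
      unfolding discrete_topology_unique
    proof (intro conjI ballI)
      show "topspace (subtopology (topo G) D) = D" using Ds(2) by (auto simp: topspace_T)
      fix d assume d: "d \<in> D"
      obtain U where U: "openin (topo G) U" "{x \<in> ker0 I. x \<ominus> d \<in> adel} = U \<inter> ker0 I"
        using coset[OF d] by (auto simp: openin_subtopology)
      \<comment> \<open>A coset of \<open>adel\<close> contains at most one point of
        \<open>D\<close>, so openness of the coset isolates \<open>d\<close>.\<close>
      have "U \<inter> D = {d}"
      proof (intro subset_antisym subsetI)
        fix x assume x: "x \<in> U \<inter> D"
        then have xk: "x \<in> ker0 I" using DE(2) by auto
        then have "x \<ominus> d \<in> adel" using x U(2) by blast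
        then have "\<delta> x = d" by (rule \<delta>u[OF xk d])
        moreover have "\<delta> x = x" using x kc[OF xk] As(3) by (intro \<delta>u[OF xk]) (auto simp: a_minus_def r_neg)
        ultimately show "x \<in> {d}" by simp
      next
        fix x assume "x \<in> {d}"
        moreover have "d \<ominus> d = \<zero>" using d Ds(2) by (auto simp: a_minus_def r_neg subset_iff)
        moreover have "d \<in> {x \<in> ker0 I. x \<ominus> d \<in> adel}" using calculation(2) d DE(2) As(3) by auto
        ultimately show "x \<in> U \<inter> D" unfolding U(2) using d by simp
      qed
      then show "openin (subtopology (topo G) D) {d}" using U(1) by (auto simp: openin_subtopology)
    qed
    then show "topo (submod G D) = discrete_topology (carrier (submod G D))" by simp
  qed
  have iso2: "lca_isomorphic (submod G Q) (direct_sum V (submod G adel))"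
    unfolding lca_isomorphic_def
  proof (intro exI conjI ballI)
    have Qc: "x \<in> carrier G" if "x \<in> Q" for x using that QK Kc by auto
    show "lca_morphism (submod G Q) (direct_sum V (submod G adel)) (\<lambda>x. (\<rho> x, \<pi> x))"
    proof (rule lca_morphismI)
      show "continuous_map (topo (submod G Q)) (topo (direct_sum V (submod G adel))) (\<lambda>x. (\<rho> x, \<pi> x))"
        unfolding direct_sum_simps submod_simps
        by (intro continuous_map_pairedI continuous_map_into_subtopology continuous_map_from_subtopology \<rho>cont \<pi>cont)
           (auto simp: Q_def)
    qed (use Qc in \<open>auto simp: \<rho>V \<rho>add \<rho>sm \<pi>add \<pi>sm Q_def\<close>)
    have VQ: "\<sigma> v \<oplus> y \<in> Q" "\<rho> (\<sigma> v \<oplus> y) = v" "\<pi> (\<sigma> v \<oplus> y) = y" if v: "v \<in> carrier V" and y: "y \<in> adel" for v y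
    proof -
      have yk: "y \<in> ker0 I" and yc: "y \<in> carrier G" using y adk kc by auto
      show pi: "\<pi> (\<sigma> v \<oplus> y) = y" using \<pi>add[OF \<sigma>c[OF v] yc] \<pi>\<sigma>[OF v] \<pi>id[OF yk] yc by simp
      have "\<sigma> v \<oplus> y \<in> K" using Ks(6)[OF \<sigma>K[OF v]] yk kK by auto
      then show "\<sigma> v \<oplus> y \<in> Q" using pi y by (simp add: Q_def)
      have "\<rho> (\<sigma> v \<oplus> y) = v \<oplus>\<^bsub>V\<^esub> \<zero>\<^bsub>V\<^esub>" using \<rho>add[OF \<sigma>c[OF v] yc] \<rho>\<sigma>[OF v] \<rho>0[OF yk] by simp
      also have "\<dots> = v"
      proof
        fix k show "(v \<oplus>\<^bsub>V\<^esub> \<zero>\<^bsub>V\<^esub>) k = v k"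
          using V_arb[OF v, of k] by (cases "k < m") (simp_all add: Vadd V0)
      qed
      finally show "\<rho> (\<sigma> v \<oplus> y) = v" .
    qed
    have ac: "y \<in> carrier G" if "y \<in> adel" for y using that As(2) by auto
    show "lca_morphism (direct_sum V (submod G adel)) (submod G Q) (\<lambda>u. \<sigma> (fst u) \<oplus> snd u)"
    proof (rule lca_morphismI)
      show "continuous_map (topo (direct_sum V (submod G adel))) (topo (submod G Q)) (\<lambda>u. \<sigma> (fst u) \<oplus> snd u)"
        unfolding direct_sum_simps submod_simps
      proof (intro continuous_map_into_subtopology add_cont')
        show "continuous_map (prod_topology (topo V) (subtopology (topo G) adel)) (topo G) (\<lambda>u. \<sigma> (fst u))"
          using continuous_map_compose[OF continuous_map_fst \<sigma>cont] by (simp add: o_def)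
        show "continuous_map (prod_topology (topo V) (subtopology (topo G) adel)) (topo G) snd"
          using continuous_map_snd continuous_map_into_fulltopology by blast
        have "topspace (topo V) = carrier V" unfolding Vt Vc topspace_product_topology by (rule PiE_cong, subst Vtk) auto
        then show "(\<lambda>u. \<sigma> (fst u) \<oplus> snd u) \<in> topspace (prod_topology (topo V) (subtopology (topo G) adel)) \<rightarrow> Q"
          using VQ(1) by auto
      qed
    next
      fix u v assume "u \<in> carrier (direct_sum V (submod G adel))" "v \<in> carrier (direct_sum V (submod G adel))"
      then have uv: "fst u \<in> carrier V" "snd u \<in> carrier G" "fst v \<in> carrier V" "snd v \<in> carrier G" using ac by auto
      then show "\<sigma> (fst (u \<oplus>\<^bsub>direct_sum V (submod G adel)\<^esub> v)) \<oplus> snd (u \<oplus>\<^bsub>direct_sum V (submod G adel)\<^esub> v) =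
         (\<sigma> (fst u) \<oplus> snd u) \<oplus>\<^bsub>submod G Q\<^esub> (\<sigma> (fst v) \<oplus> snd v)"
        using \<sigma>c[OF uv(1)] \<sigma>c[OF uv(3)] by (simp add: \<sigma>add a_ac)
    next
      fix \<alpha> u assume "u \<in> carrier (direct_sum V (submod G adel))"
      then have u: "fst u \<in> carrier V" "snd u \<in> carrier G" using ac by auto
      then show "\<sigma> (fst (\<alpha> \<odot>\<^bsub>direct_sum V (submod G adel)\<^esub> u)) \<oplus> snd (\<alpha> \<odot>\<^bsub>direct_sum V (submod G adel)\<^esub> u) =
         \<alpha> \<odot>\<^bsub>submod G Q\<^esub> (\<sigma> (fst u) \<oplus> snd u)"
        using \<sigma>c[OF u(1)] by (simp add: \<sigma>sm smult_r_distr)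
    qed (use VQ(1) in auto)
    show "\<sigma> (fst (\<rho> x, \<pi> x)) \<oplus> snd (\<rho> x, \<pi> x) = x" if "x \<in> carrier (submod G Q)" for x
    proof -
      have xc: "x \<in> carrier G" using that Qc by simp
      show ?thesis using \<sigma>c[OF \<rho>V[OF xc]] xc by (simp add: \<pi>_def a_minus_def a_lcomm[of _ x] r_neg)
    qed
    show "(\<rho> (\<sigma> (fst y) \<oplus> snd y), \<pi> (\<sigma> (fst y) \<oplus> snd y)) = y" if "y \<in> carrier (direct_sum V (submod G adel))" for y
      using that VQ(2,3) by auto
  qed
  have Qblock: "quasi_adelic_block (submod G Q)"
    unfolding quasi_adelic_block_def
  proof (intro conjI)
    show "lca_object (submod G Q)" by (rule submod_lca[OF Qf Qcl])
    define C' where "C' = {x \<in> adel. h x \<in> C}"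
    have ac: "y \<in> carrier G" if "y \<in> adel" for y using that As(2) by auto
    have 1: "submodule C' integers_rec (submod G adel)"
    proof (intro submodule.intro submodule_axioms.intro subgroup.intro)
      show "C' \<subseteq> carrier (add_monoid (submod G adel))" by (auto simp: C'_def)
      show "x \<otimes>\<^bsub>add_monoid (submod G adel)\<^esub> y \<in> C'" if "x \<in> C'" "y \<in> C'" for x y
        using that As(6) C_closed(2) ac by (auto simp: C'_def h_simps)
      show "\<one>\<^bsub>add_monoid (submod G adel)\<^esub> \<in> C'" using As(3) C_closed(1) by (simp add: C'_def h_zero)
      show "inv\<^bsub>add_monoid (submod G adel)\<^esub> x \<in> C'" if x: "x \<in> C'" for x
      proof -
        have xa: "x \<in> adel" using x by (simp add: C'_def)
        have "inv\<^bsub>add_monoid (submod G adel)\<^esub> x = \<ominus> x" using submod_neg[OF As(1) xa] by (simp add: a_inv_def)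
        then show ?thesis using x As(5)[OF xa] C_closed(4) h_neg[OF ac[OF xa]] by (simp add: C'_def)
      qed
      show "a \<odot>\<^bsub>submod G adel\<^esub> x \<in> C'" if "a \<in> carrier integers_rec" "x \<in> C'" for a x
        using that As(7) C_closed(5) ac by (auto simp: C'_def h_simps integers_rec_def)
    qed
    \<comment> \<open>All archimedean coordinates vanish on \<open>adel\<close>, so a box of radius
      0 contains the candidate for \<open>C\<close>.\<close>
    have 2: "compactin (topo (submod G adel)) C'"
    proof -
      have "C' = lat {..<n}" by (auto simp: C'_def lat_def adel_def ker0_def)
      moreover have "compactin (topo G) (lat {..<n})"
      proof (rule lat_compact[of "{..<n}" "lat {..<n}" 0])
        show "closedin (topo G) (lat {..<n})" by (rule lat_closed) simp
      qed (auto simp: lat_def ker0_def)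
      ultimately show ?thesis unfolding submod_simps compactin_subtopology by (auto simp: C'_def)
    qed
    have 3: "openin (topo (submod G adel)) C'"
    proof -
      have "C' = {x \<in> carrier G. h x \<in> C} \<inter> adel" using ac by (auto simp: C'_def)
      then show ?thesis unfolding submod_simps openin_subtopology using h_C_clopen(1) by blast
    qed
    have 4: "carrier (submod G adel) = (\<Union>m\<in>{1::nat..}. (\<lambda>x. (1 / of_nat m) \<odot>\<^bsub>submod G adel\<^esub> x) ` C')"
      unfolding submod_simps
    proof (intro subset_antisym subsetI)
      fix x assume x: "x \<in> adel"
      have "h x \<in> carrier Hm" by (rule h_simps(1)[OF ac[OF x]])
      then obtain j u where j: "j \<ge> (1::nat)" "u \<in> C" "h x = (1 / of_nat j) \<odot>\<^bsub>Hm\<^esub> u" unfolding HC by auto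
      have "h (of_nat j \<odot> x) = of_nat j \<odot>\<^bsub>Hm\<^esub> ((1 / of_nat j) \<odot>\<^bsub>Hm\<^esub> u)"
        using h_simps(3)[OF ac[OF x]] j(3) by simp
      also have "\<dots> = u" using j cC[OF j(2)] by (simp add: Hm.smult_assoc[symmetric])
      finally have "of_nat j \<odot> x \<in> C'" using j(2) As(7)[OF x] by (simp add: C'_def)
      moreover have "x = (1 / of_nat j) \<odot> (of_nat j \<odot> x)" using j ac[OF x] by (simp add: smult_assoc[symmetric])
      ultimately show "x \<in> (\<Union>m\<in>{1::nat..}. (\<lambda>x. (1 / of_nat m) \<odot> x) ` C')" using j(1) by blast
    next
      fix x assume "x \<in> (\<Union>m\<in>{1::nat..}. (\<lambda>x. (1 / of_nat m) \<odot> x) ` C')"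
      then show "x \<in> adel" using As(7) by (auto simp: C'_def)
    qed
    have 5: "set (map \<nu> L) \<subseteq> arch_embeddings" using LI I \<nu> by auto
    show "\<exists>\<nu>s (H :: ('f, 'a) topmod) C. set \<nu>s \<subseteq> arch_embeddings \<and> lca_object H \<and> submodule C integers_rec H \<and>
      compactin (topo H) C \<and> openin (topo H) C \<and> carrier H = (\<Union>n\<in>{1::nat..}. (\<lambda>x. (1 / of_nat n) \<odot>\<^bsub>H\<^esub> x) ` C) \<and>
      lca_isomorphic (submod G Q) (direct_sum (list_direct_sum (map arch_module \<nu>s)) H)"
      by (rule exI[of _ "map \<nu> L"], rule exI[of _ "submod G adel"], rule exI[of _ C'])
         (intro conjI 1 2 3 4 5 submod_lca[OF adel_fsub adel_closed] iso2[unfolded V_def])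
  qed
  show ?thesis unfolding lca_qab_fd_def
    using submod_lca[OF K] Qblock Dfd iso1 by blast
qed

end

section \<open>Coordinates on the source and its kernel\<close>

lemma lca_morphism_compose:
  assumes "lca_morphism A B f" "lca_morphism B C g" shows "lca_morphism A C (\<lambda>x. g (f x))"
  using lca_morphismD[OF assms(1)] lca_morphismD[OF assms(2)]
    continuous_map_compose[OF lca_morphismD(4)[OF assms(1)] lca_morphismD(4)[OF assms(2)]]
  by (intro lca_morphismI) (simp_all add: o_def)

lemma lca_morphism_fst: "lca_morphism (direct_sum A B) A fst"
  by (rule lca_morphismI) (auto intro: continuous_map_fst)

lemma lca_morphism_snd: "lca_morphism (direct_sum A B) B snd"
  by (rule lca_morphismI) (auto intro: continuous_map_snd)

text \<open>Transport along the two given isomorphisms provides the coordinates of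
  \<open>lca_coords\<close> on \<open>G\<close>, and the kernel is a closed submodule because points
  of \<open>G'\<close> are closed.\<close>

theorem mainTheorem10:
  fixes G :: "('f::field_char_0, 'a) topmod"
    and G' :: "('f, 'b) topmod"
    and f :: "'a \<Rightarrow> 'b"
  assumes "number_field TYPE('f)"
    and "lca_qab_fd G"
    and "lca_object G'"
    and "lca_morphism G G' f"
  shows "lca_qab_fd (lca_kernel G G' f)"
proof -
  have G: "lca_object G" using assms(2) by (simp add: lca_qab_fd_def)
  obtain Q D :: "('f, 'a) topmod" where QD: "quasi_adelic_block Q" "finite_dim_discrete D" "lca_isomorphic G (direct_sum Q D)"
    using assms(2) by (auto simp: lca_qab_fd_def)
  obtain f1 g1 where f1: "lca_morphism G (direct_sum Q D) f1" and g1: "lca_morphism (direct_sum Q D) G g1"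
    and gf1: "\<And>x. x \<in> carrier G \<Longrightarrow> g1 (f1 x) = x" and fg1: "\<And>y. y \<in> carrier (direct_sum Q D) \<Longrightarrow> f1 (g1 y) = y"
    using QD(3) unfolding lca_isomorphic_def by blast
  obtain \<nu>s and Hm :: "('f, 'a) topmod" and C where H: "set \<nu>s \<subseteq> arch_embeddings" "lca_object Hm" "submodule C integers_rec Hm"
    "compactin (topo Hm) C" "openin (topo Hm) C"
    "carrier Hm = (\<Union>n\<in>{1::nat..}. (\<lambda>x. (1 / of_nat n) \<odot>\<^bsub>Hm\<^esub> x) ` C)"
    "lca_isomorphic Q (direct_sum (list_direct_sum (map arch_module \<nu>s)) Hm)"
    using QD(1) unfolding quasi_adelic_block_def by (elim exE conjE) (rule that; assumption)
  define V where "V = list_direct_sum (map arch_module \<nu>s)"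
  obtain f2 g2 where f2: "lca_morphism Q (direct_sum V Hm) f2" and g2: "lca_morphism (direct_sum V Hm) Q g2"
    and gf2: "\<And>x. x \<in> carrier Q \<Longrightarrow> g2 (f2 x) = x" and fg2: "\<And>y. y \<in> carrier (direct_sum V Hm) \<Longrightarrow> f2 (g2 y) = y"
    using H(7) unfolding lca_isomorphic_def V_def by blast
  define n where "n = length \<nu>s"
  define \<nu> where "\<nu> i = \<nu>s ! i" for i
  define q where "q x = f2 (fst (f1 x))" for x
  have q: "lca_morphism G (direct_sum V Hm) q"
    using lca_morphism_compose[OF lca_morphism_compose[OF f1 lca_morphism_fst] f2] by (simp add: q_def[abs_def])
  define v where "v x = fst (q x)" for x
  define h where "h x = snd (q x)" for x
  define dd where "dd x = snd (f1 x)" for x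
  define p where "p i x = v x i" for i x
  have v: "lca_morphism G V v" using lca_morphism_compose[OF q lca_morphism_fst] by (simp add: v_def[abs_def])
  have h: "lca_morphism G Hm h" using lca_morphism_compose[OF q lca_morphism_snd] by (simp add: h_def[abs_def])
  have dd: "lca_morphism G D dd" using lca_morphism_compose[OF f1 lca_morphism_snd] by (simp add: dd_def[abs_def])
  have Vc: "carrier V = (\<Pi>\<^sub>E i\<in>{..<n}. arch_field (\<nu> i))" unfolding V_def by (auto simp: n_def \<nu>_def intro!: PiE_cong)
  have Vt: "topo V = product_topology (\<lambda>i. topo (map arch_module \<nu>s ! i)) {..<n}"
    unfolding V_def list_direct_sum_simps by (simp add: n_def)
  have Vtk: "topo (map arch_module \<nu>s ! i) = top_of_set (arch_field (\<nu> i))" if "i < n" for i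
    using that by (simp add: n_def \<nu>_def)
  have vV: "v x \<in> carrier V" if "x \<in> carrier G" for x by (rule lca_morphismD(1)[OF v that])
  interpret lca G by unfold_locales (rule G)
  interpret G': lca G' by unfold_locales (rule assms(3))
  define K where "K = {x \<in> carrier G. f x = \<zero>\<^bsub>G'\<^esub>}"
  note fs = lca_morphismD[OF assms(4)]
  \<comment> \<open>Both isomorphisms have left inverses, so the three coordinates together
    determine a point.\<close>
  have eq: "x = y" if "x \<in> carrier G" "y \<in> carrier G" "v x = v y" "h x = h y" "dd x = dd y" for x y
  proof -
    have c: "fst (f1 x) \<in> carrier Q" "fst (f1 y) \<in> carrier Q"
      using lca_morphismD(1)[OF f1 that(1)] lca_morphismD(1)[OF f1 that(2)] by auto
    have "q x = q y" using that(3,4) unfolding v_def h_def by (rule prod_eqI)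
    then have "g2 (q x) = g2 (q y)" by (rule arg_cong)
    then have "fst (f1 x) = fst (f1 y)" unfolding q_def gf2[OF c(1)] gf2[OF c(2)] .
    then have "f1 x = f1 y" using that(5) unfolding dd_def by (rule prod_eqI)
    then have "g1 (f1 x) = g1 (f1 y)" by (rule arg_cong)
    then show ?thesis unfolding gf1[OF that(1)] gf1[OF that(2)] .
  qed
  have "lca_coords G n \<nu> p Hm C h D dd K"
  proof (intro lca_coords.intro lca_coords_axioms.intro lca.intro)
    show "lca_object G" by (rule G)
    show "number_field TYPE('f)" by (rule assms(1))
    show "\<nu> i \<in> arch_embeddings" if "i < n" for i using H(1) that by (auto simp: \<nu>_def n_def)
    show "continuous_map (topo G) euclidean (p i)" if "i < n" for i
    proof -
      have "continuous_map (topo V) (topo (map arch_module \<nu>s ! i)) (\<lambda>u. u i)"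
        unfolding Vt by (rule continuous_map_product_projection) (use that in simp)
      from continuous_map_compose[OF lca_morphismD(4)[OF v] this[unfolded Vtk[OF that]]]
      show ?thesis by (simp add: o_def p_def[abs_def] continuous_map_in_subtopology)
    qed
    show "p i (x \<oplus>\<^bsub>G\<^esub> y) = p i x + p i y" if "i < n" "x \<in> carrier G" "y \<in> carrier G" for i x y
      using lca_morphismD(2)[OF v that(2,3)] that(1) by (simp add: p_def V_def n_def)
    show "p i (\<alpha> \<odot>\<^bsub>G\<^esub> x) = \<nu> i \<alpha> * p i x" if "i < n" "x \<in> carrier G" for i \<alpha> x
      using lca_morphismD(3)[OF v that(2)] that(1) by (simp add: p_def V_def n_def \<nu>_def)
    show "p i x \<in> arch_field (\<nu> i)" if "i < n" "x \<in> carrier G" for i x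
      using vV[OF that(2)] that(1) by (auto simp: p_def Vc)
    show "lca_object Hm" "submodule C integers_rec Hm" "compactin (topo Hm) C" "openin (topo Hm) C" by (rule H)+
    show "carrier Hm = (\<Union>m\<in>{1::nat..}. (\<lambda>x. (1 / of_nat m) \<odot>\<^bsub>Hm\<^esub> x) ` C)" by (rule H(6))
    show "lca_morphism G Hm h" "lca_morphism G D dd" by (rule h, rule dd)
    show "lca_object D" by (rule finite_dim_discrete_lca[OF QD(2)])
    show "finite_dim_discrete D" by (rule QD(2))
    show "x = \<zero>\<^bsub>G\<^esub>" if x: "x \<in> carrier G" "\<And>i. i < n \<Longrightarrow> p i x = 0" "h x = \<zero>\<^bsub>Hm\<^esub>" "dd x = \<zero>\<^bsub>D\<^esub>" for x
    proof (rule eq[OF x(1) zero_closed])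
      interpret Hm: lca Hm by unfold_locales (rule H(2))
      interpret D: lca D by unfold_locales (rule finite_dim_discrete_lca[OF QD(2)])
      show "h x = h \<zero>\<^bsub>G\<^esub>" using lca_morphismD(3)[OF h zero_closed, of 0] lca_morphismD(1)[OF h zero_closed] x(3) by simp
      show "dd x = dd \<zero>\<^bsub>G\<^esub>" using lca_morphismD(3)[OF dd zero_closed, of 0] lca_morphismD(1)[OF dd zero_closed] x(4) by simp
      show "v x = v \<zero>\<^bsub>G\<^esub>"
      proof (rule PiE_ext[OF vV[OF x(1), unfolded Vc] vV[OF zero_closed, unfolded Vc]])
        fix i assume "i \<in> {..<n}"
        then have i: "i < n" by simp
        then have e: "\<nu> i \<in> arch_embeddings" using H(1) by (auto simp: \<nu>_def n_def)
        \<comment> \<open>\<open>V\<close> has not been shown to satisfy the module laws, so the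
          value at zero is read off from scaling by 0.\<close>
        have "v \<zero>\<^bsub>G\<^esub> = 0 \<odot>\<^bsub>V\<^esub> v \<zero>\<^bsub>G\<^esub>"
          using lca_morphismD(3)[OF v zero_closed, of 0] by simp
        from fun_cong[OF this, of i] have "v \<zero>\<^bsub>G\<^esub> i = 0"
          using i embedding_simps(4)[OF e] by (simp add: V_def n_def \<nu>_def)
        then show "v x i = v \<zero>\<^bsub>G\<^esub> i" using x(2)[OF i] by (simp add: p_def)
      qed
    qed
    show "compactin (topo G) {x \<in> carrier G. (\<forall>i<n. cmod (p i x) \<le> r) \<and> h x \<in> C \<and> dd x = \<zero>\<^bsub>D\<^esub>}" for r
    proof -
      interpret D: lca D by unfold_locales (rule finite_dim_discrete_lca[OF QD(2)])
      \<comment> \<open>The set in question is the image, under the inverse isomorphisms, of a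
        product of compact sets: closed balls in the completions, \<open>C\<close>, and the zero of
        \<open>D\<close>.\<close>
      define B where "B = (\<Pi>\<^sub>E i\<in>{..<n}. arch_field (\<nu> i) \<inter> cball 0 r)"
      have "compactin (topo V) B"
        unfolding Vt B_def compactin_PiE
      proof (intro disjI2 ballI)
        fix i assume "i \<in> {..<n}"
        then have i: "i < n" by simp
        have "closed (arch_field (\<nu> i))" by (simp add: arch_field_def closed_complex_Reals)
        then have "compact (arch_field (\<nu> i) \<inter> cball 0 r)" by (intro closed_Int_compact) auto
        then show "compactin (topo (map arch_module \<nu>s ! i)) (arch_field (\<nu> i) \<inter> cball 0 r)"
          unfolding Vtk[OF i] by (simp add: compactin_subtopology compactin_euclidean_iff)
      qed
      then have "compactin (prod_topology (topo V) (topo Hm)) (B \<times> C)" using H(4) by (simp add: compactin_Times)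
      from image_compactin[OF this[folded direct_sum_simps(5)] lca_morphismD(4)[OF g2]]
      have "compactin (topo Q) (g2 ` (B \<times> C))" .
      moreover have "compactin (topo D) {\<zero>\<^bsub>D\<^esub>}" by (simp add: D.topspace_T)
      ultimately have "compactin (prod_topology (topo Q) (topo D)) (g2 ` (B \<times> C) \<times> {\<zero>\<^bsub>D\<^esub>})" by (simp add: compactin_Times)
      from image_compactin[OF this[folded direct_sum_simps(5)] lca_morphismD(4)[OF g1]]
      have cpt: "compactin (topo G) (g1 ` (g2 ` (B \<times> C) \<times> {\<zero>\<^bsub>D\<^esub>}))" .
      have BV: "B \<subseteq> carrier V" unfolding B_def Vc by (rule PiE_mono) auto
      have CH: "C \<subseteq> carrier Hm"
        using H(5) openin_subset H(2) by (auto simp: lca_object_def)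
      have "{x \<in> carrier G. (\<forall>i<n. cmod (p i x) \<le> r) \<and> h x \<in> C \<and> dd x = \<zero>\<^bsub>D\<^esub>} = g1 ` (g2 ` (B \<times> C) \<times> {\<zero>\<^bsub>D\<^esub>})"
      proof (intro subset_antisym subsetI)
        fix x assume "x \<in> {x \<in> carrier G. (\<forall>i<n. cmod (p i x) \<le> r) \<and> h x \<in> C \<and> dd x = \<zero>\<^bsub>D\<^esub>}"
        then have x: "x \<in> carrier G" "\<forall>i<n. cmod (p i x) \<le> r" "h x \<in> C" "dd x = \<zero>\<^bsub>D\<^esub>" by auto
        have "v x \<in> B" using vV[OF x(1)] x(2) by (auto simp: B_def Vc p_def PiE_iff)
        then have "q x \<in> B \<times> C" using x(3) by (simp add: v_def h_def mem_Times_iff)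
        then have "g2 (q x) \<in> g2 ` (B \<times> C)" by (rule imageI)
        moreover have "fst (f1 x) \<in> carrier Q" using lca_morphismD(1)[OF f1 x(1)] by auto
        ultimately have "fst (f1 x) \<in> g2 ` (B \<times> C)" unfolding q_def by (simp only: gf2)
        then have "f1 x \<in> g2 ` (B \<times> C) \<times> {\<zero>\<^bsub>D\<^esub>}" using x(4) unfolding mem_Times_iff dd_def by simp
        then show "x \<in> g1 ` (g2 ` (B \<times> C) \<times> {\<zero>\<^bsub>D\<^esub>})" by (rule rev_image_eqI) (rule gf1[OF x(1), symmetric])
      next
        fix x assume "x \<in> g1 ` (g2 ` (B \<times> C) \<times> {\<zero>\<^bsub>D\<^esub>})"
        then obtain b c where bc: "b \<in> B" "c \<in> C" "x = g1 (g2 (b, c), \<zero>\<^bsub>D\<^esub>)" by auto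
        have m: "(b, c) \<in> carrier (direct_sum V Hm)" using bc BV CH by auto
        have m2: "(g2 (b, c), \<zero>\<^bsub>D\<^esub>) \<in> carrier (direct_sum Q D)" using lca_morphismD(1)[OF g2 m] by simp
        have xc: "x \<in> carrier G" unfolding bc(3) by (rule lca_morphismD(1)[OF g1 m2])
        have fx: "f1 x = (g2 (b, c), \<zero>\<^bsub>D\<^esub>)" unfolding bc(3) by (rule fg1[OF m2])
        have qx: "q x = (b, c)" unfolding q_def fx fst_conv by (rule fg2[OF m])
        have "cmod (p i x) \<le> r" if "i < n" for i 
        proof -
          have "b i \<in> arch_field (\<nu> i) \<inter> cball 0 r" by (rule PiE_mem[OF bc(1)[unfolded B_def]]) (use that in simp)
          moreover have "p i x = b i" by (simp add: p_def v_def qx)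
          ultimately show ?thesis by simp
        qed
        then show "x \<in> {x \<in> carrier G. (\<forall>i<n. cmod (p i x) \<le> r) \<and> h x \<in> C \<and> dd x = \<zero>\<^bsub>D\<^esub>}"
          using xc bc(2) by (simp add: h_def dd_def fx qx)
      qed
      with cpt show ?thesis by simp
    qed
    have fz: "f \<zero>\<^bsub>G\<^esub> = \<zero>\<^bsub>G'\<^esub>" using fs(3)[OF zero_closed, of 0] fs(1)[OF zero_closed] by simp
    show "lca.fsub G K"
    proof (rule fsubI)
      show "x \<oplus>\<^bsub>G\<^esub> y \<in> K" if "x \<in> K" "y \<in> K" for x y using that by (simp add: K_def fs)
      show "\<alpha> \<odot>\<^bsub>G\<^esub> x \<in> K" if "x \<in> K" for \<alpha> x using that by (simp add: K_def fs)
    qed (auto simp: K_def fz)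
    have "closedin (topo G') {\<zero>\<^bsub>G'\<^esub>}"
      by (rule closedin_Hausdorff_singleton[OF G'.hausdorff_T]) (simp add: G'.topspace_T)
    from closedin_continuous_map_preimage[OF fs(4) this]
    show "closedin (topo G) K" by (simp add: K_def topspace_T)
  qed
  then have "lca_qab_fd (submod G K)" by (rule lca_coords.closed_submodule_qab_fd)
  moreover have "lca_kernel G G' f = submod G K" by (simp add: lca_kernel_def submod_def K_def Let_def)
  ultimately show ?thesis by simp
qed

end
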